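(* Let $\mathcal{E}$ be a locally cartesian closed category with finite limits. Let $\mathbf{B}$ be a complete internal category in $\mathcal{E}$ and let $R\colon\mathbf{B}\to\mathbf{A}$ be a continuous functor between internal categories in $\mathcal{E}$. Then $R$ is a right adjoint, i.e., it has a left adjoint $L\colon\mathbf{A}\to\mathbf{B}$ (an adjunction $L\dashv R$ in the 2-category of internal categories in $\mathcal{E}$).
   Context: $\mathcal{E}$ is equipped with a functorial choice of binary products and a chosen terminal object $\mathbb{1}$. $\mathrm{Cat}_{\mathcal{E}}$ denotes the 2-category of internal categories in $\mathcal{E}$, internal functors and internal natural transformations. It has finite limits (computed on objects of objects and objects of arrows), with terminal object $\mathbb{1}_{\mathrm{Cat}_{\mathcal{E}}}$, and is cartesian closed; $[\mathbf{D},\mathbf{A}]$ denotes the exponential (the internal category of functors $\mathbf{D}\to\mathbf{A}$ and natural transformations), $\Delta\colon\mathbf{A}\to[\mathbf{D},\mathbf{A}]$ the diagonal functor, and for a functor $D\colon\mathbf{D}\to\mathbf{A}$, $\ulcorner D\urcorner\colon\mathbb{1}_{\mathrm{Cat}_{\mathcal{E}}}\to[\mathbf{D},\mathbf{A}]$ is the corresponding point. A functor $F\colon\mathbf{A}\to\mathbf{B}$ induces the post-composition functor $[\mathbf{D},F]\colon[\mathbf{D},\mathbf{A}]\to[\mathbf{D},\mathbf{B}]$, which satisfies $[\mathbf{D},F]\ulcorner D\urcorner=\ulcorner FD\urcorner$ and $[\mathbf{D},F]\Delta=\Delta F$. For an object $I$ of $\mathcal{E}$, $I^*\colon\mathcal{E}\to\mathcal{E}/I$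 is pullback along $I\to\mathbb{1}$. It preserves finite limits and exponentials and induces $I^*\colon\mathrm{Cat}_{\mathcal{E}}\to\mathrm{Cat}_{\mathcal{E}/I}$, with a canonical isomorphism $I^*[\mathbf{D},\mathbf{A}]\cong[I^*\mathbf{D},I^*\mathbf{A}]$. Each slice $\mathcal{E}/I$ is again locally cartesian closed with finite limits, so all the definitions given here also apply with $\mathcal{E}/I$ in place of $\mathcal{E}$. A diagram of shape $\mathbf{D}$ in $\mathbf{A}$ is an internal functor $D\colon\mathbf{D}\to\mathbf{A}$. A cone over $D$ with vertex $V\colon\mathbb{1}_{\mathrm{Cat}_{\mathcal{E}}}\to\mathbf{A}$ is a natural transformation $\gamma\colon\Delta V\to\ulcorner D\urcorner$; a morphism of cones $(V_0,\gamma_0)\to(V_1,\gamma_1)$ is a natural transformation $h\colon V_0\to V_1$ with $\gamma_1\circ(\Delta h)=\gamma_0$. A cone over $D$ is sent by $I^*$ (and the canonical isomorphism $I^*[\mathbf{D},\mathbf{A}]\cong[I^*\mathbf{D},I^*\mathbf{A}]$) to a cone over $I^*D\colon I^*\mathbf{D}\to I^*\mathbf{A}$. A cone $(V,\gamma)$ over $D$ is universal, and $V$ is a limit of $D$, if for every object $I$ of $\mathcal{E}$ the cone $I^*(V,\gamma)$ is a terminal object in the (external) category of cones over $I^*D$. An internal category $\mathbf{A}$ in $\mathcal{E}$ is complete if, for every object $I$ of $\mathcal{E}$, every diagram $D\colon\mathbf{D}\to I^*\mathbf{A}$ in $\mathrm{Cat}_{\mathcal{E}/I}$ (of any shape $\mathbf{D}$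 an internal category in $\mathcal{E}/I$) admits a limit relative to $\mathcal{E}/I$, that is, there is a cone $(V,\gamma)$ over $D$ in $\mathrm{Cat}_{\mathcal{E}/I}$ such that, for every object $K$ of $\mathcal{E}/I$, $K^*(V,\gamma)$ is a terminal object in the (external) category of cones over $K^*D$, where $K^*\colon\mathrm{Cat}_{\mathcal{E}/I}\to\mathrm{Cat}_{(\mathcal{E}/I)/K}$ is induced by pullback along the unique arrow from $K$ to the terminal object of $\mathcal{E}/I$. A functor $F\colon\mathbf{A}\to\mathbf{B}$ of internal categories in $\mathcal{E}$ is continuous if, for every object $I$ of $\mathcal{E}$ and every diagram $D\colon\mathbf{D}\to I^*\mathbf{A}$ in $\mathrm{Cat}_{\mathcal{E}/I}$ admitting a universal cone $\pi\colon\Delta\lim_D\to\ulcorner D\urcorner$, the cone $[\mathbf{D},I^*F]\pi\colon\Delta (I^*F)\lim_D\to\ulcorner (I^*F)D\urcorner$ is a universal cone for $(I^*F)D$. *)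

theory Defs
  imports Main
begin

section \<open>Categories\<close>

record ('o, 'm) cat =
  Obj :: "'o set"
  Arr :: "'m set"
  Dom :: "'m \<Rightarrow> 'o"
  Cod :: "'m \<Rightarrow> 'o"
  Idn :: "'o \<Rightarrow> 'm"
  Comp :: "'m \<Rightarrow> 'm \<Rightarrow> 'm"  (infixr "\<cdot>\<index>" 70)

definition Hom :: "('o, 'm) cat \<Rightarrow> 'o \<Rightarrow> 'o \<Rightarrow> 'm set" where
  "Hom C X Y = {f \<in> Arr C. Dom C f = X \<and> Cod C f = Y}"

locale category =
  fixes C :: "('o, 'm) cat" (structure)
  assumes Dom_Obj: "f \<in> Arr C \<Longrightarrow> Dom C f \<in> Obj C"
    and Cod_Obj: "f \<in> Arr C \<Longrightarrow> Cod C f \<in> Obj C"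
    and Idn_Hom: "X \<in> Obj C \<Longrightarrow> Idn C X \<in> Hom C X X"
    and Comp_Hom: "f \<in> Hom C X Y \<Longrightarrow> g \<in> Hom C Y Z \<Longrightarrow> g \<cdot> f \<in> Hom C X Z"
    and Comp_Idn: "f \<in> Hom C X Y \<Longrightarrow> f \<cdot> Idn C X = f"
    and Idn_Comp: "f \<in> Hom C X Y \<Longrightarrow> Idn C Y \<cdot> f = f"
    and Comp_assoc: "f \<in> Hom C W X \<Longrightarrow> g \<in> Hom C X Y \<Longrightarrow> h \<in> Hom C Y Z \<Longrightarrow>
      h \<cdot> (g \<cdot> f) = (h \<cdot> g) \<cdot> f"

subsection \<open>Finite limits\<close>

definition is_functor ::
  "('p, 'n) cat \<Rightarrow> ('o, 'm) cat \<Rightarrow> ('p \<Rightarrow> 'o) \<Rightarrow> ('n \<Rightarrow> 'm) \<Rightarrow> bool" where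
  "is_functor J C Fo Fa \<longleftrightarrow>
     (\<forall>j\<in>Obj J. Fo j \<in> Obj C \<and> Fa (Idn J j) = Idn C (Fo j)) \<and>
     (\<forall>u\<in>Arr J. Fa u \<in> Hom C (Fo (Dom J u)) (Fo (Cod J u))) \<and>
     (\<forall>u\<in>Arr J. \<forall>v\<in>Arr J. Dom J v = Cod J u \<longrightarrow> Fa (v \<cdot>\<^bsub>J\<^esub> u) = Fa v \<cdot>\<^bsub>C\<^esub> Fa u)"

definition is_cone ::
  "('p, 'n) cat \<Rightarrow> ('o, 'm) cat \<Rightarrow> ('p \<Rightarrow> 'o) \<Rightarrow> ('n \<Rightarrow> 'm) \<Rightarrow> 'o \<Rightarrow> ('p \<Rightarrow> 'm) \<Rightarrow> bool" where
  "is_cone J C Fo Fa X p \<longleftrightarrow>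
     X \<in> Obj C \<and> (\<forall>j\<in>Obj J. p j \<in> Hom C X (Fo j)) \<and>
     (\<forall>u\<in>Arr J. Fa u \<cdot>\<^bsub>C\<^esub> p (Dom J u) = p (Cod J u))"

definition is_limit_cone ::
  "('p, 'n) cat \<Rightarrow> ('o, 'm) cat \<Rightarrow> ('p \<Rightarrow> 'o) \<Rightarrow> ('n \<Rightarrow> 'm) \<Rightarrow> 'o \<Rightarrow> ('p \<Rightarrow> 'm) \<Rightarrow> bool" where
  "is_limit_cone J C Fo Fa X p \<longleftrightarrow>
     is_cone J C Fo Fa X p \<and>
     (\<forall>Y q. is_cone J C Fo Fa Y q \<longrightarrow>
        (\<exists>!u. u \<in> Hom C Y X \<and> (\<forall>j\<in>Obj J. p j \<cdot>\<^bsub>C\<^esub> u = q j)))"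

text \<open>Every finite category is isomorphic to one whose objects and arrows are natural numbers,
  so no finite shape is lost by the choice of index type.\<close>

definition has_finite_limits :: "('o, 'm) cat \<Rightarrow> bool" where
  "has_finite_limits C \<longleftrightarrow>
     (\<forall>(J :: (nat, nat) cat) Fo Fa.
        category J \<and> finite (Obj J) \<and> finite (Arr J) \<and> is_functor J C Fo Fa \<longrightarrow>
        (\<exists>X p. is_limit_cone J C Fo Fa X p))"

subsection \<open>Chosen terminal objects, products, pullbacks and exponentials\<close>

text \<open>Limits and exponentials are chosen once and for all by Hilbert choice, in every category,
  hence also in every slice and in every category of internal categories.\<close>

definition is_terminal :: "('o, 'm) cat \<Rightarrow> 'o \<Rightarrow> bool" where
  "is_terminal C T \<longleftrightarrow> T \<in> Obj C \<and> (\<forall>X\<in>Obj C. \<exists>!f. f \<in> Hom C X T)"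

definition terminal :: "('o, 'm) cat \<Rightarrow> 'o" where
  "terminal C = (SOME T. is_terminal C T)"

definition bang :: "('o, 'm) cat \<Rightarrow> 'o \<Rightarrow> 'm" where
  "bang C X = (THE f. f \<in> Hom C X (terminal C))"

definition is_product :: "('o, 'm) cat \<Rightarrow> 'o \<Rightarrow> 'o \<Rightarrow> 'm \<Rightarrow> 'm \<Rightarrow> bool" where
  "is_product C X Y p q \<longleftrightarrow>
     (\<exists>P\<in>Obj C. p \<in> Hom C P X \<and> q \<in> Hom C P Y \<and>
        (\<forall>W f g. f \<in> Hom C W X \<and> g \<in> Hom C W Y \<longrightarrow>
           (\<exists>!u. u \<in> Hom C W P \<and> p \<cdot>\<^bsub>C\<^esub> u = f \<and> q \<cdot>\<^bsub>C\<^esub> u = g)))"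

definition proj :: "('o, 'm) cat \<Rightarrow> 'o \<Rightarrow> 'o \<Rightarrow> 'm \<times> 'm" where
  "proj C X Y = (SOME r. is_product C X Y (fst r) (snd r))"

abbreviation proj1 :: "('o, 'm) cat \<Rightarrow> 'o \<Rightarrow> 'o \<Rightarrow> 'm" where
  "proj1 C X Y \<equiv> fst (proj C X Y)"

abbreviation proj2 :: "('o, 'm) cat \<Rightarrow> 'o \<Rightarrow> 'o \<Rightarrow> 'm" where
  "proj2 C X Y \<equiv> snd (proj C X Y)"

definition prod_obj :: "('o, 'm) cat \<Rightarrow> 'o \<Rightarrow> 'o \<Rightarrow> 'o" where
  "prod_obj C X Y = Dom C (proj1 C X Y)"

definition is_pullback :: "('o, 'm) cat \<Rightarrow> 'm \<Rightarrow> 'm \<Rightarrow> 'm \<Rightarrow> 'm \<Rightarrow> bool" where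
  "is_pullback C f g p q \<longleftrightarrow>
     (\<exists>P\<in>Obj C. p \<in> Hom C P (Dom C f) \<and> q \<in> Hom C P (Dom C g) \<and>
        f \<cdot>\<^bsub>C\<^esub> p = g \<cdot>\<^bsub>C\<^esub> q \<and>
        (\<forall>W h k. h \<in> Hom C W (Dom C f) \<and> k \<in> Hom C W (Dom C g) \<and>
           f \<cdot>\<^bsub>C\<^esub> h = g \<cdot>\<^bsub>C\<^esub> k \<longrightarrow>
           (\<exists>!u. u \<in> Hom C W P \<and> p \<cdot>\<^bsub>C\<^esub> u = h \<and> q \<cdot>\<^bsub>C\<^esub> u = k)))"

definition pb :: "('o, 'm) cat \<Rightarrow> 'm \<Rightarrow> 'm \<Rightarrow> 'm \<times> 'm" where
  "pb C f g = (SOME r. is_pullback C f g (fst r) (snd r))"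

abbreviation pb1 :: "('o, 'm) cat \<Rightarrow> 'm \<Rightarrow> 'm \<Rightarrow> 'm" where
  "pb1 C f g \<equiv> fst (pb C f g)"

abbreviation pb2 :: "('o, 'm) cat \<Rightarrow> 'm \<Rightarrow> 'm \<Rightarrow> 'm" where
  "pb2 C f g \<equiv> snd (pb C f g)"

definition pb_obj :: "('o, 'm) cat \<Rightarrow> 'm \<Rightarrow> 'm \<Rightarrow> 'o" where
  "pb_obj C f g = Dom C (pb1 C f g)"

text \<open>The arrow induced by \<open>f\<close> and \<open>g\<close> into the product or pullback with projections
  \<open>p\<close> and \<open>q\<close>.\<close>

definition pair_into :: "('o, 'm) cat \<Rightarrow> 'm \<Rightarrow> 'm \<Rightarrow> 'm \<Rightarrow> 'm \<Rightarrow> 'm" where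
  "pair_into C p q f g =
     (THE u. u \<in> Hom C (Dom C f) (Dom C p) \<and> p \<cdot>\<^bsub>C\<^esub> u = f \<and> q \<cdot>\<^bsub>C\<^esub> u = g)"

text \<open>The arrow \<open>g \<times> X : W \<times> X \<rightarrow> Z \<times> X\<close> for \<open>g : W \<rightarrow> Z\<close>.\<close>

definition times_right :: "('o, 'm) cat \<Rightarrow> 'm \<Rightarrow> 'o \<Rightarrow> 'm" where
  "times_right C g X =
     pair_into C (proj1 C (Cod C g) X) (proj2 C (Cod C g) X)
       (g \<cdot>\<^bsub>C\<^esub> proj1 C (Dom C g) X) (proj2 C (Dom C g) X)"

definition is_exponential :: "('o, 'm) cat \<Rightarrow> 'o \<Rightarrow> 'o \<Rightarrow> 'o \<Rightarrow> 'm \<Rightarrow> bool" where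
  "is_exponential C X Y Z e \<longleftrightarrow>
     Z \<in> Obj C \<and> e \<in> Hom C (prod_obj C Z X) Y \<and>
     (\<forall>W\<in>Obj C. \<forall>f\<in>Hom C (prod_obj C W X) Y.
        \<exists>!g. g \<in> Hom C W Z \<and> e \<cdot>\<^bsub>C\<^esub> times_right C g X = f)"

definition expo_ev :: "('o, 'm) cat \<Rightarrow> 'o \<Rightarrow> 'o \<Rightarrow> 'o \<times> 'm" where
  "expo_ev C X Y = (SOME r. is_exponential C X Y (fst r) (snd r))"

text \<open>\<open>expo C X Y\<close> is the exponential \<open>[X, Y]\<close>, with exponent \<open>X\<close>.\<close>

abbreviation expo :: "('o, 'm) cat \<Rightarrow> 'o \<Rightarrow> 'o \<Rightarrow> 'o" where
  "expo C X Y \<equiv> fst (expo_ev C X Y)"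

abbreviation ev :: "('o, 'm) cat \<Rightarrow> 'o \<Rightarrow> 'o \<Rightarrow> 'm" where
  "ev C X Y \<equiv> snd (expo_ev C X Y)"

text \<open>The transpose \<open>W \<rightarrow> [X, Y]\<close> of \<open>f : W \<times> X \<rightarrow> Y\<close>.\<close>

definition transpose :: "('o, 'm) cat \<Rightarrow> 'o \<Rightarrow> 'o \<Rightarrow> 'o \<Rightarrow> 'm \<Rightarrow> 'm" where
  "transpose C W X Y f =
     (THE g. g \<in> Hom C W (expo C X Y) \<and> ev C X Y \<cdot>\<^bsub>C\<^esub> times_right C g X = f)"

definition cartesian_closed :: "('o, 'm) cat \<Rightarrow> bool" where
  "cartesian_closed C \<longleftrightarrow>
     category C \<and> (\<exists>T. is_terminal C T) \<and>
     (\<forall>X\<in>Obj C. \<forall>Y\<in>Obj C. \<exists>p q. is_product C X Y p q) \<and>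
     (\<forall>X\<in>Obj C. \<forall>Y\<in>Obj C. \<exists>Z e. is_exponential C X Y Z e)"

subsection \<open>Slices\<close>

text \<open>An arrow of the slice from \<open>f\<close> to \<open>g\<close> is a triple \<open>(f, h, g)\<close> with \<open>g \<cdot> h = f\<close>.\<close>

definition slice :: "('o, 'm) cat \<Rightarrow> 'o \<Rightarrow> ('m, 'm \<times> 'm \<times> 'm) cat" where
  "slice C I =
     \<lparr> Obj = {f \<in> Arr C. Cod C f = I},
       Arr = {(f, h, g). f \<in> Arr C \<and> Cod C f = I \<and> g \<in> Arr C \<and> Cod C g = I \<and>
                h \<in> Hom C (Dom C f) (Dom C g) \<and> g \<cdot>\<^bsub>C\<^esub> h = f},
       Dom = (\<lambda>(f, h, g). f),
       Cod = (\<lambda>(f, h, g). g),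
       Idn = (\<lambda>f. (f, Idn C (Dom C f), f)),
       Comp = (\<lambda>(f', k, g') (f, h, g). (f, k \<cdot>\<^bsub>C\<^esub> h, g')) \<rparr>"

definition locally_cartesian_closed :: "('o, 'm) cat \<Rightarrow> bool" where
  "locally_cartesian_closed C \<longleftrightarrow> category C \<and> (\<forall>I\<in>Obj C. cartesian_closed (slice C I))"

text \<open>The functor \<open>I\<^sup>* : C \<rightarrow> C/I\<close>: pullback along \<open>I \<rightarrow> 1\<close>.\<close>

definition star_obj :: "('o, 'm) cat \<Rightarrow> 'o \<Rightarrow> 'o \<Rightarrow> 'm" where
  "star_obj C I X = pb1 C (bang C I) (bang C X)"

definition star_arr :: "('o, 'm) cat \<Rightarrow> 'o \<Rightarrow> 'm \<Rightarrow> 'm \<times> 'm \<times> 'm" where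
  "star_arr C I h =
     (let X = Dom C h; Y = Cod C h in
      (star_obj C I X,
       pair_into C (pb1 C (bang C I) (bang C Y)) (pb2 C (bang C I) (bang C Y))
         (pb1 C (bang C I) (bang C X)) (h \<cdot>\<^bsub>C\<^esub> pb2 C (bang C I) (bang C X)),
       star_obj C I Y))"

section \<open>Internal categories\<close>

text \<open>Composition \<open>Cmp\<close> is defined on the chosen pullback of \<open>Src\<close> and \<open>Tgt\<close>, whose generalized
  elements are the pairs \<open>(g, f)\<close> with \<open>Src g = Tgt f\<close>; it sends \<open>(g, f)\<close> to \<open>g \<circ> f\<close>.\<close>

record ('o, 'm) icat =
  Ob :: 'o
  Mor :: 'o
  Src :: 'm
  Tgt :: 'm
  Ids :: 'm
  Cmp :: 'm

text \<open>The composite \<open>g \<circ> f\<close> of generalized elements of \<open>Mor A\<close> with \<open>Src g = Tgt f\<close>.\<close>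

definition icomp :: "('o, 'm) cat \<Rightarrow> ('o, 'm) icat \<Rightarrow> 'm \<Rightarrow> 'm \<Rightarrow> 'm" where
  "icomp C A g f =
     Cmp A \<cdot>\<^bsub>C\<^esub> pair_into C (pb1 C (Src A) (Tgt A)) (pb2 C (Src A) (Tgt A)) g f"

text \<open>In the associativity axiom, \<open>r1\<close> and \<open>r2\<close> are the projections \<open>(h, g, f) \<mapsto> (h, g)\<close> and
  \<open>(h, g, f) \<mapsto> (g, f)\<close> from the object of composable triples.\<close>

definition internal_category :: "('o, 'm) cat \<Rightarrow> ('o, 'm) icat \<Rightarrow> bool" where
  "internal_category C A \<longleftrightarrow>
     Ob A \<in> Obj C \<and> Mor A \<in> Obj C \<and>
     Src A \<in> Hom C (Mor A) (Ob A) \<and> Tgt A \<in> Hom C (Mor A) (Ob A) \<and>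
     Ids A \<in> Hom C (Ob A) (Mor A) \<and>
     Cmp A \<in> Hom C (pb_obj C (Src A) (Tgt A)) (Mor A) \<and>
     Src A \<cdot>\<^bsub>C\<^esub> Ids A = Idn C (Ob A) \<and> Tgt A \<cdot>\<^bsub>C\<^esub> Ids A = Idn C (Ob A) \<and>
     Src A \<cdot>\<^bsub>C\<^esub> Cmp A = Src A \<cdot>\<^bsub>C\<^esub> pb2 C (Src A) (Tgt A) \<and>
     Tgt A \<cdot>\<^bsub>C\<^esub> Cmp A = Tgt A \<cdot>\<^bsub>C\<^esub> pb1 C (Src A) (Tgt A) \<and>
     icomp C A (Ids A \<cdot>\<^bsub>C\<^esub> Tgt A) (Idn C (Mor A)) = Idn C (Mor A) \<and>
     icomp C A (Idn C (Mor A)) (Ids A \<cdot>\<^bsub>C\<^esub> Src A) = Idn C (Mor A) \<and>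
     (let p = pb1 C (Src A) (Tgt A); q = pb2 C (Src A) (Tgt A);
          r1 = pb1 C q p; r2 = pb2 C q p in
      icomp C A (Cmp A \<cdot>\<^bsub>C\<^esub> r1) (q \<cdot>\<^bsub>C\<^esub> r2) = icomp C A (p \<cdot>\<^bsub>C\<^esub> r1) (Cmp A \<cdot>\<^bsub>C\<^esub> r2))"

record ('o, 'm) ifun =
  FDom :: "('o, 'm) icat"
  FCod :: "('o, 'm) icat"
  F0 :: 'm
  F1 :: 'm

definition internal_functor :: "('o, 'm) cat \<Rightarrow> ('o, 'm) ifun \<Rightarrow> bool" where
  "internal_functor C F \<longleftrightarrow>
     (let A = FDom F; B = FCod F;
          p = pb1 C (Src A) (Tgt A); q = pb2 C (Src A) (Tgt A) in
      internal_category C A \<and> internal_category C B \<and>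
      F0 F \<in> Hom C (Ob A) (Ob B) \<and> F1 F \<in> Hom C (Mor A) (Mor B) \<and>
      Src B \<cdot>\<^bsub>C\<^esub> F1 F = F0 F \<cdot>\<^bsub>C\<^esub> Src A \<and>
      Tgt B \<cdot>\<^bsub>C\<^esub> F1 F = F0 F \<cdot>\<^bsub>C\<^esub> Tgt A \<and>
      F1 F \<cdot>\<^bsub>C\<^esub> Ids A = Ids B \<cdot>\<^bsub>C\<^esub> F0 F \<and>
      F1 F \<cdot>\<^bsub>C\<^esub> Cmp A = icomp C B (F1 F \<cdot>\<^bsub>C\<^esub> p) (F1 F \<cdot>\<^bsub>C\<^esub> q))"

definition CAT :: "('o, 'm) cat \<Rightarrow> (('o, 'm) icat, ('o, 'm) ifun) cat" where
  "CAT C =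
     \<lparr> Obj = {A. internal_category C A},
       Arr = {F. internal_functor C F},
       Dom = FDom,
       Cod = FCod,
       Idn = (\<lambda>A. \<lparr> FDom = A, FCod = A, F0 = Idn C (Ob A), F1 = Idn C (Mor A) \<rparr>),
       Comp = (\<lambda>G F. \<lparr> FDom = FDom F, FCod = FCod G,
                       F0 = F0 G \<cdot>\<^bsub>C\<^esub> F0 F, F1 = F1 G \<cdot>\<^bsub>C\<^esub> F1 F \<rparr>) \<rparr>"

text \<open>A natural transformation \<open>F \<rightarrow> G\<close> between functors \<open>A \<rightarrow> B\<close> is an arrow \<open>Ob A \<rightarrow> Mor B\<close>.
  With this encoding the whiskerings \<open>H\<alpha>\<close> and \<open>\<alpha>K\<close> are \<open>F1 H \<cdot> \<alpha>\<close> and \<open>\<alpha> \<cdot> F0 K\<close>, the vertical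
  composite of \<open>\<alpha>\<close> and \<open>\<beta>\<close> is \<open>icomp C B \<beta> \<alpha>\<close>, and the identity on \<open>F\<close> is \<open>Ids B \<cdot> F0 F\<close>.\<close>

definition nat_trans ::
  "('o, 'm) cat \<Rightarrow> ('o, 'm) ifun \<Rightarrow> ('o, 'm) ifun \<Rightarrow> 'm \<Rightarrow> bool" where
  "nat_trans C F G \<alpha> \<longleftrightarrow>
     (let A = FDom F; B = FCod F in
      F \<in> Hom (CAT C) A B \<and> G \<in> Hom (CAT C) A B \<and>
      \<alpha> \<in> Hom C (Ob A) (Mor B) \<and>
      Src B \<cdot>\<^bsub>C\<^esub> \<alpha> = F0 F \<and> Tgt B \<cdot>\<^bsub>C\<^esub> \<alpha> = F0 G \<and>
      icomp C B (\<alpha> \<cdot>\<^bsub>C\<^esub> Tgt A) (F1 F) = icomp C B (F1 G) (\<alpha> \<cdot>\<^bsub>C\<^esub> Src A))"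

definition adjunction ::
  "('o, 'm) cat \<Rightarrow> ('o, 'm) ifun \<Rightarrow> ('o, 'm) ifun \<Rightarrow> 'm \<Rightarrow> 'm \<Rightarrow> bool" where
  "adjunction C L R \<eta> \<epsilon> \<longleftrightarrow>
     (let A = FDom L; B = FCod L in
      L \<in> Hom (CAT C) A B \<and> R \<in> Hom (CAT C) B A \<and>
      nat_trans C (Idn (CAT C) A) (R \<cdot>\<^bsub>CAT C\<^esub> L) \<eta> \<and>
      nat_trans C (L \<cdot>\<^bsub>CAT C\<^esub> R) (Idn (CAT C) B) \<epsilon> \<and>
      icomp C B (\<epsilon> \<cdot>\<^bsub>C\<^esub> F0 L) (F1 L \<cdot>\<^bsub>C\<^esub> \<eta>) = Ids B \<cdot>\<^bsub>C\<^esub> F0 L \<and>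
      icomp C A (F1 R \<cdot>\<^bsub>C\<^esub> \<epsilon>) (\<eta> \<cdot>\<^bsub>C\<^esub> F0 R) = Ids A \<cdot>\<^bsub>C\<^esub> F0 R)"

subsection \<open>Functor categories\<close>

text \<open>The diagonal \<open>\<Delta> : A \<rightarrow> [D, A]\<close>.\<close>

definition diag :: "('o, 'm) cat \<Rightarrow> ('o, 'm) icat \<Rightarrow> ('o, 'm) icat \<Rightarrow> ('o, 'm) ifun" where
  "diag C D A = transpose (CAT C) A D A (proj1 (CAT C) A D)"

text \<open>The point \<open>1 \<rightarrow> [D, A]\<close> corresponding to a functor \<open>F : D \<rightarrow> A\<close>.\<close>

definition point :: "('o, 'm) cat \<Rightarrow> ('o, 'm) ifun \<Rightarrow> ('o, 'm) ifun" where
  "point C F = transpose (CAT C) (terminal (CAT C)) (FDom F) (FCod F)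
     (F \<cdot>\<^bsub>CAT C\<^esub> proj2 (CAT C) (terminal (CAT C)) (FDom F))"

text \<open>The post-composition functor \<open>[D, F] : [D, A] \<rightarrow> [D, B]\<close> for \<open>F : A \<rightarrow> B\<close>.\<close>

definition postcomp :: "('o, 'm) cat \<Rightarrow> ('o, 'm) icat \<Rightarrow> ('o, 'm) ifun \<Rightarrow> ('o, 'm) ifun" where
  "postcomp C D F = transpose (CAT C) (expo (CAT C) D (FDom F)) D (FCod F)
     (F \<cdot>\<^bsub>CAT C\<^esub> ev (CAT C) D (FDom F))"

subsection \<open>The functors induced by \<open>I\<^sup>*\<close> on internal categories\<close>

text \<open>The composition of \<open>I\<^sup>*A\<close> is \<open>I\<^sup>*(Cmp A)\<close> preceded by the canonical isomorphism from the
  chosen pullback of \<open>I\<^sup>*(Src A)\<close> and \<open>I\<^sup>*(Tgt A)\<close> to the image under \<open>I\<^sup>*\<close> of the chosen pullback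
  of \<open>Src A\<close> and \<open>Tgt A\<close>.\<close>

definition star_icat ::
  "('o, 'm) cat \<Rightarrow> 'o \<Rightarrow> ('o, 'm) icat \<Rightarrow> ('m, 'm \<times> 'm \<times> 'm) icat" where
  "star_icat C I A =
     (let s = star_arr C I (Src A); t = star_arr C I (Tgt A) in
      \<lparr> Ob = star_obj C I (Ob A),
        Mor = star_obj C I (Mor A),
        Src = s,
        Tgt = t,
        Ids = star_arr C I (Ids A),
        Cmp = star_arr C I (Cmp A) \<cdot>\<^bsub>slice C I\<^esub>
          pair_into (slice C I)
            (star_arr C I (pb1 C (Src A) (Tgt A))) (star_arr C I (pb2 C (Src A) (Tgt A)))
            (pb1 (slice C I) s t) (pb2 (slice C I) s t) \<rparr>)"

definition star_ifun ::
  "('o, 'm) cat \<Rightarrow> 'o \<Rightarrow> ('o, 'm) ifun \<Rightarrow> ('m, 'm \<times> 'm \<times> 'm) ifun" where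
  "star_ifun C I F =
     \<lparr> FDom = star_icat C I (FDom F), FCod = star_icat C I (FCod F),
       F0 = star_arr C I (F0 F), F1 = star_arr C I (F1 F) \<rparr>"

text \<open>The canonical isomorphism \<open>1 \<rightarrow> I\<^sup>*1\<close>.\<close>

definition star_terminal_iso :: "('o, 'm) cat \<Rightarrow> 'o \<Rightarrow> ('m, 'm \<times> 'm \<times> 'm) ifun" where
  "star_terminal_iso C I =
     (THE u. u \<in> Hom (CAT (slice C I)) (terminal (CAT (slice C I)))
                                       (star_icat C I (terminal (CAT C))))"

text \<open>The canonical isomorphism \<open>I\<^sup>*[D, A] \<rightarrow> [I\<^sup>*D, I\<^sup>*A]\<close>: the transpose of the composite
  \<open>I\<^sup>*[D, A] \<times> I\<^sup>*D \<cong> I\<^sup>*([D, A] \<times> D) \<rightarrow> I\<^sup>*A\<close>.\<close>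

definition star_expo_iso ::
  "('o, 'm) cat \<Rightarrow> 'o \<Rightarrow> ('o, 'm) icat \<Rightarrow> ('o, 'm) icat \<Rightarrow> ('m, 'm \<times> 'm \<times> 'm) ifun" where
  "star_expo_iso C I D A =
     (let K = CAT (slice C I); X = expo (CAT C) D A;
          X' = star_icat C I X; D' = star_icat C I D; A' = star_icat C I A in
      transpose K X' D' A'
        (star_ifun C I (ev (CAT C) D A) \<cdot>\<^bsub>K\<^esub>
         pair_into K (star_ifun C I (proj1 (CAT C) X D)) (star_ifun C I (proj2 (CAT C) X D))
           (proj1 K X' D') (proj2 K X' D')))"

section \<open>Internal limits\<close>

text \<open>A cone over a diagram \<open>D\<close> is a pair of a vertex \<open>V : 1 \<rightarrow> A\<close> and a natural transformation
  from \<open>\<Delta>V\<close> to \<open>point C D\<close>.\<close>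

definition cone_cat ::
  "('o, 'm) cat \<Rightarrow> ('o, 'm) ifun \<Rightarrow>
   (('o, 'm) ifun \<times> 'm,
    (('o, 'm) ifun \<times> 'm) \<times> 'm \<times> (('o, 'm) ifun \<times> 'm)) cat" where
  "cone_cat C D =
     (let J = FDom D; A = FCod D; \<Delta> = diag C J A;
          cones = {(V, \<gamma>). V \<in> Hom (CAT C) (terminal (CAT C)) A \<and>
                     nat_trans C (\<Delta> \<cdot>\<^bsub>CAT C\<^esub> V) (point C D) \<gamma>} in
      \<lparr> Obj = cones,
        Arr = {((V0, \<gamma>0), h, (V1, \<gamma>1)). (V0, \<gamma>0) \<in> cones \<and> (V1, \<gamma>1) \<in> cones \<and>
                 nat_trans C V0 V1 h \<and>
                 icomp C (expo (CAT C) J A) \<gamma>1 (F1 \<Delta> \<cdot>\<^bsub>C\<^esub> h) = \<gamma>0},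
        Dom = (\<lambda>(c, h, c'). c),
        Cod = (\<lambda>(c, h, c'). c'),
        Idn = (\<lambda>(V, \<gamma>). ((V, \<gamma>), Ids A \<cdot>\<^bsub>C\<^esub> F0 V, (V, \<gamma>))),
        Comp = (\<lambda>(d, k, d') (c, h, c'). (c, icomp C A k h, d')) \<rparr>)"

definition star_cone ::
  "('o, 'm) cat \<Rightarrow> 'o \<Rightarrow> ('o, 'm) ifun \<Rightarrow> ('o, 'm) ifun \<times> 'm \<Rightarrow>
   ('m, 'm \<times> 'm \<times> 'm) ifun \<times> ('m \<times> 'm \<times> 'm)" where
  "star_cone C I D = (\<lambda>(V, \<gamma>).
     (star_ifun C I V \<cdot>\<^bsub>CAT (slice C I)\<^esub> star_terminal_iso C I,
      F1 (star_expo_iso C I (FDom D) (FCod D)) \<cdot>\<^bsub>slice C I\<^esub>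
        star_arr C I \<gamma> \<cdot>\<^bsub>slice C I\<^esub> F0 (star_terminal_iso C I)))"

definition universal_cone ::
  "('o, 'm) cat \<Rightarrow> ('o, 'm) ifun \<Rightarrow> ('o, 'm) ifun \<times> 'm \<Rightarrow> bool" where
  "universal_cone C D c \<longleftrightarrow>
     c \<in> Obj (cone_cat C D) \<and>
     (\<forall>I\<in>Obj C. is_terminal (cone_cat (slice C I) (star_ifun C I D)) (star_cone C I D c))"

definition internally_complete :: "('o, 'm) cat \<Rightarrow> ('o, 'm) icat \<Rightarrow> bool" where
  "internally_complete C A \<longleftrightarrow>
     (\<forall>I\<in>Obj C. \<forall>D\<in>Arr (CAT (slice C I)). FCod D = star_icat C I A \<longrightarrow>
        (\<exists>c. universal_cone (slice C I) D c))"

definition internally_continuous :: "('o, 'm) cat \<Rightarrow> ('o, 'm) ifun \<Rightarrow> bool" where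
  "internally_continuous C F \<longleftrightarrow>
     (\<forall>I\<in>Obj C. \<forall>D\<in>Arr (CAT (slice C I)). FCod D = star_icat C I (FDom F) \<longrightarrow>
        (\<forall>V \<pi>. universal_cone (slice C I) D (V, \<pi>) \<longrightarrow>
           universal_cone (slice C I) (star_ifun C I F \<cdot>\<^bsub>CAT (slice C I)\<^esub> D)
             (star_ifun C I F \<cdot>\<^bsub>CAT (slice C I)\<^esub> V,
              F1 (postcomp (slice C I) (FDom D) (star_ifun C I F)) \<cdot>\<^bsub>slice C I\<^esub> \<pi>)))"

end

theory Submission
  imports Defs
begin

text \<open>The left adjoint of \<open>R : B \<rightarrow> A\<close> sends an object \<open>a\<close> to the limit of the projection
  \<open>P : (a \<down> R) \<rightarrow> B\<close> from the comma category. No solution set condition is needed, because the comma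
  category is itself an internal category and \<open>B\<close> has limits of all internal diagrams.

  To treat all objects of \<open>A\<close> at once, one works in the slice over \<open>Ob A\<close>, where there is a generic
  object \<open>a\<close> of \<open>A\<close>. There \<open>P\<close> has a limit \<open>v\<close>, which \<open>R\<close> preserves, so the tautological cone from \<open>a\<close> to
  \<open>R P\<close> factors through an arrow \<open>\<eta> : a \<rightarrow> R v\<close>. The component of the limit cone at the object \<open>(v, \<eta>)\<close> of the
  comma category is an endomorphism of the limit cone, hence the identity, and then naturality of the
  limit cone shows that every arrow from \<open>(v, \<eta>)\<close> is a component of the cone. So \<open>\<eta>\<close> is a universal
  arrow, at all stages (\<open>universal_arrow_from_limits\<close>). Read in \<open>E\<close>, it is a universal arrow from the
  generic object of \<open>A\<close> to \<open>R\<close>, and this amounts to an internal left adjoint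
  (\<open>adjunction_from_universal_arrows\<close>).

  Since limits are defined by cones in the internal category of functors \<open>[D, A]\<close>, this argument needs
  the description of such a cone by its components \<open>Ob D \<rightarrow> Mor A\<close> (\<open>cone_elem_cone\<close>, \<open>ex_cone\<close>,
  \<open>cone_arrow_iff\<close>). The chosen exponential is only known through its universal property for functors,
  so \<open>[D, A]\<close> is constructed as the object representing functors and natural transformations at all
  stages (\<open>functor_category\<close>), compared with the chosen one, and seen to classify natural
  transformations too (\<open>ev_transposes\<close>). The universal property of a limit is stated after base change
  along all objects; the proof uses it only over the terminal object, where base change is an
  equivalence (\<open>star_terminal_cone\<close>).

  Calculations in an internal category are made with generalized elements: \<open>icomp\<close> makes the arrows
  from a stage \<open>W\<close> to \<open>Ob A\<close> and \<open>Mor A\<close> a category, naturally in \<open>W\<close>, and internal categories, functors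
  and universal properties are determined by these categories.\<close>

section \<open>Universal arrows in a category\<close>

text \<open>Membership in a hom-set is always expanded, so that the simplifier can discharge typing conditions
  by computing domains and codomains.\<close>

lemma in_Hom [simp]: "f \<in> Hom C X Y \<longleftrightarrow> f \<in> Arr C \<and> Dom C f = X \<and> Cod C f = Y"
  by (auto simp: Hom_def)

context category
begin

declare Dom_Obj [simp] Cod_Obj [simp]

lemma comp_arr [simp]: "f \<in> Arr C \<Longrightarrow> g \<in> Arr C \<Longrightarrow> Dom C g = Cod C f \<Longrightarrow> g \<cdot> f \<in> Arr C"
  and Dom_comp [simp]: "f \<in> Arr C \<Longrightarrow> g \<in> Arr C \<Longrightarrow> Dom C g = Cod C f \<Longrightarrow> Dom C (g \<cdot> f) = Dom C f"
  and Cod_comp [simp]: "f \<in> Arr C \<Longrightarrow> g \<in> Arr C \<Longrightarrow> Dom C g = Cod C f \<Longrightarrow> Cod C (g \<cdot> f) = Cod C g"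
  using Comp_Hom[of f "Dom C f" "Cod C f" g "Cod C g"] by simp_all

lemma Idn_arr [simp]: "X \<in> Obj C \<Longrightarrow> Idn C X \<in> Arr C"
  and Dom_Idn [simp]: "X \<in> Obj C \<Longrightarrow> Dom C (Idn C X) = X"
  and Cod_Idn [simp]: "X \<in> Obj C \<Longrightarrow> Cod C (Idn C X) = X"
  using Idn_Hom[of X] by simp_all

lemma comp_Idn_right [simp]: "f \<in> Arr C \<Longrightarrow> Dom C f = X \<Longrightarrow> f \<cdot> Idn C X = f"
  and comp_Idn_left [simp]: "f \<in> Arr C \<Longrightarrow> Cod C f = X \<Longrightarrow> Idn C X \<cdot> f = f"
  by (simp_all add: Comp_Idn[of f X "Cod C f"] Idn_Comp[of f "Dom C f" X])

lemma comp_assoc [simp]: "f \<in> Arr C \<Longrightarrow> g \<in> Arr C \<Longrightarrow> h \<in> Arr C \<Longrightarrow> Dom C g = Cod C f \<Longrightarrow>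
    Dom C h = Cod C g \<Longrightarrow> (h \<cdot> g) \<cdot> f = h \<cdot> (g \<cdot> f)"
  using Comp_assoc[of f "Dom C f" "Cod C f" g "Cod C g" h "Cod C h"] by simp

text \<open>Equations between composites are used in this form, applied to a generalized element \<open>f\<close>.\<close>

lemma comp_eq_comp: "h \<cdot> g = k \<Longrightarrow> f \<in> Arr C \<Longrightarrow> g \<in> Arr C \<Longrightarrow> h \<in> Arr C \<Longrightarrow> Dom C g = Cod C f \<Longrightarrow>
    Dom C h = Cod C g \<Longrightarrow> h \<cdot> (g \<cdot> f) = k \<cdot> f"
  using comp_assoc by metis

subsection \<open>Terminal objects\<close>

lemma terminal_arrows_eq:
  "is_terminal C T \<Longrightarrow> f \<in> Arr C \<Longrightarrow> g \<in> Arr C \<Longrightarrow> Dom C f = Dom C g \<Longrightarrow> Cod C f = T \<Longrightarrow>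
    Cod C g = T \<Longrightarrow> f = g"
  unfolding is_terminal_def by (metis Dom_Obj in_Hom)

lemma is_terminal_iso:
  assumes "is_terminal C T" "u \<in> Hom C S T" "v \<in> Hom C T S" "v \<cdot> u = Idn C S"
  shows "is_terminal C S"
  unfolding is_terminal_def
proof (intro conjI ballI)
  show "S \<in> Obj C" using assms by auto
  fix X assume X: "X \<in> Obj C"
  obtain t where t: "t \<in> Hom C X T" using assms(1) X unfolding is_terminal_def by blast
  show "\<exists>!f. f \<in> Hom C X S"
  proof
    show "v \<cdot> t \<in> Hom C X S" using t assms by auto
    fix f assume f: "f \<in> Hom C X S"
    have "u \<cdot> f = t" by (rule terminal_arrows_eq[of T]; use f t assms in auto)
    then have "v \<cdot> t = v \<cdot> u \<cdot> f" by simp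
    also have "\<dots> = (v \<cdot> u) \<cdot> f" using f assms(2,3) by simp
    also have "\<dots> = f" using f assms(4) by simp
    finally show "f = v \<cdot> t" by simp
  qed
qed

text \<open>The arrow to a terminal object \<open>T\<close>, which need not be the chosen one.\<close>

definition to_terminal :: "'o \<Rightarrow> 'o \<Rightarrow> 'm" where
  "to_terminal T X = (THE f. f \<in> Hom C X T)"

lemma to_terminal:
  assumes "is_terminal C T" "X \<in> Obj C"
  shows "to_terminal T X \<in> Arr C" "Dom C (to_terminal T X) = X" "Cod C (to_terminal T X) = T"
proof -
  have "\<exists>!f. f \<in> Hom C X T" using assms by (auto simp: is_terminal_def)
  then have "to_terminal T X \<in> Hom C X T" unfolding to_terminal_def by (rule theI')
  then show "to_terminal T X \<in> Arr C" "Dom C (to_terminal T X) = X" "Cod C (to_terminal T X) = T"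
    by auto
qed

lemma to_terminal_comp:
  assumes "is_terminal C T" "f \<in> Arr C" "Cod C f = X"
  shows "to_terminal T X \<cdot> f = to_terminal T (Dom C f)"
  by (rule terminal_arrows_eq[of T]; use assms in \<open>auto simp: to_terminal\<close>)

subsection \<open>Binary products\<close>

lemma is_productD:
  assumes "is_product C X Y p q"
  shows "p \<in> Arr C" "q \<in> Arr C" "Dom C q = Dom C p" "Cod C p = X" "Cod C q = Y"
  using assms unfolding is_product_def by auto

lemma is_product_ex1:
  assumes "is_product C X Y p q" "f \<in> Hom C W X" "g \<in> Hom C W Y"
  shows "\<exists>!u. u \<in> Hom C W (Dom C p) \<and> p \<cdot> u = f \<and> q \<cdot> u = g"
proof -
  obtain P where P: "p \<in> Hom C P X" and u: "\<forall>W f g. f \<in> Hom C W X \<and> g \<in> Hom C W Y \<longrightarrow>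
     (\<exists>!u. u \<in> Hom C W P \<and> p \<cdot> u = f \<and> q \<cdot> u = g)"
    using assms(1) unfolding is_product_def by blast
  have "Dom C p = P" using P by simp
  then show ?thesis using u[rule_format, OF conjI, OF assms(2,3)] by simp
qed

lemma pair_product:
  assumes "is_product C X Y p q" "f \<in> Arr C" "g \<in> Arr C" "Dom C f = Dom C g" "Cod C f = X" "Cod C g = Y"
  shows "pair_into C p q f g \<in> Arr C" "Dom C (pair_into C p q f g) = Dom C g"
    "Cod C (pair_into C p q f g) = Dom C p" "p \<cdot> pair_into C p q f g = f"
    "q \<cdot> pair_into C p q f g = g"
proof -
  have "\<exists>!u. u \<in> Hom C (Dom C f) (Dom C p) \<and> p \<cdot> u = f \<and> q \<cdot> u = g"
    by (rule is_product_ex1[OF assms(1)]) (use assms in simp_all)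
  from theI'[OF this] show "pair_into C p q f g \<in> Arr C"
    "Dom C (pair_into C p q f g) = Dom C g"
    "Cod C (pair_into C p q f g) = Dom C p" "p \<cdot> pair_into C p q f g = f"
    "q \<cdot> pair_into C p q f g = g" using assms unfolding pair_into_def by auto
qed

lemma pair_product_comp:
  assumes "is_product C X Y p q" "f \<in> Arr C" "g \<in> Arr C" "Dom C f = Dom C g" "Cod C f = X" "Cod C g = Y"
    "h \<in> Arr C" "Cod C h = Dom C g"
  shows "p \<cdot> (pair_into C p q f g \<cdot> h) = f \<cdot> h" "q \<cdot> (pair_into C p q f g \<cdot> h) = g \<cdot> h"
  by (rule comp_eq_comp; use assms is_productD[OF assms(1)] pair_product[OF assms(1-6)] in simp)+

lemma product_eqI:
  assumes "is_product C X Y p q" "u \<in> Arr C" "v \<in> Arr C" "Dom C u = Dom C v" "Cod C u = Dom C p"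
    "Cod C v = Dom C p" "p \<cdot> u = p \<cdot> v" "q \<cdot> u = q \<cdot> v"
  shows "u = v"
proof -
  have *: "p \<cdot> u \<in> Hom C (Dom C u) X" "q \<cdot> u \<in> Hom C (Dom C u) Y"
    using assms is_productD[OF assms(1)] by auto
  have "u \<in> Hom C (Dom C u) (Dom C p) \<and> p \<cdot> u = p \<cdot> u \<and> q \<cdot> u = q \<cdot> u"
    "v \<in> Hom C (Dom C u) (Dom C p) \<and> p \<cdot> v = p \<cdot> u \<and> q \<cdot> v = q \<cdot> u"
    using assms by simp_all
  with is_product_ex1[OF assms(1) *] show ?thesis by blast
qed

lemma is_productI:
  assumes "p \<in> Arr C" "q \<in> Arr C" "Dom C q = Dom C p" "Cod C p = X" "Cod C q = Y"
    and "\<And>W f g. f \<in> Hom C W X \<Longrightarrow> g \<in> Hom C W Y \<Longrightarrow>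
       \<exists>u\<in>Hom C W (Dom C p). p \<cdot> u = f \<and> q \<cdot> u = g"
    and "\<And>u v. u \<in> Arr C \<Longrightarrow> v \<in> Arr C \<Longrightarrow> Dom C u = Dom C v \<Longrightarrow> Cod C u = Dom C p \<Longrightarrow>
       Cod C v = Dom C p \<Longrightarrow> p \<cdot> u = p \<cdot> v \<Longrightarrow> q \<cdot> u = q \<cdot> v \<Longrightarrow> u = v"
  shows "is_product C X Y p q"
  unfolding is_product_def
proof (rule bexI[of _ "Dom C p"], intro conjI allI impI)
  fix W f g assume fg: "f \<in> Hom C W X \<and> g \<in> Hom C W Y"
  then obtain u where u: "u\<in>Hom C W (Dom C p)" "p \<cdot> u = f" "q \<cdot> u = g" using assms(6) by blast
  show "\<exists>!u. u \<in> Hom C W (Dom C p) \<and> p \<cdot> u = f \<and> q \<cdot> u = g"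
    using u assms(7) by (intro ex1I[of _ u]) auto
qed (use assms(1-5) in auto)

lemma is_product_iso:
  assumes "is_product C X Y p q" "u \<in> Hom C P (Dom C p)" "v \<in> Hom C (Dom C p) P"
    "v \<cdot> u = Idn C P" "u \<cdot> v = Idn C (Dom C p)"
  shows "is_product C X Y (p \<cdot> u) (q \<cdot> u)"
proof (rule is_productI)
  note [simp] = is_productD[OF assms(1)]
  have [simp]: "u \<in> Arr C" "v \<in> Arr C" "Dom C u = P" "Cod C u = Dom C p" "Dom C v = Dom C p"
      "Cod C v = P"
    using assms by auto
  have uv: "u \<cdot> (v \<cdot> x) = x" if "x \<in> Arr C" "Cod C x = Dom C p" for x
    using comp_eq_comp[OF assms(5), of x] that by simp
  have vu: "v \<cdot> (u \<cdot> x) = x" if "x \<in> Arr C" "Cod C x = P" for x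
    using comp_eq_comp[OF assms(4), of x] that by simp
  show "p \<cdot> u \<in> Arr C" "q \<cdot> u \<in> Arr C" "Dom C (q \<cdot> u) = Dom C (p \<cdot> u)" "Cod C (p \<cdot> u) = X"
    "Cod C (q \<cdot> u) = Y" by auto
  fix W f g assume fg: "f \<in> Hom C W X" "g \<in> Hom C W Y"
  show "\<exists>w\<in>Hom C W (Dom C (p \<cdot> u)). (p \<cdot> u) \<cdot> w = f \<and> (q \<cdot> u) \<cdot> w = g"
    using fg by (intro bexI[of _ "v \<cdot> pair_into C p q f g"]) (auto simp: pair_product[OF assms(1)] uv)
next
  note [simp] = is_productD[OF assms(1)]
  have [simp]: "u \<in> Arr C" "v \<in> Arr C" "Dom C u = P" "Cod C u = Dom C p" "Dom C v = Dom C p"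
      "Cod C v = P"
    using assms by auto
  have vu: "v \<cdot> (u \<cdot> x) = x" if "x \<in> Arr C" "Cod C x = P" for x
    using comp_eq_comp[OF assms(4), of x] that by simp
  fix w w' assume w: "w \<in> Arr C" "w' \<in> Arr C" "Dom C w = Dom C w'" "Cod C w = Dom C (p \<cdot> u)"
    "Cod C w' = Dom C (p \<cdot> u)" "(p \<cdot> u) \<cdot> w = (p \<cdot> u) \<cdot> w'" "(q \<cdot> u) \<cdot> w = (q \<cdot> u) \<cdot> w'"
  have "u \<cdot> w = u \<cdot> w'" by (rule product_eqI[OF assms(1)]) (use w in auto)
  then have "v \<cdot> (u \<cdot> w) = v \<cdot> (u \<cdot> w')" by (rule arg_cong)
  moreover have "Cod C w = P" "Cod C w' = P" using w(4,5) by simp_all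
  ultimately show "w = w'" using vu[OF w(1)] vu[OF w(2)] by simp
qed

lemma product_unique:
  assumes "is_product C X Y p q" "is_product C X Y p' q'"
  obtains u v where "u \<in> Hom C (Dom C p') (Dom C p)" "v \<in> Hom C (Dom C p) (Dom C p')"
    "v \<cdot> u = Idn C (Dom C p')" "u \<cdot> v = Idn C (Dom C p)" "p \<cdot> u = p'" "q \<cdot> u = q'"
proof
  note [simp] = is_productD[OF assms(1)] is_productD[OF assms(2)] pair_product[OF assms(1)]
      pair_product[OF assms(2)]
  let ?u = "pair_into C p q p' q'" and ?v = "pair_into C p' q' p q"
  have e: "p \<cdot> (?u \<cdot> ?v) = p" "q \<cdot> (?u \<cdot> ?v) = q" "p' \<cdot> (?v \<cdot> ?u) = p'" "q' \<cdot> (?v \<cdot> ?u) = q'"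
    by (simp_all add: pair_product_comp[OF assms(1)] pair_product_comp[OF assms(2)])
  show "?u \<in> Hom C (Dom C p') (Dom C p)" "?v \<in> Hom C (Dom C p) (Dom C p')" "p \<cdot> ?u = p'" "q \<cdot> ?u = q'"
    by auto
  show "?v \<cdot> ?u = Idn C (Dom C p')" by (rule product_eqI[OF assms(2)]) (auto simp: e)
  show "?u \<cdot> ?v = Idn C (Dom C p)" by (rule product_eqI[OF assms(1)]) (auto simp: e)
qed

end

text \<open>Categories with finite products.\<close>

locale fprod_cat = category C for C :: "('o, 'm) cat" (structure) +
  assumes ex_terminal: "\<exists>T. is_terminal C T"
    and ex_product: "X \<in> Obj C \<Longrightarrow> Y \<in> Obj C \<Longrightarrow> \<exists>p q. is_product C X Y p q"
begin

lemma terminal: "is_terminal C (terminal C)"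
  unfolding terminal_def using ex_terminal by (rule someI_ex)

lemma terminal_Obj [simp]: "terminal C \<in> Obj C"
  using terminal by (simp add: is_terminal_def)

lemma bang [simp]: "X \<in> Obj C \<Longrightarrow> bang C X \<in> Arr C" "X \<in> Obj C \<Longrightarrow> Dom C (bang C X) = X"
  "X \<in> Obj C \<Longrightarrow> Cod C (bang C X) = terminal C"
  using to_terminal[OF terminal, of X] by (simp_all add: bang_def to_terminal_def)

lemma bang_eq: "f \<in> Arr C \<Longrightarrow> g \<in> Arr C \<Longrightarrow> Dom C f = Dom C g \<Longrightarrow> Cod C f = terminal C \<Longrightarrow>
    Cod C g = terminal C \<Longrightarrow> f = g"
  using terminal_arrows_eq[OF terminal] .

lemma proj: "X \<in> Obj C \<Longrightarrow> Y \<in> Obj C \<Longrightarrow> is_product C X Y (proj1 C X Y) (proj2 C X Y)"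
  unfolding proj_def using ex_product[of X Y] someI_ex[of "\<lambda>r. is_product C X Y (fst r) (snd r)"]
    by auto

lemma proj_simps [simp]:
  assumes "X \<in> Obj C" "Y \<in> Obj C"
  shows "proj1 C X Y \<in> Arr C" "proj2 C X Y \<in> Arr C" "Dom C (proj1 C X Y) = prod_obj C X Y"
    "Dom C (proj2 C X Y) = prod_obj C X Y" "Cod C (proj1 C X Y) = X" "Cod C (proj2 C X Y) = Y"
    "prod_obj C X Y \<in> Obj C"
  using is_productD[OF proj[OF assms]] by (auto simp: prod_obj_def)

text \<open>Generalized elements of the chosen product are written \<open>pr X Y x y\<close>.\<close>

abbreviation pr :: "'o \<Rightarrow> 'o \<Rightarrow> 'm \<Rightarrow> 'm \<Rightarrow> 'm" where
  "pr X Y x y \<equiv> pair_into C (proj1 C X Y) (proj2 C X Y) x y"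

lemma pr_simps [simp]:
  assumes "X \<in> Obj C" "Y \<in> Obj C" "x \<in> Arr C" "y \<in> Arr C" "Dom C x = Dom C y" "Cod C x = X"
      "Cod C y = Y"
  shows "pr X Y x y \<in> Arr C" "Dom C (pr X Y x y) = Dom C y" "Cod C (pr X Y x y) = prod_obj C X Y"
    "proj1 C X Y \<cdot> pr X Y x y = x" "proj2 C X Y \<cdot> pr X Y x y = y"
  using pair_product[OF proj[OF assms(1,2)] assms(3-7)] assms(1,2) by simp_all

lemma prod_eqI:
  assumes "u \<in> Arr C" "v \<in> Arr C" "Dom C u = Dom C v" "Cod C u = prod_obj C X Y"
    "Cod C v = prod_obj C X Y" "proj1 C X Y \<cdot> u = proj1 C X Y \<cdot> v" "proj2 C X Y \<cdot> u = proj2 C X Y \<cdot> v"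
    "X \<in> Obj C" "Y \<in> Obj C"
  shows "u = v"
  using product_eqI[OF proj[OF assms(8,9)], of u v] assms by simp

lemma pr_proj [simp]:
  assumes "X \<in> Obj C" "Y \<in> Obj C" "p \<in> Arr C" "Cod C p = prod_obj C X Y"
  shows "pr X Y (proj1 C X Y \<cdot> p) (proj2 C X Y \<cdot> p) = p"
  by (rule prod_eqI[of _ _ X Y]; use assms in auto)

lemma pr_proj_id [simp]:
  assumes "X \<in> Obj C" "Y \<in> Obj C"
  shows "pr X Y (proj1 C X Y) (proj2 C X Y) = Idn C (prod_obj C X Y)"
  using pr_proj[OF assms, of "Idn C (prod_obj C X Y)"] assms by simp

lemma proj_pr_comp [simp]:
  assumes "X \<in> Obj C" "Y \<in> Obj C" "x \<in> Arr C" "y \<in> Arr C" "Dom C x = Dom C y" "Cod C x = X"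
      "Cod C y = Y"
    "h \<in> Arr C" "Cod C h = Dom C y"
  shows "proj1 C X Y \<cdot> (pr X Y x y \<cdot> h) = x \<cdot> h" "proj2 C X Y \<cdot> (pr X Y x y \<cdot> h) = y \<cdot> h"
  by (rule comp_eq_comp; use assms in simp)+

lemma pr_comp [simp]:
  assumes "X \<in> Obj C" "Y \<in> Obj C" "x \<in> Arr C" "y \<in> Arr C" "Dom C x = Dom C y" "Cod C x = X"
      "Cod C y = Y"
    "h \<in> Arr C" "Cod C h = Dom C y"
  shows "pr X Y x y \<cdot> h = pr X Y (x \<cdot> h) (y \<cdot> h)"
  by (rule prod_eqI[of _ _ X Y]; use assms in auto)

lemma times_right_simps [simp]:
  assumes "g \<in> Arr C" "X \<in> Obj C"
  shows "times_right C g X \<in> Arr C" "Dom C (times_right C g X) = prod_obj C (Dom C g) X"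
    "Cod C (times_right C g X) = prod_obj C (Cod C g) X"
  using assms by (simp_all add: times_right_def)

lemma times_right_pr [simp]:
  assumes "g \<in> Arr C" "X \<in> Obj C" "w \<in> Arr C" "x \<in> Arr C" "Dom C w = Dom C x" "Cod C w = Dom C g"
      "Cod C x = X"
    "Y = Dom C g"
  shows "times_right C g X \<cdot> pr Y X w x = pr (Cod C g) X (g \<cdot> w) x"
  using assms unfolding times_right_def by simp

lemma times_right_comp:
  assumes "g \<in> Arr C" "h \<in> Arr C" "Dom C h = Cod C g" "X \<in> Obj C"
  shows "times_right C h X \<cdot> times_right C g X = times_right C (h \<cdot> g) X"
  unfolding times_right_def[of _ g] times_right_def[of _ "h \<cdot> g"] using assms by simp

lemma times_right_Idn:
  assumes "Y \<in> Obj C" "X \<in> Obj C"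
  shows "times_right C (Idn C Y) X = Idn C (prod_obj C Y X)"
  unfolding times_right_def using assms by simp

lemma exponential_unique:
  assumes "is_exponential C X Y Z e" "is_exponential C X Y Z' e'" "X \<in> Obj C"
  obtains u v where "u \<in> Hom C Z' Z" "v \<in> Hom C Z Z'" "u \<cdot> v = Idn C Z" "v \<cdot> u = Idn C Z'"
    "e \<cdot> times_right C u X = e'" "e' \<cdot> times_right C v X = e"
proof -
  have ex: "\<exists>g\<in>Hom C W Z. e \<cdot> times_right C g X = f"
    and un: "g \<in> Hom C W Z \<Longrightarrow> g' \<in> Hom C W Z \<Longrightarrow> e \<cdot> times_right C g X = f \<Longrightarrow> e \<cdot> times_right C g' X = f \<Longrightarrow>
        g = g'"
    if "is_exponential C X Y Z e" "W \<in> Obj C" "f \<in> Hom C (prod_obj C W X) Y" for Z e W f g g'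
    using that unfolding is_exponential_def by blast+
  have [simp]: "Z \<in> Obj C" "e \<in> Arr C" "Dom C e = prod_obj C Z X" "Cod C e = Y"
    "Z' \<in> Obj C" "e' \<in> Arr C" "Dom C e' = prod_obj C Z' X" "Cod C e' = Y"
    using assms(1,2) unfolding is_exponential_def by simp_all
  note [simp] = assms(3)
  obtain u where u: "u \<in> Hom C Z' Z" "e \<cdot> times_right C u X = e'" using ex[OF assms(1), of Z' e']
    by auto
  obtain v where v: "v \<in> Hom C Z Z'" "e' \<cdot> times_right C v X = e" using ex[OF assms(2), of Z e] by auto
  have uv: "e \<cdot> times_right C (u \<cdot> v) X = e"
    using u v comp_assoc[of "times_right C v X" "times_right C u X" e] times_right_comp[of v u X]
      by simp
  have vu: "e' \<cdot> times_right C (v \<cdot> u) X = e'"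
    using u v comp_assoc[of "times_right C u X" "times_right C v X" e'] times_right_comp[of u v X]
      by simp
  have "u \<cdot> v = Idn C Z" by (rule un[OF assms(1), of Z e]) (use u v uv times_right_Idn[of Z X] in auto)
  moreover have "v \<cdot> u = Idn C Z'"
    by (rule un[OF assms(2), of Z' e']) (use u v vu times_right_Idn[of Z' X] in auto)
  ultimately show thesis using that u v by blast
qed

end

text \<open>Cartesian closed categories.\<close>

locale ccc = fprod_cat C for C :: "('o, 'm) cat" (structure) +
  assumes ex_exponential: "X \<in> Obj C \<Longrightarrow> Y \<in> Obj C \<Longrightarrow> \<exists>Z e. is_exponential C X Y Z e"

lemma ccc_iff: "ccc C \<longleftrightarrow> cartesian_closed C"
  unfolding ccc_def ccc_axioms_def fprod_cat_def fprod_cat_axioms_def cartesian_closed_def by auto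

context ccc
begin

lemma exponential: "X \<in> Obj C \<Longrightarrow> Y \<in> Obj C \<Longrightarrow> is_exponential C X Y (expo C X Y) (ev C X Y)"
  unfolding expo_ev_def
    using ex_exponential[of X Y] someI_ex[of "\<lambda>r. is_exponential C X Y (fst r) (snd r)"] by auto

lemma expo_simps [simp]:
  assumes "X \<in> Obj C" "Y \<in> Obj C"
  shows "expo C X Y \<in> Obj C" "ev C X Y \<in> Arr C" "Dom C (ev C X Y) = prod_obj C (expo C X Y) X"
    "Cod C (ev C X Y) = Y"
  using exponential[OF assms] unfolding is_exponential_def by auto

text \<open>Application of a generalized element of \<open>[X, Y]\<close> to one of \<open>X\<close>.\<close>

definition app :: "'o \<Rightarrow> 'o \<Rightarrow> 'm \<Rightarrow> 'm \<Rightarrow> 'm" where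
  "app X Y k x = ev C X Y \<cdot> pr (expo C X Y) X k x"

lemma app_simps [simp]:
  assumes "X \<in> Obj C" "Y \<in> Obj C" "k \<in> Arr C" "x \<in> Arr C" "Dom C k = Dom C x" "Cod C k = expo C X Y"
      "Cod C x = X"
  shows "app X Y k x \<in> Arr C" "Dom C (app X Y k x) = Dom C x" "Cod C (app X Y k x) = Y"
  using assms by (simp_all add: app_def)

lemma app_comp:
  assumes "X \<in> Obj C" "Y \<in> Obj C" "k \<in> Arr C" "x \<in> Arr C" "Dom C k = Dom C x" "Cod C k = expo C X Y"
      "Cod C x = X"
    "h \<in> Arr C" "Cod C h = Dom C x"
  shows "app X Y k x \<cdot> h = app X Y (k \<cdot> h) (x \<cdot> h)"
  using assms by (simp add: app_def)

lemma exponential_ex1: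
  assumes "W \<in> Obj C" "X \<in> Obj C" "Y \<in> Obj C" "f \<in> Hom C (prod_obj C W X) Y"
  shows "\<exists>!g. g \<in> Hom C W (expo C X Y) \<and> ev C X Y \<cdot> times_right C g X = f"
  using exponential[OF assms(2,3)] assms(1,4) unfolding is_exponential_def by blast

lemma transpose_props:
  assumes "W \<in> Obj C" "X \<in> Obj C" "Y \<in> Obj C" "f \<in> Arr C" "Dom C f = prod_obj C W X" "Cod C f = Y"
  shows "transpose C W X Y f \<in> Arr C" "Dom C (transpose C W X Y f) = W"
    "Cod C (transpose C W X Y f) = expo C X Y" "ev C X Y \<cdot> times_right C (transpose C W X Y f) X = f"
proof -
  have "\<exists>!g. g \<in> Hom C W (expo C X Y) \<and> ev C X Y \<cdot> times_right C g X = f"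
    by (rule exponential_ex1) (use assms in simp_all)
  from theI'[OF this] show "transpose C W X Y f \<in> Arr C" "Dom C (transpose C W X Y f) = W"
    "Cod C (transpose C W X Y f) = expo C X Y" "ev C X Y \<cdot> times_right C (transpose C W X Y f) X = f"
    unfolding transpose_def by auto
qed

lemma app_transpose:
  assumes "W \<in> Obj C" "X \<in> Obj C" "Y \<in> Obj C" "f \<in> Arr C" "Dom C f = prod_obj C W X" "Cod C f = Y"
    "w \<in> Arr C" "x \<in> Arr C" "Dom C w = Dom C x" "Cod C w = W" "Cod C x = X"
  shows "app X Y (transpose C W X Y f \<cdot> w) x = f \<cdot> pr W X w x"
proof -
  note [simp] = transpose_props(1-3)[OF assms(1-6)]
  have "app X Y (transpose C W X Y f \<cdot> w) x =
      ev C X Y \<cdot> (times_right C (transpose C W X Y f) X \<cdot> pr W X w x)"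
    using assms by (simp add: app_def)
  also have "\<dots> = (ev C X Y \<cdot> times_right C (transpose C W X Y f) X) \<cdot> pr W X w x"
    using assms by simp
  finally show ?thesis using transpose_props(4)[OF assms(1-6)] by simp
qed

text \<open>Two generalized elements of an exponential are equal if they agree on all arguments at all
  later stages.\<close>

lemma expo_eqI:
  assumes "X \<in> Obj C" "Y \<in> Obj C" "k \<in> Arr C" "k' \<in> Arr C" "Dom C k = Dom C k'" "Cod C k = expo C X Y"
    "Cod C k' = expo C X Y"
    and "\<And>V w x. w \<in> Hom C V (Dom C k) \<Longrightarrow> x \<in> Hom C V X \<Longrightarrow> app X Y (k \<cdot> w) x = app X Y (k' \<cdot> w) x"
  shows "k = k'"
proof -
  let ?W = "Dom C k"
  have W: "?W \<in> Obj C" using assms by simp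
  have tr: "times_right C l X = pr (expo C X Y) X (l \<cdot> proj1 C ?W X) (proj2 C ?W X)"
    if "l \<in> Arr C" "Dom C l = ?W" "Cod C l = expo C X Y" for l
    using that unfolding times_right_def by simp
  have e: "ev C X Y \<cdot> times_right C k X = ev C X Y \<cdot> times_right C k' X"
    using assms(8)[of "proj1 C ?W X" "prod_obj C ?W X" "proj2 C ?W X"] W assms(1-7) tr[of k] tr[of k']
    by (simp add: app_def)
  have "ev C X Y \<cdot> times_right C k X \<in> Hom C (prod_obj C ?W X) Y" using W assms(1-7) by simp
  then have "\<exists>!g. g \<in> Hom C ?W (expo C X Y) \<and>
      ev C X Y \<cdot> times_right C g X = ev C X Y \<cdot> times_right C k X"
    using exponential_ex1[OF W assms(1,2)] by blast
  moreover have "k \<in> Hom C ?W (expo C X Y) \<and>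
      ev C X Y \<cdot> times_right C k X = ev C X Y \<cdot> times_right C k X"
    using assms(3-7) by simp
  moreover have "k' \<in> Hom C ?W (expo C X Y) \<and>
      ev C X Y \<cdot> times_right C k' X = ev C X Y \<cdot> times_right C k X"
    using assms(3-7) e by simp
  ultimately show ?thesis by blast
qed

end

subsection \<open>Finite limits\<close>

text \<open>Categories with finite limits, given by a terminal object and pullbacks.\<close>

locale lex_cat = category C for C :: "('o, 'm) cat" (structure) +
  assumes ex_terminal': "\<exists>T. is_terminal C T"
    and ex_pullback: "f \<in> Arr C \<Longrightarrow> g \<in> Arr C \<Longrightarrow> Cod C f = Cod C g \<Longrightarrow> \<exists>p q. is_pullback C f g p q"
begin

lemma pb: "f \<in> Arr C \<Longrightarrow> g \<in> Arr C \<Longrightarrow> Cod C f = Cod C g \<Longrightarrow> is_pullback C f g (pb1 C f g) (pb2 C f g)"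
  unfolding pb_def using ex_pullback[of f g] someI_ex[of "\<lambda>r. is_pullback C f g (fst r) (snd r)"]
    by auto

lemma pb_simps [simp]:
  assumes "f \<in> Arr C" "g \<in> Arr C" "Cod C f = Cod C g"
  shows "pb1 C f g \<in> Arr C" "pb2 C f g \<in> Arr C" "Dom C (pb1 C f g) = pb_obj C f g"
    "Dom C (pb2 C f g) = pb_obj C f g" "Cod C (pb1 C f g) = Dom C f" "Cod C (pb2 C f g) = Dom C g"
    "pb_obj C f g \<in> Obj C"
  using pb[OF assms] by (auto simp: is_pullback_def pb_obj_def)

lemma pb_square:
  assumes "f \<in> Arr C" "g \<in> Arr C" "Cod C f = Cod C g"
  shows "f \<cdot> pb1 C f g = g \<cdot> pb2 C f g"
  using pb[OF assms] by (auto simp: is_pullback_def)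

lemma pb_square_comp:
  assumes "f \<in> Arr C" "g \<in> Arr C" "Cod C f = Cod C g" "h \<in> Arr C" "Cod C h = pb_obj C f g"
  shows "f \<cdot> (pb1 C f g \<cdot> h) = g \<cdot> (pb2 C f g \<cdot> h)"
  using comp_eq_comp[OF pb_square[OF assms(1-3)], of h] assms by simp

lemma pb_ex1:
  assumes "f \<in> Arr C" "g \<in> Arr C" "Cod C f = Cod C g" "x \<in> Hom C W (Dom C f)" "y \<in> Hom C W (Dom C g)"
    "f \<cdot> x = g \<cdot> y"
  shows "\<exists>!u. u \<in> Hom C W (pb_obj C f g) \<and> pb1 C f g \<cdot> u = x \<and> pb2 C f g \<cdot> u = y"
proof -
  obtain P where P: "pb1 C f g \<in> Hom C P (Dom C f)" and u: "\<forall>W h k. h \<in> Hom C W (Dom C f) \<and>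
      k \<in> Hom C W (Dom C g) \<and> f \<cdot> h = g \<cdot> k \<longrightarrow>
     (\<exists>!u. u \<in> Hom C W P \<and> pb1 C f g \<cdot> u = h \<and> pb2 C f g \<cdot> u = k)"
    using pb[OF assms(1-3)] unfolding is_pullback_def by blast
  have "pb_obj C f g = P" using P by (simp add: pb_obj_def)
  then show ?thesis using u[rule_format, OF conjI, OF assms(4) conjI, OF assms(5,6)] by simp
qed

text \<open>The generalized element \<open>(x, y)\<close> of the chosen pullback of \<open>f\<close> and \<open>g\<close>.\<close>

abbreviation pbpair :: "'m \<Rightarrow> 'm \<Rightarrow> 'm \<Rightarrow> 'm \<Rightarrow> 'm" where
  "pbpair f g x y \<equiv> pair_into C (pb1 C f g) (pb2 C f g) x y"

lemma pbpair_simps [simp]: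
  assumes "f \<in> Arr C" "g \<in> Arr C" "Cod C f = Cod C g" "x \<in> Arr C" "y \<in> Arr C" "Cod C x = Dom C f"
    "Cod C y = Dom C g" "f \<cdot> x = g \<cdot> y"
  shows "pbpair f g x y \<in> Arr C" "Dom C (pbpair f g x y) = Dom C y"
      "Cod C (pbpair f g x y) = pb_obj C f g"
    "pb1 C f g \<cdot> pbpair f g x y = x" "pb2 C f g \<cdot> pbpair f g x y = y"
proof -
  have d: "Dom C x = Dom C y" using assms Dom_comp[of x f] Dom_comp[of y g] by simp
  have "\<exists>!u. u \<in> Hom C (Dom C x) (Dom C (pb1 C f g)) \<and> pb1 C f g \<cdot> u = x \<and> pb2 C f g \<cdot> u = y"
    using pb_ex1[OF assms(1-3), of x "Dom C x" y] assms d by simp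
  from theI'[OF this] show "pbpair f g x y \<in> Arr C" "Dom C (pbpair f g x y) = Dom C y"
    "Cod C (pbpair f g x y) = pb_obj C f g" "pb1 C f g \<cdot> pbpair f g x y = x"
        "pb2 C f g \<cdot> pbpair f g x y = y"
    using assms d unfolding pair_into_def by auto
qed

lemma pb_eqI:
  assumes "f \<in> Arr C" "g \<in> Arr C" "Cod C f = Cod C g" "u \<in> Arr C" "v \<in> Arr C" "Dom C u = Dom C v"
    "Cod C u = pb_obj C f g" "Cod C v = pb_obj C f g" "pb1 C f g \<cdot> u = pb1 C f g \<cdot> v"
    "pb2 C f g \<cdot> u = pb2 C f g \<cdot> v"
  shows "u = v"
proof -
  have *: "pb1 C f g \<cdot> u \<in> Hom C (Dom C u) (Dom C f)" "pb2 C f g \<cdot> u \<in> Hom C (Dom C u) (Dom C g)"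
    "f \<cdot> (pb1 C f g \<cdot> u) = g \<cdot> (pb2 C f g \<cdot> u)"
    using assms(1-8) by (auto simp: pb_square_comp)
  have "u \<in> Hom C (Dom C u) (pb_obj C f g) \<and> pb1 C f g \<cdot> u = pb1 C f g \<cdot> u \<and>
      pb2 C f g \<cdot> u = pb2 C f g \<cdot> u"
    "v \<in> Hom C (Dom C u) (pb_obj C f g) \<and> pb1 C f g \<cdot> v = pb1 C f g \<cdot> u \<and> pb2 C f g \<cdot> v = pb2 C f g \<cdot> u"
    using assms by simp_all
  with pb_ex1[OF assms(1-3) *] show ?thesis by blast
qed

lemma pb_pbpair_comp [simp]:
  assumes "f \<in> Arr C" "g \<in> Arr C" "Cod C f = Cod C g" "x \<in> Arr C" "y \<in> Arr C" "Cod C x = Dom C f"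
    "Cod C y = Dom C g" "f \<cdot> x = g \<cdot> y" "h \<in> Arr C" "Cod C h = Dom C y"
  shows "pb1 C f g \<cdot> (pbpair f g x y \<cdot> h) = x \<cdot> h" "pb2 C f g \<cdot> (pbpair f g x y \<cdot> h) = y \<cdot> h"
  by (rule comp_eq_comp; use assms in simp)+

lemma pbpair_comp:
  assumes "f \<in> Arr C" "g \<in> Arr C" "Cod C f = Cod C g" "x \<in> Arr C" "y \<in> Arr C" "Cod C x = Dom C f"
    "Cod C y = Dom C g" "f \<cdot> x = g \<cdot> y" "h \<in> Arr C" "Cod C h = Dom C y"
  shows "pbpair f g x y \<cdot> h = pbpair f g (x \<cdot> h) (y \<cdot> h)"
proof -
  have d: "Dom C x = Dom C y" using assms Dom_comp[of x f] Dom_comp[of y g] by simp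
  have e: "f \<cdot> (x \<cdot> h) = g \<cdot> (y \<cdot> h)" using comp_eq_comp[OF assms(8), of h] assms d by simp
  show ?thesis by (rule pb_eqI[of f g]; use assms d e in auto)
qed

lemma pbpair_pb [simp]:
  assumes "f \<in> Arr C" "g \<in> Arr C" "Cod C f = Cod C g" "u \<in> Arr C" "Cod C u = pb_obj C f g"
  shows "pbpair f g (pb1 C f g \<cdot> u) (pb2 C f g \<cdot> u) = u"
  by (rule pb_eqI[of f g]; use assms in \<open>auto simp: pb_square_comp\<close>)

lemma product_from_pullback:
  assumes "is_terminal C T" "f \<in> Hom C X T" "g \<in> Hom C Y T"
  shows "is_product C X Y (pb1 C f g) (pb2 C f g)"
proof (rule is_productI)
  fix W x y assume xy: "x \<in> Hom C W X" "y \<in> Hom C W Y"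
  have "f \<cdot> x = g \<cdot> y" by (rule terminal_arrows_eq[OF assms(1)]) (use assms xy in auto)
  then show "\<exists>u\<in>Hom C W (Dom C (pb1 C f g)). pb1 C f g \<cdot> u = x \<and> pb2 C f g \<cdot> u = y"
    using assms xy by (intro bexI[of _ "pbpair f g x y"]) auto
next
  fix u v assume uv: "u \<in> Arr C" "v \<in> Arr C" "Dom C u = Dom C v" "Cod C u = Dom C (pb1 C f g)"
     "Cod C v = Dom C (pb1 C f g)" "pb1 C f g \<cdot> u = pb1 C f g \<cdot> v" "pb2 C f g \<cdot> u = pb2 C f g \<cdot> v"
  show "u = v" by (rule pb_eqI[of f g]; use uv assms in auto)
qed (use assms in auto)

end

sublocale lex_cat \<subseteq> fprod_cat
proof
  show "\<exists>T. is_terminal C T" by (rule ex_terminal')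
  fix X Y assume XY: "X \<in> Obj C" "Y \<in> Obj C"
  obtain T where T: "is_terminal C T" using ex_terminal' ..
  show "\<exists>p q. is_product C X Y p q"
    using product_from_pullback[OF T, of "to_terminal T X" X "to_terminal T Y" Y] to_terminal[OF T] XY
    by auto
qed

context lex_cat
begin

lemma ex_equalizer:
  assumes "f \<in> Hom C X Y" "g \<in> Hom C X Y"
  obtains e where "e \<in> Arr C" "Cod C e = X" "f \<cdot> e = g \<cdot> e"
    "\<And>h. h \<in> Arr C \<Longrightarrow> Cod C h = X \<Longrightarrow> f \<cdot> h = g \<cdot> h \<Longrightarrow> \<exists>k\<in>Hom C (Dom C h) (Dom C e). e \<cdot> k = h"
    "\<And>h k. h \<in> Arr C \<Longrightarrow> k \<in> Arr C \<Longrightarrow> Dom C h = Dom C k \<Longrightarrow> Cod C h = Dom C e \<Longrightarrow> Cod C k = Dom C e \<Longrightarrow>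
       e \<cdot> h = e \<cdot> k \<Longrightarrow> h = k"
proof -
  have XY [simp]: "X \<in> Obj C" "Y \<in> Obj C" "f \<in> Arr C" "g \<in> Arr C" "Dom C f = X" "Dom C g = X"
      "Cod C f = Y" "Cod C g = Y"
    using assms by auto
  let ?f = "pr X Y (Idn C X) f" and ?g = "pr X Y (Idn C X) g"
  let ?e = "pb1 C ?f ?g" and ?d = "pb2 C ?f ?g"
  have s: "?f \<cdot> ?e = ?g \<cdot> ?d" by (rule pb_square) auto
  have ed: "?e = ?d" using arg_cong[OF s, of "\<lambda>x. proj1 C X Y \<cdot> x"] by simp
  have fe: "f \<cdot> ?e = g \<cdot> ?e" using arg_cong[OF s, of "\<lambda>x. proj2 C X Y \<cdot> x"] ed by simp
  show thesis
  proof (rule that[of ?e, OF _ _ fe])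
    fix h assume h: "h \<in> Arr C" "Cod C h = X" "f \<cdot> h = g \<cdot> h"
    then have "?f \<cdot> h = ?g \<cdot> h" by simp
    then show "\<exists>k\<in>Hom C (Dom C h) (Dom C ?e). ?e \<cdot> k = h"
      using h by (intro bexI[of _ "pbpair ?f ?g h h"]) (auto simp del: pr_comp)
  next
    fix h k assume hk: "h \<in> Arr C" "k \<in> Arr C" "Dom C h = Dom C k" "Cod C h = Dom C ?e"
        "Cod C k = Dom C ?e"
       "?e \<cdot> h = ?e \<cdot> k"
    show "h = k" by (rule pb_eqI[of ?f ?g]; use hk ed in auto)
  qed auto
qed

end

text \<open>Cartesian closed categories with finite limits. Such are the slices of a locally cartesian closed
  category with finite limits.\<close>

locale lexcc_cat = lex_cat C + ccc C for C :: "('o, 'm) cat" (structure)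

section \<open>Internal categories by generalized elements\<close>

lemma icat_axioms:
  assumes "internal_category C A"
  shows "Src A \<cdot>\<^bsub>C\<^esub> Cmp A = Src A \<cdot>\<^bsub>C\<^esub> pb2 C (Src A) (Tgt A)"
    "Tgt A \<cdot>\<^bsub>C\<^esub> Cmp A = Tgt A \<cdot>\<^bsub>C\<^esub> pb1 C (Src A) (Tgt A)"
    "icomp C A (Ids A \<cdot>\<^bsub>C\<^esub> Tgt A) (Idn C (Mor A)) = Idn C (Mor A)"
    "icomp C A (Idn C (Mor A)) (Ids A \<cdot>\<^bsub>C\<^esub> Src A) = Idn C (Mor A)"
    "let p = pb1 C (Src A) (Tgt A); q = pb2 C (Src A) (Tgt A); r1 = pb1 C q p; r2 = pb2 C q p in
      icomp C A (Cmp A \<cdot>\<^bsub>C\<^esub> r1) (q \<cdot>\<^bsub>C\<^esub> r2) = icomp C A (p \<cdot>\<^bsub>C\<^esub> r1) (Cmp A \<cdot>\<^bsub>C\<^esub> r2)"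
  using assms unfolding internal_category_def by blast+

context lex_cat
begin

lemma icat_simps [simp]:
  assumes "internal_category C A"
  shows "Ob A \<in> Obj C" "Mor A \<in> Obj C" "Src A \<in> Arr C" "Dom C (Src A) = Mor A" "Cod C (Src A) = Ob A"
    "Tgt A \<in> Arr C" "Dom C (Tgt A) = Mor A" "Cod C (Tgt A) = Ob A"
    "Ids A \<in> Arr C" "Dom C (Ids A) = Ob A" "Cod C (Ids A) = Mor A"
    "Cmp A \<in> Arr C" "Dom C (Cmp A) = pb_obj C (Src A) (Tgt A)" "Cod C (Cmp A) = Mor A"
    "Src A \<cdot> Ids A = Idn C (Ob A)" "Tgt A \<cdot> Ids A = Idn C (Ob A)"
  using assms by (simp_all add: internal_category_def)

lemma Src_Ids [simp]:
  assumes "internal_category C A" "x \<in> Arr C" "Cod C x = Ob A"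
  shows "Src A \<cdot> (Ids A \<cdot> x) = x" "Tgt A \<cdot> (Ids A \<cdot> x) = x"
  using comp_eq_comp[of "Src A" "Ids A" "Idn C (Ob A)" x]
      comp_eq_comp[of "Tgt A" "Ids A" "Idn C (Ob A)" x]
    assms by auto

lemma icomp_simps [simp]:
  assumes "internal_category C A" "g \<in> Arr C" "f \<in> Arr C" "Cod C g = Mor A" "Cod C f = Mor A"
    "Src A \<cdot> g = Tgt A \<cdot> f"
  shows "icomp C A g f \<in> Arr C" "Dom C (icomp C A g f) = Dom C f" "Cod C (icomp C A g f) = Mor A"
    "Src A \<cdot> icomp C A g f = Src A \<cdot> f" "Tgt A \<cdot> icomp C A g f = Tgt A \<cdot> g"
proof -
  let ?p = "pbpair (Src A) (Tgt A) g f"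
  note e = icat_axioms(1,2)[OF assms(1)]
  show "icomp C A g f \<in> Arr C" "Dom C (icomp C A g f) = Dom C f" "Cod C (icomp C A g f) = Mor A"
    using assms by (simp_all add: icomp_def)
  show "Src A \<cdot> icomp C A g f = Src A \<cdot> f" "Tgt A \<cdot> icomp C A g f = Tgt A \<cdot> g"
    using comp_eq_comp[OF e(1), of ?p] comp_eq_comp[OF e(2), of ?p] assms by (simp_all add: icomp_def)
qed

lemma icomp_comp:
  assumes "internal_category C A" "g \<in> Arr C" "f \<in> Arr C" "Cod C g = Mor A" "Cod C f = Mor A"
    "Src A \<cdot> g = Tgt A \<cdot> f" "h \<in> Arr C" "Cod C h = Dom C f"
  shows "icomp C A g f \<cdot> h = icomp C A (g \<cdot> h) (f \<cdot> h)"
  using assms by (simp add: icomp_def pbpair_comp)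

lemma composable_Dom:
  assumes "internal_category C A" "g \<in> Arr C" "f \<in> Arr C" "Cod C g = Mor A" "Cod C f = Mor A"
    "Src A \<cdot> g = Tgt A \<cdot> f"
  shows "Dom C g = Dom C f"
  using assms Dom_comp[of g "Src A"] Dom_comp[of f "Tgt A"] by simp

lemma composable_comp:
  assumes "Src A \<cdot> g = Tgt A \<cdot> f" "internal_category C A" "g \<in> Arr C" "f \<in> Arr C" "Cod C g = Mor A"
      "Cod C f = Mor A"
    "h \<in> Arr C" "Cod C h = Dom C f"
  shows "Src A \<cdot> (g \<cdot> h) = Tgt A \<cdot> (f \<cdot> h)"
  using comp_eq_comp[OF assms(1), of h] assms composable_Dom[of A g f] by simp

lemma icomp_Ids_left [simp]:
  assumes "internal_category C A" "f \<in> Arr C" "Cod C f = Mor A" "Tgt A \<cdot> f = y"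
  shows "icomp C A (Ids A \<cdot> y) f = f"
proof -
  from arg_cong[OF icat_axioms(3)[OF assms(1)], of "\<lambda>x. x \<cdot> f"] show ?thesis using assms(1-3)
    by (simp add: icomp_comp flip: assms(4))
qed

lemma icomp_Ids_right [simp]:
  assumes "internal_category C A" "f \<in> Arr C" "Cod C f = Mor A" "Src A \<cdot> f = y"
  shows "icomp C A f (Ids A \<cdot> y) = f"
proof -
  from arg_cong[OF icat_axioms(4)[OF assms(1)], of "\<lambda>x. x \<cdot> f"] show ?thesis using assms(1-3)
    by (simp add: icomp_comp flip: assms(4))
qed

lemma icomp_assoc:
  assumes "internal_category C A" "h \<in> Arr C" "g \<in> Arr C" "f \<in> Arr C" "Cod C h = Mor A"
      "Cod C g = Mor A"
    "Cod C f = Mor A" "Src A \<cdot> h = Tgt A \<cdot> g" "Src A \<cdot> g = Tgt A \<cdot> f"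
  shows "icomp C A (icomp C A h g) f = icomp C A h (icomp C A g f)"
proof -
  let ?s = "Src A" and ?t = "Tgt A"
  let ?p = "pb1 C ?s ?t" and ?q = "pb2 C ?s ?t"
  let ?x = "pbpair ?q ?p (pbpair ?s ?t h g) (pbpair ?s ?t g f)"
  note A [simp] = assms(1)
  let ?r1 = "pb1 C ?q ?p" and ?r2 = "pb2 C ?q ?p"
  have s1: "?s \<cdot> (?p \<cdot> ?r1) = ?t \<cdot> (?q \<cdot> ?r1)" by (rule pb_square_comp) auto
  have s2: "?s \<cdot> (?p \<cdot> ?r2) = ?t \<cdot> (?q \<cdot> ?r2)" by (rule pb_square_comp) auto
  have qp: "?q \<cdot> ?r1 = ?p \<cdot> ?r2" by (rule pb_square) auto
  note m = icat_axioms(1,2)[OF assms(1)]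
  have c: "?s \<cdot> (Cmp A \<cdot> ?r1) = ?t \<cdot> (?q \<cdot> ?r2)" "?s \<cdot> (?p \<cdot> ?r1) = ?t \<cdot> (Cmp A \<cdot> ?r2)"
    using comp_eq_comp[OF m(1), of ?r1] comp_eq_comp[OF m(2), of ?r2] by (simp_all add: qp s1 s2)
  have x: "?q \<cdot> pbpair ?s ?t h g = ?p \<cdot> pbpair ?s ?t g f" using assms by simp
  have d: "Dom C h = Dom C f" "Dom C g = Dom C f"
    using assms composable_Dom[of A h g] composable_Dom[of A g f] by auto
  have pqx: "?q \<cdot> (pb2 C ?q ?p \<cdot> ?x) = f" "?p \<cdot> (pb1 C ?q ?p \<cdot> ?x) = h" using assms x d by simp_all
  from arg_cong[OF icat_axioms(5)[OF assms(1), unfolded Let_def], of "\<lambda>z. z \<cdot> ?x"]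
  have "icomp C A (Cmp A \<cdot> (pb1 C ?q ?p \<cdot> ?x)) (?q \<cdot> (pb2 C ?q ?p \<cdot> ?x)) =
      icomp C A (?p \<cdot> (pb1 C ?q ?p \<cdot> ?x)) (Cmp A \<cdot> (pb2 C ?q ?p \<cdot> ?x))"
    using assms c x d by (simp add: icomp_comp del: pbpair_simps(4,5))
  then show ?thesis using assms x d unfolding pqx by (simp add: icomp_def)
qed

text \<open>Pasting of two commutative squares with common side \<open>b\<close>.\<close>

lemma icomp_paste:
  assumes "internal_category C A"
    and ar: "x1 \<in> Arr C" "x2 \<in> Arr C" "y1 \<in> Arr C" "y2 \<in> Arr C" "a \<in> Arr C" "b \<in> Arr C" "c \<in> Arr C"
      "Cod C x1 = Mor A" "Cod C x2 = Mor A" "Cod C y1 = Mor A" "Cod C y2 = Mor A" "Cod C a = Mor A"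
          "Cod C b = Mor A" "Cod C c = Mor A"
    and "Src A \<cdot> y1 = Tgt A \<cdot> a" "Src A \<cdot> b = Tgt A \<cdot> x1" "Src A \<cdot> y2 = Tgt A \<cdot> y1"
        "Src A \<cdot> y2 = Tgt A \<cdot> b"
      "Src A \<cdot> c = Tgt A \<cdot> x2" "Src A \<cdot> x2 = Tgt A \<cdot> x1"
    and 1: "icomp C A y1 a = icomp C A b x1" and 2: "icomp C A y2 b = icomp C A c x2"
  shows "icomp C A (icomp C A y2 y1) a = icomp C A c (icomp C A x2 x1)"
proof -
  have "icomp C A (icomp C A y2 y1) a = icomp C A y2 (icomp C A y1 a)"
    using assms(1-21) by (intro icomp_assoc) simp_all
  also have "\<dots> = icomp C A (icomp C A y2 b) x1"
    unfolding 1 using assms(1-21) by (intro icomp_assoc[symmetric]) simp_all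
  also have "\<dots> = icomp C A c (icomp C A x2 x1)"
    unfolding 2 using assms(1-21) by (intro icomp_assoc) simp_all
  finally show ?thesis .
qed

text \<open>Interchange of the two inner arrows of a composite of four.\<close>

lemma icomp_middle:
  assumes "internal_category C A"
    and ar: "p \<in> Arr C" "q \<in> Arr C" "r \<in> Arr C" "s \<in> Arr C" "q' \<in> Arr C" "r' \<in> Arr C"
      "Cod C p = Mor A" "Cod C q = Mor A" "Cod C r = Mor A" "Cod C s = Mor A" "Cod C q' = Mor A"
          "Cod C r' = Mor A"
    and "Src A \<cdot> p = Tgt A \<cdot> q" "Src A \<cdot> q = Tgt A \<cdot> r" "Src A \<cdot> r = Tgt A \<cdot> s"
      "Src A \<cdot> p = Tgt A \<cdot> r'" "Src A \<cdot> r' = Tgt A \<cdot> q'" "Src A \<cdot> q' = Tgt A \<cdot> s"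
    and e: "icomp C A q r = icomp C A r' q'"
  shows "icomp C A (icomp C A p q) (icomp C A r s) = icomp C A (icomp C A p r') (icomp C A q' s)"
proof -
  have "icomp C A (icomp C A p q) (icomp C A r s) = icomp C A p (icomp C A q (icomp C A r s))"
    using assms(1-19) by (intro icomp_assoc) simp_all
  also have "icomp C A q (icomp C A r s) = icomp C A (icomp C A q r) s"
    using assms(1-19) by (intro icomp_assoc[symmetric]) simp_all
  also have "icomp C A (icomp C A q r) s = icomp C A r' (icomp C A q' s)"
    unfolding e using assms(1-19) by (intro icomp_assoc) simp_all
  also have "icomp C A p \<dots> = icomp C A (icomp C A p r') (icomp C A q' s)"
    using assms(1-19) by (intro icomp_assoc[symmetric]) simp_all
  finally show ?thesis .
qed

lemma internal_categoryI:
  assumes ty: "Ob A \<in> Obj C" "Mor A \<in> Obj C" "Src A \<in> Hom C (Mor A) (Ob A)"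
      "Tgt A \<in> Hom C (Mor A) (Ob A)"
    "Ids A \<in> Hom C (Ob A) (Mor A)" "Cmp A \<in> Hom C (pb_obj C (Src A) (Tgt A)) (Mor A)"
    "Src A \<cdot> Ids A = Idn C (Ob A)" "Tgt A \<cdot> Ids A = Idn C (Ob A)"
    and st: "\<And>W g f. g \<in> Hom C W (Mor A) \<Longrightarrow> f \<in> Hom C W (Mor A) \<Longrightarrow> Src A \<cdot> g = Tgt A \<cdot> f \<Longrightarrow>
      Src A \<cdot> icomp C A g f = Src A \<cdot> f \<and> Tgt A \<cdot> icomp C A g f = Tgt A \<cdot> g"
    and idl: "\<And>W f. f \<in> Hom C W (Mor A) \<Longrightarrow> icomp C A (Ids A \<cdot> (Tgt A \<cdot> f)) f = f"
    and idr: "\<And>W f. f \<in> Hom C W (Mor A) \<Longrightarrow> icomp C A f (Ids A \<cdot> (Src A \<cdot> f)) = f"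
    and assoc: "\<And>W h g f. h \<in> Hom C W (Mor A) \<Longrightarrow> g \<in> Hom C W (Mor A) \<Longrightarrow> f \<in> Hom C W (Mor A) \<Longrightarrow>
      Src A \<cdot> h = Tgt A \<cdot> g \<Longrightarrow> Src A \<cdot> g = Tgt A \<cdot> f \<Longrightarrow>
      icomp C A (icomp C A h g) f = icomp C A h (icomp C A g f)"
  shows "internal_category C A"
proof -
  let ?s = "Src A" and ?t = "Tgt A"
  let ?p = "pb1 C ?s ?t" and ?q = "pb2 C ?s ?t"
  let ?r1 = "pb1 C ?q ?p" and ?r2 = "pb2 C ?q ?p"
  have ty' [simp]: "Ob A \<in> Obj C" "Mor A \<in> Obj C" "Src A \<in> Arr C" "Dom C (Src A) = Mor A"
      "Cod C (Src A) = Ob A"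
    "Tgt A \<in> Arr C" "Dom C (Tgt A) = Mor A" "Cod C (Tgt A) = Ob A"
    "Ids A \<in> Arr C" "Dom C (Ids A) = Ob A" "Cod C (Ids A) = Mor A"
    "Cmp A \<in> Arr C" "Dom C (Cmp A) = pb_obj C (Src A) (Tgt A)" "Cod C (Cmp A) = Mor A"
    using ty by simp_all
  have sq: "?s \<cdot> ?p = ?t \<cdot> ?q" by (rule pb_square) auto
  have pq: "icomp C A (?p \<cdot> x) (?q \<cdot> x) = Cmp A \<cdot> x" if "x \<in> Arr C" "Cod C x = pb_obj C ?s ?t" for x
    using that by (simp add: icomp_def)
  have pq1: "icomp C A ?p ?q = Cmp A" using pq[of "Idn C (pb_obj C ?s ?t)"] by simp
  have s1: "?s \<cdot> (?p \<cdot> ?r1) = ?t \<cdot> (?q \<cdot> ?r1)" by (rule pb_square_comp) auto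
  have s2: "?s \<cdot> (?p \<cdot> ?r2) = ?t \<cdot> (?q \<cdot> ?r2)" by (rule pb_square_comp) auto
  have qp: "?q \<cdot> ?r1 = ?p \<cdot> ?r2" by (rule pb_square) auto
  have pq2: "icomp C A (?p \<cdot> ?r1) (?p \<cdot> ?r2) = Cmp A \<cdot> ?r1" using pq[of ?r1] qp by simp
  have "icomp C A (icomp C A (?p \<cdot> ?r1) (?p \<cdot> ?r2)) (?q \<cdot> ?r2) =
      icomp C A (?p \<cdot> ?r1) (icomp C A (?p \<cdot> ?r2) (?q \<cdot> ?r2))"
    by (rule assoc[of _ "pb_obj C ?q ?p"]) (use s1 s2 qp in simp_all)
  then have a: "icomp C A (Cmp A \<cdot> ?r1) (?q \<cdot> ?r2) = icomp C A (?p \<cdot> ?r1) (Cmp A \<cdot> ?r2)"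
    by (simp add: pq pq2)
  show ?thesis
    unfolding internal_category_def
    using a st[of ?p "pb_obj C ?s ?t" ?q, unfolded pq1] sq idl[of "Idn C (Mor A)" "Mor A"]
        idr[of "Idn C (Mor A)" "Mor A"]
      ty(3-8)
    by (simp add: Let_def)
qed

text \<open>By the Yoneda lemma, it is enough to give the composition on generalized elements, naturally in
  the stage.\<close>

lemma ex_internal_category:
  fixes c :: "'m \<Rightarrow> 'm \<Rightarrow> 'm"
  assumes ty: "X \<in> Obj C" "Y \<in> Obj C" "s \<in> Hom C Y X" "t \<in> Hom C Y X" "i \<in> Hom C X Y"
    "s \<cdot> i = Idn C X" "t \<cdot> i = Idn C X"
    and c: "\<And>W g f. g \<in> Hom C W Y \<Longrightarrow> f \<in> Hom C W Y \<Longrightarrow> s \<cdot> g = t \<cdot> f \<Longrightarrow>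
      c g f \<in> Hom C W Y \<and> s \<cdot> c g f = s \<cdot> f \<and> t \<cdot> c g f = t \<cdot> g"
    and nat: "\<And>V W g f h. g \<in> Hom C W Y \<Longrightarrow> f \<in> Hom C W Y \<Longrightarrow> h \<in> Hom C V W \<Longrightarrow> s \<cdot> g = t \<cdot> f \<Longrightarrow>
      c g f \<cdot> h = c (g \<cdot> h) (f \<cdot> h)"
    and idl: "\<And>W f. f \<in> Hom C W Y \<Longrightarrow> c (i \<cdot> (t \<cdot> f)) f = f"
    and idr: "\<And>W f. f \<in> Hom C W Y \<Longrightarrow> c f (i \<cdot> (s \<cdot> f)) = f"
    and assoc: "\<And>W h g f. h \<in> Hom C W Y \<Longrightarrow> g \<in> Hom C W Y \<Longrightarrow> f \<in> Hom C W Y \<Longrightarrow>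
      s \<cdot> h = t \<cdot> g \<Longrightarrow> s \<cdot> g = t \<cdot> f \<Longrightarrow> c (c h g) f = c h (c g f)"
  obtains A where "internal_category C A" "Ob A = X" "Mor A = Y" "Src A = s" "Tgt A = t" "Ids A = i"
    "\<And>W g f. g \<in> Hom C W Y \<Longrightarrow> f \<in> Hom C W Y \<Longrightarrow> s \<cdot> g = t \<cdot> f \<Longrightarrow> icomp C A g f = c g f"
proof -
  have [simp]: "X \<in> Obj C" "Y \<in> Obj C" "s \<in> Arr C" "Dom C s = Y" "Cod C s = X" "t \<in> Arr C" "Dom C t = Y"
    "Cod C t = X" "i \<in> Arr C" "Dom C i = X" "Cod C i = Y" using ty by simp_all
  define A where "A = \<lparr>Ob = X, Mor = Y, Src = s, Tgt = t, Ids = i, Cmp = c (pb1 C s t) (pb2 C s t)\<rparr>"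
  have A [simp]: "Ob A = X" "Mor A = Y" "Src A = s" "Tgt A = t" "Ids A = i"
      "Cmp A = c (pb1 C s t) (pb2 C s t)"
    by (simp_all add: A_def)
  have sq: "s \<cdot> pb1 C s t = t \<cdot> pb2 C s t" by (rule pb_square) auto
  have cp: "c (pb1 C s t) (pb2 C s t) \<in> Hom C (pb_obj C s t) Y"
    using c[of "pb1 C s t" "pb_obj C s t" "pb2 C s t"] sq by simp
  have ic: "icomp C A g f = c g f" if "g \<in> Hom C W Y" "f \<in> Hom C W Y" "s \<cdot> g = t \<cdot> f" for W g f
    using that nat[of "pb1 C s t" "pb_obj C s t" "pb2 C s t" "pbpair s t g f" W] sq
    by (simp add: icomp_def)
  have isi: "s \<cdot> (i \<cdot> x) = x" "t \<cdot> (i \<cdot> x) = x" if "x \<in> Arr C" "Cod C x = X" for x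
    using comp_eq_comp[OF ty(6), of x] comp_eq_comp[OF ty(7), of x] that by simp_all
  have "internal_category C A"
  proof (rule internal_categoryI)
    fix W g f assume *: "g \<in> Hom C W (Mor A)" "f \<in> Hom C W (Mor A)" "Src A \<cdot> g = Tgt A \<cdot> f"
    show "Src A \<cdot> icomp C A g f = Src A \<cdot> f \<and> Tgt A \<cdot> icomp C A g f = Tgt A \<cdot> g"
      using * c[of g W f] by (simp add: ic[of g W f])
  next
    fix W f assume *: "f \<in> Hom C W (Mor A)"
    show "icomp C A (Ids A \<cdot> (Tgt A \<cdot> f)) f = f" using * idl[of f W] by (simp add: ic[of _ W] isi)
    show "icomp C A f (Ids A \<cdot> (Src A \<cdot> f)) = f" using * idr[of f W] by (simp add: ic[of _ W] isi)
  next
    fix W h g f assume *: "h \<in> Hom C W (Mor A)" "g \<in> Hom C W (Mor A)" "f \<in> Hom C W (Mor A)"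
      "Src A \<cdot> h = Tgt A \<cdot> g" "Src A \<cdot> g = Tgt A \<cdot> f"
    show "icomp C A (icomp C A h g) f = icomp C A h (icomp C A g f)"
      using * assoc[of h W g f] c[of h W g] c[of g W f] by (simp add: ic[of _ W])
  qed (use ty cp in simp_all)
  then show thesis using that[of A] ic by simp
qed

lemma ifun_eqI: "FDom F = FDom G \<Longrightarrow> FCod F = FCod G \<Longrightarrow> F0 F = F0 G \<Longrightarrow> F1 F = F1 G \<Longrightarrow>
    F = (G :: ('o, 'm) ifun)"
  by simp

lemma ifun_simps [simp]:
  assumes "internal_functor C F"
  shows "internal_category C (FDom F)" "internal_category C (FCod F)"
    "F0 F \<in> Arr C" "Dom C (F0 F) = Ob (FDom F)" "Cod C (F0 F) = Ob (FCod F)"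
    "F1 F \<in> Arr C" "Dom C (F1 F) = Mor (FDom F)" "Cod C (F1 F) = Mor (FCod F)"
  using assms by (simp_all add: internal_functor_def Let_def)

lemma ifun_laws:
  assumes "internal_functor C F"
  shows "Src (FCod F) \<cdot> F1 F = F0 F \<cdot> Src (FDom F)" "Tgt (FCod F) \<cdot> F1 F = F0 F \<cdot> Tgt (FDom F)"
    "F1 F \<cdot> Ids (FDom F) = Ids (FCod F) \<cdot> F0 F"
  using assms unfolding internal_functor_def Let_def by blast+

lemma ifun_app [simp]:
  assumes "internal_functor C F" "f \<in> Arr C" "Cod C f = Mor (FDom F)" "FCod F = B"
  shows "Src B \<cdot> (F1 F \<cdot> f) = F0 F \<cdot> (Src (FDom F) \<cdot> f)"
      "Tgt B \<cdot> (F1 F \<cdot> f) = F0 F \<cdot> (Tgt (FDom F) \<cdot> f)"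
  using comp_eq_comp[OF ifun_laws(1)[OF assms(1)], of f]
      comp_eq_comp[OF ifun_laws(2)[OF assms(1)], of f] assms
  by auto

lemma ifun_Ids [simp]:
  assumes "internal_functor C F" "x \<in> Arr C" "Cod C x = Ob (FDom F)" "FDom F = A"
  shows "F1 F \<cdot> (Ids A \<cdot> x) = Ids (FCod F) \<cdot> (F0 F \<cdot> x)"
  using comp_eq_comp[OF ifun_laws(3)[OF assms(1)], of x] assms by auto

lemma ifun_icomp [simp]:
  assumes "internal_functor C F" "FDom F = A" "g \<in> Arr C" "f \<in> Arr C" "Cod C g = Mor A"
      "Cod C f = Mor A"
    "Src A \<cdot> g = Tgt A \<cdot> f"
  shows "F1 F \<cdot> icomp C A g f = icomp C (FCod F) (F1 F \<cdot> g) (F1 F \<cdot> f)"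
proof -
  let ?x = "pbpair (Src A) (Tgt A) g f" and ?p = "pb1 C (Src A) (Tgt A)"
      and ?q = "pb2 C (Src A) (Tgt A)"
  have A [simp]: "internal_category C A" using ifun_simps(1)[OF assms(1)] assms(2) by simp
  have d: "Dom C g = Dom C f" using composable_Dom[of A g f] assms by simp
  have pq: "Src A \<cdot> ?p = Tgt A \<cdot> ?q" by (rule pb_square) auto
  have "F1 F \<cdot> Cmp A = icomp C (FCod F) (F1 F \<cdot> ?p) (F1 F \<cdot> ?q)"
    using assms(1) unfolding internal_functor_def Let_def assms(2) by blast
  then have "F1 F \<cdot> (Cmp A \<cdot> ?x) = icomp C (FCod F) (F1 F \<cdot> ?p) (F1 F \<cdot> ?q) \<cdot> ?x"
    by (rule comp_eq_comp) (use assms in simp_all)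
  also have "\<dots> = icomp C (FCod F) (F1 F \<cdot> g) (F1 F \<cdot> f)"
    using assms pq d by (simp add: icomp_comp)
  finally show ?thesis by (simp add: icomp_def)
qed

lemma internal_functorI:
  assumes "internal_category C (FDom F)" "internal_category C (FCod F)"
    and "F0 F \<in> Hom C (Ob (FDom F)) (Ob (FCod F))" "F1 F \<in> Hom C (Mor (FDom F)) (Mor (FCod F))"
    and st: "\<And>W f. f \<in> Hom C W (Mor (FDom F)) \<Longrightarrow> Src (FCod F) \<cdot> (F1 F \<cdot> f) = F0 F \<cdot> (Src (FDom F) \<cdot> f) \<and>
      Tgt (FCod F) \<cdot> (F1 F \<cdot> f) = F0 F \<cdot> (Tgt (FDom F) \<cdot> f)"
    and i: "\<And>W x. x \<in> Hom C W (Ob (FDom F)) \<Longrightarrow> F1 F \<cdot> (Ids (FDom F) \<cdot> x) = Ids (FCod F) \<cdot> (F0 F \<cdot> x)"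
    and c: "\<And>W g f. g \<in> Hom C W (Mor (FDom F)) \<Longrightarrow> f \<in> Hom C W (Mor (FDom F)) \<Longrightarrow>
      Src (FDom F) \<cdot> g = Tgt (FDom F) \<cdot> f \<Longrightarrow>
      F1 F \<cdot> icomp C (FDom F) g f = icomp C (FCod F) (F1 F \<cdot> g) (F1 F \<cdot> f)"
  shows "internal_functor C F"
proof -
  let ?A = "FDom F"
  let ?p = "pb1 C (Src ?A) (Tgt ?A)" and ?q = "pb2 C (Src ?A) (Tgt ?A)"
  note [simp] = assms(1,2)
  have t [simp]: "F0 F \<in> Arr C" "F1 F \<in> Arr C" "Dom C (F0 F) = Ob ?A" "Cod C (F0 F) = Ob (FCod F)"
    "Dom C (F1 F) = Mor ?A" "Cod C (F1 F) = Mor (FCod F)" using assms(3,4) by simp_all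
  have sq: "Src ?A \<cdot> ?p = Tgt ?A \<cdot> ?q" by (rule pb_square) auto
  have "pbpair (Src ?A) (Tgt ?A) ?p ?q = Idn C (pb_obj C (Src ?A) (Tgt ?A))"
    using pbpair_pb[of "Src ?A" "Tgt ?A" "Idn C (pb_obj C (Src ?A) (Tgt ?A))"] by simp
  then have pq: "icomp C ?A ?p ?q = Cmp ?A" by (simp add: icomp_def)
  show ?thesis
    unfolding internal_functor_def
    using st[of "Idn C (Mor ?A)" "Mor ?A"] i[of "Idn C (Ob ?A)" "Ob ?A"]
        c[of ?p "pb_obj C (Src ?A) (Tgt ?A)" ?q] sq pq
    by (simp add: Let_def)
qed

end

lemma CAT_simps [simp]:
  "A \<in> Obj (CAT C) \<longleftrightarrow> internal_category C A" "F \<in> Arr (CAT C) \<longleftrightarrow> internal_functor C F"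
  "Dom (CAT C) F = FDom F" "Cod (CAT C) F = FCod F"
  "FDom (G \<cdot>\<^bsub>CAT C\<^esub> F) = FDom F" "FCod (G \<cdot>\<^bsub>CAT C\<^esub> F) = FCod G"
  "F0 (G \<cdot>\<^bsub>CAT C\<^esub> F) = F0 G \<cdot>\<^bsub>C\<^esub> F0 F" "F1 (G \<cdot>\<^bsub>CAT C\<^esub> F) = F1 G \<cdot>\<^bsub>C\<^esub> F1 F"
  "FDom (Idn (CAT C) A) = A" "FCod (Idn (CAT C) A) = A"
  "F0 (Idn (CAT C) A) = Idn C (Ob A)" "F1 (Idn (CAT C) A) = Idn C (Mor A)"
  by (simp_all add: CAT_def)

context lex_cat
begin

lemma CAT_category: "category (CAT C)"
proof
  fix f :: "('o, 'm) ifun" assume "f \<in> Arr (CAT C)"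
  then show "Dom (CAT C) f \<in> Obj (CAT C)" "Cod (CAT C) f \<in> Obj (CAT C)" by auto
next
  fix X :: "('o, 'm) icat" assume X: "X \<in> Obj (CAT C)"
  have "internal_functor C (Idn (CAT C) X)"
    by (rule internal_functorI) (use X in auto)
  then show "Idn (CAT C) X \<in> Hom (CAT C) X X" using X by simp
next
  fix f X Y g Z assume *: "f \<in> Hom (CAT C) X Y" "g \<in> Hom (CAT C) Y Z"
  then have [simp]: "internal_functor C f" "FDom f = X" "FCod f = Y" "internal_functor C g" "FDom g = Y"
      "FCod g = Z" by auto
  have [simp]: "internal_category C X" "internal_category C Y" "internal_category C Z"
    using ifun_simps(1,2)[of f] ifun_simps(1,2)[of g] by simp_all
  have "internal_functor C (g \<cdot>\<^bsub>CAT C\<^esub> f)"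
    by (rule internal_functorI) auto
  then show "g \<cdot>\<^bsub>CAT C\<^esub> f \<in> Hom (CAT C) X Z" by simp
qed (auto intro!: ifun_eqI)

subsection \<open>Finite products of internal categories\<close>

lemma is_terminal_CATI:
  assumes T: "internal_category C T" "is_terminal C (Ob T)" "is_terminal C (Mor T)"
  shows "is_terminal (CAT C) T"
  unfolding is_terminal_def
proof (intro conjI ballI)
  fix X assume "X \<in> Obj (CAT C)"
  then have X [simp]: "internal_category C X" by simp
  note [simp] = T(1) to_terminal[OF T(2)] to_terminal[OF T(3)]
  note eqI = terminal_arrows_eq[OF T(2)] terminal_arrows_eq[OF T(3)]
  let ?F = "\<lparr>FDom = X, FCod = T, F0 = to_terminal (Ob T) (Ob X), F1 = to_terminal (Mor T) (Mor X)\<rparr>"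
  have "internal_functor C ?F"
  proof (rule internal_functorI)
    fix W f assume f: "f \<in> Hom C W (Mor (FDom ?F))"
    show "Src (FCod ?F) \<cdot> (F1 ?F \<cdot> f) = F0 ?F \<cdot> (Src (FDom ?F) \<cdot> f) \<and>
      Tgt (FCod ?F) \<cdot> (F1 ?F \<cdot> f) = F0 ?F \<cdot> (Tgt (FDom ?F) \<cdot> f)"
      by (rule conjI; rule eqI(1); use f in simp)
  next
    fix W x assume x: "x \<in> Hom C W (Ob (FDom ?F))"
    show "F1 ?F \<cdot> (Ids (FDom ?F) \<cdot> x) = Ids (FCod ?F) \<cdot> (F0 ?F \<cdot> x)"
      by (rule eqI(2); use x in simp)
  next
    fix W g f assume gf: "g \<in> Hom C W (Mor (FDom ?F))" "f \<in> Hom C W (Mor (FDom ?F))"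
      "Src (FDom ?F) \<cdot> g = Tgt (FDom ?F) \<cdot> f"
    have "Src T \<cdot> (to_terminal (Mor T) (Mor X) \<cdot> g) = Tgt T \<cdot> (to_terminal (Mor T) (Mor X) \<cdot> f)"
      by (rule eqI(1); use gf in simp)
    then show "F1 ?F \<cdot> icomp C (FDom ?F) g f = icomp C (FCod ?F) (F1 ?F \<cdot> g) (F1 ?F \<cdot> f)"
      by - (rule eqI(2); use gf in simp)
  qed simp_all
  show "\<exists>!f. f \<in> Hom (CAT C) X T"
  proof (rule ex1I[of _ ?F])
    show "?F \<in> Hom (CAT C) X T" using \<open>internal_functor C ?F\<close> by simp
    fix f assume "f \<in> Hom (CAT C) X T"
    then show "f = ?F" using ifun_simps[of f] by (intro ifun_eqI; simp add: eqI)
  qed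
qed (use assms in simp)

lemma ex_terminal_CAT: "\<exists>T. internal_category C T \<and> is_terminal C (Ob T) \<and> is_terminal C (Mor T)"
proof -
  let ?T = "terminal C"
  obtain A where "internal_category C A" "Ob A = ?T" "Mor A = ?T"
    by (rule ex_internal_category[of ?T ?T "Idn C ?T" "Idn C ?T" "Idn C ?T" "\<lambda>g f. f"]) auto
  then show ?thesis using terminal by auto
qed

lemma is_product_CATI:
  assumes p: "p \<in> Hom (CAT C) P X" and q: "q \<in> Hom (CAT C) P Y"
    and 0: "is_product C (Ob X) (Ob Y) (F0 p) (F0 q)"
        and 1: "is_product C (Mor X) (Mor Y) (F1 p) (F1 q)"
  shows "is_product (CAT C) X Y p q"
proof -
  interpret K: category "CAT C" by (rule CAT_category)
  have [simp]: "internal_functor C p" "internal_functor C q" "FDom p = P" "FCod p = X" "FDom q = P"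
      "FCod q = Y"
    using p q by simp_all
  have [simp]: "internal_category C P" "internal_category C X" "internal_category C Y"
    using ifun_simps(1,2)[of p] ifun_simps(2)[of q] by simp_all
  note [simp] = pair_product[OF 0] pair_product[OF 1] pair_product_comp[OF 0] pair_product_comp[OF 1]
  note eq0 = product_eqI[OF 0] and eq1 = product_eqI[OF 1]
  show ?thesis
  proof (rule K.is_productI)
    fix W f g assume "f \<in> Hom (CAT C) W X" "g \<in> Hom (CAT C) W Y"
    then have [simp]: "internal_functor C f" "internal_functor C g" "FDom f = W" "FCod f = X"
        "FDom g = W" "FCod g = Y"
      by simp_all
    have [simp]: "internal_category C W" using ifun_simps(1)[of f] by simp
    let ?u = "\<lparr>FDom = W, FCod = P, F0 = pair_into C (F0 p) (F0 q) (F0 f) (F0 g), F1 =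
        pair_into C (F1 p) (F1 q) (F1 f) (F1 g)\<rparr>"
    have st: "Src P \<cdot> (pair_into C (F1 p) (F1 q) (F1 f) (F1 g) \<cdot> a) =
        pair_into C (F0 p) (F0 q) (F0 f) (F0 g) \<cdot> (Src W \<cdot> a)"
      "Tgt P \<cdot> (pair_into C (F1 p) (F1 q) (F1 f) (F1 g) \<cdot> a) =
          pair_into C (F0 p) (F0 q) (F0 f) (F0 g) \<cdot> (Tgt W \<cdot> a)"
      if "a \<in> Arr C" "Cod C a = Mor W" for a
      using that ifun_app[of p "pair_into C (F1 p) (F1 q) (F1 f) (F1 g) \<cdot> a" X]
          ifun_app[of q "pair_into C (F1 p) (F1 q) (F1 f) (F1 g) \<cdot> a" Y]
      by - (rule eq0; simp)+
    have "internal_functor C ?u"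
    proof (rule internal_functorI)
      fix V a assume "a \<in> Hom C V (Mor (FDom ?u))"
      then show "Src (FCod ?u) \<cdot> (F1 ?u \<cdot> a) = F0 ?u \<cdot> (Src (FDom ?u) \<cdot> a) \<and>
        Tgt (FCod ?u) \<cdot> (F1 ?u \<cdot> a) = F0 ?u \<cdot> (Tgt (FDom ?u) \<cdot> a)"
        using st by simp
    next
      fix V x assume x: "x \<in> Hom C V (Ob (FDom ?u))"
      show "F1 ?u \<cdot> (Ids (FDom ?u) \<cdot> x) = Ids (FCod ?u) \<cdot> (F0 ?u \<cdot> x)"
        by (rule eq1; use x in simp)
    next
      fix V b a assume ba: "b \<in> Hom C V (Mor (FDom ?u))" "a \<in> Hom C V (Mor (FDom ?u))"
        "Src (FDom ?u) \<cdot> b = Tgt (FDom ?u) \<cdot> a"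
      show "F1 ?u \<cdot> icomp C (FDom ?u) b a = icomp C (FCod ?u) (F1 ?u \<cdot> b) (F1 ?u \<cdot> a)"
        by (rule eq1; use ba st in simp)
    qed simp_all
    then show "\<exists>u\<in>Hom (CAT C) W (Dom (CAT C) p). p \<cdot>\<^bsub>CAT C\<^esub> u = f \<and> q \<cdot>\<^bsub>CAT C\<^esub> u = g"
      by (intro bexI[of _ ?u]) (auto intro!: ifun_eqI)
  next
    fix u v assume *: "u \<in> Arr (CAT C)" "v \<in> Arr (CAT C)" "Dom (CAT C) u = Dom (CAT C) v"
        "Cod (CAT C) u = Dom (CAT C) p"
       "Cod (CAT C) v = Dom (CAT C) p" "p \<cdot>\<^bsub>CAT C\<^esub> u = p \<cdot>\<^bsub>CAT C\<^esub> v" "q \<cdot>\<^bsub>CAT C\<^esub> u = q \<cdot>\<^bsub>CAT C\<^esub> v"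
    from arg_cong[OF *(6), of F0] arg_cong[OF *(7), of F0] arg_cong[OF *(6), of F1]
        arg_cong[OF *(7), of F1]
    have e: "F0 p \<cdot> F0 u = F0 p \<cdot> F0 v" "F0 q \<cdot> F0 u = F0 q \<cdot> F0 v" "F1 p \<cdot> F1 u = F1 p \<cdot> F1 v"
        "F1 q \<cdot> F1 u = F1 q \<cdot> F1 v"
      by simp_all
    show "u = v"
    proof (rule ifun_eqI)
      show "F0 u = F0 v" by (rule eq0; use * e in simp)
      show "F1 u = F1 v" by (rule eq1; use * e in simp)
    qed (use * in auto)
  qed auto
qed

lemma ex_product_CAT:
  assumes [simp]: "internal_category C X" "internal_category C Y"
  obtains p q where "is_product (CAT C) X Y p q" "is_product C (Ob X) (Ob Y) (F0 p) (F0 q)"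
    "is_product C (Mor X) (Mor Y) (F1 p) (F1 q)"
proof -
  let ?p0 = "proj1 C (Ob X) (Ob Y)" and ?q0 = "proj2 C (Ob X) (Ob Y)"
  let ?p1 = "proj1 C (Mor X) (Mor Y)" and ?q1 = "proj2 C (Mor X) (Mor Y)"
  let ?pr0 = "pr (Ob X) (Ob Y)" and ?pr1 = "pr (Mor X) (Mor Y)"
  let ?O = "prod_obj C (Ob X) (Ob Y)" and ?M = "prod_obj C (Mor X) (Mor Y)"
  let ?s = "?pr0 (Src X \<cdot> ?p1) (Src Y \<cdot> ?q1)" and ?t = "?pr0 (Tgt X \<cdot> ?p1) (Tgt Y \<cdot> ?q1)"
  let ?i = "?pr1 (Ids X \<cdot> ?p0) (Ids Y \<cdot> ?q0)"
  let ?c = "\<lambda>g f. ?pr1 (icomp C X (?p1 \<cdot> g) (?p1 \<cdot> f)) (icomp C Y (?q1 \<cdot> g) (?q1 \<cdot> f))"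
  have comp: "Src X \<cdot> (?p1 \<cdot> g) = Tgt X \<cdot> (?p1 \<cdot> f)" "Src Y \<cdot> (?q1 \<cdot> g) = Tgt Y \<cdot> (?q1 \<cdot> f)"
    if "g \<in> Hom C W ?M" "f \<in> Hom C W ?M" "?s \<cdot> g = ?t \<cdot> f" for W g f
    using arg_cong[OF that(3), of "\<lambda>x. ?p0 \<cdot> x"] arg_cong[OF that(3), of "\<lambda>x. ?q0 \<cdot> x"] that(1,2)
      by simp_all
  obtain P where P: "internal_category C P" "Ob P = ?O" "Mor P = ?M" "Src P = ?s" "Tgt P = ?t"
      "Ids P = ?i"
    "\<And>W g f. g \<in> Hom C W ?M \<Longrightarrow> f \<in> Hom C W ?M \<Longrightarrow> ?s \<cdot> g = ?t \<cdot> f \<Longrightarrow> icomp C P g f = ?c g f"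
  proof (rule ex_internal_category[of ?O ?M ?s ?t ?i ?c])
    fix W g f assume *: "g \<in> Hom C W ?M" "f \<in> Hom C W ?M" "?s \<cdot> g = ?t \<cdot> f"
    show "?c g f \<in> Hom C W ?M \<and> ?s \<cdot> ?c g f = ?s \<cdot> f \<and> ?t \<cdot> ?c g f = ?t \<cdot> g"
      using *(1,2) comp[OF *] by simp
  next
    fix V W g f h assume *: "g \<in> Hom C W ?M" "f \<in> Hom C W ?M" "h \<in> Hom C V W" "?s \<cdot> g = ?t \<cdot> f"
    show "?c g f \<cdot> h = ?c (g \<cdot> h) (f \<cdot> h)"
      using *(1-3) comp[OF *(1,2,4)] by (simp add: icomp_comp)
  next
    fix W h g f assume *: "h \<in> Hom C W ?M" "g \<in> Hom C W ?M" "f \<in> Hom C W ?M" "?s \<cdot> h = ?t \<cdot> g"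
        "?s \<cdot> g = ?t \<cdot> f"
    show "?c (?c h g) f = ?c h (?c g f)"
      using *(1-3) comp[OF *(1,2,4)] comp[OF *(2,3,5)] by (simp add: icomp_assoc)
  qed (auto simp del: pr_proj_id simp flip: pr_proj_id)
  let ?pp = "\<lparr>FDom = P, FCod = X, F0 = ?p0, F1 = ?p1\<rparr>"
      and ?qq = "\<lparr>FDom = P, FCod = Y, F0 = ?q0, F1 = ?q1\<rparr>"
  have 0: "is_product C (Ob X) (Ob Y) ?p0 ?q0" and 1: "is_product C (Mor X) (Mor Y) ?p1 ?q1"
    by (simp_all add: proj)
  have p: "internal_functor C ?pp"
  proof (rule internal_functorI)
    fix W b a assume ba: "b \<in> Hom C W (Mor (FDom ?pp))" "a \<in> Hom C W (Mor (FDom ?pp))"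
      "Src (FDom ?pp) \<cdot> b = Tgt (FDom ?pp) \<cdot> a"
    then have c: "b \<in> Hom C W ?M" "a \<in> Hom C W ?M" "?s \<cdot> b = ?t \<cdot> a"
      by (simp_all add: P(1-6) del: pr_comp)
    show "F1 ?pp \<cdot> icomp C (FDom ?pp) b a = icomp C (FCod ?pp) (F1 ?pp \<cdot> b) (F1 ?pp \<cdot> a)"
      using c(1,2) comp[OF c] P(7)[OF c] by simp
  qed (simp_all add: P(1-6))
  have q: "internal_functor C ?qq"
  proof (rule internal_functorI)
    fix W b a assume ba: "b \<in> Hom C W (Mor (FDom ?qq))" "a \<in> Hom C W (Mor (FDom ?qq))"
      "Src (FDom ?qq) \<cdot> b = Tgt (FDom ?qq) \<cdot> a"
    then have c: "b \<in> Hom C W ?M" "a \<in> Hom C W ?M" "?s \<cdot> b = ?t \<cdot> a"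
      by (simp_all add: P(1-6) del: pr_comp)
    show "F1 ?qq \<cdot> icomp C (FDom ?qq) b a = icomp C (FCod ?qq) (F1 ?qq \<cdot> b) (F1 ?qq \<cdot> a)"
      using c(1,2) comp[OF c] P(7)[OF c] by simp
  qed (simp_all add: P(1-6))
  show thesis
    by (rule that[of ?pp ?qq]; (rule is_product_CATI)?) (use p q 0 1 in simp_all)
qed

lemma CAT_fprod: "fprod_cat (CAT C)"
proof -
  interpret K: category "CAT C" by (rule CAT_category)
  show ?thesis
  proof
    show "\<exists>T. is_terminal (CAT C) T" using ex_terminal_CAT is_terminal_CATI by blast
    fix X Y assume "X \<in> Obj (CAT C)" "Y \<in> Obj (CAT C)"
    then have XY: "internal_category C X" "internal_category C Y" by simp_all
    obtain p q where "is_product (CAT C) X Y p q" by (rule ex_product_CAT[OF XY])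
    then show "\<exists>p q. is_product (CAT C) X Y p q" by blast
  qed
qed

lemma terminal_CAT:
  assumes "is_terminal (CAT C) S"
  shows "internal_category C S" "is_terminal C (Ob S)" "is_terminal C (Mor S)"
proof -
  interpret K: fprod_cat "CAT C" by (rule CAT_fprod)
  obtain T where T: "internal_category C T" "is_terminal C (Ob T)" "is_terminal C (Mor T)"
    using ex_terminal_CAT by blast
  have T': "is_terminal (CAT C) T" by (rule is_terminal_CATI[OF T])
  show S: "internal_category C S" using assms by (simp add: is_terminal_def)
  let ?u = "K.to_terminal T S" and ?v = "K.to_terminal S T"
  have u: "internal_functor C ?u" "FDom ?u = S" "FCod ?u = T"
      and v: "internal_functor C ?v" "FDom ?v = T" "FCod ?v = S"
    using K.to_terminal[OF T', of S] K.to_terminal[OF assms, of T] T S by auto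
  have "?v \<cdot>\<^bsub>CAT C\<^esub> ?u = Idn (CAT C) S"
    by (rule K.terminal_arrows_eq[OF assms]) (use u v S K.comp_arr[of ?u ?v] K.Idn_arr[of S] in auto)
  from arg_cong[OF this, of F0] arg_cong[OF this, of F1]
  have "F0 ?v \<cdot> F0 ?u = Idn C (Ob S)" "F1 ?v \<cdot> F1 ?u = Idn C (Mor S)" by simp_all
  then show "is_terminal C (Ob S)" "is_terminal C (Mor S)"
    using is_terminal_iso[OF T(2), of "F0 ?u" "Ob S" "F0 ?v"]
        is_terminal_iso[OF T(3), of "F1 ?u" "Mor S" "F1 ?v"] u v
    by auto
qed

lemma product_CAT:
  assumes "is_product (CAT C) X Y p q"
  shows "is_product C (Ob X) (Ob Y) (F0 p) (F0 q)" "is_product C (Mor X) (Mor Y) (F1 p) (F1 q)"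
proof -
  interpret K: fprod_cat "CAT C" by (rule CAT_fprod)
  have XY: "internal_category C X" "internal_category C Y"
    using K.is_productD[OF assms] ifun_simps(2)[of p] ifun_simps(2)[of q] by auto
  obtain p' q' where pq: "is_product (CAT C) X Y p' q'" "is_product C (Ob X) (Ob Y) (F0 p') (F0 q')"
    "is_product C (Mor X) (Mor Y) (F1 p') (F1 q')" using ex_product_CAT[OF XY] .
  obtain u v where u: "u \<in> Hom (CAT C) (FDom p) (FDom p')" "v \<in> Hom (CAT C) (FDom p') (FDom p)"
    and uv: "v \<cdot>\<^bsub>CAT C\<^esub> u = Idn (CAT C) (FDom p)" "u \<cdot>\<^bsub>CAT C\<^esub> v = Idn (CAT C) (FDom p')"
    and pu: "p' \<cdot>\<^bsub>CAT C\<^esub> u = p" "q' \<cdot>\<^bsub>CAT C\<^esub> u = q"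
    using K.product_unique[OF pq(1) assms, of thesis] by simp
  have p': "internal_functor C p'" using K.is_productD[OF pq(1)] by simp
  have "is_product C (Ob X) (Ob Y) (F0 p' \<cdot> F0 u) (F0 q' \<cdot> F0 u)"
    by (rule is_product_iso[OF pq(2), of _ "Ob (FDom p)" "F0 v"])
      (use u p' arg_cong[OF uv(1), of F0] arg_cong[OF uv(2), of F0] in auto)
  then show "is_product C (Ob X) (Ob Y) (F0 p) (F0 q)"
    using arg_cong[OF pu(1), of F0] arg_cong[OF pu(2), of F0] by simp
  have "is_product C (Mor X) (Mor Y) (F1 p' \<cdot> F1 u) (F1 q' \<cdot> F1 u)"
    by (rule is_product_iso[OF pq(3), of _ "Mor (FDom p)" "F1 v"])
      (use u p' arg_cong[OF uv(1), of F1] arg_cong[OF uv(2), of F1] in auto)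
  then show "is_product C (Mor X) (Mor Y) (F1 p) (F1 q)"
    using arg_cong[OF pu(1), of F1] arg_cong[OF pu(2), of F1] by simp
qed

end

section \<open>Functor categories\<close>

context lex_cat
begin

subsection \<open>Generalized elements of products of internal categories\<close>

sublocale K: fprod_cat "CAT C" by (rule CAT_fprod)

lemma internal_functor_comp [simp]:
  "internal_functor C F \<Longrightarrow> internal_functor C G \<Longrightarrow> FCod F = FDom G \<Longrightarrow> internal_functor C (G \<cdot>\<^bsub>CAT C\<^esub> F)"
  using K.comp_arr[of F G] by simp

lemma internal_functor_Idn [simp]: "internal_category C A \<Longrightarrow> internal_functor C (Idn (CAT C) A)"
  using K.Idn_arr[of A] by simp

text \<open>The products of internal categories used here are chosen by their universal property in the
  category of internal categories, but their objects of objects and of arrows are products again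
  (\<open>product_CAT\<close>). The generalized elements \<open>(x, y)\<close> of these two objects are \<open>cp0 X Y x y\<close> and
  \<open>cp1 X Y x y\<close>.\<close>

definition cp0 :: "('o, 'm) icat \<Rightarrow> ('o, 'm) icat \<Rightarrow> 'm \<Rightarrow> 'm \<Rightarrow> 'm" where
  "cp0 X Y = pair_into C (F0 (proj1 (CAT C) X Y)) (F0 (proj2 (CAT C) X Y))"

definition cp1 :: "('o, 'm) icat \<Rightarrow> ('o, 'm) icat \<Rightarrow> 'm \<Rightarrow> 'm \<Rightarrow> 'm" where
  "cp1 X Y = pair_into C (F1 (proj1 (CAT C) X Y)) (F1 (proj2 (CAT C) X Y))"

lemma CAT_proj [simp]:
  assumes "internal_category C X" "internal_category C Y"
  shows "internal_functor C (proj1 (CAT C) X Y)" "internal_functor C (proj2 (CAT C) X Y)"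
    "FDom (proj1 (CAT C) X Y) = prod_obj (CAT C) X Y" "FDom (proj2 (CAT C) X Y) = prod_obj (CAT C) X Y"
    "FCod (proj1 (CAT C) X Y) = X" "FCod (proj2 (CAT C) X Y) = Y"
    "internal_category C (prod_obj (CAT C) X Y)"
  using K.proj_simps[of X Y] assms by simp_all

lemma CAT_proj_products:
  assumes "internal_category C X" "internal_category C Y"
  shows "is_product C (Ob X) (Ob Y) (F0 (proj1 (CAT C) X Y)) (F0 (proj2 (CAT C) X Y))"
    "is_product C (Mor X) (Mor Y) (F1 (proj1 (CAT C) X Y)) (F1 (proj2 (CAT C) X Y))"
  using product_CAT[OF K.proj, of X Y] assms by simp_all

lemma cp0 [simp]:
  assumes "internal_category C X" "internal_category C Y"
    "x \<in> Arr C" "y \<in> Arr C" "Dom C x = Dom C y" "Cod C x = Ob X" "Cod C y = Ob Y"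
  shows "cp0 X Y x y \<in> Arr C" "Dom C (cp0 X Y x y) = Dom C y"
      "Cod C (cp0 X Y x y) = Ob (prod_obj (CAT C) X Y)"
    "F0 (proj1 (CAT C) X Y) \<cdot> cp0 X Y x y = x" "F0 (proj2 (CAT C) X Y) \<cdot> cp0 X Y x y = y"
  using pair_product[OF CAT_proj_products(1)[OF assms(1,2)] assms(3-)] assms(1,2) unfolding cp0_def
    by simp_all

lemma cp1 [simp]:
  assumes "internal_category C X" "internal_category C Y"
    "x \<in> Arr C" "y \<in> Arr C" "Dom C x = Dom C y" "Cod C x = Mor X" "Cod C y = Mor Y"
  shows "cp1 X Y x y \<in> Arr C" "Dom C (cp1 X Y x y) = Dom C y"
      "Cod C (cp1 X Y x y) = Mor (prod_obj (CAT C) X Y)"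
    "F1 (proj1 (CAT C) X Y) \<cdot> cp1 X Y x y = x" "F1 (proj2 (CAT C) X Y) \<cdot> cp1 X Y x y = y"
  using pair_product[OF CAT_proj_products(2)[OF assms(1,2)] assms(3-)] assms(1,2) unfolding cp1_def
    by simp_all

lemma cp0_eqI:
  assumes "F0 (proj1 (CAT C) X Y) \<cdot> u = F0 (proj1 (CAT C) X Y) \<cdot> v"
    "F0 (proj2 (CAT C) X Y) \<cdot> u = F0 (proj2 (CAT C) X Y) \<cdot> v"
    "internal_category C X" "internal_category C Y"
    "u \<in> Arr C" "v \<in> Arr C" "Dom C u = Dom C v" "Cod C u = Ob (prod_obj (CAT C) X Y)"
    "Cod C v = Ob (prod_obj (CAT C) X Y)"
  shows "u = v"
  using product_eqI[OF CAT_proj_products(1)[OF assms(3,4)], of u v] assms by simp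

lemma cp1_eqI:
  assumes "F1 (proj1 (CAT C) X Y) \<cdot> u = F1 (proj1 (CAT C) X Y) \<cdot> v"
    "F1 (proj2 (CAT C) X Y) \<cdot> u = F1 (proj2 (CAT C) X Y) \<cdot> v"
    "internal_category C X" "internal_category C Y"
    "u \<in> Arr C" "v \<in> Arr C" "Dom C u = Dom C v" "Cod C u = Mor (prod_obj (CAT C) X Y)"
    "Cod C v = Mor (prod_obj (CAT C) X Y)"
  shows "u = v"
  using product_eqI[OF CAT_proj_products(2)[OF assms(3,4)], of u v] assms by simp

lemma proj_cp0_comp [simp]:
  assumes "internal_category C X" "internal_category C Y"
    "x \<in> Arr C" "y \<in> Arr C" "Dom C x = Dom C y" "Cod C x = Ob X" "Cod C y = Ob Y" "h \<in> Arr C"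
        "Cod C h = Dom C y"
  shows "F0 (proj1 (CAT C) X Y) \<cdot> (cp0 X Y x y \<cdot> h) = x \<cdot> h"
      "F0 (proj2 (CAT C) X Y) \<cdot> (cp0 X Y x y \<cdot> h) = y \<cdot> h"
  by (rule comp_eq_comp; use assms in simp)+

lemma proj_cp1_comp [simp]:
  assumes "internal_category C X" "internal_category C Y"
    "x \<in> Arr C" "y \<in> Arr C" "Dom C x = Dom C y" "Cod C x = Mor X" "Cod C y = Mor Y" "h \<in> Arr C"
        "Cod C h = Dom C y"
  shows "F1 (proj1 (CAT C) X Y) \<cdot> (cp1 X Y x y \<cdot> h) = x \<cdot> h"
      "F1 (proj2 (CAT C) X Y) \<cdot> (cp1 X Y x y \<cdot> h) = y \<cdot> h"
  by (rule comp_eq_comp; use assms in simp)+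

lemma cp0_comp [simp]:
  assumes "internal_category C X" "internal_category C Y"
    "x \<in> Arr C" "y \<in> Arr C" "Dom C x = Dom C y" "Cod C x = Ob X" "Cod C y = Ob Y" "h \<in> Arr C"
        "Cod C h = Dom C y"
  shows "cp0 X Y x y \<cdot> h = cp0 X Y (x \<cdot> h) (y \<cdot> h)"
  by (rule cp0_eqI; use assms in simp)

lemma cp1_comp [simp]:
  assumes "internal_category C X" "internal_category C Y"
    "x \<in> Arr C" "y \<in> Arr C" "Dom C x = Dom C y" "Cod C x = Mor X" "Cod C y = Mor Y" "h \<in> Arr C"
        "Cod C h = Dom C y"
  shows "cp1 X Y x y \<cdot> h = cp1 X Y (x \<cdot> h) (y \<cdot> h)"
  by (rule cp1_eqI; use assms in simp)

lemma cp0_cases: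
  assumes "internal_category C X" "internal_category C Y" "p \<in> Hom C V (Ob (prod_obj (CAT C) X Y))"
  obtains x y where "x \<in> Hom C V (Ob X)" "y \<in> Hom C V (Ob Y)" "p = cp0 X Y x y"
proof (rule that)
  show "p = cp0 X Y (F0 (proj1 (CAT C) X Y) \<cdot> p) (F0 (proj2 (CAT C) X Y) \<cdot> p)"
    by (rule cp0_eqI; use assms in simp)
qed (use assms in auto)

lemma cp1_cases:
  assumes "internal_category C X" "internal_category C Y" "p \<in> Hom C V (Mor (prod_obj (CAT C) X Y))"
  obtains x y where "x \<in> Hom C V (Mor X)" "y \<in> Hom C V (Mor Y)" "p = cp1 X Y x y"
proof (rule that)
  show "p = cp1 X Y (F1 (proj1 (CAT C) X Y) \<cdot> p) (F1 (proj2 (CAT C) X Y) \<cdot> p)"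
    by (rule cp1_eqI; use assms in simp)
qed (use assms in auto)

lemma Src_cp1 [simp]:
  assumes "internal_category C X" "internal_category C Y"
    "x \<in> Arr C" "y \<in> Arr C" "Dom C x = Dom C y" "Cod C x = Mor X" "Cod C y = Mor Y"
  shows "Src (prod_obj (CAT C) X Y) \<cdot> cp1 X Y x y = cp0 X Y (Src X \<cdot> x) (Src Y \<cdot> y)"
    "Tgt (prod_obj (CAT C) X Y) \<cdot> cp1 X Y x y = cp0 X Y (Tgt X \<cdot> x) (Tgt Y \<cdot> y)"
  using assms ifun_app[of "proj1 (CAT C) X Y" "cp1 X Y x y" X]
      ifun_app[of "proj2 (CAT C) X Y" "cp1 X Y x y" Y]
  by - (rule cp0_eqI; simp)+

lemma Ids_cp0:
  assumes "internal_category C X" "internal_category C Y"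
    "x \<in> Arr C" "y \<in> Arr C" "Dom C x = Dom C y" "Cod C x = Ob X" "Cod C y = Ob Y"
  shows "Ids (prod_obj (CAT C) X Y) \<cdot> cp0 X Y x y = cp1 X Y (Ids X \<cdot> x) (Ids Y \<cdot> y)"
  using assms by - (rule cp1_eqI; simp)

lemma icomp_cp1 [simp]:
  assumes "internal_category C X" "internal_category C Y"
    "x \<in> Arr C" "y \<in> Arr C" "Dom C x = Dom C y" "Cod C x = Mor X" "Cod C y = Mor Y"
    "x' \<in> Arr C" "y' \<in> Arr C" "Dom C x' = Dom C y'" "Cod C x' = Mor X" "Cod C y' = Mor Y"
    "Src X \<cdot> x' = Tgt X \<cdot> x" "Src Y \<cdot> y' = Tgt Y \<cdot> y"
  shows "icomp C (prod_obj (CAT C) X Y) (cp1 X Y x' y') (cp1 X Y x y) =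
      cp1 X Y (icomp C X x' x) (icomp C Y y' y)"
  using assms composable_Dom[of X x' x] by - (rule cp1_eqI; simp)

lemma cp0_inject:
  assumes "cp0 X Y x y = cp0 X Y x' y'" "internal_category C X" "internal_category C Y"
    "x \<in> Arr C" "y \<in> Arr C" "Dom C x = Dom C y" "Cod C x = Ob X" "Cod C y = Ob Y"
    "x' \<in> Arr C" "y' \<in> Arr C" "Dom C x' = Dom C y'" "Cod C x' = Ob X" "Cod C y' = Ob Y"
  shows "x = x'" "y = y'"
  using arg_cong[OF assms(1), of "\<lambda>p. F0 (proj1 (CAT C) X Y) \<cdot> p"]
    arg_cong[OF assms(1), of "\<lambda>p. F0 (proj2 (CAT C) X Y) \<cdot> p"] assms(2-) by simp_all

lemma times_right_CAT [simp]:
  assumes "internal_functor C G" "internal_category C D"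
  shows "internal_functor C (times_right (CAT C) G D)"
      "FDom (times_right (CAT C) G D) = prod_obj (CAT C) (FDom G) D"
    "FCod (times_right (CAT C) G D) = prod_obj (CAT C) (FCod G) D"
  using K.times_right_simps[of G D] assms by simp_all

lemma times_right_proj:
  assumes "internal_functor C G" "internal_category C D"
  shows "proj1 (CAT C) (FCod G) D \<cdot>\<^bsub>CAT C\<^esub> times_right (CAT C) G D =
      G \<cdot>\<^bsub>CAT C\<^esub> proj1 (CAT C) (FDom G) D"
    "proj2 (CAT C) (FCod G) D \<cdot>\<^bsub>CAT C\<^esub> times_right (CAT C) G D = proj2 (CAT C) (FDom G) D"
  using assms unfolding times_right_def by simp_all

lemma times_right_cp [simp]:
  assumes "internal_functor C G" "internal_category C D" "FDom G = W" "x \<in> Arr C" "y \<in> Arr C"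
      "Dom C x = Dom C y"
  shows "Cod C x = Ob W \<Longrightarrow> Cod C y = Ob D \<Longrightarrow>
      F0 (times_right (CAT C) G D) \<cdot> cp0 W D x y = cp0 (FCod G) D (F0 G \<cdot> x) y"
    "Cod C x = Mor W \<Longrightarrow> Cod C y = Mor D \<Longrightarrow>
      F1 (times_right (CAT C) G D) \<cdot> cp1 W D x y = cp1 (FCod G) D (F1 G \<cdot> x) y"
proof -
  note [simp] = assms
  have [simp]: "internal_category C W" using ifun_simps(1)[OF assms(1)] assms(3) by simp
  note e = times_right_proj[OF assms(1,2)]
  have e0: "F0 (proj1 (CAT C) (FCod G) D) \<cdot> F0 (times_right (CAT C) G D) =
      F0 G \<cdot> F0 (proj1 (CAT C) W D)"
    "F0 (proj2 (CAT C) (FCod G) D) \<cdot> F0 (times_right (CAT C) G D) = F0 (proj2 (CAT C) W D)"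
    "F1 (proj1 (CAT C) (FCod G) D) \<cdot> F1 (times_right (CAT C) G D) = F1 G \<cdot> F1 (proj1 (CAT C) W D)"
    "F1 (proj2 (CAT C) (FCod G) D) \<cdot> F1 (times_right (CAT C) G D) = F1 (proj2 (CAT C) W D)"
    using arg_cong[OF e(1), of F0] arg_cong[OF e(2), of F0] arg_cong[OF e(1), of F1]
        arg_cong[OF e(2), of F1]
    by simp_all
  show "F0 (times_right (CAT C) G D) \<cdot> cp0 W D x y = cp0 (FCod G) D (F0 G \<cdot> x) y"
      if "Cod C x = Ob W" "Cod C y = Ob D"
    by (rule cp0_eqI) (simp_all add: that comp_eq_comp[OF e0(1)] comp_eq_comp[OF e0(2)])
  show "F1 (times_right (CAT C) G D) \<cdot> cp1 W D x y = cp1 (FCod G) D (F1 G \<cdot> x) y"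
      if "Cod C x = Mor W" "Cod C y = Mor D"
    by (rule cp1_eqI) (simp_all add: that comp_eq_comp[OF e0(3)] comp_eq_comp[OF e0(4)])
qed

text \<open>It suffices to check functoriality on pairs.\<close>

lemma internal_functor_productI:
  assumes [simp]: "internal_category C X" "internal_category C D" "internal_category C B"
    and F: "FDom F = prod_obj (CAT C) X D" "FCod F = B"
      "F0 F \<in> Hom C (Ob (prod_obj (CAT C) X D)) (Ob B)"
          "F1 F \<in> Hom C (Mor (prod_obj (CAT C) X D)) (Mor B)"
    and st: "\<And>W x d. x \<in> Hom C W (Mor X) \<Longrightarrow> d \<in> Hom C W (Mor D) \<Longrightarrow>
       Src B \<cdot> (F1 F \<cdot> cp1 X D x d) = F0 F \<cdot> cp0 X D (Src X \<cdot> x) (Src D \<cdot> d) \<and>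
       Tgt B \<cdot> (F1 F \<cdot> cp1 X D x d) = F0 F \<cdot> cp0 X D (Tgt X \<cdot> x) (Tgt D \<cdot> d)"
    and i: "\<And>W x d. x \<in> Hom C W (Ob X) \<Longrightarrow> d \<in> Hom C W (Ob D) \<Longrightarrow>
       F1 F \<cdot> cp1 X D (Ids X \<cdot> x) (Ids D \<cdot> d) = Ids B \<cdot> (F0 F \<cdot> cp0 X D x d)"
    and c: "\<And>W x d x' d'. x \<in> Hom C W (Mor X) \<Longrightarrow> d \<in> Hom C W (Mor D) \<Longrightarrow> x' \<in> Hom C W (Mor X) \<Longrightarrow>
       d' \<in> Hom C W (Mor D) \<Longrightarrow> Src X \<cdot> x' = Tgt X \<cdot> x \<Longrightarrow> Src D \<cdot> d' = Tgt D \<cdot> d \<Longrightarrow>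
       F1 F \<cdot> cp1 X D (icomp C X x' x) (icomp C D d' d) = icomp C B (F1 F \<cdot> cp1 X D x' d')
           (F1 F \<cdot> cp1 X D x d)"
  shows "internal_functor C F"
proof (rule internal_functorI)
  fix W f assume f: "f \<in> Hom C W (Mor (FDom F))"
  obtain x d where xd: "x \<in> Hom C W (Mor X)" "d \<in> Hom C W (Mor D)" "f = cp1 X D x d"
    using cp1_cases[of X D f W thesis] f F(1) by simp
  show "Src (FCod F) \<cdot> (F1 F \<cdot> f) = F0 F \<cdot> (Src (FDom F) \<cdot> f) \<and>
    Tgt (FCod F) \<cdot> (F1 F \<cdot> f) = F0 F \<cdot> (Tgt (FDom F) \<cdot> f)" using st[OF xd(1,2)] xd F(1,2) by simp
next
  fix W f assume f: "f \<in> Hom C W (Ob (FDom F))"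
  obtain x d where xd: "x \<in> Hom C W (Ob X)" "d \<in> Hom C W (Ob D)" "f = cp0 X D x d"
    using cp0_cases[of X D f W thesis] f F(1) by simp
  show "F1 F \<cdot> (Ids (FDom F) \<cdot> f) = Ids (FCod F) \<cdot> (F0 F \<cdot> f)" using i[OF xd(1,2)] xd F(1,2)
    by (simp add: Ids_cp0)
next
  fix W g f assume *: "g \<in> Hom C W (Mor (FDom F))" "f \<in> Hom C W (Mor (FDom F))"
      "Src (FDom F) \<cdot> g = Tgt (FDom F) \<cdot> f"
  obtain x d where xd: "x \<in> Hom C W (Mor X)" "d \<in> Hom C W (Mor D)" "f = cp1 X D x d"
    using cp1_cases[of X D f W thesis] * F(1) by simp
  obtain x' d' where xd': "x' \<in> Hom C W (Mor X)" "d' \<in> Hom C W (Mor D)" "g = cp1 X D x' d'"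
    using cp1_cases[of X D g W thesis] * F(1) by simp
  have "cp0 X D (Src X \<cdot> x') (Src D \<cdot> d') = cp0 X D (Tgt X \<cdot> x) (Tgt D \<cdot> d)"
    using *(3) xd xd' F(1) by simp
  from cp0_inject[OF this] have "Src X \<cdot> x' = Tgt X \<cdot> x" "Src D \<cdot> d' = Tgt D \<cdot> d" using xd xd'
    by simp_all
  then show "F1 F \<cdot> icomp C (FDom F) g f = icomp C (FCod F) (F1 F \<cdot> g) (F1 F \<cdot> f)"
    using c[OF xd(1,2) xd'(1,2)] xd xd' F(1,2) by simp
qed (use F in simp_all)

end

subsection \<open>Subobjects cut out by equations\<close>

text \<open>The monomorphism \<open>m\<close> into \<open>P\<close> has as its generalized elements those of \<open>P\<close> that satisfy \<open>T\<close>.\<close>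

definition (in category) carves :: "'o \<Rightarrow> ('m \<Rightarrow> bool) \<Rightarrow> 'm \<Rightarrow> bool" where
  "carves P T m \<longleftrightarrow> m \<in> Arr C \<and> Cod C m = P \<and>
     (\<forall>h k. h \<in> Arr C \<longrightarrow> k \<in> Arr C \<longrightarrow> Dom C h = Dom C k \<longrightarrow> Cod C h = Dom C m \<longrightarrow> Cod C k = Dom C m \<longrightarrow>
        m \<cdot> h = m \<cdot> k \<longrightarrow> h = k) \<and>
     (\<forall>k. k \<in> Arr C \<longrightarrow> Cod C k = P \<longrightarrow> (\<exists>h\<in>Hom C (Dom C k) (Dom C m). m \<cdot> h = k) = T k)"

lemma (in category) carvesD:
  assumes "carves P T m"
  shows "m \<in> Arr C" "Cod C m = P"
    "h \<in> Arr C \<Longrightarrow> k \<in> Arr C \<Longrightarrow> Dom C h = Dom C k \<Longrightarrow> Cod C h = Dom C m \<Longrightarrow> Cod C k = Dom C m \<Longrightarrow>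
      m \<cdot> h = m \<cdot> k \<Longrightarrow> h = k"
    "k \<in> Arr C \<Longrightarrow> Cod C k = P \<Longrightarrow> (\<exists>h\<in>Hom C (Dom C k) (Dom C m). m \<cdot> h = k) = T k"
  using assms unfolding carves_def by blast+

context lexcc_cat
begin

text \<open>If \<open>\<Phi>\<close> and \<open>\<Psi>\<close> are two operations \<open>P \<times> X \<rightarrow> Y\<close>, natural in the stage and defined where \<open>T\<close>
  holds, then the condition that they agree for all arguments in \<open>X\<close> at all later stages also cuts out
  a subobject: the equalizer of their transposes.\<close>

lemma carves_refine:
  assumes m: "carves P T m" and XY [simp]: "X \<in> Obj C" "Y \<in> Obj C"
    and \<Phi>: "\<And>k x. k \<in> Arr C \<Longrightarrow> Cod C k = P \<Longrightarrow> T k \<Longrightarrow> x \<in> Hom C (Dom C k) X \<Longrightarrow> \<Phi> k x \<in> Hom C (Dom C k) Y"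
    and \<Phi>n: "\<And>k x h. k \<in> Arr C \<Longrightarrow> Cod C k = P \<Longrightarrow> T k \<Longrightarrow> x \<in> Hom C (Dom C k) X \<Longrightarrow> h \<in> Arr C \<Longrightarrow>
        Cod C h = Dom C k \<Longrightarrow>
      \<Phi> (k \<cdot> h) (x \<cdot> h) = \<Phi> k x \<cdot> h"
    and \<Psi>: "\<And>k x. k \<in> Arr C \<Longrightarrow> Cod C k = P \<Longrightarrow> T k \<Longrightarrow> x \<in> Hom C (Dom C k) X \<Longrightarrow> \<Psi> k x \<in> Hom C (Dom C k) Y"
    and \<Psi>n: "\<And>k x h. k \<in> Arr C \<Longrightarrow> Cod C k = P \<Longrightarrow> T k \<Longrightarrow> x \<in> Hom C (Dom C k) X \<Longrightarrow> h \<in> Arr C \<Longrightarrow>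
        Cod C h = Dom C k \<Longrightarrow>
      \<Psi> (k \<cdot> h) (x \<cdot> h) = \<Psi> k x \<cdot> h"
  shows "\<exists>m'. carves P (\<lambda>k. T k \<and> (\<forall>V w x. w \<in> Hom C V (Dom C k) \<longrightarrow> x \<in> Hom C V X \<longrightarrow>
      \<Phi> (k \<cdot> w) x = \<Psi> (k \<cdot> w) x)) m'"
proof -
  note mm [simp] = carvesD(1,2)[OF m] and mono = carvesD(3)[OF m] and T = carvesD(4)[OF m]
  have Tm: "T (m \<cdot> h)" if "h \<in> Arr C" "Cod C h = Dom C m" for h
    using T[of "m \<cdot> h"] that by auto
  let ?Q = "Dom C m"
  let ?g = "m \<cdot> proj1 C ?Q X" and ?x = "proj2 C ?Q X"
  have gx: "?g \<in> Arr C" "Cod C ?g = P" "T ?g" "?x \<in> Hom C (Dom C ?g) X"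
    using Tm[of "proj1 C ?Q X"] by simp_all
  note \<Phi>g = \<Phi>[OF gx] and \<Psi>g = \<Psi>[OF gx]
  have [simp]: "\<Phi> ?g ?x \<in> Arr C" "Dom C (\<Phi> ?g ?x) = prod_obj C ?Q X" "Cod C (\<Phi> ?g ?x) = Y"
     "\<Psi> ?g ?x \<in> Arr C" "Dom C (\<Psi> ?g ?x) = prod_obj C ?Q X" "Cod C (\<Psi> ?g ?x) = Y" using \<Phi>g \<Psi>g by simp_all
  let ?\<phi> = "transpose C ?Q X Y (\<Phi> ?g ?x)" and ?\<psi> = "transpose C ?Q X Y (\<Psi> ?g ?x)"
  have \<phi>: "?\<phi> \<in> Hom C ?Q (expo C X Y)" and \<psi>: "?\<psi> \<in> Hom C ?Q (expo C X Y)"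
    by (simp_all add: transpose_props)
  then have [simp]: "?\<phi> \<in> Arr C" "Dom C ?\<phi> = ?Q" "Cod C ?\<phi> = expo C X Y"
    "?\<psi> \<in> Arr C" "Dom C ?\<psi> = ?Q" "Cod C ?\<psi> = expo C X Y" by simp_all
  have app\<phi>: "app X Y (?\<phi> \<cdot> q) x = \<Phi> (m \<cdot> q) x" and app\<psi>: "app X Y (?\<psi> \<cdot> q) x = \<Psi> (m \<cdot> q) x"
    if "q \<in> Arr C" "Cod C q = ?Q" "x \<in> Hom C (Dom C q) X" for q x
    using that \<Phi>n[OF gx, of "pr ?Q X q x"] \<Psi>n[OF gx, of "pr ?Q X q x"]
    by (simp_all add: app_transpose)
  obtain e where e [simp]: "e \<in> Arr C" "Cod C e = ?Q" and fe: "?\<phi> \<cdot> e = ?\<psi> \<cdot> e"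
    and e_ex: "\<And>h. h \<in> Arr C \<Longrightarrow> Cod C h = ?Q \<Longrightarrow> ?\<phi> \<cdot> h = ?\<psi> \<cdot> h \<Longrightarrow> \<exists>k\<in>Hom C (Dom C h) (Dom C e). e \<cdot> k = h"
    and e_mono: "\<And>h k. h \<in> Arr C \<Longrightarrow> k \<in> Arr C \<Longrightarrow> Dom C h = Dom C k \<Longrightarrow> Cod C h = Dom C e \<Longrightarrow>
        Cod C k = Dom C e \<Longrightarrow>
       e \<cdot> h = e \<cdot> k \<Longrightarrow> h = k"
    using ex_equalizer[OF \<phi> \<psi>] by blast
  show ?thesis
  proof (rule exI[of _ "m \<cdot> e"], unfold carves_def, intro conjI allI impI)
    fix h k assume hk: "h \<in> Arr C" "k \<in> Arr C" "Dom C h = Dom C k" "Cod C h = Dom C (m \<cdot> e)"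
        "Cod C k = Dom C (m \<cdot> e)"
       "(m \<cdot> e) \<cdot> h = (m \<cdot> e) \<cdot> k"
    have eh: "e \<cdot> h = e \<cdot> k" by (rule mono) (use hk in simp_all)
    show "h = k" by (rule e_mono[OF hk(1,2,3) _ _ eh]) (use hk(4,5) in simp_all)
  next
    fix k assume k: "k \<in> Arr C" "Cod C k = P"
    show "(\<exists>h\<in>Hom C (Dom C k) (Dom C (m \<cdot> e)). (m \<cdot> e) \<cdot> h = k) =
        (T k \<and> (\<forall>V w x. w \<in> Hom C V (Dom C k) \<longrightarrow> x \<in> Hom C V X \<longrightarrow>
      \<Phi> (k \<cdot> w) x = \<Psi> (k \<cdot> w) x))"
    proof
      assume "\<exists>h\<in>Hom C (Dom C k) (Dom C (m \<cdot> e)). (m \<cdot> e) \<cdot> h = k"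
      then obtain h where h': "h \<in> Hom C (Dom C k) (Dom C (m \<cdot> e))" "(m \<cdot> e) \<cdot> h = k" by blast
      have h: "h \<in> Hom C (Dom C k) (Dom C e)" using h'(1) by simp
      have mh: "m \<cdot> (e \<cdot> h) = k" using h'(2) h by simp
      have "\<Phi> (k \<cdot> w) x = \<Psi> (k \<cdot> w) x" if w: "w \<in> Hom C V (Dom C k)" "x \<in> Hom C V X" for V w x
      proof -
        have "m \<cdot> ((e \<cdot> h) \<cdot> w) = k \<cdot> w" by (rule comp_eq_comp[OF mh]) (use w h in simp_all)
        moreover have "?\<phi> \<cdot> (e \<cdot> (h \<cdot> w)) = (?\<psi> \<cdot> e) \<cdot> (h \<cdot> w)"
          by (rule comp_eq_comp[OF fe]) (use w h in simp_all)
        ultimately show ?thesis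
          using w h app\<phi>[of "e \<cdot> (h \<cdot> w)" x] app\<psi>[of "e \<cdot> (h \<cdot> w)" x] by simp
      qed
      moreover have "T k" using Tm[of "e \<cdot> h"] h mh by simp
      ultimately show "T k \<and>
          (\<forall>V w x. w \<in> Hom C V (Dom C k) \<longrightarrow> x \<in> Hom C V X \<longrightarrow> \<Phi> (k \<cdot> w) x = \<Psi> (k \<cdot> w) x)" by blast
    next
      assume *: "T k \<and> (\<forall>V w x. w \<in> Hom C V (Dom C k) \<longrightarrow> x \<in> Hom C V X \<longrightarrow> \<Phi> (k \<cdot> w) x = \<Psi> (k \<cdot> w) x)"
      then obtain h where h: "h \<in> Hom C (Dom C k) ?Q" "m \<cdot> h = k" using T[OF k] by blast
      have "?\<phi> \<cdot> h = ?\<psi> \<cdot> h"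
      proof (rule expo_eqI[of X Y])
        fix V w x assume w: "w \<in> Hom C V (Dom C (?\<phi> \<cdot> h))" "x \<in> Hom C V X"
        have h' [simp]: "h \<in> Arr C" "Dom C h = Dom C k" "Cod C h = ?Q" using h by simp_all
        have w' [simp]: "w \<in> Arr C" "Dom C w = V" "Cod C w = Dom C k" using w by simp_all
        have "m \<cdot> (h \<cdot> w) = k \<cdot> w" by (rule comp_eq_comp[OF h(2)]) simp_all
        moreover have "\<Phi> (k \<cdot> w) x = \<Psi> (k \<cdot> w) x" using * w(2) w' by (metis in_Hom)
        ultimately show "app X Y ((?\<phi> \<cdot> h) \<cdot> w) x = app X Y ((?\<psi> \<cdot> h) \<cdot> w) x"
          using w(2) app\<phi>[of "h \<cdot> w" x] app\<psi>[of "h \<cdot> w" x] by simp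
      qed (use h(1) in simp_all)
      moreover have "h \<in> Arr C" "Cod C h = ?Q" "Dom C h = Dom C k" using h(1) by simp_all
      ultimately obtain l where l: "l \<in> Hom C (Dom C k) (Dom C e)" "e \<cdot> l = h" using e_ex[of h] by metis
      have "(m \<cdot> e) \<cdot> l = m \<cdot> (e \<cdot> l)" using l(1) by simp
      then have "(m \<cdot> e) \<cdot> l = k" unfolding l(2) h(2) .
      then show "\<exists>h\<in>Hom C (Dom C k) (Dom C (m \<cdot> e)). (m \<cdot> e) \<cdot> h = k"
        using l(1) by (intro bexI[of _ l]) simp_all
    qed
  qed simp_all
qed

text \<open>The case of operations that are defined on all of \<open>P\<close>.\<close>

lemma carves_refine_total:
  assumes "carves P T m" "X \<in> Obj C" "Y \<in> Obj C"
    and "\<And>k x. k \<in> Arr C \<Longrightarrow> Cod C k = P \<Longrightarrow> x \<in> Hom C (Dom C k) X \<Longrightarrow> \<Phi> k x \<in> Hom C (Dom C k) Y"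
    and "\<And>k x h. k \<in> Arr C \<Longrightarrow> Cod C k = P \<Longrightarrow> x \<in> Hom C (Dom C k) X \<Longrightarrow> h \<in> Arr C \<Longrightarrow> Cod C h = Dom C k \<Longrightarrow>
      \<Phi> (k \<cdot> h) (x \<cdot> h) = \<Phi> k x \<cdot> h"
    and "\<And>k x. k \<in> Arr C \<Longrightarrow> Cod C k = P \<Longrightarrow> x \<in> Hom C (Dom C k) X \<Longrightarrow> \<Psi> k x \<in> Hom C (Dom C k) Y"
    and "\<And>k x h. k \<in> Arr C \<Longrightarrow> Cod C k = P \<Longrightarrow> x \<in> Hom C (Dom C k) X \<Longrightarrow> h \<in> Arr C \<Longrightarrow> Cod C h = Dom C k \<Longrightarrow>
      \<Psi> (k \<cdot> h) (x \<cdot> h) = \<Psi> k x \<cdot> h"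
  shows "\<exists>m'. carves P (\<lambda>k. T k \<and> (\<forall>V w x. w \<in> Hom C V (Dom C k) \<longrightarrow> x \<in> Hom C V X \<longrightarrow>
      \<Phi> (k \<cdot> w) x = \<Psi> (k \<cdot> w) x)) m'"
  by (rule carves_refine[OF assms(1-3)]; rule assms; assumption)

lemma carves_all: "P \<in> Obj C \<Longrightarrow> carves P (\<lambda>k. True) (Idn C P)"
  unfolding carves_def by auto

end

subsection \<open>The object of functors and the object of natural transformations\<close>

context lex_cat
begin

text \<open>A functor from \<open>D\<close> to \<open>A\<close> at stage \<open>W\<close>, that is, a functor from \<open>W \<times> D\<close> to \<open>A\<close> with \<open>W\<close>
  discrete, given by its action on generalized elements.\<close>

definition sfun :: "('o, 'm) icat \<Rightarrow> ('o, 'm) icat \<Rightarrow> 'o \<Rightarrow> ('m \<Rightarrow> 'm \<Rightarrow> 'm) \<Rightarrow> ('m \<Rightarrow> 'm \<Rightarrow> 'm) \<Rightarrow> bool" where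
  "sfun D A W f0 f1 \<longleftrightarrow>
     (\<forall>V w d. w \<in> Hom C V W \<longrightarrow> d \<in> Hom C V (Ob D) \<longrightarrow>
        f0 w d \<in> Hom C V (Ob A) \<and> (\<forall>U h. h \<in> Hom C U V \<longrightarrow> f0 w d \<cdot> h = f0 (w \<cdot> h) (d \<cdot> h)) \<and>
        f1 w (Ids D \<cdot> d) = Ids A \<cdot> f0 w d) \<and>
     (\<forall>V w u. w \<in> Hom C V W \<longrightarrow> u \<in> Hom C V (Mor D) \<longrightarrow>
        f1 w u \<in> Hom C V (Mor A) \<and> (\<forall>U h. h \<in> Hom C U V \<longrightarrow> f1 w u \<cdot> h = f1 (w \<cdot> h) (u \<cdot> h)) \<and>
        Src A \<cdot> f1 w u = f0 w (Src D \<cdot> u) \<and> Tgt A \<cdot> f1 w u = f0 w (Tgt D \<cdot> u)) \<and>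
     (\<forall>V w u v. w \<in> Hom C V W \<longrightarrow> u \<in> Hom C V (Mor D) \<longrightarrow> v \<in> Hom C V (Mor D) \<longrightarrow>
        Src D \<cdot> v = Tgt D \<cdot> u \<longrightarrow> f1 w (icomp C D v u) = icomp C A (f1 w v) (f1 w u))"

lemma sfun_Ob:
  assumes "sfun D A W f0 f1" "w \<in> Arr C" "Cod C w = W" "d \<in> Arr C" "Dom C w = Dom C d" "Cod C d = Ob D"
  shows "f0 w d \<in> Arr C" "Dom C (f0 w d) = Dom C d" "Cod C (f0 w d) = Ob A"
    "h \<in> Arr C \<Longrightarrow> Cod C h = Dom C d \<Longrightarrow> f0 w d \<cdot> h = f0 (w \<cdot> h) (d \<cdot> h)"
    "f1 w (Ids D \<cdot> d) = Ids A \<cdot> f0 w d"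
proof -
  have "w \<in> Hom C (Dom C d) W" "d \<in> Hom C (Dom C d) (Ob D)" using assms(2-) by simp_all
  then have *: "f0 w d \<in> Hom C (Dom C d) (Ob A)" "f1 w (Ids D \<cdot> d) = Ids A \<cdot> f0 w d"
    "\<And>U h. h \<in> Hom C U (Dom C d) \<Longrightarrow> f0 w d \<cdot> h = f0 (w \<cdot> h) (d \<cdot> h)"
    using assms(1) unfolding sfun_def by blast+
  show "f0 w d \<in> Arr C" "Dom C (f0 w d) = Dom C d" "Cod C (f0 w d) = Ob A"
    "h \<in> Arr C \<Longrightarrow> Cod C h = Dom C d \<Longrightarrow> f0 w d \<cdot> h = f0 (w \<cdot> h) (d \<cdot> h)"
    "f1 w (Ids D \<cdot> d) = Ids A \<cdot> f0 w d" using * by simp_all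
qed

lemma sfun_Mor:
  assumes "sfun D A W f0 f1" "w \<in> Arr C" "Cod C w = W" "u \<in> Arr C" "Dom C w = Dom C u" "Cod C u = Mor D"
  shows "f1 w u \<in> Arr C" "Dom C (f1 w u) = Dom C u" "Cod C (f1 w u) = Mor A"
    "h \<in> Arr C \<Longrightarrow> Cod C h = Dom C u \<Longrightarrow> f1 w u \<cdot> h = f1 (w \<cdot> h) (u \<cdot> h)"
    "Src A \<cdot> f1 w u = f0 w (Src D \<cdot> u)" "Tgt A \<cdot> f1 w u = f0 w (Tgt D \<cdot> u)"
    "v \<in> Arr C \<Longrightarrow> Dom C v = Dom C u \<Longrightarrow> Cod C v = Mor D \<Longrightarrow> Src D \<cdot> v = Tgt D \<cdot> u \<Longrightarrow>
      f1 w (icomp C D v u) = icomp C A (f1 w v) (f1 w u)"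
proof -
  have "w \<in> Hom C (Dom C u) W" "u \<in> Hom C (Dom C u) (Mor D)" using assms(2-) by simp_all
  then have *: "f1 w u \<in> Hom C (Dom C u) (Mor A)"
    "\<And>U h. h \<in> Hom C U (Dom C u) \<Longrightarrow> f1 w u \<cdot> h = f1 (w \<cdot> h) (u \<cdot> h)"
    "Src A \<cdot> f1 w u = f0 w (Src D \<cdot> u)" "Tgt A \<cdot> f1 w u = f0 w (Tgt D \<cdot> u)"
    "\<And>v. v \<in> Hom C (Dom C u) (Mor D) \<Longrightarrow> Src D \<cdot> v = Tgt D \<cdot> u \<Longrightarrow>
      f1 w (icomp C D v u) = icomp C A (f1 w v) (f1 w u)"
    using assms(1) unfolding sfun_def by blast+
  show "f1 w u \<in> Arr C" "Dom C (f1 w u) = Dom C u" "Cod C (f1 w u) = Mor A"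
    "h \<in> Arr C \<Longrightarrow> Cod C h = Dom C u \<Longrightarrow> f1 w u \<cdot> h = f1 (w \<cdot> h) (u \<cdot> h)"
    "Src A \<cdot> f1 w u = f0 w (Src D \<cdot> u)" "Tgt A \<cdot> f1 w u = f0 w (Tgt D \<cdot> u)"
    "v \<in> Arr C \<Longrightarrow> Dom C v = Dom C u \<Longrightarrow> Cod C v = Mor D \<Longrightarrow> Src D \<cdot> v = Tgt D \<cdot> u \<Longrightarrow>
      f1 w (icomp C D v u) = icomp C A (f1 w v) (f1 w u)" using * by simp_all
qed

end

text \<open>The object \<open>Q\<close> of functors from \<open>D\<close> to \<open>A\<close>, with universal family \<open>a0\<close>, \<open>a1\<close>: a functor at stage \<open>W\<close>
  is \<open>a0 (z \<cdot> w)\<close>, \<open>a1 (z \<cdot> w)\<close> for a unique \<open>z : W \<rightarrow> Q\<close>.\<close>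

locale functor_object = lexcc_cat C for C :: "('o, 'm) cat" (structure) +
  fixes D A :: "('o, 'm) icat" and Q :: 'o and a0 a1 :: "'m \<Rightarrow> 'm \<Rightarrow> 'm"
  assumes D [simp]: "internal_category C D" and A [simp]: "internal_category C A"
      and Q [simp]: "Q \<in> Obj C"
    and univ: "sfun D A Q a0 a1"
    and functor_eqI: "z \<in> Hom C W Q \<Longrightarrow> z' \<in> Hom C W Q \<Longrightarrow>
      (\<And>V w d. w \<in> Hom C V W \<Longrightarrow> d \<in> Hom C V (Ob D) \<Longrightarrow> a0 (z \<cdot> w) d = a0 (z' \<cdot> w) d) \<Longrightarrow>
      (\<And>V w u. w \<in> Hom C V W \<Longrightarrow> u \<in> Hom C V (Mor D) \<Longrightarrow> a1 (z \<cdot> w) u = a1 (z' \<cdot> w) u) \<Longrightarrow> z = z'"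
    and ex_functor: "W \<in> Obj C \<Longrightarrow> sfun D A W f0 f1 \<Longrightarrow> \<exists>z\<in>Hom C W Q. \<forall>V w. w \<in> Hom C V W \<longrightarrow>
      (\<forall>d\<in>Hom C V (Ob D). a0 (z \<cdot> w) d = f0 w d) \<and> (\<forall>u\<in>Hom C V (Mor D). a1 (z \<cdot> w) u = f1 w u)"

text \<open>\<open>Q\<close> is cut out of \<open>[Ob D, Ob A] \<times> [Mor D, Mor A]\<close> by the laws for sources, targets, identities and
  composites. The law for composites can only be stated where the first two hold.\<close>

lemma (in lexcc_cat) ex_functor_object:
  assumes D [simp]: "internal_category C D" and A [simp]: "internal_category C A"
  shows "\<exists>Q a0 a1. functor_object C D A Q a0 a1"
proof -
  let ?X0 = "expo C (Ob D) (Ob A)" and ?X1 = "expo C (Mor D) (Mor A)"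
  let ?P = "prod_obj C ?X0 ?X1"
  let ?D2 = "pb_obj C (Src D) (Tgt D)"
  define b0 where "b0 k d = app (Ob D) (Ob A) (proj1 C ?X0 ?X1 \<cdot> k) d" for k d
  define b1 where "b1 k u = app (Mor D) (Mor A) (proj2 C ?X0 ?X1 \<cdot> k) u" for k u
  have b0 [simp]: "b0 k d \<in> Arr C" "Dom C (b0 k d) = Dom C d" "Cod C (b0 k d) = Ob A"
    if "k \<in> Arr C" "Cod C k = ?P" "d \<in> Arr C" "Dom C k = Dom C d" "Cod C d = Ob D" for k d
    using that by (simp_all add: b0_def)
  have b1 [simp]: "b1 k d \<in> Arr C" "Dom C (b1 k d) = Dom C d" "Cod C (b1 k d) = Mor A"
    if "k \<in> Arr C" "Cod C k = ?P" "d \<in> Arr C" "Dom C k = Dom C d" "Cod C d = Mor D" for k d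
    using that by (simp_all add: b1_def)
  have b0n: "b0 k d \<cdot> h = b0 (k \<cdot> h) (d \<cdot> h)"
    if "k \<in> Arr C" "Cod C k = ?P" "d \<in> Arr C" "Dom C k = Dom C d" "Cod C d = Ob D" "h \<in> Arr C"
        "Cod C h = Dom C d" for k d h
    using that by (simp add: b0_def app_comp)
  have b1n: "b1 k d \<cdot> h = b1 (k \<cdot> h) (d \<cdot> h)"
    if "k \<in> Arr C" "Cod C k = ?P" "d \<in> Arr C" "Dom C k = Dom C d" "Cod C d = Mor D" "h \<in> Arr C"
        "Cod C h = Dom C d" for k d h
    using that by (simp add: b1_def app_comp)
  let ?T1 = "\<lambda>k. \<forall>V w x. w \<in> Hom C V (Dom C k) \<longrightarrow> x \<in> Hom C V (Mor D) \<longrightarrow>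
    Src A \<cdot> b1 (k \<cdot> w) x = b0 (k \<cdot> w) (Src D \<cdot> x)"
  let ?T2 = "\<lambda>k. \<forall>V w x. w \<in> Hom C V (Dom C k) \<longrightarrow> x \<in> Hom C V (Mor D) \<longrightarrow>
    Tgt A \<cdot> b1 (k \<cdot> w) x = b0 (k \<cdot> w) (Tgt D \<cdot> x)"
  let ?T3 = "\<lambda>k. \<forall>V w x. w \<in> Hom C V (Dom C k) \<longrightarrow> x \<in> Hom C V (Ob D) \<longrightarrow>
    b1 (k \<cdot> w) (Ids D \<cdot> x) = Ids A \<cdot> b0 (k \<cdot> w) x"
  let ?p = "pb1 C (Src D) (Tgt D)" and ?q = "pb2 C (Src D) (Tgt D)"
  let ?T4 = "\<lambda>k. \<forall>V w x. w \<in> Hom C V (Dom C k) \<longrightarrow> x \<in> Hom C V ?D2 \<longrightarrow>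
    b1 (k \<cdot> w) (Cmp D \<cdot> x) = icomp C A (b1 (k \<cdot> w) (?p \<cdot> x)) (b1 (k \<cdot> w) (?q \<cdot> x))"
  have P: "?P \<in> Obj C" by simp
  have "\<exists>m. carves ?P (\<lambda>k. True \<and> ?T1 k) m"
    by (rule carves_refine_total[OF carves_all[OF P]]) (simp_all add: b0n b1n)
  then obtain m1 where m1: "carves ?P (\<lambda>k. True \<and> ?T1 k) m1" ..
  have "\<exists>m. carves ?P (\<lambda>k. (True \<and> ?T1 k) \<and> ?T2 k) m"
    by (rule carves_refine_total[OF m1]) (simp_all add: b0n b1n)
  then obtain m2 where m2: "carves ?P (\<lambda>k. (True \<and> ?T1 k) \<and> ?T2 k) m2" ..
  have "\<exists>m. carves ?P (\<lambda>k. ((True \<and> ?T1 k) \<and> ?T2 k) \<and> ?T3 k) m"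
    by (rule carves_refine_total[OF m2]) (simp_all add: b0n b1n)
  then obtain m3 where m3: "carves ?P (\<lambda>k. ((True \<and> ?T1 k) \<and> ?T2 k) \<and> ?T3 k) m3" ..
  have sq: "Src D \<cdot> (?p \<cdot> x) = Tgt D \<cdot> (?q \<cdot> x)" if "x \<in> Arr C" "Cod C x = ?D2" for x
    by (rule pb_square_comp) (use that in simp_all)
  have cmp: "Src A \<cdot> b1 k (?p \<cdot> x) = Tgt A \<cdot> b1 k (?q \<cdot> x)"
    if k: "k \<in> Arr C" "Cod C k = ?P" "?T1 k" "?T2 k" "x \<in> Hom C (Dom C k) ?D2" for k x
    using k(3)[rule_format, of "Idn C (Dom C k)" "Dom C k" "?p \<cdot> x"]
      k(4)[rule_format, of "Idn C (Dom C k)" "Dom C k" "?q \<cdot> x"] k(1,2,5) sq[of x] by simp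
  have "\<exists>m. carves ?P (\<lambda>k. (((True \<and> ?T1 k) \<and> ?T2 k) \<and> ?T3 k) \<and> ?T4 k) m"
  proof (rule carves_refine[OF m3])
    fix k x assume k: "k \<in> Arr C" "Cod C k = ?P" "((True \<and> ?T1 k) \<and> ?T2 k) \<and> ?T3 k"
        "x \<in> Hom C (Dom C k) ?D2"
    have c: "Src A \<cdot> b1 k (?p \<cdot> x) = Tgt A \<cdot> b1 k (?q \<cdot> x)"
      by (rule cmp) (use k in blast)+
    show "icomp C A (b1 k (?p \<cdot> x)) (b1 k (?q \<cdot> x)) \<in> Hom C (Dom C k) (Mor A)"
      using c k(1,2,4) by simp
    fix h assume h: "h \<in> Arr C" "Cod C h = Dom C k"
    show "icomp C A (b1 (k \<cdot> h) (?p \<cdot> (x \<cdot> h))) (b1 (k \<cdot> h) (?q \<cdot> (x \<cdot> h))) =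
      icomp C A (b1 k (?p \<cdot> x)) (b1 k (?q \<cdot> x)) \<cdot> h"
      using c k(1,2,4) h by (simp add: icomp_comp b1n)
  next
    fix k x h assume "k \<in> Arr C" "Cod C k = ?P" "x \<in> Hom C (Dom C k) ?D2"
        and h: "h \<in> Arr C" "Cod C h = Dom C k"
    then show "b1 (k \<cdot> h) (Cmp D \<cdot> (x \<cdot> h)) = b1 k (Cmp D \<cdot> x) \<cdot> h" by (simp add: b1n)
  next
    fix k x assume "k \<in> Arr C" "Cod C k = ?P" "x \<in> Hom C (Dom C k) ?D2"
    then show "b1 k (Cmp D \<cdot> x) \<in> Hom C (Dom C k) (Mor A)" by simp
  qed simp_all
  then obtain m where m: "carves ?P (\<lambda>k. (((True \<and> ?T1 k) \<and> ?T2 k) \<and> ?T3 k) \<and> ?T4 k) m" ..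
  note mm [simp] = carvesD(1,2)[OF m] and mono = carvesD(3)[OF m] and T = carvesD(4)[OF m]
  let ?Q = "Dom C m"
  define a0 where "a0 z d = b0 (m \<cdot> z) d" for z d
  define a1 where "a1 z d = b1 (m \<cdot> z) d" for z d
  have "functor_object C D A ?Q a0 a1"
  proof
    show "sfun D A ?Q a0 a1"
      unfolding sfun_def
    proof (intro conjI allI impI)
      fix V w d assume "w \<in> Hom C V ?Q" "d \<in> Hom C V (Ob D)"
      then have [simp]: "w \<in> Arr C" "Dom C w = V" "Cod C w = ?Q" "d \<in> Arr C" "Dom C d = V"
          "Cod C d = Ob D" by simp_all
      have V: "V \<in> Obj C" using Dom_Obj[of w] by simp
      have "\<exists>h\<in>Hom C (Dom C (m \<cdot> w)) ?Q. m \<cdot> h = m \<cdot> w" by (rule bexI[of _ w]) simp_all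
      then have "?T3 (m \<cdot> w)" using T[of "m \<cdot> w"] by simp
      from this[rule_format, of "Idn C V" V d] show "a1 w (Ids D \<cdot> d) = Ids A \<cdot> a0 w d" using V
        by (simp add: a0_def a1_def)
      show "a0 w d \<in> Hom C V (Ob A)" by (simp add: a0_def)
      fix U h assume "h \<in> Hom C U V"
      then show "a0 w d \<cdot> h = a0 (w \<cdot> h) (d \<cdot> h)" by (simp add: a0_def b0n)
    next
      fix V w u assume "w \<in> Hom C V ?Q" "u \<in> Hom C V (Mor D)"
      then have [simp]: "w \<in> Arr C" "Dom C w = V" "Cod C w = ?Q" "u \<in> Arr C" "Dom C u = V"
          "Cod C u = Mor D" by simp_all
      have V: "V \<in> Obj C" using Dom_Obj[of w] by simp
      have "\<exists>h\<in>Hom C (Dom C (m \<cdot> w)) ?Q. m \<cdot> h = m \<cdot> w" by (rule bexI[of _ w]) simp_all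
      then have t: "?T1 (m \<cdot> w)" "?T2 (m \<cdot> w)" using T[of "m \<cdot> w"] by simp_all
      from t(1)[rule_format, of "Idn C V" V u] t(2)[rule_format, of "Idn C V" V u]
      show "Src A \<cdot> a1 w u = a0 w (Src D \<cdot> u)" "Tgt A \<cdot> a1 w u = a0 w (Tgt D \<cdot> u)" using V
        by (simp_all add: a0_def a1_def)
      show "a1 w u \<in> Hom C V (Mor A)" by (simp add: a1_def)
      fix U h assume "h \<in> Hom C U V"
      then show "a1 w u \<cdot> h = a1 (w \<cdot> h) (u \<cdot> h)" by (simp add: a1_def b1n)
    next
      fix V w u v assume "w \<in> Hom C V ?Q" "u \<in> Hom C V (Mor D)" "v \<in> Hom C V (Mor D)"
          and uv: "Src D \<cdot> v = Tgt D \<cdot> u"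
      then have [simp]: "w \<in> Arr C" "Dom C w = V" "Cod C w = ?Q" "u \<in> Arr C" "Dom C u = V"
          "Cod C u = Mor D"
        "v \<in> Arr C" "Dom C v = V" "Cod C v = Mor D" by simp_all
      have V: "V \<in> Obj C" using Dom_Obj[of w] by simp
      have "\<exists>h\<in>Hom C (Dom C (m \<cdot> w)) ?Q. m \<cdot> h = m \<cdot> w" by (rule bexI[of _ w]) simp_all
      then have "?T4 (m \<cdot> w)" using T[of "m \<cdot> w"] by simp
      from this[rule_format, of "Idn C V" V "pbpair (Src D) (Tgt D) v u"]
      show "a1 w (icomp C D v u) = icomp C A (a1 w v) (a1 w u)" using V uv
        by (simp add: a1_def icomp_def[of C D])
    qed
  next
    fix z W z' assume z: "z \<in> Hom C W ?Q" "z' \<in> Hom C W ?Q"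
      and e: "\<And>V w d. w \<in> Hom C V W \<Longrightarrow> d \<in> Hom C V (Ob D) \<Longrightarrow> a0 (z \<cdot> w) d = a0 (z' \<cdot> w) d"
        "\<And>V w u. w \<in> Hom C V W \<Longrightarrow> u \<in> Hom C V (Mor D) \<Longrightarrow> a1 (z \<cdot> w) u = a1 (z' \<cdot> w) u"
    have [simp]: "z \<in> Arr C" "Dom C z = W" "Cod C z = ?Q" "z' \<in> Arr C" "Dom C z' = W" "Cod C z' = ?Q"
      using z by simp_all
    have "proj1 C ?X0 ?X1 \<cdot> (m \<cdot> z) = proj1 C ?X0 ?X1 \<cdot> (m \<cdot> z')"
    proof (rule expo_eqI[of "Ob D" "Ob A"])
      fix V w x assume "w \<in> Hom C V (Dom C (proj1 C ?X0 ?X1 \<cdot> (m \<cdot> z)))" "x \<in> Hom C V (Ob D)"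
      then show "app (Ob D) (Ob A) ((proj1 C ?X0 ?X1 \<cdot> (m \<cdot> z)) \<cdot> w) x =
          app (Ob D) (Ob A) ((proj1 C ?X0 ?X1 \<cdot> (m \<cdot> z')) \<cdot> w) x"
        using e(1)[of w V x] by (simp add: a0_def b0_def)
    qed simp_all
    moreover have "proj2 C ?X0 ?X1 \<cdot> (m \<cdot> z) = proj2 C ?X0 ?X1 \<cdot> (m \<cdot> z')"
    proof (rule expo_eqI[of "Mor D" "Mor A"])
      fix V w x assume "w \<in> Hom C V (Dom C (proj2 C ?X0 ?X1 \<cdot> (m \<cdot> z)))" "x \<in> Hom C V (Mor D)"
      then show "app (Mor D) (Mor A) ((proj2 C ?X0 ?X1 \<cdot> (m \<cdot> z)) \<cdot> w) x =
          app (Mor D) (Mor A) ((proj2 C ?X0 ?X1 \<cdot> (m \<cdot> z')) \<cdot> w) x"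
        using e(2)[of w V x] by (simp add: a1_def b1_def)
    qed simp_all
    ultimately have "m \<cdot> z = m \<cdot> z'" by (rule prod_eqI[rotated 5]) simp_all
    then show "z = z'" by (rule mono[rotated 5]) simp_all
  next
    fix W f0 f1 assume W [simp]: "W \<in> Obj C" and f: "sfun D A W f0 f1"
    show "\<exists>z\<in>Hom C W ?Q. \<forall>V w. w \<in> Hom C V W \<longrightarrow> (\<forall>d\<in>Hom C V (Ob D). a0 (z \<cdot> w) d = f0 w d) \<and>
        (\<forall>u\<in>Hom C V (Mor D). a1 (z \<cdot> w) u = f1 w u)"
    proof -
      note s [simp] = sfun_Ob[OF f] sfun_Mor[OF f]
      let ?f0 = "f0 (proj1 C W (Ob D)) (proj2 C W (Ob D))"
          and ?f1 = "f1 (proj1 C W (Mor D)) (proj2 C W (Mor D))"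
      let ?k0 = "transpose C W (Ob D) (Ob A) ?f0" and ?k1 = "transpose C W (Mor D) (Mor A) ?f1"
      have [simp]: "?k0 \<in> Arr C" "Dom C ?k0 = W" "Cod C ?k0 = ?X0" "?k1 \<in> Arr C" "Dom C ?k1 = W"
          "Cod C ?k1 = ?X1"
        by (simp_all add: transpose_props)
      let ?k = "pr ?X0 ?X1 ?k0 ?k1"
      have k0: "b0 (?k \<cdot> w) d = f0 w d" if "w \<in> Hom C V W" "d \<in> Hom C V (Ob D)" for V w d
        using that by (simp add: b0_def app_transpose)
      have k1: "b1 (?k \<cdot> w) d = f1 w d" if "w \<in> Hom C V W" "d \<in> Hom C V (Mor D)" for V w d
        using that by (simp add: b1_def app_transpose)
      have "?T1 ?k" "?T2 ?k" "?T3 ?k" using k0 k1 by (simp_all del: pr_comp)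
      moreover have "?T4 ?k"
      proof (intro allI impI)
        fix V w x assume w: "w \<in> Hom C V (Dom C ?k)" "x \<in> Hom C V ?D2"
        have "Cmp D \<cdot> x = icomp C D (?p \<cdot> x) (?q \<cdot> x)" using w by (simp add: icomp_def)
        then show "b1 (?k \<cdot> w) (Cmp D \<cdot> x) = icomp C A (b1 (?k \<cdot> w) (?p \<cdot> x)) (b1 (?k \<cdot> w) (?q \<cdot> x))"
          using w sq[of x] k1[of w V] by (simp del: pr_comp)
      qed
      ultimately have "\<exists>h\<in>Hom C (Dom C ?k) ?Q. m \<cdot> h = ?k" using T[of ?k] by simp
      then obtain z where z: "z \<in> Hom C W ?Q" and mz: "m \<cdot> z = ?k" by auto
      have mzw: "m \<cdot> (z \<cdot> w) = ?k \<cdot> w" if "w \<in> Hom C V W" for w V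
        by (rule comp_eq_comp[OF mz]) (use that z in simp_all)
      show ?thesis
        unfolding a0_def a1_def by (rule bexI[OF _ z]) (metis mzw k0 k1)
    qed
  qed simp_all
  then show ?thesis by blast
qed

context functor_object
begin

lemmas a_simps [simp] = sfun_Ob[OF univ] sfun_Mor(1-6)[OF univ] and a_icomp = sfun_Mor(7)[OF univ]

end

text \<open>The object \<open>N\<close> of natural transformations between functors from \<open>D\<close> to \<open>A\<close>; the components of
  the transformation \<open>n\<close> are \<open>b n d\<close>.\<close>

locale transformation_object = functor_object C D A Q a0 a1 for C :: "('o, 'm) cat" (structure)
    and D A Q a0 a1 +
  fixes N :: 'o and sQ tQ :: 'm and b :: "'m \<Rightarrow> 'm \<Rightarrow> 'm"
  assumes N [simp]: "N \<in> Obj C" "sQ \<in> Arr C" "Dom C sQ = N" "Cod C sQ = Q" "tQ \<in> Arr C" "Dom C tQ = N"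
      "Cod C tQ = Q"
    and b [simp]: "n \<in> Arr C \<Longrightarrow> Cod C n = N \<Longrightarrow> d \<in> Arr C \<Longrightarrow> Dom C n = Dom C d \<Longrightarrow> Cod C d = Ob D \<Longrightarrow>
        b n d \<in> Arr C"
      "n \<in> Arr C \<Longrightarrow> Cod C n = N \<Longrightarrow> d \<in> Arr C \<Longrightarrow> Dom C n = Dom C d \<Longrightarrow> Cod C d = Ob D \<Longrightarrow>
          Dom C (b n d) = Dom C d"
      "n \<in> Arr C \<Longrightarrow> Cod C n = N \<Longrightarrow> d \<in> Arr C \<Longrightarrow> Dom C n = Dom C d \<Longrightarrow> Cod C d = Ob D \<Longrightarrow> Cod C (b n d) = Mor A"
      "n \<in> Arr C \<Longrightarrow> Cod C n = N \<Longrightarrow> d \<in> Arr C \<Longrightarrow> Dom C n = Dom C d \<Longrightarrow> Cod C d = Ob D \<Longrightarrow> h \<in> Arr C \<Longrightarrow>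
        Cod C h = Dom C d \<Longrightarrow> b n d \<cdot> h = b (n \<cdot> h) (d \<cdot> h)"
      "n \<in> Arr C \<Longrightarrow> Cod C n = N \<Longrightarrow> d \<in> Arr C \<Longrightarrow> Dom C n = Dom C d \<Longrightarrow> Cod C d = Ob D \<Longrightarrow>
          Src A \<cdot> b n d = a0 (sQ \<cdot> n) d"
      "n \<in> Arr C \<Longrightarrow> Cod C n = N \<Longrightarrow> d \<in> Arr C \<Longrightarrow> Dom C n = Dom C d \<Longrightarrow> Cod C d = Ob D \<Longrightarrow>
          Tgt A \<cdot> b n d = a0 (tQ \<cdot> n) d"
    and b_nat: "n \<in> Arr C \<Longrightarrow> Cod C n = N \<Longrightarrow> u \<in> Arr C \<Longrightarrow> Dom C n = Dom C u \<Longrightarrow> Cod C u = Mor D \<Longrightarrow>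
        icomp C A (b n (Tgt D \<cdot> u)) (a1 (sQ \<cdot> n) u) = icomp C A (a1 (tQ \<cdot> n) u) (b n (Src D \<cdot> u))"
    and trans_eqI: "n \<in> Hom C W N \<Longrightarrow> n' \<in> Hom C W N \<Longrightarrow> sQ \<cdot> n = sQ \<cdot> n' \<Longrightarrow> tQ \<cdot> n = tQ \<cdot> n' \<Longrightarrow>
      (\<And>V w d. w \<in> Hom C V W \<Longrightarrow> d \<in> Hom C V (Ob D) \<Longrightarrow> b (n \<cdot> w) d = b (n' \<cdot> w) d) \<Longrightarrow> n = n'"
    and ex_trans: "W \<in> Obj C \<Longrightarrow> s \<in> Hom C W Q \<Longrightarrow> t \<in> Hom C W Q \<Longrightarrow>
      (\<And>V w d. w \<in> Hom C V W \<Longrightarrow> d \<in> Hom C V (Ob D) \<Longrightarrow>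
         \<beta> w d \<in> Hom C V (Mor A) \<and> Src A \<cdot> \<beta> w d = a0 (s \<cdot> w) d \<and> Tgt A \<cdot> \<beta> w d = a0 (t \<cdot> w) d) \<Longrightarrow>
      (\<And>U V w d h. w \<in> Hom C V W \<Longrightarrow> d \<in> Hom C V (Ob D) \<Longrightarrow> h \<in> Hom C U V \<Longrightarrow> \<beta> w d \<cdot> h = \<beta> (w \<cdot> h) (d \<cdot> h)) \<Longrightarrow>
      (\<And>V w u. w \<in> Hom C V W \<Longrightarrow> u \<in> Hom C V (Mor D) \<Longrightarrow>
         icomp C A (\<beta> w (Tgt D \<cdot> u)) (a1 (s \<cdot> w) u) = icomp C A (a1 (t \<cdot> w) u) (\<beta> w (Src D \<cdot> u))) \<Longrightarrow>
      \<exists>n\<in>Hom C W N. sQ \<cdot> n = s \<and> tQ \<cdot> n = t \<and>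
        (\<forall>V w d. w \<in> Hom C V W \<longrightarrow> d \<in> Hom C V (Ob D) \<longrightarrow> b (n \<cdot> w) d = \<beta> w d)"

text \<open>\<open>N\<close> is cut out of \<open>Q \<times> (Q \<times> [Ob D, Mor A])\<close> by the laws for sources and targets and by
  naturality.\<close>

lemma (in functor_object) ex_transformation_object:
    "\<exists>N sQ tQ b. transformation_object C D A Q a0 a1 N sQ tQ b"
proof -
  let ?X = "expo C (Ob D) (Mor A)"
  let ?R = "prod_obj C Q ?X"
  let ?P = "prod_obj C Q ?R"
  define s where "s k = proj1 C Q ?R \<cdot> k" for k
  define t where "t k = proj1 C Q ?X \<cdot> (proj2 C Q ?R \<cdot> k)" for k
  define c where "c k d = app (Ob D) (Mor A) (proj2 C Q ?X \<cdot> (proj2 C Q ?R \<cdot> k)) d" for k d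
  have [simp]: "s k \<in> Arr C" "Dom C (s k) = Dom C k" "Cod C (s k) = Q" "t k \<in> Arr C"
      "Dom C (t k) = Dom C k" "Cod C (t k) = Q"
    if "k \<in> Arr C" "Cod C k = ?P" for k using that by (simp_all add: s_def t_def)
  have n [simp]: "s k \<cdot> h = s (k \<cdot> h)" "t k \<cdot> h = t (k \<cdot> h)"
      if "k \<in> Arr C" "Cod C k = ?P" "h \<in> Arr C" "Cod C h = Dom C k" for k h
    using that by (simp_all add: s_def t_def)
  have c [simp]: "c k d \<in> Arr C" "Dom C (c k d) = Dom C d" "Cod C (c k d) = Mor A"
    if "k \<in> Arr C" "Cod C k = ?P" "d \<in> Arr C" "Dom C k = Dom C d" "Cod C d = Ob D" for k d
    using that by (simp_all add: c_def)
  have cn [simp]: "c k d \<cdot> h = c (k \<cdot> h) (d \<cdot> h)"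
    if "k \<in> Arr C" "Cod C k = ?P" "d \<in> Arr C" "Dom C k = Dom C d" "Cod C d = Ob D" "h \<in> Arr C"
        "Cod C h = Dom C d" for k d h
    using that by (simp add: c_def app_comp)
  let ?T1 = "\<lambda>k. \<forall>V w x. w \<in> Hom C V (Dom C k) \<longrightarrow> x \<in> Hom C V (Ob D) \<longrightarrow>
      Src A \<cdot> c (k \<cdot> w) x = a0 (s (k \<cdot> w)) x"
  let ?T2 = "\<lambda>k. \<forall>V w x. w \<in> Hom C V (Dom C k) \<longrightarrow> x \<in> Hom C V (Ob D) \<longrightarrow>
      Tgt A \<cdot> c (k \<cdot> w) x = a0 (t (k \<cdot> w)) x"
  let ?T3 = "\<lambda>k. \<forall>V w x. w \<in> Hom C V (Dom C k) \<longrightarrow> x \<in> Hom C V (Mor D) \<longrightarrow>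
    icomp C A (c (k \<cdot> w) (Tgt D \<cdot> x)) (a1 (s (k \<cdot> w)) x) = icomp C A (a1 (t (k \<cdot> w)) x)
        (c (k \<cdot> w) (Src D \<cdot> x))"
  have P: "?P \<in> Obj C" by simp
  have "\<exists>m. carves ?P (\<lambda>k. True \<and> ?T1 k) m"
    by (rule carves_refine_total[OF carves_all[OF P]]) simp_all
  then obtain m1 where m1: "carves ?P (\<lambda>k. True \<and> ?T1 k) m1" ..
  have "\<exists>m. carves ?P (\<lambda>k. (True \<and> ?T1 k) \<and> ?T2 k) m"
    by (rule carves_refine_total[OF m1]) simp_all
  then obtain m2 where m2: "carves ?P (\<lambda>k. (True \<and> ?T1 k) \<and> ?T2 k) m2" ..
  have cmp: "Src A \<cdot> c k (Tgt D \<cdot> x) = a0 (s k) (Tgt D \<cdot> x)"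
      "Tgt A \<cdot> c k (Src D \<cdot> x) = a0 (t k) (Src D \<cdot> x)"
    if k: "k \<in> Arr C" "Cod C k = ?P" "?T1 k" "?T2 k" "x \<in> Hom C (Dom C k) (Mor D)" for k x
    using k(3)[rule_format, of "Idn C (Dom C k)" "Dom C k" "Tgt D \<cdot> x"]
      k(4)[rule_format, of "Idn C (Dom C k)" "Dom C k" "Src D \<cdot> x"] k(1,2,5) by simp_all
  have "\<exists>m. carves ?P (\<lambda>k. ((True \<and> ?T1 k) \<and> ?T2 k) \<and> ?T3 k) m"
  proof (rule carves_refine[OF m2])
    fix k x assume k: "k \<in> Arr C" "Cod C k = ?P" "(True \<and> ?T1 k) \<and> ?T2 k" "x \<in> Hom C (Dom C k) (Mor D)"
    have e: "Src A \<cdot> c k (Tgt D \<cdot> x) = a0 (s k) (Tgt D \<cdot> x)"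
        "Tgt A \<cdot> c k (Src D \<cdot> x) = a0 (t k) (Src D \<cdot> x)"
      by (rule cmp; use k in blast)+
    show "icomp C A (c k (Tgt D \<cdot> x)) (a1 (s k) x) \<in> Hom C (Dom C k) (Mor A)"
      "icomp C A (a1 (t k) x) (c k (Src D \<cdot> x)) \<in> Hom C (Dom C k) (Mor A)"
      using e k(1,2,4) by simp_all
    fix h assume h: "h \<in> Arr C" "Cod C h = Dom C k"
    show "icomp C A (c (k \<cdot> h) (Tgt D \<cdot> (x \<cdot> h))) (a1 (s (k \<cdot> h)) (x \<cdot> h)) =
        icomp C A (c k (Tgt D \<cdot> x)) (a1 (s k) x) \<cdot> h"
      "icomp C A (a1 (t (k \<cdot> h)) (x \<cdot> h)) (c (k \<cdot> h) (Src D \<cdot> (x \<cdot> h))) =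
          icomp C A (a1 (t k) x) (c k (Src D \<cdot> x)) \<cdot> h"
      using e k(1,2,4) h by (simp_all add: icomp_comp)
  qed simp_all
  then obtain m where m: "carves ?P (\<lambda>k. ((True \<and> ?T1 k) \<and> ?T2 k) \<and> ?T3 k) m" ..
  note mm [simp] = carvesD(1,2)[OF m] and mono = carvesD(3)[OF m] and T = carvesD(4)[OF m]
  let ?N = "Dom C m"
  have TT: "?T1 (m \<cdot> n)" "?T2 (m \<cdot> n)" "?T3 (m \<cdot> n)" if "n \<in> Arr C" "Cod C n = ?N" for n
  proof -
    have "\<exists>h\<in>Hom C (Dom C (m \<cdot> n)) ?N. m \<cdot> h = m \<cdot> n" by (rule bexI[of _ n]) (use that in simp_all)
    then have "((True \<and> ?T1 (m \<cdot> n)) \<and> ?T2 (m \<cdot> n)) \<and> ?T3 (m \<cdot> n)"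
      by (subst (asm) T) (use that in simp_all)
    then show "?T1 (m \<cdot> n)" "?T2 (m \<cdot> n)" "?T3 (m \<cdot> n)" by blast+
  qed
  have sm: "s m \<cdot> n = s (m \<cdot> n)" "t m \<cdot> n = t (m \<cdot> n)" if "n \<in> Arr C" "Cod C n = ?N" for n using that
    by simp_all
  have "transformation_object C D A Q a0 a1 ?N (s m) (t m) (\<lambda>n d. c (m \<cdot> n) d)"
  proof
    fix n d assume [simp]: "n \<in> Arr C" "Cod C n = ?N" "d \<in> Arr C" "Dom C n = Dom C d" "Cod C d = Ob D"
    show "Src A \<cdot> c (m \<cdot> n) d = a0 (s m \<cdot> n) d" "Tgt A \<cdot> c (m \<cdot> n) d = a0 (t m \<cdot> n) d"
      using TT(1)[of n, rule_format, of "Idn C (Dom C d)" "Dom C d" d]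
        TT(2)[of n, rule_format, of "Idn C (Dom C d)" "Dom C d" d] by simp_all
    show "c (m \<cdot> n) d \<in> Arr C" "Dom C (c (m \<cdot> n) d) = Dom C d" "Cod C (c (m \<cdot> n) d) = Mor A" by simp_all
    fix h assume "h \<in> Arr C" "Cod C h = Dom C d"
    then show "c (m \<cdot> n) d \<cdot> h = c (m \<cdot> (n \<cdot> h)) (d \<cdot> h)" by simp
  next
    fix n u assume [simp]: "n \<in> Arr C" "Cod C n = ?N" "u \<in> Arr C" "Dom C n = Dom C u" "Cod C u = Mor D"
    show "icomp C A (c (m \<cdot> n) (Tgt D \<cdot> u)) (a1 (s m \<cdot> n) u) =
        icomp C A (a1 (t m \<cdot> n) u) (c (m \<cdot> n) (Src D \<cdot> u))"
      using TT(3)[of n, rule_format, of "Idn C (Dom C u)" "Dom C u" u] by simp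
  next
    fix n W n' assume n: "n \<in> Hom C W ?N" "n' \<in> Hom C W ?N" "s m \<cdot> n = s m \<cdot> n'" "t m \<cdot> n = t m \<cdot> n'"
      and e: "\<And>V w d. w \<in> Hom C V W \<Longrightarrow> d \<in> Hom C V (Ob D) \<Longrightarrow> c (m \<cdot> (n \<cdot> w)) d = c (m \<cdot> (n' \<cdot> w)) d"
    have [simp]: "n \<in> Arr C" "Dom C n = W" "Cod C n = ?N" "n' \<in> Arr C" "Dom C n' = W" "Cod C n' = ?N"
      using n(1,2) by simp_all
    have st: "s (m \<cdot> n) = s (m \<cdot> n')" "t (m \<cdot> n) = t (m \<cdot> n')" using n(3,4) sm[of n] sm[of n']
      by simp_all
    have "proj2 C Q ?X \<cdot> (proj2 C Q ?R \<cdot> (m \<cdot> n)) = proj2 C Q ?X \<cdot> (proj2 C Q ?R \<cdot> (m \<cdot> n'))"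
        (is "?l = ?r")
    proof (rule expo_eqI[of "Ob D" "Mor A"])
      fix V w x assume "w \<in> Hom C V (Dom C ?l)" "x \<in> Hom C V (Ob D)"
      then show "app (Ob D) (Mor A) (?l \<cdot> w) x = app (Ob D) (Mor A) (?r \<cdot> w) x"
        using e[of w V x] by (simp add: c_def)
    qed simp_all
    with st(2) have "proj2 C Q ?R \<cdot> (m \<cdot> n) = proj2 C Q ?R \<cdot> (m \<cdot> n')"
      unfolding t_def by - (rule prod_eqI[of _ _ Q ?X]; simp)
    with st(1) have "m \<cdot> n = m \<cdot> n'"
      unfolding s_def by - (rule prod_eqI[of _ _ Q ?R]; simp)
    then show "n = n'" by (rule mono[rotated 5]) simp_all
  next
    fix W \<sigma> \<tau> \<beta> assume W [simp]: "W \<in> Obj C" and st: "\<sigma> \<in> Hom C W Q" "\<tau> \<in> Hom C W Q"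
      and 1: "\<And>V w d. w \<in> Hom C V W \<Longrightarrow> d \<in> Hom C V (Ob D) \<Longrightarrow>
         \<beta> w d \<in> Hom C V (Mor A) \<and> Src A \<cdot> \<beta> w d = a0 (\<sigma> \<cdot> w) d \<and> Tgt A \<cdot> \<beta> w d = a0 (\<tau> \<cdot> w) d"
      and 2: "\<And>U V w d h. w \<in> Hom C V W \<Longrightarrow> d \<in> Hom C V (Ob D) \<Longrightarrow> h \<in> Hom C U V \<Longrightarrow>
          \<beta> w d \<cdot> h = \<beta> (w \<cdot> h) (d \<cdot> h)"
      and 3: "\<And>V w u. w \<in> Hom C V W \<Longrightarrow> u \<in> Hom C V (Mor D) \<Longrightarrow>
         icomp C A (\<beta> w (Tgt D \<cdot> u)) (a1 (\<sigma> \<cdot> w) u) = icomp C A (a1 (\<tau> \<cdot> w) u) (\<beta> w (Src D \<cdot> u))"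
    have [simp]: "\<sigma> \<in> Arr C" "Dom C \<sigma> = W" "Cod C \<sigma> = Q" "\<tau> \<in> Arr C" "Dom C \<tau> = W" "Cod C \<tau> = Q"
      using st by simp_all
    let ?\<beta> = "\<beta> (proj1 C W (Ob D)) (proj2 C W (Ob D))"
    have [simp]: "?\<beta> \<in> Arr C" "Dom C ?\<beta> = prod_obj C W (Ob D)" "Cod C ?\<beta> = Mor A"
      using 1[of "proj1 C W (Ob D)" "prod_obj C W (Ob D)" "proj2 C W (Ob D)"] by simp_all
    let ?b = "transpose C W (Ob D) (Mor A) ?\<beta>"
    have [simp]: "?b \<in> Arr C" "Dom C ?b = W" "Cod C ?b = ?X" by (simp_all add: transpose_props)
    let ?k = "pr Q ?R \<sigma> (pr Q ?X \<tau> ?b)"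
    have k: "s (?k \<cdot> w) = \<sigma> \<cdot> w" "t (?k \<cdot> w) = \<tau> \<cdot> w" if "w \<in> Hom C V W" for V w
      using that by (simp_all add: s_def t_def)
    have kc: "c (?k \<cdot> w) d = \<beta> w d" if "w \<in> Hom C V W" "d \<in> Hom C V (Ob D)" for V w d
      using that 2[of "proj1 C W (Ob D)" "prod_obj C W (Ob D)" "proj2 C W (Ob D)" "pr W (Ob D) w d"]
      by (simp add: c_def app_transpose)
    have "?T1 ?k" "?T2 ?k" using k kc 1 by (simp_all del: pr_comp)
    moreover have "?T3 ?k"
    proof (intro allI impI)
      fix V w x assume w: "w \<in> Hom C V (Dom C ?k)" "x \<in> Hom C V (Mor D)"
      then show "icomp C A (c (?k \<cdot> w) (Tgt D \<cdot> x)) (a1 (s (?k \<cdot> w)) x) =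
          icomp C A (a1 (t (?k \<cdot> w)) x) (c (?k \<cdot> w) (Src D \<cdot> x))"
        using k[of w V] kc[of w V] 3[of w V x] by (simp del: pr_comp)
    qed
    ultimately have "\<exists>h\<in>Hom C (Dom C ?k) ?N. m \<cdot> h = ?k" by (subst T) simp_all
    then obtain n where n: "n \<in> Hom C W ?N" and mn: "m \<cdot> n = ?k" by auto
    have mnw: "m \<cdot> (n \<cdot> w) = ?k \<cdot> w" if "w \<in> Hom C V W" for w V
      by (rule comp_eq_comp[OF mn]) (use that n in simp_all)
    have "s m \<cdot> n = \<sigma>" "t m \<cdot> n = \<tau>" using sm[of n] n mn by (simp_all add: s_def t_def)
    moreover have "\<forall>V w d. w \<in> Hom C V W \<longrightarrow> d \<in> Hom C V (Ob D) \<longrightarrow> c (m \<cdot> (n \<cdot> w)) d = \<beta> w d"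
      by (metis mnw kc)
    ultimately show "\<exists>n\<in>Hom C W ?N. s m \<cdot> n = \<sigma> \<and> t m \<cdot> n = \<tau> \<and>
        (\<forall>V w d. w \<in> Hom C V W \<longrightarrow> d \<in> Hom C V (Ob D) \<longrightarrow> c (m \<cdot> (n \<cdot> w)) d = \<beta> w d)"
      using n by blast
  qed simp_all
  then show ?thesis by blast
qed

text \<open>The internal category of functors from \<open>D\<close> to \<open>A\<close>, with evaluation \<open>a0\<close>, \<open>a1\<close> on functors and \<open>b\<close> on
  transformations.\<close>

locale functor_category = transformation_object C D A "Ob Z" a0 a1 "Mor Z" "Src Z" "Tgt Z" b
  for C :: "('o, 'm) cat" (structure) and D A Z a0 a1 b +
  assumes Z [simp]: "internal_category C Z"
    and b_Ids [simp]: "z \<in> Arr C \<Longrightarrow> Cod C z = Ob Z \<Longrightarrow> d \<in> Arr C \<Longrightarrow> Dom C z = Dom C d \<Longrightarrow> Cod C d = Ob D \<Longrightarrow>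
      b (Ids Z \<cdot> z) d = Ids A \<cdot> a0 z d"
    and b_icomp: "n \<in> Arr C \<Longrightarrow> Cod C n = Mor Z \<Longrightarrow> n' \<in> Arr C \<Longrightarrow> Cod C n' = Mor Z \<Longrightarrow>
      Src Z \<cdot> n' = Tgt Z \<cdot> n \<Longrightarrow> d \<in> Arr C \<Longrightarrow> Dom C n = Dom C d \<Longrightarrow> Cod C d = Ob D \<Longrightarrow>
      b (icomp C Z n' n) d = icomp C A (b n' d) (b n d)"

lemma (in transformation_object) ex_functor_category:
  "\<exists>Z. functor_category C D A Z a0 a1 b"
proof -
  have "\<exists>n\<in>Hom C Q N. sQ \<cdot> n = Idn C Q \<and> tQ \<cdot> n = Idn C Q \<and>
        (\<forall>V w d. w \<in> Hom C V Q \<longrightarrow> d \<in> Hom C V (Ob D) \<longrightarrow> b (n \<cdot> w) d = Ids A \<cdot> a0 w d)"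
    by (rule ex_trans) auto
  then obtain i where i: "i \<in> Hom C Q N" "sQ \<cdot> i = Idn C Q" "tQ \<cdot> i = Idn C Q"
    and bi: "\<And>V w d. w \<in> Hom C V Q \<Longrightarrow> d \<in> Hom C V (Ob D) \<Longrightarrow> b (i \<cdot> w) d = Ids A \<cdot> a0 w d" by blast
  have [simp]: "i \<in> Arr C" "Dom C i = Q" "Cod C i = N" using i by simp_all
  have si: "sQ \<cdot> (i \<cdot> w) = w" "tQ \<cdot> (i \<cdot> w) = w" if "w \<in> Arr C" "Cod C w = Q" for w
    using comp_eq_comp[OF i(2), of w] comp_eq_comp[OF i(3), of w] that by simp_all
  have cN: "sQ \<cdot> (g \<cdot> w) = tQ \<cdot> (f \<cdot> w)"
      if "g \<in> Hom C W N" "f \<in> Hom C W N" "sQ \<cdot> g = tQ \<cdot> f" "w \<in> Hom C V W" for g f W V w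
    using comp_eq_comp[OF that(3), of w] that(1,2,4) by simp
  define P where "P g f n \<longleftrightarrow> n \<in> Hom C (Dom C f) N \<and> sQ \<cdot> n = sQ \<cdot> f \<and> tQ \<cdot> n = tQ \<cdot> g \<and>
    (\<forall>V w d. w \<in> Hom C V (Dom C f) \<longrightarrow> d \<in> Hom C V (Ob D) \<longrightarrow> b (n \<cdot> w) d = icomp C A (b (g \<cdot> w) d)
        (b (f \<cdot> w) d))" for g f n
  have exP: "\<exists>n. P g f n" if g: "g \<in> Hom C W N" and f: "f \<in> Hom C W N" and gf: "sQ \<cdot> g = tQ \<cdot> f"
      for g f W
  proof -
    have [simp]: "g \<in> Arr C" "Dom C g = W" "Cod C g = N" "f \<in> Arr C" "Dom C f = W" "Cod C f = N"
      using g f by simp_all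
    have W: "W \<in> Obj C" using Dom_Obj[of g] by simp
    have "\<exists>n\<in>Hom C W N. sQ \<cdot> n = sQ \<cdot> f \<and> tQ \<cdot> n = tQ \<cdot> g \<and>
      (\<forall>V w d. w \<in> Hom C V W \<longrightarrow> d \<in> Hom C V (Ob D) \<longrightarrow> b (n \<cdot> w) d = icomp C A (b (g \<cdot> w) d)
          (b (f \<cdot> w) d))"
    proof (rule ex_trans)
      fix V w u assume w: "w \<in> Hom C V W" "u \<in> Hom C V (Mor D)"
      have [simp]: "w \<in> Arr C" "Dom C w = V" "Cod C w = W" "u \<in> Arr C" "Dom C u = V" "Cod C u = Mor D"
        using w by simp_all
      note e [simp] = cN[OF g f gf w(1)]
      show "icomp C A (icomp C A (b (g \<cdot> w) (Tgt D \<cdot> u)) (b (f \<cdot> w) (Tgt D \<cdot> u))) (a1 ((sQ \<cdot> f) \<cdot> w) u)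
          =
           icomp C A (a1 ((tQ \<cdot> g) \<cdot> w) u) (icomp C A (b (g \<cdot> w) (Src D \<cdot> u)) (b (f \<cdot> w) (Src D \<cdot> u)))"
        using b_nat[of "f \<cdot> w" u] b_nat[of "g \<cdot> w" u]
        by (intro icomp_paste[where b = "a1 (tQ \<cdot> (f \<cdot> w)) u"]) simp_all
    next
      fix V w d assume w: "w \<in> Hom C V W" "d \<in> Hom C V (Ob D)"
      show "icomp C A (b (g \<cdot> w) d) (b (f \<cdot> w) d) \<in> Hom C V (Mor A) \<and>
          Src A \<cdot> icomp C A (b (g \<cdot> w) d) (b (f \<cdot> w) d) = a0 ((sQ \<cdot> f) \<cdot> w) d \<and>
          Tgt A \<cdot> icomp C A (b (g \<cdot> w) d) (b (f \<cdot> w) d) = a0 ((tQ \<cdot> g) \<cdot> w) d"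
        using w cN[OF g f gf w(1)] by simp
      fix U h assume "h \<in> Hom C U V"
      then show "icomp C A (b (g \<cdot> w) d) (b (f \<cdot> w) d) \<cdot> h =
          icomp C A (b (g \<cdot> (w \<cdot> h)) (d \<cdot> h)) (b (f \<cdot> (w \<cdot> h)) (d \<cdot> h))"
        using w cN[OF g f gf w(1)] by (simp add: icomp_comp)
    qed (use W in simp_all)
    then show ?thesis unfolding P_def by auto
  qed
  define c where "c g f = (SOME n. P g f n)" for g f
  have Pc: "P g f (c g f)" if "g \<in> Hom C W N" "f \<in> Hom C W N" "sQ \<cdot> g = tQ \<cdot> f" for g f W
    unfolding c_def using exP[OF that] by (rule someI_ex)
  have c: "c g f \<in> Arr C" "Dom C (c g f) = W" "Cod C (c g f) = N" "sQ \<cdot> c g f = sQ \<cdot> f"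
      "tQ \<cdot> c g f = tQ \<cdot> g"
    if "g \<in> Hom C W N" "f \<in> Hom C W N" "sQ \<cdot> g = tQ \<cdot> f" for g f W
    using Pc[OF that] that(2) unfolding P_def by simp_all
  have bc: "b (c g f \<cdot> w) d = icomp C A (b (g \<cdot> w) d) (b (f \<cdot> w) d)"
    if "g \<in> Hom C W N" "f \<in> Hom C W N" "sQ \<cdot> g = tQ \<cdot> f" "w \<in> Hom C V W" "d \<in> Hom C V (Ob D)"
        for g f W V w d
    using Pc[OF that(1-3)] that(2,4,5) unfolding P_def by simp
  have cst: "sQ \<cdot> (c g f \<cdot> w) = sQ \<cdot> (f \<cdot> w)" "tQ \<cdot> (c g f \<cdot> w) = tQ \<cdot> (g \<cdot> w)"
    if "g \<in> Hom C W N" "f \<in> Hom C W N" "sQ \<cdot> g = tQ \<cdot> f" "w \<in> Hom C V W" for g f W V w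
    using comp_eq_comp[OF c(4)[OF that(1-3)], of w] comp_eq_comp[OF c(5)[OF that(1-3)], of w]
        c(1-3)[OF that(1-3)] that(1,2,4)
    by simp_all
  obtain Z where Z: "internal_category C Z" "Ob Z = Q" "Mor Z = N" "Src Z = sQ" "Tgt Z = tQ" "Ids Z = i"
    and Zc: "\<And>W g f. g \<in> Hom C W N \<Longrightarrow> f \<in> Hom C W N \<Longrightarrow> sQ \<cdot> g = tQ \<cdot> f \<Longrightarrow> icomp C Z g f = c g f"
  proof (rule ex_internal_category[of Q N sQ tQ i c])
    fix W g f assume gf: "g \<in> Hom C W N" "f \<in> Hom C W N" "sQ \<cdot> g = tQ \<cdot> f"
    show "c g f \<in> Hom C W N \<and> sQ \<cdot> c g f = sQ \<cdot> f \<and> tQ \<cdot> c g f = tQ \<cdot> g" using c[OF gf] by simp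
  next
    fix V W g f h assume gf: "g \<in> Hom C W N" "f \<in> Hom C W N" and h: "h \<in> Hom C V W"
        and e: "sQ \<cdot> g = tQ \<cdot> f"
    have gfh: "g \<cdot> h \<in> Hom C V N" "f \<cdot> h \<in> Hom C V N" "sQ \<cdot> (g \<cdot> h) = tQ \<cdot> (f \<cdot> h)"
      using gf h cN[OF gf e h] by simp_all
    note c1 = c[OF gf e] and c2 = c[OF gfh]
    show "c g f \<cdot> h = c (g \<cdot> h) (f \<cdot> h)"
    proof (rule trans_eqI[of _ V])
      fix U w d assume w: "w \<in> Hom C U V" "d \<in> Hom C U (Ob D)"
      have hw: "h \<cdot> w \<in> Hom C U W" using w h by simp
      show "b ((c g f \<cdot> h) \<cdot> w) d = b (c (g \<cdot> h) (f \<cdot> h) \<cdot> w) d"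
        using bc[OF gf e hw w(2)] bc[OF gfh w] c1(1-3) gf h w by simp
    qed (use c1 c2 cst[OF gf e h] gf h in simp_all)
  next
    fix W f assume f: "f \<in> Hom C W N"
    have W: "W \<in> Obj C" using f by auto
    have p: "i \<cdot> (tQ \<cdot> f) \<in> Hom C W N" "sQ \<cdot> (i \<cdot> (tQ \<cdot> f)) = tQ \<cdot> f" using f si[of "tQ \<cdot> f"]
      by simp_all
    show "c (i \<cdot> (tQ \<cdot> f)) f = f"
    proof (rule trans_eqI[of _ W])
      fix V w d assume w: "w \<in> Hom C V W" "d \<in> Hom C V (Ob D)"
      show "b (c (i \<cdot> (tQ \<cdot> f)) f \<cdot> w) d = b (f \<cdot> w) d"
        using bc[OF p(1) f p(2) w] bi[of "tQ \<cdot> (f \<cdot> w)" V d] f w by simp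
    qed (use c[OF p(1) f p(2)] f si[of "tQ \<cdot> f"] in simp_all)
    have q: "i \<cdot> (sQ \<cdot> f) \<in> Hom C W N" "sQ \<cdot> f = tQ \<cdot> (i \<cdot> (sQ \<cdot> f))" using f si[of "sQ \<cdot> f"]
      by simp_all
    show "c f (i \<cdot> (sQ \<cdot> f)) = f"
    proof (rule trans_eqI[of _ W])
      fix V w d assume w: "w \<in> Hom C V W" "d \<in> Hom C V (Ob D)"
      show "b (c f (i \<cdot> (sQ \<cdot> f)) \<cdot> w) d = b (f \<cdot> w) d"
        using bc[OF f q w] bi[of "sQ \<cdot> (f \<cdot> w)" V d] f w by simp
    qed (use c[OF f q] f si[of "sQ \<cdot> f"] in simp_all)
  next
    fix W h g f assume hgf: "h \<in> Hom C W N" "g \<in> Hom C W N" "f \<in> Hom C W N"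
        and e: "sQ \<cdot> h = tQ \<cdot> g" "sQ \<cdot> g = tQ \<cdot> f"
    note c1 = c[OF hgf(1,2) e(1)] and c2 = c[OF hgf(2,3) e(2)]
    have p: "c h g \<in> Hom C W N" "sQ \<cdot> c h g = tQ \<cdot> f" using c1 e by simp_all
    have q: "c g f \<in> Hom C W N" "sQ \<cdot> h = tQ \<cdot> c g f" using c2 e by simp_all
    show "c (c h g) f = c h (c g f)"
    proof (rule trans_eqI[of _ W])
      fix V w d assume w: "w \<in> Hom C V W" "d \<in> Hom C V (Ob D)"
      show "b (c (c h g) f \<cdot> w) d = b (c h (c g f) \<cdot> w) d"
        unfolding bc[OF p(1) hgf(3) p(2) w] bc[OF hgf(1) q w] bc[OF hgf(1,2) e(1) w]
            bc[OF hgf(2,3) e(2) w]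
        by (rule icomp_assoc)
            (use hgf w cN[OF hgf(1,2) e(1) w(1)] cN[OF hgf(2,3) e(2) w(1)] in simp_all)
    qed (use c[OF p(1) hgf(3) p(2)] c[OF hgf(1) q] c1 c2 in simp_all)
  qed (use i in simp_all)
  have "transformation_object C D A (Ob Z) a0 a1 (Mor Z) (Src Z) (Tgt Z) b"
    unfolding Z by (rule transformation_object_axioms)
  then have "functor_category C D A Z a0 a1 b"
  proof (rule functor_category.intro, unfold_locales)
    fix z d assume "z \<in> Arr C" "Cod C z = Ob Z" "d \<in> Arr C" "Dom C z = Dom C d" "Cod C d = Ob D"
    then show "b (Ids Z \<cdot> z) d = Ids A \<cdot> a0 z d" using bi[of z "Dom C d" d] by (simp add: Z)
  next
    fix n n' d assume n: "n \<in> Arr C" "Cod C n = Mor Z" "n' \<in> Arr C" "Cod C n' = Mor Z"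
      "Src Z \<cdot> n' = Tgt Z \<cdot> n" "d \<in> Arr C" "Dom C n = Dom C d" "Cod C d = Ob D"
    have "Dom C n' = Dom C n" using composable_Dom[OF Z(1), of n' n] n by simp
    then have 1: "n' \<in> Hom C (Dom C d) N" "n \<in> Hom C (Dom C d) N" "sQ \<cdot> n' = tQ \<cdot> n" using n Z
      by simp_all
    show "b (icomp C Z n' n) d = icomp C A (b n' d) (b n d)"
      using bc[OF 1, of "Idn C (Dom C d)" "Dom C d" d] Zc[OF 1] n 1 c[OF 1] by simp
  qed (rule Z)
  then show ?thesis by blast
qed

subsection \<open>Cartesian closure of the category of internal categories\<close>

context lex_cat
begin

text \<open>The universal property of the exponential \<open>Z\<close>, with evaluation \<open>e\<close>, for natural transformations
  at a stage \<open>W\<close>: an arrow \<open>W \<rightarrow> Mor Z\<close> amounts to a family of components natural in the stage and in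
  the objects of \<open>D\<close>.\<close>

definition transposes_transformations ::
  "('o, 'm) icat \<Rightarrow> ('o, 'm) icat \<Rightarrow> ('o, 'm) icat \<Rightarrow> ('o, 'm) ifun \<Rightarrow> bool" where
  "transposes_transformations D A Z e \<longleftrightarrow>
     (\<forall>W n n'. n \<in> Hom C W (Mor Z) \<longrightarrow> n' \<in> Hom C W (Mor Z) \<longrightarrow> Src Z \<cdot> n = Src Z \<cdot> n' \<longrightarrow> Tgt Z \<cdot> n = Tgt Z \<cdot>
         n' \<longrightarrow>
        (\<forall>V w d. w \<in> Hom C V W \<longrightarrow> d \<in> Hom C V (Ob D) \<longrightarrow>
           F1 e \<cdot> cp1 Z D (n \<cdot> w) (Ids D \<cdot> d) = F1 e \<cdot> cp1 Z D (n' \<cdot> w) (Ids D \<cdot> d)) \<longrightarrow> n = n') \<and>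
     (\<forall>W s t \<beta>. W \<in> Obj C \<longrightarrow> s \<in> Hom C W (Ob Z) \<longrightarrow> t \<in> Hom C W (Ob Z) \<longrightarrow>
        (\<forall>V w d. w \<in> Hom C V W \<longrightarrow> d \<in> Hom C V (Ob D) \<longrightarrow> \<beta> w d \<in> Hom C V (Mor A) \<and>
           Src A \<cdot> \<beta> w d = F0 e \<cdot> cp0 Z D (s \<cdot> w) d \<and> Tgt A \<cdot> \<beta> w d = F0 e \<cdot> cp0 Z D (t \<cdot> w) d) \<longrightarrow>
        (\<forall>U V w d h. w \<in> Hom C V W \<longrightarrow> d \<in> Hom C V (Ob D) \<longrightarrow> h \<in> Hom C U V \<longrightarrow> \<beta> w d \<cdot> h = \<beta> (w \<cdot> h) (d \<cdot> h))
            \<longrightarrow>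
        (\<forall>V w u. w \<in> Hom C V W \<longrightarrow> u \<in> Hom C V (Mor D) \<longrightarrow>
           icomp C A (\<beta> w (Tgt D \<cdot> u)) (F1 e \<cdot> cp1 Z D (Ids Z \<cdot> (s \<cdot> w)) u) =
           icomp C A (F1 e \<cdot> cp1 Z D (Ids Z \<cdot> (t \<cdot> w)) u) (\<beta> w (Src D \<cdot> u))) \<longrightarrow>
        (\<exists>n\<in>Hom C W (Mor Z). Src Z \<cdot> n = s \<and> Tgt Z \<cdot> n = t \<and>
           (\<forall>V w d. w \<in> Hom C V W \<longrightarrow> d \<in> Hom C V (Ob D) \<longrightarrow> F1 e \<cdot> cp1 Z D (n \<cdot> w) (Ids D \<cdot> d) = \<beta> w d)))"

text \<open>This property passes from one exponential to any other.\<close>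

lemma transposes_transformations_iso:
  assumes e: "transposes_transformations D A Z e" "internal_functor C e" "FDom e = prod_obj (CAT C) Z D"
      "FCod e = A"
    and D [simp]: "internal_category C D"
    and u: "u \<in> Hom (CAT C) Z' Z" and v: "v \<in> Hom (CAT C) Z Z'"
    and uv: "u \<cdot>\<^bsub>CAT C\<^esub> v = Idn (CAT C) Z" and vu: "v \<cdot>\<^bsub>CAT C\<^esub> u = Idn (CAT C) Z'"
    and e': "e \<cdot>\<^bsub>CAT C\<^esub> times_right (CAT C) u D = e'"
  shows "transposes_transformations D A Z' e'"
proof -
  have [simp]: "internal_functor C u" "FDom u = Z'" "FCod u = Z" "internal_functor C v" "FDom v = Z"
      "FCod v = Z'"
    using u v by simp_all
  have [simp]: "internal_category C Z" "internal_category C Z'" "internal_category C A"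
    using ifun_simps(1,2)[of u] ifun_simps(2)[OF e(2)] e(4) by simp_all
  note [simp] = e(2,3,4)
  have e0: "F0 e' \<cdot> cp0 Z' D z d = F0 e \<cdot> cp0 Z D (F0 u \<cdot> z) d"
    if "z \<in> Arr C" "d \<in> Arr C" "Dom C z = Dom C d" "Cod C z = Ob Z'" "Cod C d = Ob D" for z d
    using that unfolding e'[symmetric] by simp
  have e1: "F1 e' \<cdot> cp1 Z' D z d = F1 e \<cdot> cp1 Z D (F1 u \<cdot> z) d"
    if "z \<in> Arr C" "d \<in> Arr C" "Dom C z = Dom C d" "Cod C z = Mor Z'" "Cod C d = Mor D" for z d
    using that unfolding e'[symmetric] by simp
  have iv: "F0 u \<cdot> F0 v = Idn C (Ob Z)" "F1 u \<cdot> F1 v = Idn C (Mor Z)" "F0 v \<cdot> F0 u = Idn C (Ob Z')"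
      "F1 v \<cdot> F1 u = Idn C (Mor Z')"
    using arg_cong[OF uv, of F0] arg_cong[OF uv, of F1] arg_cong[OF vu, of F0] arg_cong[OF vu, of F1]
      by simp_all
  have iv' [simp]: "x \<in> Arr C \<Longrightarrow> Cod C x = Ob Z \<Longrightarrow> F0 u \<cdot> (F0 v \<cdot> x) = x"
      "x \<in> Arr C \<Longrightarrow> Cod C x = Mor Z \<Longrightarrow> F1 u \<cdot> (F1 v \<cdot> x) = x"
     "x \<in> Arr C \<Longrightarrow> Cod C x = Ob Z' \<Longrightarrow> F0 v \<cdot> (F0 u \<cdot> x) = x"
         "x \<in> Arr C \<Longrightarrow> Cod C x = Mor Z' \<Longrightarrow> F1 v \<cdot> (F1 u \<cdot> x) = x" for x
    using comp_eq_comp[OF iv(1), of x] comp_eq_comp[OF iv(2), of x] comp_eq_comp[OF iv(3), of x]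
        comp_eq_comp[OF iv(4), of x]
    by simp_all
  show ?thesis
    unfolding transposes_transformations_def
  proof (intro conjI allI impI)
    fix W n n' assume n: "n \<in> Hom C W (Mor Z')" "n' \<in> Hom C W (Mor Z')" "Src Z' \<cdot> n = Src Z' \<cdot> n'"
        "Tgt Z' \<cdot> n = Tgt Z' \<cdot> n'"
      and eq: "\<forall>V w d. w \<in> Hom C V W \<longrightarrow> d \<in> Hom C V (Ob D) \<longrightarrow>
           F1 e' \<cdot> cp1 Z' D (n \<cdot> w) (Ids D \<cdot> d) = F1 e' \<cdot> cp1 Z' D (n' \<cdot> w) (Ids D \<cdot> d)"
    have n' [simp]: "n \<in> Arr C" "Dom C n = W" "Cod C n = Mor Z'" "n' \<in> Arr C" "Dom C n' = W"
        "Cod C n' = Mor Z'" using n(1,2) by simp_all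
    have "F1 e \<cdot> cp1 Z D ((F1 u \<cdot> n) \<cdot> w) (Ids D \<cdot> d) = F1 e \<cdot> cp1 Z D ((F1 u \<cdot> n') \<cdot> w) (Ids D \<cdot> d)"
      if "w \<in> Hom C V W" "d \<in> Hom C V (Ob D)" for V w d
      using eq[rule_format, OF that] e1[of "n \<cdot> w" "Ids D \<cdot> d"] e1[of "n' \<cdot> w" "Ids D \<cdot> d"] that by simp
    then have "F1 u \<cdot> n = F1 u \<cdot> n'"
      using e(1)[unfolded transposes_transformations_def, THEN conjunct1, rule_format, of "F1 u \<cdot> n" W
          "F1 u \<cdot> n'"] n(3,4) by simp
    then have "F1 v \<cdot> (F1 u \<cdot> n) = F1 v \<cdot> (F1 u \<cdot> n')" by (rule arg_cong)
    then show "n = n'" by simp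
  next
    fix W s t \<beta> assume W: "W \<in> Obj C" and s: "s \<in> Hom C W (Ob Z')" and t: "t \<in> Hom C W (Ob Z')"
      and 1: "\<forall>V w d. w \<in> Hom C V W \<longrightarrow> d \<in> Hom C V (Ob D) \<longrightarrow> \<beta> w d \<in> Hom C V (Mor A) \<and>
           Src A \<cdot> \<beta> w d = F0 e' \<cdot> cp0 Z' D (s \<cdot> w) d \<and> Tgt A \<cdot> \<beta> w d = F0 e' \<cdot> cp0 Z' D (t \<cdot> w) d"
      and 2: "\<forall>U V w d h. w \<in> Hom C V W \<longrightarrow> d \<in> Hom C V (Ob D) \<longrightarrow> h \<in> Hom C U V \<longrightarrow>
          \<beta> w d \<cdot> h = \<beta> (w \<cdot> h) (d \<cdot> h)"
      and 3: "\<forall>V w u. w \<in> Hom C V W \<longrightarrow> u \<in> Hom C V (Mor D) \<longrightarrow>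
           icomp C A (\<beta> w (Tgt D \<cdot> u)) (F1 e' \<cdot> cp1 Z' D (Ids Z' \<cdot> (s \<cdot> w)) u) =
           icomp C A (F1 e' \<cdot> cp1 Z' D (Ids Z' \<cdot> (t \<cdot> w)) u) (\<beta> w (Src D \<cdot> u))"
    have [simp]: "s \<in> Arr C" "Dom C s = W" "Cod C s = Ob Z'" "t \<in> Arr C" "Dom C t = W" "Cod C t = Ob Z'"
      using s t by simp_all
    have "\<exists>n\<in>Hom C W (Mor Z). Src Z \<cdot> n = F0 u \<cdot> s \<and> Tgt Z \<cdot> n = F0 u \<cdot> t \<and>
           (\<forall>V w d. w \<in> Hom C V W \<longrightarrow> d \<in> Hom C V (Ob D) \<longrightarrow> F1 e \<cdot> cp1 Z D (n \<cdot> w) (Ids D \<cdot> d) = \<beta> w d)"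
    proof (rule e(1)[unfolded transposes_transformations_def, THEN conjunct2, rule_format])
      fix V w d assume "w \<in> Hom C V W" "d \<in> Hom C V (Ob D)"
      then show "\<beta> w d \<in> Hom C V (Mor A) \<and>
           Src A \<cdot> \<beta> w d = F0 e \<cdot> cp0 Z D ((F0 u \<cdot> s) \<cdot> w) d \<and> Tgt A \<cdot> \<beta> w d = F0 e \<cdot> cp0 Z D
               ((F0 u \<cdot> t) \<cdot> w) d"
        using 1[rule_format, of w V d] e0[of "s \<cdot> w" d] e0[of "t \<cdot> w" d] by simp
    next
      fix V w x assume "w \<in> Hom C V W" "x \<in> Hom C V (Mor D)"
      then show "icomp C A (\<beta> w (Tgt D \<cdot> x)) (F1 e \<cdot> cp1 Z D (Ids Z \<cdot> ((F0 u \<cdot> s) \<cdot> w)) x) =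
           icomp C A (F1 e \<cdot> cp1 Z D (Ids Z \<cdot> ((F0 u \<cdot> t) \<cdot> w)) x) (\<beta> w (Src D \<cdot> x))"
        using 3[rule_format, of w V x] e1[of "Ids Z' \<cdot> (s \<cdot> w)" x] e1[of "Ids Z' \<cdot> (t \<cdot> w)" x] by simp
    qed (use W 2 in simp_all)
    then obtain n where n: "n \<in> Hom C W (Mor Z)" "Src Z \<cdot> n = F0 u \<cdot> s" "Tgt Z \<cdot> n = F0 u \<cdot> t"
      and nb: "\<And>V w d. w \<in> Hom C V W \<Longrightarrow> d \<in> Hom C V (Ob D) \<Longrightarrow> F1 e \<cdot> cp1 Z D (n \<cdot> w) (Ids D \<cdot> d) = \<beta> w d"
        by blast
    show "\<exists>n\<in>Hom C W (Mor Z'). Src Z' \<cdot> n = s \<and> Tgt Z' \<cdot> n = t \<and>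
           (\<forall>V w d. w \<in> Hom C V W \<longrightarrow> d \<in> Hom C V (Ob D) \<longrightarrow> F1 e' \<cdot> cp1 Z' D (n \<cdot> w) (Ids D \<cdot> d) = \<beta> w d)"
    proof (rule bexI[of _ "F1 v \<cdot> n"], intro conjI allI impI)
      show "Src Z' \<cdot> (F1 v \<cdot> n) = s" "Tgt Z' \<cdot> (F1 v \<cdot> n) = t" "F1 v \<cdot> n \<in> Hom C W (Mor Z')" using n
        by simp_all
      fix V w d assume w: "w \<in> Hom C V W" "d \<in> Hom C V (Ob D)"
      show "F1 e' \<cdot> cp1 Z' D ((F1 v \<cdot> n) \<cdot> w) (Ids D \<cdot> d) = \<beta> w d"
        using nb[OF w] e1[of "F1 v \<cdot> (n \<cdot> w)" "Ids D \<cdot> d"] w n(1) by simp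
    qed
  qed
qed

end

context functor_category
begin

text \<open>The evaluation functor \<open>[D, A] \<times> D \<rightarrow> A\<close>. On an arrow \<open>(n, u)\<close> it is the composite of the source of
  \<open>n\<close>, applied to \<open>u\<close>, with the component of \<open>n\<close> at the target of \<open>u\<close>.\<close>

definition evaluation :: "('o, 'm) ifun" where
  "evaluation = \<lparr>FDom = prod_obj (CAT C) Z D, FCod = A,
     F0 = a0 (F0 (proj1 (CAT C) Z D)) (F0 (proj2 (CAT C) Z D)),
     F1 = icomp C A (b (F1 (proj1 (CAT C) Z D)) (Tgt D \<cdot> F1 (proj2 (CAT C) Z D)))
           (a1 (Src Z \<cdot> F1 (proj1 (CAT C) Z D)) (F1 (proj2 (CAT C) Z D)))\<rparr>"

lemma evaluation_fields [simp]: "FDom evaluation = prod_obj (CAT C) Z D" "FCod evaluation = A"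
  by (simp_all add: evaluation_def)

lemma evaluation_F0 [simp]:
  assumes "z \<in> Arr C" "Cod C z = Ob Z" "d \<in> Arr C" "Dom C z = Dom C d" "Cod C d = Ob D"
  shows "F0 evaluation \<cdot> cp0 Z D z d = a0 z d"
  using assms by (simp add: evaluation_def)

lemma evaluation_F1:
  assumes "n \<in> Arr C" "Cod C n = Mor Z" "u \<in> Arr C" "Dom C n = Dom C u" "Cod C u = Mor D"
  shows "F1 evaluation \<cdot> cp1 Z D n u = icomp C A (b n (Tgt D \<cdot> u)) (a1 (Src Z \<cdot> n) u)"
  using assms by (simp add: evaluation_def icomp_comp)

lemma evaluation_arr:
  "F0 evaluation \<in> Hom C (Ob (prod_obj (CAT C) Z D)) (Ob A)"
      "F1 evaluation \<in> Hom C (Mor (prod_obj (CAT C) Z D)) (Mor A)"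
  by (simp_all add: evaluation_def)

lemma evaluation_functor [simp]: "internal_functor C evaluation"
proof (rule internal_functor_productI[of Z D A])
  fix W x d assume "x \<in> Hom C W (Mor Z)" "d \<in> Hom C W (Mor D)"
  then show "Src A \<cdot> (F1 evaluation \<cdot> cp1 Z D x d) = F0 evaluation \<cdot> cp0 Z D (Src Z \<cdot> x) (Src D \<cdot> d) \<and>
       Tgt A \<cdot> (F1 evaluation \<cdot> cp1 Z D x d) = F0 evaluation \<cdot> cp0 Z D (Tgt Z \<cdot> x) (Tgt D \<cdot> d)"
    by (simp add: evaluation_F1)
next
  fix W x d assume "x \<in> Hom C W (Ob Z)" "d \<in> Hom C W (Ob D)"
  then show "F1 evaluation \<cdot> cp1 Z D (Ids Z \<cdot> x) (Ids D \<cdot> d) = Ids A \<cdot> (F0 evaluation \<cdot> cp0 Z D x d)"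
    by (simp add: evaluation_F1)
next
  fix W x d x' d' assume xd: "x \<in> Hom C W (Mor Z)" "d \<in> Hom C W (Mor D)" "x' \<in> Hom C W (Mor Z)"
      "d' \<in> Hom C W (Mor D)"
    "Src Z \<cdot> x' = Tgt Z \<cdot> x" "Src D \<cdot> d' = Tgt D \<cdot> d"
  have "F1 evaluation \<cdot> cp1 Z D (icomp C Z x' x) (icomp C D d' d) =
    icomp C A (icomp C A (b x' (Tgt D \<cdot> d')) (b x (Tgt D \<cdot> d')))
        (icomp C A (a1 (Src Z \<cdot> x) d') (a1 (Src Z \<cdot> x) d))"
    using xd by (simp add: evaluation_F1 b_icomp a_icomp)
  also have "\<dots> = icomp C A (icomp C A (b x' (Tgt D \<cdot> d')) (a1 (Tgt Z \<cdot> x) d'))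
      (icomp C A (b x (Src D \<cdot> d')) (a1 (Src Z \<cdot> x) d))"
    by (rule icomp_middle) (use xd b_nat[of x d'] in simp_all)
  also have "\<dots> = icomp C A (F1 evaluation \<cdot> cp1 Z D x' d') (F1 evaluation \<cdot> cp1 Z D x d)"
    using xd by (simp add: evaluation_F1)
  finally show "F1 evaluation \<cdot> cp1 Z D (icomp C Z x' x) (icomp C D d' d) =
    icomp C A (F1 evaluation \<cdot> cp1 Z D x' d') (F1 evaluation \<cdot> cp1 Z D x d)" .
qed (use evaluation_arr in simp_all)

lemma evaluation_component:
  assumes "n \<in> Arr C" "Cod C n = Mor Z" "d \<in> Arr C" "Dom C n = Dom C d" "Cod C d = Ob D"
  shows "F1 evaluation \<cdot> cp1 Z D n (Ids D \<cdot> d) = b n d"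
  using assms by (simp add: evaluation_F1)

lemma evaluation_arrow:
  assumes "z \<in> Arr C" "Cod C z = Ob Z" "u \<in> Arr C" "Dom C z = Dom C u" "Cod C u = Mor D"
  shows "F1 evaluation \<cdot> cp1 Z D (Ids Z \<cdot> z) u = a1 z u"
  using assms by (simp add: evaluation_F1)

lemma evaluation_transposes: "transposes_transformations D A Z evaluation"
  unfolding transposes_transformations_def
proof (intro conjI allI impI)
  fix W n n' assume n: "n \<in> Hom C W (Mor Z)" "n' \<in> Hom C W (Mor Z)" "Src Z \<cdot> n = Src Z \<cdot> n'"
      "Tgt Z \<cdot> n = Tgt Z \<cdot> n'"
    and e: "\<forall>V w d. w \<in> Hom C V W \<longrightarrow> d \<in> Hom C V (Ob D) \<longrightarrow>
           F1 evaluation \<cdot> cp1 Z D (n \<cdot> w) (Ids D \<cdot> d) = F1 evaluation \<cdot> cp1 Z D (n' \<cdot> w) (Ids D \<cdot> d)"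
  show "n = n'"
  proof (rule trans_eqI[OF n])
    fix V w d assume w: "w \<in> Hom C V W" "d \<in> Hom C V (Ob D)"
    show "b (n \<cdot> w) d = b (n' \<cdot> w) d"
      using e[rule_format, OF w] n(1,2) w by (simp add: evaluation_component)
  qed
next
  fix W s t \<beta> assume W: "W \<in> Obj C" and s: "s \<in> Hom C W (Ob Z)" and t: "t \<in> Hom C W (Ob Z)"
    and 1: "\<forall>V w d. w \<in> Hom C V W \<longrightarrow> d \<in> Hom C V (Ob D) \<longrightarrow> \<beta> w d \<in> Hom C V (Mor A) \<and>
           Src A \<cdot> \<beta> w d = F0 evaluation \<cdot> cp0 Z D (s \<cdot> w) d \<and> Tgt A \<cdot> \<beta> w d = F0 evaluation \<cdot> cp0 Z D
               (t \<cdot> w) d"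
    and 2: "\<forall>U V w d h. w \<in> Hom C V W \<longrightarrow> d \<in> Hom C V (Ob D) \<longrightarrow> h \<in> Hom C U V \<longrightarrow>
        \<beta> w d \<cdot> h = \<beta> (w \<cdot> h) (d \<cdot> h)"
    and 3: "\<forall>V w u. w \<in> Hom C V W \<longrightarrow> u \<in> Hom C V (Mor D) \<longrightarrow>
           icomp C A (\<beta> w (Tgt D \<cdot> u)) (F1 evaluation \<cdot> cp1 Z D (Ids Z \<cdot> (s \<cdot> w)) u) =
           icomp C A (F1 evaluation \<cdot> cp1 Z D (Ids Z \<cdot> (t \<cdot> w)) u) (\<beta> w (Src D \<cdot> u))"
  have [simp]: "s \<in> Arr C" "Dom C s = W" "Cod C s = Ob Z" "t \<in> Arr C" "Dom C t = W" "Cod C t = Ob Z"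
    using s t by simp_all
  have "\<exists>n\<in>Hom C W (Mor Z). Src Z \<cdot> n = s \<and> Tgt Z \<cdot> n = t \<and>
      (\<forall>V w d. w \<in> Hom C V W \<longrightarrow> d \<in> Hom C V (Ob D) \<longrightarrow> b (n \<cdot> w) d = \<beta> w d)"
  proof (rule ex_trans[OF W s t])
    fix V w d assume "w \<in> Hom C V W" "d \<in> Hom C V (Ob D)"
    then show "\<beta> w d \<in> Hom C V (Mor A) \<and> Src A \<cdot> \<beta> w d = a0 (s \<cdot> w) d \<and> Tgt A \<cdot> \<beta> w d = a0 (t \<cdot> w) d"
      using 1[rule_format, of w V d] by simp
  next
    fix V w u assume "w \<in> Hom C V W" "u \<in> Hom C V (Mor D)"
    then show "icomp C A (\<beta> w (Tgt D \<cdot> u)) (a1 (s \<cdot> w) u) = icomp C A (a1 (t \<cdot> w) u) (\<beta> w (Src D \<cdot> u))"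
      using 3[rule_format, of w V u] evaluation_arrow[of "s \<cdot> w" u] evaluation_arrow[of "t \<cdot> w" u]
        by simp
  qed (use 2 in simp)
  then obtain n where n: "n \<in> Hom C W (Mor Z)" "Src Z \<cdot> n = s" "Tgt Z \<cdot> n = t"
    and nb: "\<And>V w d. w \<in> Hom C V W \<Longrightarrow> d \<in> Hom C V (Ob D) \<Longrightarrow> b (n \<cdot> w) d = \<beta> w d" by blast
  have "F1 evaluation \<cdot> cp1 Z D (n \<cdot> w) (Ids D \<cdot> d) = \<beta> w d" if "w \<in> Hom C V W" "d \<in> Hom C V (Ob D)"
      for V w d
    using nb[OF that] that n(1) by (simp add: evaluation_component)
  then show "\<exists>n\<in>Hom C W (Mor Z). Src Z \<cdot> n = s \<and> Tgt Z \<cdot> n = t \<and>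
      (\<forall>V w d. w \<in> Hom C V W \<longrightarrow> d \<in> Hom C V (Ob D) \<longrightarrow> F1 evaluation \<cdot> cp1 Z D (n \<cdot> w) (Ids D \<cdot> d) = \<beta> w
          d)"
    using n by blast
qed

lemma ex_transpose_functor:
  assumes W [simp]: "internal_category C W" and f: "f \<in> Hom (CAT C) (prod_obj (CAT C) W D) A"
  shows "\<exists>G\<in>Hom (CAT C) W Z. evaluation \<cdot>\<^bsub>CAT C\<^esub> times_right (CAT C) G D = f"
proof -
  have [simp]: "internal_functor C f" "FDom f = prod_obj (CAT C) W D" "FCod f = A" using f by simp_all
  have f_comp: "icomp C A (F1 f \<cdot> cp1 W D x' d') (F1 f \<cdot> cp1 W D x d) =
      F1 f \<cdot> cp1 W D (icomp C W x' x) (icomp C D d' d)"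
    if "x \<in> Arr C" "d \<in> Arr C" "Dom C x = Dom C d" "Cod C x = Mor W" "Cod C d = Mor D"
      "x' \<in> Arr C" "d' \<in> Arr C" "Dom C x' = Dom C d'" "Cod C x' = Mor W" "Cod C d' = Mor D"
      "Src W \<cdot> x' = Tgt W \<cdot> x" "Src D \<cdot> d' = Tgt D \<cdot> d" for x d x' d'
    using that ifun_icomp[of f "prod_obj (CAT C) W D" "cp1 W D x' d'" "cp1 W D x d"] by simp
  have f_Ids: "F1 f \<cdot> cp1 W D (Ids W \<cdot> x) (Ids D \<cdot> d) = Ids A \<cdot> (F0 f \<cdot> cp0 W D x d)"
    if "x \<in> Arr C" "d \<in> Arr C" "Dom C x = Dom C d" "Cod C x = Ob W" "Cod C d = Ob D" for x d
    using that by (simp flip: Ids_cp0)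
  have self: "icomp C W (Ids W \<cdot> x) (Ids W \<cdot> x) = Ids W \<cdot> x" if "x \<in> Arr C" "Cod C x = Ob W" for x
    using that by simp
  have selfD: "icomp C D (Ids D \<cdot> x) (Ids D \<cdot> x) = Ids D \<cdot> x" if "x \<in> Arr C" "Cod C x = Ob D" for x
    using that by simp
  have "sfun D A (Ob W) (\<lambda>w d. F0 f \<cdot> cp0 W D w d) (\<lambda>w u. F1 f \<cdot> cp1 W D (Ids W \<cdot> w) u)"
    unfolding sfun_def by (auto simp: f_Ids f_comp)
  then have "\<exists>z\<in>Hom C (Ob W) (Ob Z). \<forall>V w. w \<in> Hom C V (Ob W) \<longrightarrow>
      (\<forall>d\<in>Hom C V (Ob D). a0 (z \<cdot> w) d = F0 f \<cdot> cp0 W D w d) \<and>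
      (\<forall>u\<in>Hom C V (Mor D). a1 (z \<cdot> w) u = F1 f \<cdot> cp1 W D (Ids W \<cdot> w) u)"
    by (intro ex_functor) simp_all
  then obtain g0 where g0: "g0 \<in> Hom C (Ob W) (Ob Z)"
    and a0g: "\<And>V w d. w \<in> Hom C V (Ob W) \<Longrightarrow> d \<in> Hom C V (Ob D) \<Longrightarrow> a0 (g0 \<cdot> w) d = F0 f \<cdot> cp0 W D w d"
    and a1g: "\<And>V w u. w \<in> Hom C V (Ob W) \<Longrightarrow> u \<in> Hom C V (Mor D) \<Longrightarrow>
        a1 (g0 \<cdot> w) u = F1 f \<cdot> cp1 W D (Ids W \<cdot> w) u"
    by blast
  have [simp]: "g0 \<in> Arr C" "Dom C g0 = Ob W" "Cod C g0 = Ob Z" using g0 by simp_all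
  have a0g' [simp]: "a0 (g0 \<cdot> w) d = F0 f \<cdot> cp0 W D w d"
    if "w \<in> Arr C" "Cod C w = Ob W" "d \<in> Arr C" "Dom C w = Dom C d" "Cod C d = Ob D" for w d
    using a0g[of w "Dom C d" d] that by simp
  have a1g' [simp]: "a1 (g0 \<cdot> w) u = F1 f \<cdot> cp1 W D (Ids W \<cdot> w) u"
    if "w \<in> Arr C" "Cod C w = Ob W" "u \<in> Arr C" "Dom C w = Dom C u" "Cod C u = Mor D" for w u
    using a1g[of w "Dom C u" u] that by simp
  have "\<exists>n\<in>Hom C (Mor W) (Mor Z). Src Z \<cdot> n = g0 \<cdot> Src W \<and> Tgt Z \<cdot> n = g0 \<cdot> Tgt W \<and>
      (\<forall>V w d. w \<in> Hom C V (Mor W) \<longrightarrow> d \<in> Hom C V (Ob D) \<longrightarrow> b (n \<cdot> w) d = F1 f \<cdot> cp1 W D w (Ids D \<cdot> d))"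
    by (rule ex_trans) (auto simp: f_comp)
  then obtain g1 where g1: "g1 \<in> Hom C (Mor W) (Mor Z)" "Src Z \<cdot> g1 = g0 \<cdot> Src W"
      "Tgt Z \<cdot> g1 = g0 \<cdot> Tgt W"
    and bg: "\<And>V w d. w \<in> Hom C V (Mor W) \<Longrightarrow> d \<in> Hom C V (Ob D) \<Longrightarrow>
        b (g1 \<cdot> w) d = F1 f \<cdot> cp1 W D w (Ids D \<cdot> d)" by blast
  have [simp]: "g1 \<in> Arr C" "Dom C g1 = Mor W" "Cod C g1 = Mor Z" using g1 by simp_all
  have bg' [simp]: "b (g1 \<cdot> w) d = F1 f \<cdot> cp1 W D w (Ids D \<cdot> d)"
    if "w \<in> Arr C" "Cod C w = Mor W" "d \<in> Arr C" "Dom C w = Dom C d" "Cod C d = Ob D" for w d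
    using bg[of w "Dom C d" d] that by simp
  have st [simp]: "Src Z \<cdot> (g1 \<cdot> x) = g0 \<cdot> (Src W \<cdot> x)" "Tgt Z \<cdot> (g1 \<cdot> x) = g0 \<cdot> (Tgt W \<cdot> x)"
    if "x \<in> Arr C" "Cod C x = Mor W" for x
    using that comp_eq_comp[OF g1(2), of x] comp_eq_comp[OF g1(3), of x] by simp_all
  let ?G = "\<lparr>FDom = W, FCod = Z, F0 = g0, F1 = g1\<rparr>"
  have G [simp]: "internal_functor C ?G"
  proof (rule internal_functorI)
    fix V x assume "x \<in> Hom C V (Ob (FDom ?G))"
    then have x [simp]: "x \<in> Arr C" "Dom C x = V" "Cod C x = Ob W" by simp_all
    have "g1 \<cdot> (Ids W \<cdot> x) = Ids Z \<cdot> (g0 \<cdot> x)"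
    proof (rule trans_eqI[of _ V])
      fix U w d assume "w \<in> Hom C U V" "d \<in> Hom C U (Ob D)"
      then show "b ((g1 \<cdot> (Ids W \<cdot> x)) \<cdot> w) d = b ((Ids Z \<cdot> (g0 \<cdot> x)) \<cdot> w) d" by (simp add: f_Ids)
    qed simp_all
    then show "F1 ?G \<cdot> (Ids (FDom ?G) \<cdot> x) = Ids (FCod ?G) \<cdot> (F0 ?G \<cdot> x)" by simp
  next
    fix V h k assume "h \<in> Hom C V (Mor (FDom ?G))" "k \<in> Hom C V (Mor (FDom ?G))"
        and hk: "Src (FDom ?G) \<cdot> h = Tgt (FDom ?G) \<cdot> k"
    then have x [simp]: "h \<in> Arr C" "Dom C h = V" "Cod C h = Mor W" "k \<in> Arr C" "Dom C k = V"
        "Cod C k = Mor W"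
      and hk' [simp]: "Src W \<cdot> h = Tgt W \<cdot> k" by simp_all
    have "g1 \<cdot> icomp C W h k = icomp C Z (g1 \<cdot> h) (g1 \<cdot> k)"
    proof (rule trans_eqI[of _ V])
      fix U w d assume w: "w \<in> Hom C U V" "d \<in> Hom C U (Ob D)"
      have hkw: "Src W \<cdot> (h \<cdot> w) = Tgt W \<cdot> (k \<cdot> w)"
        by (rule composable_comp[OF hk']) (use w in simp_all)
      show "b ((g1 \<cdot> icomp C W h k) \<cdot> w) d = b (icomp C Z (g1 \<cdot> h) (g1 \<cdot> k) \<cdot> w) d"
        using w hkw by (simp add: icomp_comp b_icomp f_comp)
    qed simp_all
    then show "F1 ?G \<cdot> icomp C (FDom ?G) h k = icomp C (FCod ?G) (F1 ?G \<cdot> h) (F1 ?G \<cdot> k)" by simp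
  qed simp_all
  have "evaluation \<cdot>\<^bsub>CAT C\<^esub> times_right (CAT C) ?G D = f"
  proof (rule ifun_eqI)
    let ?P = "prod_obj (CAT C) W D"
    obtain x d where "x \<in> Hom C (Ob ?P) (Ob W)" "d \<in> Hom C (Ob ?P) (Ob D)"
        and e: "Idn C (Ob ?P) = cp0 W D x d"
      using cp0_cases[OF W D, of "Idn C (Ob ?P)" "Ob ?P" thesis] by simp
    then have xd [simp]: "x \<in> Arr C" "Dom C x = Ob ?P" "Cod C x = Ob W" "d \<in> Arr C" "Dom C d = Ob ?P"
        "Cod C d = Ob D" by simp_all
    have [simp]: "F0 f \<cdot> cp0 W D x d = F0 f" unfolding e[symmetric] by simp
    have "F0 (evaluation \<cdot>\<^bsub>CAT C\<^esub> times_right (CAT C) ?G D) =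
        F0 (evaluation \<cdot>\<^bsub>CAT C\<^esub> times_right (CAT C) ?G D) \<cdot> cp0 W D x d"
      unfolding e[symmetric] by simp
    also have "\<dots> = F0 f" by simp
    finally show "F0 (evaluation \<cdot>\<^bsub>CAT C\<^esub> times_right (CAT C) ?G D) = F0 f" .
    obtain x d where "x \<in> Hom C (Mor ?P) (Mor W)" "d \<in> Hom C (Mor ?P) (Mor D)"
        and e: "Idn C (Mor ?P) = cp1 W D x d"
      using cp1_cases[OF W D, of "Idn C (Mor ?P)" "Mor ?P" thesis] by simp
    then have xd [simp]: "x \<in> Arr C" "Dom C x = Mor ?P" "Cod C x = Mor W" "d \<in> Arr C" "Dom C d = Mor ?P"
        "Cod C d = Mor D" by simp_all
    have [simp]: "F1 f \<cdot> cp1 W D x d = F1 f" unfolding e[symmetric] by simp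
    have "F1 (evaluation \<cdot>\<^bsub>CAT C\<^esub> times_right (CAT C) ?G D) =
        F1 (evaluation \<cdot>\<^bsub>CAT C\<^esub> times_right (CAT C) ?G D) \<cdot> cp1 W D x d"
      unfolding e[symmetric] by simp
    also have "\<dots> = F1 f" by (simp add: evaluation_F1 f_comp)
    finally show "F1 (evaluation \<cdot>\<^bsub>CAT C\<^esub> times_right (CAT C) ?G D) = F1 f" .
  qed simp_all
  then show ?thesis by (intro bexI[of _ ?G]) simp_all
qed

lemma transpose_functor_unique:
  assumes G: "G \<in> Hom (CAT C) W Z" "H \<in> Hom (CAT C) W Z"
    and e: "evaluation \<cdot>\<^bsub>CAT C\<^esub> times_right (CAT C) G D = evaluation \<cdot>\<^bsub>CAT C\<^esub> times_right (CAT C) H D"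
  shows "G = H"
proof -
  have [simp]: "internal_functor C G" "FDom G = W" "FCod G = Z" "internal_functor C H" "FDom H = W"
      "FCod H = Z"
    using G by simp_all
  have [simp]: "internal_category C W" using ifun_simps(1)[of G] by simp
  have e0: "a0 (F0 G \<cdot> w) d = a0 (F0 H \<cdot> w) d"
    if "w \<in> Arr C" "Cod C w = Ob W" "d \<in> Arr C" "Dom C w = Dom C d" "Cod C d = Ob D" for w d
    using arg_cong[OF arg_cong[OF e, of F0], of "\<lambda>x. x \<cdot> cp0 W D w d"] that by simp
  have e1: "F1 evaluation \<cdot> cp1 Z D (F1 G \<cdot> w) d = F1 evaluation \<cdot> cp1 Z D (F1 H \<cdot> w) d"
    if "w \<in> Arr C" "Cod C w = Mor W" "d \<in> Arr C" "Dom C w = Dom C d" "Cod C d = Mor D" for w d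
    using arg_cong[OF arg_cong[OF e, of F1], of "\<lambda>x. x \<cdot> cp1 W D w d"] that by simp
  have 0: "F0 G = F0 H"
  proof (rule functor_eqI[of _ "Ob W"])
    fix V w d assume "w \<in> Hom C V (Ob W)" "d \<in> Hom C V (Ob D)"
    then show "a0 (F0 G \<cdot> w) d = a0 (F0 H \<cdot> w) d" using e0[of w d] by simp
  next
    fix V w u assume "w \<in> Hom C V (Ob W)" "u \<in> Hom C V (Mor D)"
    then show "a1 (F0 G \<cdot> w) u = a1 (F0 H \<cdot> w) u" using e1[of "Ids W \<cdot> w" u]
      by (simp add: evaluation_arrow)
  qed simp_all
  have "F1 G = F1 H"
  proof (rule trans_eqI[of _ "Mor W"])
    show "Src Z \<cdot> F1 G = Src Z \<cdot> F1 H" "Tgt Z \<cdot> F1 G = Tgt Z \<cdot> F1 H"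
      using ifun_laws(1,2)[of G] ifun_laws(1,2)[of H] 0 by simp_all
    fix V w d assume "w \<in> Hom C V (Mor W)" "d \<in> Hom C V (Ob D)"
    then show "b (F1 G \<cdot> w) d = b (F1 H \<cdot> w) d" using e1[of w "Ids D \<cdot> d"]
      by (simp add: evaluation_component)
  qed simp_all
  with 0 show ?thesis by (intro ifun_eqI) simp_all
qed

lemma evaluation_exponential: "is_exponential (CAT C) D A Z evaluation"
  unfolding is_exponential_def
proof (intro conjI ballI)
  fix W f assume W: "W \<in> Obj (CAT C)" and f: "f \<in> Hom (CAT C) (prod_obj (CAT C) W D) A"
  have "internal_category C W" using W by simp
  from ex_transpose_functor[OF this f]
  show "\<exists>!g. g \<in> Hom (CAT C) W Z \<and> evaluation \<cdot>\<^bsub>CAT C\<^esub> times_right (CAT C) g D = f"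
    using transpose_functor_unique by blast
qed simp_all

end

context lexcc_cat
begin

lemma ex_functor_category_locale:
  assumes "internal_category C D" "internal_category C A"
  shows "\<exists>Z a0 a1 b. functor_category C D A Z a0 a1 b"
proof -
  obtain Q a0 a1 where "functor_object C D A Q a0 a1" using ex_functor_object[OF assms] by blast
  then interpret F: functor_object C D A Q a0 a1 .
  obtain N sQ tQ b where "transformation_object C D A Q a0 a1 N sQ tQ b"
    using F.ex_transformation_object by blast
  then interpret T: transformation_object C D A Q a0 a1 N sQ tQ b .
  show ?thesis using T.ex_functor_category by blast
qed

sublocale KC: ccc "CAT C"
proof
  fix D A assume "D \<in> Obj (CAT C)" "A \<in> Obj (CAT C)"
  then obtain Z a0 a1 b where "functor_category C D A Z a0 a1 b"
    using ex_functor_category_locale[of D A] by auto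
  then interpret functor_category C D A Z a0 a1 b .
  show "\<exists>Z e. is_exponential (CAT C) D A Z e" using evaluation_exponential by blast
qed

lemma CAT_expo [simp]:
  assumes "internal_category C D" "internal_category C A"
  shows "internal_category C (expo (CAT C) D A)" "internal_functor C (ev (CAT C) D A)"
    "FDom (ev (CAT C) D A) = prod_obj (CAT C) (expo (CAT C) D A) D" "FCod (ev (CAT C) D A) = A"
  using KC.expo_simps[of D A] assms by simp_all

lemma ev_transposes:
  assumes "internal_category C D" "internal_category C A"
  shows "transposes_transformations D A (expo (CAT C) D A) (ev (CAT C) D A)"
proof -
  obtain Z a0 a1 b where "functor_category C D A Z a0 a1 b" using ex_functor_category_locale[OF assms]
    by blast
  then interpret F: functor_category C D A Z a0 a1 b .
  have e: "is_exponential (CAT C) D A (expo (CAT C) D A) (ev (CAT C) D A)"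
    by (rule KC.exponential) (use assms in simp_all)
  have D: "D \<in> Obj (CAT C)" using assms by simp
  obtain u v where "u \<in> Hom (CAT C) (expo (CAT C) D A) Z" "v \<in> Hom (CAT C) Z (expo (CAT C) D A)"
    "u \<cdot>\<^bsub>CAT C\<^esub> v = Idn (CAT C) Z" "v \<cdot>\<^bsub>CAT C\<^esub> u = Idn (CAT C) (expo (CAT C) D A)"
    "F.evaluation \<cdot>\<^bsub>CAT C\<^esub> times_right (CAT C) u D = ev (CAT C) D A"
    using K.exponential_unique[OF F.evaluation_exponential e D] by blast
  then show ?thesis by (intro transposes_transformations_iso[OF F.evaluation_transposes])
      (use assms in simp_all)
qed

end

section \<open>Cones by components\<close>

context lexcc_cat
begin

lemma transpose_elements:
  assumes [simp]: "internal_category C W" "internal_category C J" "internal_category C A"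
    and f: "f \<in> Hom (CAT C) (prod_obj (CAT C) W J) A"
  defines "G \<equiv> transpose (CAT C) W J A f"
  shows "internal_functor C G" "FDom G = W" "FCod G = expo (CAT C) J A"
    "w \<in> Arr C \<Longrightarrow> Cod C w = Ob W \<Longrightarrow> d \<in> Arr C \<Longrightarrow> Dom C w = Dom C d \<Longrightarrow> Cod C d = Ob J \<Longrightarrow>
      F0 (ev (CAT C) J A) \<cdot> cp0 (expo (CAT C) J A) J (F0 G \<cdot> w) d = F0 f \<cdot> cp0 W J w d"
    "w \<in> Arr C \<Longrightarrow> Cod C w = Mor W \<Longrightarrow> d \<in> Arr C \<Longrightarrow> Dom C w = Dom C d \<Longrightarrow> Cod C d = Mor J \<Longrightarrow>
      F1 (ev (CAT C) J A) \<cdot> cp1 (expo (CAT C) J A) J (F1 G \<cdot> w) d = F1 f \<cdot> cp1 W J w d"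
proof -
  have t: "G \<in> Arr (CAT C)" "Dom (CAT C) G = W" "Cod (CAT C) G = expo (CAT C) J A"
    "ev (CAT C) J A \<cdot>\<^bsub>CAT C\<^esub> times_right (CAT C) G J = f"
    unfolding G_def by (rule KC.transpose_props; use f in simp)+
  show G [simp]: "internal_functor C G" "FDom G = W" "FCod G = expo (CAT C) J A" using t by simp_all
  show "F0 (ev (CAT C) J A) \<cdot> cp0 (expo (CAT C) J A) J (F0 G \<cdot> w) d = F0 f \<cdot> cp0 W J w d"
    if "w \<in> Arr C" "Cod C w = Ob W" "d \<in> Arr C" "Dom C w = Dom C d" "Cod C d = Ob J"
    using arg_cong[OF arg_cong[OF t(4), of F0], of "\<lambda>x. x \<cdot> cp0 W J w d"] that by simp
  show "F1 (ev (CAT C) J A) \<cdot> cp1 (expo (CAT C) J A) J (F1 G \<cdot> w) d = F1 f \<cdot> cp1 W J w d"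
    if "w \<in> Arr C" "Cod C w = Mor W" "d \<in> Arr C" "Dom C w = Dom C d" "Cod C d = Mor J"
    using arg_cong[OF arg_cong[OF t(4), of F1], of "\<lambda>x. x \<cdot> cp1 W J w d"] that by simp
qed

lemma terminal_CAT_simps [simp]:
  "internal_category C (terminal (CAT C))" "is_terminal C (Ob (terminal (CAT C)))"
      "is_terminal C (Mor (terminal (CAT C)))"
  using terminal_CAT[OF K.terminal] by auto

text \<open>The arrow to the object of objects of the chosen terminal internal category, which need not be
  the chosen terminal object.\<close>

abbreviation tt :: "'o \<Rightarrow> 'm" where "tt \<equiv> to_terminal (Ob (terminal (CAT C)))"

lemma tt_simps [simp]:
  "X \<in> Obj C \<Longrightarrow> tt X \<in> Arr C" "X \<in> Obj C \<Longrightarrow> Dom C (tt X) = X"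
      "X \<in> Obj C \<Longrightarrow> Cod C (tt X) = Ob (terminal (CAT C))"
  "f \<in> Arr C \<Longrightarrow> Cod C f = X \<Longrightarrow> tt X \<cdot> f = tt (Dom C f)"
  using to_terminal[of "Ob (terminal (CAT C))" X] to_terminal_comp[of "Ob (terminal (CAT C))" f X]
    by simp_all

lemma to_tt: "f \<in> Arr C \<Longrightarrow> Cod C f = Ob (terminal (CAT C)) \<Longrightarrow> f = tt (Dom C f)"
  by (rule terminal_arrows_eq[of "Ob (terminal (CAT C))"]) simp_all

text \<open>A functor on the terminal internal category is determined by its effect on objects.\<close>

lemma terminal_functor_F1:
  assumes "internal_functor C G" "FDom G = terminal (CAT C)"
  shows "F1 G = Ids (FCod G) \<cdot> (F0 G \<cdot> Src (terminal (CAT C)))"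
      "Src (terminal (CAT C)) = Tgt (terminal (CAT C))"
proof -
  let ?T = "terminal (CAT C)"
  have "Ids ?T \<cdot> Src ?T = Idn C (Mor ?T)"
    by (rule terminal_arrows_eq[of "Mor ?T"]) simp_all
  then have "F1 G = F1 G \<cdot> (Ids ?T \<cdot> Src ?T)" using assms by simp
  also have "\<dots> = Ids (FCod G) \<cdot> (F0 G \<cdot> Src ?T)" using assms by simp
  finally show "F1 G = Ids (FCod G) \<cdot> (F0 G \<cdot> Src ?T)" .
  show "Src ?T = Tgt ?T" by (rule terminal_arrows_eq[of "Ob ?T"]) simp_all
qed

lemma ex_terminal_functor:
  assumes [simp]: "internal_category C A" and x: "x \<in> Hom C (Ob (terminal (CAT C))) (Ob A)"
  obtains V where "V \<in> Hom (CAT C) (terminal (CAT C)) A" "F0 V = x"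
proof -
  let ?T = "terminal (CAT C)"
  let ?V = "\<lparr>FDom = ?T, FCod = A, F0 = x, F1 = Ids A \<cdot> (x \<cdot> Src ?T)\<rparr>"
  have [simp]: "x \<in> Arr C" "Dom C x = Ob ?T" "Cod C x = Ob A" using x by simp_all
  have eq: "Src ?T \<cdot> g = Src ?T \<cdot> f" "Tgt ?T \<cdot> g = Src ?T \<cdot> f"
      if "g \<in> Arr C" "f \<in> Arr C" "Dom C g = Dom C f" "Cod C f = Mor ?T" "Cod C g = Mor ?T" for g f
    by (rule terminal_arrows_eq[of "Ob ?T"]; use that in simp)+
  have "internal_functor C ?V"
  proof (rule internal_functorI)
    fix W f assume f: "f \<in> Hom C W (Mor (FDom ?V))"
    then show "Src (FCod ?V) \<cdot> (F1 ?V \<cdot> f) = F0 ?V \<cdot> (Src (FDom ?V) \<cdot> f) \<and>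
        Tgt (FCod ?V) \<cdot> (F1 ?V \<cdot> f) = F0 ?V \<cdot> (Tgt (FDom ?V) \<cdot> f)"
      using eq[of f f] by simp
  next
    fix W g f assume f: "g \<in> Hom C W (Mor (FDom ?V))" "f \<in> Hom C W (Mor (FDom ?V))"
        "Src (FDom ?V) \<cdot> g = Tgt (FDom ?V) \<cdot> f"
    then show "F1 ?V \<cdot> icomp C (FDom ?V) g f = icomp C (FCod ?V) (F1 ?V \<cdot> g) (F1 ?V \<cdot> f)"
      using eq(1)[of g f] by simp
  qed simp_all
  then show thesis using that[of ?V] by simp
qed

lemma nat_trans_terminal:
  assumes "U \<in> Hom (CAT C) (terminal (CAT C)) A" "V \<in> Hom (CAT C) (terminal (CAT C)) A"
  shows "nat_trans C U V h \<longleftrightarrow> h \<in> Hom C (Ob (terminal (CAT C))) (Mor A) \<and> Src A \<cdot> h = F0 U \<and>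
      Tgt A \<cdot> h = F0 V"
proof -
  let ?T = "terminal (CAT C)"
  have [simp]: "internal_functor C U" "FDom U = ?T" "FCod U = A" "internal_functor C V" "FDom V = ?T"
      "FCod V = A"
    using assms by simp_all
  have [simp]: "internal_category C A" using ifun_simps(2)[of U] by simp
  have "icomp C A (h \<cdot> Tgt ?T) (F1 U) = icomp C A (F1 V) (h \<cdot> Src ?T)"
    if h: "h \<in> Hom C (Ob ?T) (Mor A)" "Src A \<cdot> h = F0 U" "Tgt A \<cdot> h = F0 V"
  proof -
    have "F1 U = Ids A \<cdot> (F0 U \<cdot> Tgt ?T)" "F1 V = Ids A \<cdot> (F0 V \<cdot> Src ?T)" "Src ?T = Tgt ?T"
      using terminal_functor_F1[of U] terminal_functor_F1[of V] by simp_all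
    moreover have "Src A \<cdot> (h \<cdot> Tgt ?T) = F0 U \<cdot> Tgt ?T" "Tgt A \<cdot> (h \<cdot> Tgt ?T) = F0 V \<cdot> Tgt ?T"
      by (rule comp_eq_comp; use h in simp)+
    ultimately show ?thesis using h(1) by simp
  qed
  then show ?thesis unfolding nat_trans_def Let_def using assms by auto
qed

lemma diag_elements [simp]:
  assumes "internal_category C J" "internal_category C A"
  shows "internal_functor C (diag C J A)" "FDom (diag C J A) = A" "FCod (diag C J A) = expo (CAT C) J A"
    "x \<in> Arr C \<Longrightarrow> Cod C x = Ob A \<Longrightarrow> d \<in> Arr C \<Longrightarrow> Dom C x = Dom C d \<Longrightarrow> Cod C d = Ob J \<Longrightarrow>
      F0 (ev (CAT C) J A) \<cdot> cp0 (expo (CAT C) J A) J (F0 (diag C J A) \<cdot> x) d = x"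
    "f \<in> Arr C \<Longrightarrow> Cod C f = Mor A \<Longrightarrow> u \<in> Arr C \<Longrightarrow> Dom C f = Dom C u \<Longrightarrow> Cod C u = Mor J \<Longrightarrow>
      F1 (ev (CAT C) J A) \<cdot> cp1 (expo (CAT C) J A) J (F1 (diag C J A) \<cdot> f) u = f"
  using transpose_elements[of A J A "proj1 (CAT C) A J"] assms by (simp_all add: diag_def)

lemma point_elements [simp]:
  assumes "internal_functor C F" "FDom F = J" "FCod F = A"
  shows "internal_functor C (point C F)" "FDom (point C F) = terminal (CAT C)"
      "FCod (point C F) = expo (CAT C) J A"
    "t \<in> Arr C \<Longrightarrow> Cod C t = Ob (terminal (CAT C)) \<Longrightarrow> d \<in> Arr C \<Longrightarrow> Dom C t = Dom C d \<Longrightarrow> Cod C d = Ob J \<Longrightarrow>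
      F0 (ev (CAT C) J A) \<cdot> cp0 (expo (CAT C) J A) J (F0 (point C F) \<cdot> t) d = F0 F \<cdot> d"
    "t \<in> Arr C \<Longrightarrow> Cod C t = Mor (terminal (CAT C)) \<Longrightarrow> u \<in> Arr C \<Longrightarrow> Dom C t = Dom C u \<Longrightarrow> Cod C u = Mor J \<Longrightarrow>
      F1 (ev (CAT C) J A) \<cdot> cp1 (expo (CAT C) J A) J (F1 (point C F) \<cdot> t) u = F1 F \<cdot> u"
proof -
  have [simp]: "internal_category C J" "internal_category C A" using ifun_simps(1,2)[OF assms(1)] assms
    by simp_all
  let ?f = "F \<cdot>\<^bsub>CAT C\<^esub> proj2 (CAT C) (terminal (CAT C)) J"
  have "?f \<in> Hom (CAT C) (prod_obj (CAT C) (terminal (CAT C)) J) A" using assms by simp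
  note t = transpose_elements[OF _ _ _ this]
  show "internal_functor C (point C F)" "FDom (point C F) = terminal (CAT C)"
      "FCod (point C F) = expo (CAT C) J A"
    "t \<in> Arr C \<Longrightarrow> Cod C t = Ob (terminal (CAT C)) \<Longrightarrow> d \<in> Arr C \<Longrightarrow> Dom C t = Dom C d \<Longrightarrow> Cod C d = Ob J \<Longrightarrow>
      F0 (ev (CAT C) J A) \<cdot> cp0 (expo (CAT C) J A) J (F0 (point C F) \<cdot> t) d = F0 F \<cdot> d"
    "t \<in> Arr C \<Longrightarrow> Cod C t = Mor (terminal (CAT C)) \<Longrightarrow> u \<in> Arr C \<Longrightarrow> Dom C t = Dom C u \<Longrightarrow> Cod C u = Mor J \<Longrightarrow>
      F1 (ev (CAT C) J A) \<cdot> cp1 (expo (CAT C) J A) J (F1 (point C F) \<cdot> t) u = F1 F \<cdot> u"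
    using t assms unfolding point_def by simp_all
qed

text \<open>The component at \<open>d\<close> of an arrow \<open>\<gamma> : 1 \<rightarrow> Mor [J, A]\<close>.\<close>

definition component :: "('o, 'm) icat \<Rightarrow> ('o, 'm) icat \<Rightarrow> 'm \<Rightarrow> 'm \<Rightarrow> 'm" where
  "component J A \<gamma> d = F1 (ev (CAT C) J A) \<cdot> cp1 (expo (CAT C) J A) J (\<gamma> \<cdot> tt (Dom C d)) (Ids J \<cdot> d)"

lemma component_simps [simp]:
  assumes "internal_category C J" "internal_category C A" "\<gamma> \<in> Arr C" "Dom C \<gamma> = Ob (terminal (CAT C))"
    "Cod C \<gamma> = Mor (expo (CAT C) J A)" "d \<in> Arr C" "Cod C d = Ob J"
  shows "component J A \<gamma> d \<in> Arr C" "Dom C (component J A \<gamma> d) = Dom C d"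
      "Cod C (component J A \<gamma> d) = Mor A"
  using assms by (simp_all add: component_def)

lemma component_comp:
  assumes "internal_category C J" "internal_category C A" "\<gamma> \<in> Arr C" "Dom C \<gamma> = Ob (terminal (CAT C))"
    "Cod C \<gamma> = Mor (expo (CAT C) J A)" "d \<in> Arr C" "Cod C d = Ob J" "h \<in> Arr C" "Cod C h = Dom C d"
  shows "component J A \<gamma> d \<cdot> h = component J A \<gamma> (d \<cdot> h)"
  using assms by (simp add: component_def)

end

text \<open>Cones with vertex \<open>v : S \<rightarrow> Ob A\<close>, where \<open>S\<close> is any terminal object, over \<open>F : J \<rightarrow> A\<close>, described by
  the arrow \<open>\<delta> : Ob J \<rightarrow> Mor A\<close> of their components.\<close>

definition (in category) elem_cone :: "('o, 'm) ifun \<Rightarrow> 'o \<Rightarrow> 'm \<Rightarrow> 'm \<Rightarrow> bool" where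
  "elem_cone F S v \<delta> \<longleftrightarrow>
     v \<in> Hom C S (Ob (FCod F)) \<and> \<delta> \<in> Hom C (Ob (FDom F)) (Mor (FCod F)) \<and>
     Src (FCod F) \<cdot> \<delta> = v \<cdot> to_terminal S (Ob (FDom F)) \<and> Tgt (FCod F) \<cdot> \<delta> = F0 F \<and>
     (\<forall>V u. u \<in> Hom C V (Mor (FDom F)) \<longrightarrow>
        icomp C (FCod F) (F1 F \<cdot> u) (\<delta> \<cdot> (Src (FDom F) \<cdot> u)) = \<delta> \<cdot> (Tgt (FDom F) \<cdot> u))"

text \<open>The universal property of a limit cone, for cones whose vertices are global elements.\<close>

definition (in category) elem_universal :: "('o, 'm) ifun \<Rightarrow> 'o \<Rightarrow> 'm \<Rightarrow> 'm \<Rightarrow> bool" where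
  "elem_universal F S v \<delta> \<longleftrightarrow> elem_cone F S v \<delta> \<and>
     (\<forall>x \<delta>'. elem_cone F S x \<delta>' \<longrightarrow>
        (\<exists>!h. h \<in> Hom C S (Mor (FCod F)) \<and> Src (FCod F) \<cdot> h = x \<and> Tgt (FCod F) \<cdot> h = v \<and>
              icomp C (FCod F) \<delta> (h \<cdot> to_terminal S (Ob (FDom F))) = \<delta>'))"

context lexcc_cat
begin

lemma cone_cat_Obj [simp]:
  "(V, \<gamma>) \<in> Obj (cone_cat C F) \<longleftrightarrow> V \<in> Hom (CAT C) (terminal (CAT C)) (FCod F) \<and>
     nat_trans C (diag C (FDom F) (FCod F) \<cdot>\<^bsub>CAT C\<^esub> V) (point C F) \<gamma>"
  by (simp add: cone_cat_def Let_def)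

lemma cone_cat_Hom:
  "((V0, \<gamma>0), h, (V1, \<gamma>1)) \<in> Arr (cone_cat C F) \<longleftrightarrow>
     (V0, \<gamma>0) \<in> Obj (cone_cat C F) \<and> (V1, \<gamma>1) \<in> Obj (cone_cat C F) \<and> nat_trans C V0 V1 h \<and>
     icomp C (expo (CAT C) (FDom F) (FCod F)) \<gamma>1 (F1 (diag C (FDom F) (FCod F)) \<cdot> h) = \<gamma>0"
  by (simp add: cone_cat_def Let_def)

text \<open>The data of a cone in the sense of functor categories, in a form convenient for simplification.\<close>

lemma cone_cat_ObjD:
  assumes "internal_functor C F" "FDom F = J" "FCod F = A" "(V, \<gamma>) \<in> Obj (cone_cat C F)"
  shows "internal_functor C V" "FDom V = terminal (CAT C)" "FCod V = A"
    "\<gamma> \<in> Arr C" "Dom C \<gamma> = Ob (terminal (CAT C))" "Cod C \<gamma> = Mor (expo (CAT C) J A)"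
    "Src (expo (CAT C) J A) \<cdot> \<gamma> = F0 (diag C J A) \<cdot> F0 V" "Tgt (expo (CAT C) J A) \<cdot> \<gamma> = F0 (point C F)"
proof -
  have [simp]: "internal_category C J" "internal_category C A" using ifun_simps(1,2)[OF assms(1)] assms
    by simp_all
  show V: "internal_functor C V" "FDom V = terminal (CAT C)" "FCod V = A" using assms by simp_all
  have n: "nat_trans C (diag C J A \<cdot>\<^bsub>CAT C\<^esub> V) (point C F) \<gamma>" using assms by simp
  have "\<gamma> \<in> Hom C (Ob (terminal (CAT C))) (Mor (expo (CAT C) J A)) \<and>
     Src (expo (CAT C) J A) \<cdot> \<gamma> = F0 (diag C J A \<cdot>\<^bsub>CAT C\<^esub> V) \<and> Tgt (expo (CAT C) J A) \<cdot> \<gamma> = F0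
         (point C F)"
    using n by (subst (asm) nat_trans_terminal[of _ "expo (CAT C) J A"]) (use V assms in simp_all)
  then show "\<gamma> \<in> Arr C" "Dom C \<gamma> = Ob (terminal (CAT C))" "Cod C \<gamma> = Mor (expo (CAT C) J A)"
    "Src (expo (CAT C) J A) \<cdot> \<gamma> = F0 (diag C J A) \<cdot> F0 V" "Tgt (expo (CAT C) J A) \<cdot> \<gamma> = F0 (point C F)"
    by simp_all
qed

lemma
  assumes F: "internal_functor C F" "FDom F = J" "FCod F = A" and cone: "(V, \<gamma>) \<in> Obj (cone_cat C F)"
  shows component_Src: "d \<in> Arr C \<Longrightarrow> Cod C d = Ob J \<Longrightarrow> Src A \<cdot> component J A \<gamma> d = F0 V \<cdot> tt (Dom C d)"
    and component_Tgt: "d \<in> Arr C \<Longrightarrow> Cod C d = Ob J \<Longrightarrow> Tgt A \<cdot> component J A \<gamma> d = F0 F \<cdot> d"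
    and component_natural: "u \<in> Arr C \<Longrightarrow> Cod C u = Mor J \<Longrightarrow>
      icomp C A (F1 F \<cdot> u) (component J A \<gamma> (Src J \<cdot> u)) = component J A \<gamma> (Tgt J \<cdot> u)"
proof -
  note [simp] = F cone_cat_ObjD[OF F cone]
  have [simp]: "internal_category C J" "internal_category C A" using ifun_simps(1,2)[OF F(1)]
    by simp_all
  let ?Z = "expo (CAT C) J A" and ?T = "terminal (CAT C)"
  let ?e = "ev (CAT C) J A"
  have s: "Src ?Z \<cdot> (\<gamma> \<cdot> t) = F0 (diag C J A) \<cdot> (F0 V \<cdot> t)" "Tgt ?Z \<cdot> (\<gamma> \<cdot> t) = F0 (point C F) \<cdot> t"
    if "t \<in> Arr C" "Cod C t = Ob ?T" for t
    using comp_eq_comp[OF cone_cat_ObjD(7)[OF F cone], of t]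
        comp_eq_comp[OF cone_cat_ObjD(8)[OF F cone], of t] that
    by simp_all
  show "d \<in> Arr C \<Longrightarrow> Cod C d = Ob J \<Longrightarrow> Src A \<cdot> component J A \<gamma> d = F0 V \<cdot> tt (Dom C d)"
    by (simp add: component_def s)
  show "d \<in> Arr C \<Longrightarrow> Cod C d = Ob J \<Longrightarrow> Tgt A \<cdot> component J A \<gamma> d = F0 F \<cdot> d"
    by (simp add: component_def s)
  assume u: "u \<in> Arr C" "Cod C u = Mor J"
  let ?t = "tt (Dom C u)"
  have Fu: "F1 F \<cdot> u = F1 ?e \<cdot> cp1 ?Z J (Ids ?Z \<cdot> (F0 (point C F) \<cdot> ?t)) u"
    using point_elements(5)[OF F, of "Ids ?T \<cdot> ?t" u] u by simp
  have Ve: "Ids A \<cdot> (F0 V \<cdot> ?t) = F1 ?e \<cdot> cp1 ?Z J (Ids ?Z \<cdot> (F0 (diag C J A) \<cdot> (F0 V \<cdot> ?t))) u"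
    using diag_elements(5)[of J A "Ids A \<cdot> (F0 V \<cdot> ?t)" u] u by simp
  have ee: "icomp C A (F1 ?e \<cdot> cp1 ?Z J x' d') (F1 ?e \<cdot> cp1 ?Z J x d) =
      F1 ?e \<cdot> cp1 ?Z J (icomp C ?Z x' x) (icomp C J d' d)"
    if "x \<in> Arr C" "d \<in> Arr C" "Dom C x = Dom C d" "Cod C x = Mor ?Z" "Cod C d = Mor J"
      "x' \<in> Arr C" "d' \<in> Arr C" "Dom C x' = Dom C d'" "Cod C x' = Mor ?Z" "Cod C d' = Mor J"
      "Src ?Z \<cdot> x' = Tgt ?Z \<cdot> x" "Src J \<cdot> d' = Tgt J \<cdot> d" for x d x' d'
    using that ifun_icomp[of ?e "prod_obj (CAT C) ?Z J" "cp1 ?Z J x' d'" "cp1 ?Z J x d"] by simp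
  have "icomp C A (F1 F \<cdot> u) (component J A \<gamma> (Src J \<cdot> u)) = F1 ?e \<cdot> cp1 ?Z J (\<gamma> \<cdot> ?t) u"
    unfolding Fu component_def using u by (subst ee) (simp_all add: s)
  also have "\<dots> = icomp C A (component J A \<gamma> (Tgt J \<cdot> u))
      (F1 ?e \<cdot> cp1 ?Z J (Ids ?Z \<cdot> (F0 (diag C J A) \<cdot> (F0 V \<cdot> ?t))) u)"
    unfolding component_def using u by (subst ee) (simp_all add: s)
  also have "\<dots> = component J A \<gamma> (Tgt J \<cdot> u)"
    unfolding Ve[symmetric] using u by (intro icomp_Ids_right) (simp_all add: component_def s)
  finally show "icomp C A (F1 F \<cdot> u) (component J A \<gamma> (Src J \<cdot> u)) = component J A \<gamma> (Tgt J \<cdot> u)" .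
qed

lemma cone_elem_cone:
  assumes F: "internal_functor C F" "FDom F = J" "FCod F = A" and cone: "(V, \<gamma>) \<in> Obj (cone_cat C F)"
  shows "elem_cone F (Ob (terminal (CAT C))) (F0 V) (component J A \<gamma> (Idn C (Ob J)))"
proof -
  note [simp] = F cone_cat_ObjD[OF F cone]
  have [simp]: "internal_category C J" "internal_category C A" using ifun_simps(1,2)[OF F(1)]
    by simp_all
  show ?thesis
    unfolding elem_cone_def
    using component_Src[OF F cone, of "Idn C (Ob J)"] component_Tgt[OF F cone, of "Idn C (Ob J)"]
        component_natural[OF F cone]
    by (simp add: component_comp)
qed

text \<open>Every cone by components comes from a cone: the object of natural transformations
  classifies families of components.\<close>

lemma ex_cone:
  assumes F: "internal_functor C F" "FDom F = J" "FCod F = A"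
      and d: "elem_cone F (Ob (terminal (CAT C))) x \<delta>"
  obtains V \<gamma> where "(V, \<gamma>) \<in> Obj (cone_cat C F)" "F0 V = x" "component J A \<gamma> (Idn C (Ob J)) = \<delta>"
proof -
  let ?Z = "expo (CAT C) J A" and ?T = "terminal (CAT C)" and ?e = "ev (CAT C) J A"
  note [simp] = F
  have [simp]: "internal_category C J" "internal_category C A" using ifun_simps(1,2)[OF F(1)]
    by simp_all
  have x [simp]: "x \<in> Arr C" "Dom C x = Ob ?T" "Cod C x = Ob A" "\<delta> \<in> Arr C" "Dom C \<delta> = Ob J"
      "Cod C \<delta> = Mor A"
    and \<delta>: "Src A \<cdot> \<delta> = x \<cdot> tt (Ob J)" "Tgt A \<cdot> \<delta> = F0 F"
      "\<And>V u. u \<in> Hom C V (Mor J) \<Longrightarrow> icomp C A (F1 F \<cdot> u) (\<delta> \<cdot> (Src J \<cdot> u)) = \<delta> \<cdot> (Tgt J \<cdot> u)"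
    using d unfolding elem_cone_def by simp_all
  have \<delta>' [simp]: "Src A \<cdot> (\<delta> \<cdot> d) = x \<cdot> tt (Dom C d)" "Tgt A \<cdot> (\<delta> \<cdot> d) = F0 F \<cdot> d"
      if "d \<in> Arr C" "Cod C d = Ob J" for d
    using comp_eq_comp[OF \<delta>(1), of d] comp_eq_comp[OF \<delta>(2), of d] that by simp_all
  obtain V where V: "V \<in> Hom (CAT C) ?T A" "F0 V = x" using ex_terminal_functor[of A x] x(1-3) by auto
  have [simp]: "internal_functor C V" "FDom V = ?T" "FCod V = A" "F0 V = x" using V by simp_all
  let ?s = "F0 (diag C J A) \<cdot> x" and ?t = "F0 (point C F)"
  have "\<exists>n\<in>Hom C (Ob ?T) (Mor ?Z). Src ?Z \<cdot> n = ?s \<and> Tgt ?Z \<cdot> n = ?t \<and>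
      (\<forall>V w d. w \<in> Hom C V (Ob ?T) \<longrightarrow> d \<in> Hom C V (Ob J) \<longrightarrow> F1 ?e \<cdot> cp1 ?Z J (n \<cdot> w) (Ids J \<cdot> d) = \<delta> \<cdot> d)"
  proof (rule ev_transposes[of J A, unfolded transposes_transformations_def, THEN conjunct2,
      rule_format])
    fix V w d assume w: "w \<in> Hom C V (Ob ?T)" "d \<in> Hom C V (Ob J)"
    then have "w = tt (Dom C w)" by (intro to_tt) simp_all
    then show "\<delta> \<cdot> d \<in> Hom C V (Mor A) \<and>
        Src A \<cdot> (\<delta> \<cdot> d) = F0 ?e \<cdot> cp0 ?Z J ((F0 (diag C J A) \<cdot> x) \<cdot> w) d \<and>
       Tgt A \<cdot> (\<delta> \<cdot> d) = F0 ?e \<cdot> cp0 ?Z J (F0 (point C F) \<cdot> w) d"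
      using w by simp
  next
    fix V w u assume w: "w \<in> Hom C V (Ob ?T)" "u \<in> Hom C V (Mor J)"
    have Fu: "F1 ?e \<cdot> cp1 ?Z J (Ids ?Z \<cdot> (F0 (point C F) \<cdot> w)) u = F1 F \<cdot> u"
      using point_elements(5)[OF F, of "Ids ?T \<cdot> w" u] w by (simp del: point_elements(5))
    have Ve: "F1 ?e \<cdot> cp1 ?Z J (Ids ?Z \<cdot> (F0 (diag C J A) \<cdot> (x \<cdot> w))) u = Ids A \<cdot> (x \<cdot> w)"
      using diag_elements(5)[of J A "Ids A \<cdot> (x \<cdot> w)" u] w by (simp del: diag_elements(5))
    have "w = tt (Dom C w)" using w by (intro to_tt) simp_all
    then show "icomp C A (\<delta> \<cdot> (Tgt J \<cdot> u)) (F1 ?e \<cdot> cp1 ?Z J (Ids ?Z \<cdot> ((F0 (diag C J A) \<cdot> x) \<cdot> w)) u) =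
      icomp C A (F1 ?e \<cdot> cp1 ?Z J (Ids ?Z \<cdot> (F0 (point C F) \<cdot> w)) u) (\<delta> \<cdot> (Src J \<cdot> u))"
      using w \<delta>(3)[OF w(2)] Fu Ve by simp
  qed simp_all
  then obtain \<gamma> where \<gamma>: "\<gamma> \<in> Hom C (Ob ?T) (Mor ?Z)" "Src ?Z \<cdot> \<gamma> = ?s" "Tgt ?Z \<cdot> \<gamma> = ?t"
    and \<gamma>d: "\<And>V w d. w \<in> Hom C V (Ob ?T) \<Longrightarrow> d \<in> Hom C V (Ob J) \<Longrightarrow>
        F1 ?e \<cdot> cp1 ?Z J (\<gamma> \<cdot> w) (Ids J \<cdot> d) = \<delta> \<cdot> d" by blast
  have "nat_trans C (diag C J A \<cdot>\<^bsub>CAT C\<^esub> V) (point C F) \<gamma>"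
    by (subst nat_trans_terminal[of _ "expo (CAT C) J A"]) (use \<gamma> in simp_all)
  then have "(V, \<gamma>) \<in> Obj (cone_cat C F)" by simp
  moreover have "component J A \<gamma> (Idn C (Ob J)) = \<delta>"
    using \<gamma>d[of "tt (Ob J)" "Ob J" "Idn C (Ob J)"] by (simp add: component_def)
  ultimately show thesis using that V by blast
qed

text \<open>Morphisms of cones can be recognized on components, because arrows to \<open>Mor [J, A]\<close> with equal
  sources, targets and components are equal.\<close>

lemma cone_arrow_iff:
  assumes F: "internal_functor C F" "FDom F = J" "FCod F = A"
    and c0: "(V0, \<gamma>0) \<in> Obj (cone_cat C F)" and c1: "(V1, \<gamma>1) \<in> Obj (cone_cat C F)"
  shows "((V0, \<gamma>0), h, (V1, \<gamma>1)) \<in> Arr (cone_cat C F) \<longleftrightarrow>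
     h \<in> Hom C (Ob (terminal (CAT C))) (Mor A) \<and> Src A \<cdot> h = F0 V0 \<and> Tgt A \<cdot> h = F0 V1 \<and>
     icomp C A (component J A \<gamma>1 (Idn C (Ob J))) (h \<cdot> tt (Ob J)) = component J A \<gamma>0 (Idn C (Ob J))"
proof -
  let ?Z = "expo (CAT C) J A" and ?T = "terminal (CAT C)" and ?e = "ev (CAT C) J A"
      and ?\<Delta> = "diag C J A"
  note [simp] = F
  have [simp]: "internal_category C J" "internal_category C A" using ifun_simps(1,2)[OF F(1)]
    by simp_all
  note c0' [simp] = cone_cat_ObjD[OF F c0] and c1' [simp] = cone_cat_ObjD[OF F c1]
  have nt: "nat_trans C V0 V1 h \<longleftrightarrow> h \<in> Hom C (Ob ?T) (Mor A) \<and> Src A \<cdot> h = F0 V0 \<and> Tgt A \<cdot> h = F0 V1"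
    by (rule nat_trans_terminal) simp_all
  have "icomp C ?Z \<gamma>1 (F1 ?\<Delta> \<cdot> h) = \<gamma>0 \<longleftrightarrow>
      icomp C A (component J A \<gamma>1 (Idn C (Ob J))) (h \<cdot> tt (Ob J)) = component J A \<gamma>0 (Idn C (Ob J))"
    if h: "h \<in> Hom C (Ob ?T) (Mor A)" "Src A \<cdot> h = F0 V0" "Tgt A \<cdot> h = F0 V1"
  proof -
    have h' [simp]: "h \<in> Arr C" "Dom C h = Ob ?T" "Cod C h = Mor A" "Src A \<cdot> h = F0 V0"
        "Tgt A \<cdot> h = F0 V1" using h by simp_all
    have hst [simp]: "Src A \<cdot> (h \<cdot> w) = F0 V0 \<cdot> w" "Tgt A \<cdot> (h \<cdot> w) = F0 V1 \<cdot> w"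
        if "w \<in> Arr C" "Cod C w = Ob ?T" for w
      using comp_eq_comp[OF h(2), of w] comp_eq_comp[OF h(3), of w] that by simp_all
    let ?n = "icomp C ?Z \<gamma>1 (F1 ?\<Delta> \<cdot> h)"
    have n [simp]: "?n \<in> Arr C" "Dom C ?n = Ob ?T" "Cod C ?n = Mor ?Z" "Src ?Z \<cdot> ?n = Src ?Z \<cdot> \<gamma>0"
        "Tgt ?Z \<cdot> ?n = Tgt ?Z \<cdot> \<gamma>0"
      by simp_all
    have s: "Src ?Z \<cdot> (\<gamma>1 \<cdot> t) = F0 ?\<Delta> \<cdot> (F0 V1 \<cdot> t)" if "t \<in> Arr C" "Cod C t = Ob ?T" for t
      using comp_eq_comp[OF c1'(7), of t] that by simp
    have comp: "component J A ?n d = icomp C A (component J A \<gamma>1 d) (h \<cdot> tt (Dom C d))"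
        if "d \<in> Arr C" "Cod C d = Ob J" for d
    proof -
      let ?t = "tt (Dom C d)"
      have hd: "h \<cdot> ?t = F1 ?e \<cdot> cp1 ?Z J (F1 ?\<Delta> \<cdot> (h \<cdot> ?t)) (Ids J \<cdot> d)"
        using diag_elements(5)[of J A "h \<cdot> ?t" "Ids J \<cdot> d"] that by simp
      have "component J A ?n d =
          F1 ?e \<cdot> cp1 ?Z J (icomp C ?Z (\<gamma>1 \<cdot> ?t) (F1 ?\<Delta> \<cdot> (h \<cdot> ?t)))
          (icomp C J (Ids J \<cdot> d) (Ids J \<cdot> d))"
        using that by (simp add: component_def icomp_comp)
      also have "\<dots> = icomp C A (component J A \<gamma>1 d) (F1 ?e \<cdot> cp1 ?Z J (F1 ?\<Delta> \<cdot> (h \<cdot> ?t)) (Ids J \<cdot> d))"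
        using that ifun_icomp[of ?e "prod_obj (CAT C) ?Z J" "cp1 ?Z J (\<gamma>1 \<cdot> ?t) (Ids J \<cdot> d)"
            "cp1 ?Z J (F1 ?\<Delta> \<cdot> (h \<cdot> ?t)) (Ids J \<cdot> d)"]
        by (simp add: component_def s)
      finally show ?thesis unfolding hd[symmetric] .
    qed
    show ?thesis
    proof
      assume "?n = \<gamma>0"
      with comp[of "Idn C (Ob J)"]
      show "icomp C A (component J A \<gamma>1 (Idn C (Ob J))) (h \<cdot> tt (Ob J)) =
          component J A \<gamma>0 (Idn C (Ob J))" by simp
    next
      assume e: "icomp C A (component J A \<gamma>1 (Idn C (Ob J))) (h \<cdot> tt (Ob J)) =
          component J A \<gamma>0 (Idn C (Ob J))"
      have e1: "component J A ?n (Idn C (Ob J)) = component J A \<gamma>0 (Idn C (Ob J))"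
        using comp[of "Idn C (Ob J)"] e by simp
      show "?n = \<gamma>0"
      proof (rule ev_transposes[of J A, unfolded transposes_transformations_def, THEN conjunct1,
          rule_format])
        fix V w d assume w: "w \<in> Hom C V (Ob ?T)" "d \<in> Hom C V (Ob J)"
        have wt: "w = tt (Dom C d)" using to_tt[of w] w by simp
        have "component J A ?n d = component J A ?n (Idn C (Ob J)) \<cdot> d"
          using w component_comp[of J A ?n "Idn C (Ob J)" d] by simp
        also have "\<dots> = component J A \<gamma>0 d"
          unfolding e1 using w component_comp[of J A \<gamma>0 "Idn C (Ob J)" d] by simp
        finally show "F1 ?e \<cdot> cp1 ?Z J (?n \<cdot> w) (Ids J \<cdot> d) = F1 ?e \<cdot> cp1 ?Z J (\<gamma>0 \<cdot> w) (Ids J \<cdot> d)"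
          unfolding component_def wt .
      qed (simp_all del: icomp_simps)
    qed
  qed
  then show ?thesis unfolding cone_cat_Hom using c0 c1 nt F by auto
qed

lemma terminal_cone_elem_universal:
  assumes F: "internal_functor C F" "FDom F = J" "FCod F = A" and t: "is_terminal (cone_cat C F) (V, \<gamma>)"
  shows "elem_universal F (Ob (terminal (CAT C))) (F0 V) (component J A \<gamma> (Idn C (Ob J)))"
  unfolding elem_universal_def
proof (intro conjI allI impI)
  have c: "(V, \<gamma>) \<in> Obj (cone_cat C F)" using t unfolding is_terminal_def by blast
  then show "elem_cone F (Ob (terminal (CAT C))) (F0 V) (component J A \<gamma> (Idn C (Ob J)))"
    by (rule cone_elem_cone[OF F])
  fix x \<delta>' assume "elem_cone F (Ob (terminal (CAT C))) x \<delta>'"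
  then obtain U \<gamma>' where U: "(U, \<gamma>') \<in> Obj (cone_cat C F)" "F0 U = x"
      "component J A \<gamma>' (Idn C (Ob J)) = \<delta>'"
    by (rule ex_cone[OF F])
  then have "\<exists>!f. f \<in> Hom (cone_cat C F) (U, \<gamma>') (V, \<gamma>)" using t unfolding is_terminal_def by blast
  moreover have "f \<in> Hom (cone_cat C F) (U, \<gamma>') (V, \<gamma>) \<longleftrightarrow>
      (\<exists>h. f = ((U, \<gamma>'), h, (V, \<gamma>)) \<and> ((U, \<gamma>'), h, (V, \<gamma>)) \<in> Arr (cone_cat C F))" for f
    unfolding in_Hom by (cases f) (auto simp: cone_cat_def Let_def)
  ultimately have "\<exists>!h. ((U, \<gamma>'), h, (V, \<gamma>)) \<in> Arr (cone_cat C F)" by (metis prod.inject)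
  then show "\<exists>!h. h \<in> Hom C (Ob (terminal (CAT C))) (Mor (FCod F)) \<and> Src (FCod F) \<cdot> h = x \<and>
      Tgt (FCod F) \<cdot> h = F0 V \<and>
     icomp C (FCod F) (component J A \<gamma> (Idn C (Ob J))) (h \<cdot> tt (Ob (FDom F))) = \<delta>'"
    unfolding cone_arrow_iff[OF F U(1) c] U(2,3) F(2,3) .
qed

lemma elem_cone_change_terminal:
  assumes F: "internal_functor C F" and S: "is_terminal C S" and S': "is_terminal C S'"
      and c: "elem_cone F S v \<delta>"
  shows "elem_cone F S' (v \<cdot> to_terminal S S') \<delta>"
proof -
  have [simp]: "S \<in> Obj C" "S' \<in> Obj C" using S S' by (simp_all add: is_terminal_def)
  note [simp] = F to_terminal[OF S] to_terminal[OF S'] to_terminal_comp[OF S] to_terminal_comp[OF S']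
  show ?thesis using c unfolding elem_cone_def by simp
qed

lemma elem_universal_change_terminal:
  assumes F: "internal_functor C F" and S: "is_terminal C S" and S': "is_terminal C S'"
      and u: "elem_universal F S v \<delta>"
  shows "elem_universal F S' (v \<cdot> to_terminal S S') \<delta>"
proof -
  have [simp]: "S \<in> Obj C" "S' \<in> Obj C" using S S' by (simp_all add: is_terminal_def)
  note [simp] = F to_terminal[OF S] to_terminal[OF S'] to_terminal_comp[OF S] to_terminal_comp[OF S']
  let ?i = "to_terminal S S'" and ?j = "to_terminal S' S" and ?A = "FCod F" and ?J = "FDom F"
  have c: "elem_cone F S v \<delta>" and un: "\<And>x \<delta>'. elem_cone F S x \<delta>' \<Longrightarrow>
        \<exists>!h. h \<in> Hom C S (Mor ?A) \<and> Src ?A \<cdot> h = x \<and> Tgt ?A \<cdot> h = v \<and> icomp C ?A \<delta>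
            (h \<cdot> to_terminal S (Ob ?J)) = \<delta>'"
    using u unfolding elem_universal_def by blast+
  have v [simp]: "v \<in> Arr C" "Dom C v = S" "Cod C v = Ob ?A" using c unfolding elem_cone_def by simp_all
  have ij: "to_terminal S S = Idn C S" by (rule terminal_arrows_eq[OF S]) simp_all
  have ji: "to_terminal S' S' = Idn C S'" by (rule terminal_arrows_eq[OF S']) simp_all
  show ?thesis
    unfolding elem_universal_def
  proof (intro conjI allI impI)
    show "elem_cone F S' (v \<cdot> ?i) \<delta>" by (rule elem_cone_change_terminal[OF F S S' c])
    fix x \<delta>' assume c': "elem_cone F S' x \<delta>'"
    then have x [simp]: "x \<in> Arr C" "Dom C x = S'" "Cod C x = Ob ?A" unfolding elem_cone_def by simp_all
    from un[OF elem_cone_change_terminal[OF F S' S c']]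
    obtain h where h: "h \<in> Hom C S (Mor ?A)" "Src ?A \<cdot> h = x \<cdot> ?j" "Tgt ?A \<cdot> h = v"
        "icomp C ?A \<delta> (h \<cdot> to_terminal S (Ob ?J)) = \<delta>'"
      and hu: "\<And>k. k \<in> Hom C S (Mor ?A) \<Longrightarrow> Src ?A \<cdot> k = x \<cdot> ?j \<Longrightarrow> Tgt ?A \<cdot> k = v \<Longrightarrow>
        icomp C ?A \<delta> (k \<cdot> to_terminal S (Ob ?J)) = \<delta>' \<Longrightarrow> k = h" by (elim ex1E conjE) blast
    show "\<exists>!h. h \<in> Hom C S' (Mor ?A) \<and> Src ?A \<cdot> h = x \<and> Tgt ?A \<cdot> h = v \<cdot> ?i \<and>
        icomp C ?A \<delta> (h \<cdot> to_terminal S' (Ob ?J)) = \<delta>'"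
    proof (rule ex1I[of _ "h \<cdot> ?i"])
      have "Src ?A \<cdot> (h \<cdot> ?i) = (x \<cdot> ?j) \<cdot> ?i" by (rule comp_eq_comp[OF h(2)]) (use h(1) in simp_all)
      moreover have "Tgt ?A \<cdot> (h \<cdot> ?i) = v \<cdot> ?i" by (rule comp_eq_comp[OF h(3)]) (use h(1) in simp_all)
      ultimately show "h \<cdot> ?i \<in> Hom C S' (Mor ?A) \<and> Src ?A \<cdot> (h \<cdot> ?i) = x \<and> Tgt ?A \<cdot> (h \<cdot> ?i) = v \<cdot> ?i \<and>
          icomp C ?A \<delta> ((h \<cdot> ?i) \<cdot> to_terminal S' (Ob ?J)) = \<delta>'"
        using h(1,4) by (simp add: ij ji)
      fix k assume k: "k \<in> Hom C S' (Mor ?A) \<and> Src ?A \<cdot> k = x \<and> Tgt ?A \<cdot> k = v \<cdot> ?i \<and>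
          icomp C ?A \<delta> (k \<cdot> to_terminal S' (Ob ?J)) = \<delta>'"
      then have k' [simp]: "k \<in> Arr C" "Dom C k = S'" "Cod C k = Mor ?A" by simp_all
      have "k \<cdot> ?j = h"
      proof (rule hu)
        show "Src ?A \<cdot> (k \<cdot> ?j) = x \<cdot> ?j" by (rule comp_eq_comp) (use k in simp_all)
        have "Tgt ?A \<cdot> (k \<cdot> ?j) = (v \<cdot> ?i) \<cdot> ?j" by (rule comp_eq_comp) (use k in simp_all)
        then show "Tgt ?A \<cdot> (k \<cdot> ?j) = v" by (simp add: ij ji)
      qed (use k in simp_all)
      then have "(k \<cdot> ?j) \<cdot> ?i = h \<cdot> ?i" by simp
      then show "k = h \<cdot> ?i" by (simp add: ij ji)
    qed
  qed
qed

end

section \<open>Slices and base change\<close>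

text \<open>The underlying arrow of an arrow of a slice.\<close>

definition mid :: "'m \<times> 'm \<times> 'm \<Rightarrow> 'm" where
  "mid t = fst (snd t)"

lemma slice_unfold:
  "w \<in> Obj (slice C K) \<longleftrightarrow> w \<in> Arr C \<and> Cod C w = K"
  "t \<in> Arr (slice C K) \<longleftrightarrow> fst t \<in> Arr C \<and> Cod C (fst t) = K \<and> snd (snd t) \<in> Arr C \<and>
      Cod C (snd (snd t)) = K \<and>
     mid t \<in> Hom C (Dom C (fst t)) (Dom C (snd (snd t))) \<and> snd (snd t) \<cdot>\<^bsub>C\<^esub> mid t = fst t"
  "Dom (slice C K) t = fst t" "Cod (slice C K) t = snd (snd t)"
  "Idn (slice C K) w = (w, Idn C (Dom C w), w)"
  "s \<cdot>\<^bsub>slice C K\<^esub> t = (fst t, mid s \<cdot>\<^bsub>C\<^esub> mid t, snd (snd s))"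
  by (auto simp: slice_def mid_def split: prod.splits)

lemma mid_comp [simp]: "mid (s \<cdot>\<^bsub>slice C K\<^esub> t) = mid s \<cdot>\<^bsub>C\<^esub> mid t"
  and mid_Idn [simp]: "mid (Idn (slice C K) w) = Idn C (Dom C w)"
  and mid_triple [simp]: "mid (a, b, c) = b"
  by (simp_all add: slice_unfold mid_def)

lemma slice_eqI: "Dom (slice C K) s = Dom (slice C K) t \<Longrightarrow> Cod (slice C K) s = Cod (slice C K) t \<Longrightarrow>
    mid s = mid t \<Longrightarrow> s = t"
  by (simp add: slice_unfold mid_def prod_eq_iff)

lemma slice_Obj [simp]: "w \<in> Obj (slice C K) \<longleftrightarrow> w \<in> Arr C \<and> Cod C w = K"
  by (rule slice_unfold)

lemma mid_simps [simp]:
  assumes "t \<in> Arr (slice C K)"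
  shows "mid t \<in> Arr C" "Dom C (mid t) = Dom C (Dom (slice C K) t)"
      "Cod C (mid t) = Dom C (Cod (slice C K) t)"
    "Dom (slice C K) t \<in> Arr C" "Cod (slice C K) t \<in> Arr C"
    "Cod C (Dom (slice C K) t) = K" "Cod C (Cod (slice C K) t) = K"
    "Cod (slice C K) t \<cdot>\<^bsub>C\<^esub> mid t = Dom (slice C K) t"
  using assms by (simp_all add: slice_unfold)

lemma slice_ArrI:
  assumes "w \<in> Arr C" "Cod C w = K" "z \<in> Arr C" "Cod C z = K" "h \<in> Hom C (Dom C w) (Dom C z)"
      "z \<cdot>\<^bsub>C\<^esub> h = w"
  shows "(w, h, z) \<in> Hom (slice C K) w z"
  using assms by (simp add: slice_unfold(2-4))

lemma slice_triple [simp]: "Dom (slice C K) (w, h, z) = w" "Cod (slice C K) (w, h, z) = z"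
  by (simp_all add: slice_unfold)

context category
begin

lemma slice_category: "category (slice C K)"
proof
  fix f assume "f \<in> Arr (slice C K)"
  then show "Dom (slice C K) f \<in> Obj (slice C K)" "Cod (slice C K) f \<in> Obj (slice C K)" by simp_all
next
  fix X assume "X \<in> Obj (slice C K)"
  then show "Idn (slice C K) X \<in> Hom (slice C K) X X"
    unfolding slice_unfold(5) by (intro slice_ArrI) simp_all
next
  fix f X Y g Z assume "f \<in> Hom (slice C K) X Y" "g \<in> Hom (slice C K) Y Z"
  then have f: "f \<in> Arr (slice C K)" "fst f = X" "snd (snd f) = Y"
      and g: "g \<in> Arr (slice C K)" "fst g = Y" "snd (snd g) = Z"
    by (simp_all add: slice_unfold(3,4))
  note m = mid_simps[OF f(1), unfolded slice_unfold(3,4) f]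
      mid_simps[OF g(1), unfolded slice_unfold(3,4) g]
  have "Z \<cdot> (mid g \<cdot> mid f) = Y \<cdot> mid f" by (rule comp_eq_comp[OF m(16)]) (use m in simp_all)
  then have "Z \<cdot> (mid g \<cdot> mid f) = X" using m(8) by simp
  then show "g \<cdot>\<^bsub>slice C K\<^esub> f \<in> Hom (slice C K) X Z"
    unfolding slice_unfold(6) f g by (intro slice_ArrI) (use m in simp_all)
next
  fix f X Y assume f: "f \<in> Hom (slice C K) X Y"
  note m = mid_simps[of f C K]
  show "f \<cdot>\<^bsub>slice C K\<^esub> Idn (slice C K) X = f"
    by (rule slice_eqI[of C K]) (use f m in \<open>simp_all add: slice_unfold(3-6)\<close>)
  show "Idn (slice C K) Y \<cdot>\<^bsub>slice C K\<^esub> f = f"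
    by (rule slice_eqI[of C K]) (use f m in \<open>simp_all add: slice_unfold(3-6)\<close>)
next
  fix f W X g Y h Z assume fgh: "f \<in> Hom (slice C K) W X" "g \<in> Hom (slice C K) X Y"
      "h \<in> Hom (slice C K) Y Z"
  then have "mid h \<cdot> (mid g \<cdot> mid f) = (mid h \<cdot> mid g) \<cdot> mid f"
    using mid_simps[of f C K] mid_simps[of g C K] mid_simps[of h C K] by simp
  then show "h \<cdot>\<^bsub>slice C K\<^esub> (g \<cdot>\<^bsub>slice C K\<^esub> f) = (h \<cdot>\<^bsub>slice C K\<^esub> g) \<cdot>\<^bsub>slice C K\<^esub> f"
    by (simp add: slice_unfold(6))
qed

lemma slice_terminal: "K \<in> Obj C \<Longrightarrow> is_terminal (slice C K) (Idn C K)"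
  unfolding is_terminal_def
proof (intro conjI ballI)
  assume K: "K \<in> Obj C"
  show "Idn C K \<in> Obj (slice C K)" using K by simp
  fix w assume w: "w \<in> Obj (slice C K)"
  show "\<exists>!f. f \<in> Hom (slice C K) w (Idn C K)"
  proof (rule ex1I[of _ "(w, w, Idn C K)"])
    show "(w, w, Idn C K) \<in> Hom (slice C K) w (Idn C K)" by (rule slice_ArrI) (use K w in auto)
    fix f assume f: "f \<in> Hom (slice C K) w (Idn C K)"
    then have "Idn C K \<cdot> mid f = w" using mid_simps(8)[of f C K] by simp
    moreover have "Idn C K \<cdot> mid f = mid f" using f mid_simps[of f C K] K
      by (intro comp_Idn_left) simp_all
    ultimately show "f = (w, w, Idn C K)" by (intro slice_eqI[of C K]) (use f in simp_all)
  qed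
qed

end

context lex_cat
begin

lemma slice_lex: "K \<in> Obj C \<Longrightarrow> lex_cat (slice C K)"
proof -
  assume K: "K \<in> Obj C"
  interpret S: category "slice C K" by (rule slice_category)
  show ?thesis
  proof
    show "\<exists>T. is_terminal (slice C K) T" using slice_terminal[OF K] by blast
    fix s t assume st [simp]: "s \<in> Arr (slice C K)" "t \<in> Arr (slice C K)"
        "Cod (slice C K) s = Cod (slice C K) t"
    let ?f = "mid s" and ?g = "mid t" and ?z = "Cod (slice C K) t"
    let ?p = "pb1 C ?f ?g" and ?q = "pb2 C ?f ?g" and ?X = "Dom (slice C K) s"
        and ?Y = "Dom (slice C K) t"
    note [simp] = mid_simps[OF st(1)] mid_simps[OF st(2)]
    have zs: "?z \<cdot> ?f = ?X" using mid_simps(8)[OF st(1)] by (simp only: st(3))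
    have sq: "?f \<cdot> ?p = ?g \<cdot> ?q" by (rule pb_square) auto
    have "?z \<cdot> (?f \<cdot> ?p) = ?X \<cdot> ?p" by (rule comp_eq_comp[OF zs]) simp_all
    moreover have "?z \<cdot> (?g \<cdot> ?q) = ?Y \<cdot> ?q" by (rule comp_eq_comp[OF mid_simps(8)[OF st(2)]]) simp_all
    ultimately have Yq: "?Y \<cdot> ?q = ?X \<cdot> ?p" unfolding sq by metis
    let ?P = "(?X \<cdot> ?p, ?p, ?X)" and ?Q = "(?X \<cdot> ?p, ?q, ?Y)"
    have P: "?P \<in> Hom (slice C K) (?X \<cdot> ?p) ?X" by (rule slice_ArrI) simp_all
    have Q: "?Q \<in> Hom (slice C K) (?X \<cdot> ?p) ?Y" by (rule slice_ArrI) (simp_all add: Yq)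
    have "is_pullback (slice C K) s t ?P ?Q"
      unfolding is_pullback_def
    proof (rule bexI[of _ "?X \<cdot> ?p"], intro conjI allI impI)
      show "?P \<in> Hom (slice C K) (?X \<cdot> ?p) (Dom (slice C K) s)"
          "?Q \<in> Hom (slice C K) (?X \<cdot> ?p) (Dom (slice C K) t)" using P Q by auto
      show "s \<cdot>\<^bsub>slice C K\<^esub> ?P = t \<cdot>\<^bsub>slice C K\<^esub> ?Q"
        by (rule slice_eqI[of C K]) (use P Q sq in simp_all)
      fix w h k assume hk:
          "h \<in> Hom (slice C K) w (Dom (slice C K) s) \<and> k \<in> Hom (slice C K) w (Dom (slice C K) t) \<and>
         s \<cdot>\<^bsub>slice C K\<^esub> h = t \<cdot>\<^bsub>slice C K\<^esub> k"
      then have [simp]: "h \<in> Arr (slice C K)" "Dom (slice C K) h = w" "Cod (slice C K) h = ?X"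
        "k \<in> Arr (slice C K)" "Dom (slice C K) k = w" "Cod (slice C K) k = ?Y" by simp_all
      have mhk: "?f \<cdot> mid h = ?g \<cdot> mid k" using arg_cong[OF hk[THEN conjunct2, THEN conjunct2], of mid]
        by simp
      have w [simp]: "w \<in> Arr C" "Cod C w = K" "Dom C (mid h) = Dom C w" "mid h \<in> Arr C"
          "Cod C (mid h) = Dom C ?X"
        "Dom C (mid k) = Dom C w" "mid k \<in> Arr C" "Cod C (mid k) = Dom C ?Y" "?X \<cdot> mid h = w"
        using mid_simps[of h C K] mid_simps[of k C K] by simp_all
      let ?u = "(w, pbpair ?f ?g (mid h) (mid k), ?X \<cdot> ?p)"
      have u: "?u \<in> Hom (slice C K) w (?X \<cdot> ?p)" by (rule slice_ArrI) (simp_all add: mhk)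
      show "\<exists>!u. u \<in> Hom (slice C K) w (?X \<cdot> ?p) \<and> ?P \<cdot>\<^bsub>slice C K\<^esub> u = h \<and> ?Q \<cdot>\<^bsub>slice C K\<^esub> u = k"
      proof (rule ex1I[of _ ?u], intro conjI)
        show "?u \<in> Hom (slice C K) w (?X \<cdot> ?p)" by (rule u)
        show "?P \<cdot>\<^bsub>slice C K\<^esub> ?u = h" by (rule slice_eqI[of C K]) (use P u mhk in simp_all)
        show "?Q \<cdot>\<^bsub>slice C K\<^esub> ?u = k" by (rule slice_eqI[of C K]) (use Q u mhk in simp_all)
        fix v assume v: "v \<in> Hom (slice C K) w (?X \<cdot> ?p) \<and> ?P \<cdot>\<^bsub>slice C K\<^esub> v = h \<and>
            ?Q \<cdot>\<^bsub>slice C K\<^esub> v = k"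
        have m: "?p \<cdot> mid v = mid h" "?q \<cdot> mid v = mid k"
          using arg_cong[OF v[THEN conjunct2, THEN conjunct1], of mid]
              arg_cong[OF v[THEN conjunct2, THEN conjunct2], of mid] by simp_all
        have "mid v = pbpair ?f ?g (mid h) (mid k)"
          by (rule pb_eqI[of ?f ?g]) (use v m mhk mid_simps[of v C K] in simp_all)
        then show "v = ?u" by (intro slice_eqI[of C K]) (use v in simp_all)
      qed
    qed simp
    then show "\<exists>p q. is_pullback (slice C K) s t p q" by blast
  qed
qed

end

text \<open>Base change \<open>K\<^sup>*\<close> from \<open>C\<close> to \<open>C/K\<close>. Generalized elements of \<open>K\<^sup>*X\<close> at the stage \<open>w\<close> of \<open>C/K\<close>
  correspond to generalized elements of \<open>X\<close> at the stage \<open>Dom w\<close>; \<open>low\<close> and \<open>lift\<close> are the two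
  directions of this bijection.\<close>

locale base_change = lex_cat C for C :: "('o, 'm) cat" (structure) +
  fixes K :: 'o
  assumes K [simp]: "K \<in> Obj C"
begin

abbreviation S :: "('m, 'm \<times> 'm \<times> 'm) cat" where "S \<equiv> slice C K"

sublocale S: lex_cat "slice C K" by (rule slice_lex) simp

abbreviation st :: "'o \<Rightarrow> 'm" where "st \<equiv> star_obj C K"

definition low :: "'o \<Rightarrow> 'm \<times> 'm \<times> 'm \<Rightarrow> 'm" where
  "low X t = pb2 C (bang C K) (bang C X) \<cdot> mid t"

definition lift :: "'o \<Rightarrow> 'm \<Rightarrow> 'm \<Rightarrow> 'm \<times> 'm \<times> 'm" where
  "lift X w x = (w, pbpair (bang C K) (bang C X) w x, st X)"

lemma st_simps [simp]:
  assumes "X \<in> Obj C"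
  shows "st X \<in> Arr C" "Cod C (st X) = K" "Dom C (st X) = pb_obj C (bang C K) (bang C X)"
  using assms by (simp_all add: star_obj_def)

lemma low_simps [simp]:
  assumes "t \<in> Arr S" "Cod S t = st X" "X \<in> Obj C"
  shows "low X t \<in> Arr C" "Dom C (low X t) = Dom C (Dom S t)" "Cod C (low X t) = X"
  using assms mid_simps[OF assms(1)] by (simp_all add: low_def)

lemma low_comp:
  assumes "t \<in> Arr S" "Cod S t = st X" "X \<in> Obj C" "s \<in> Arr S" "Cod S s = Dom S t"
  shows "low X (t \<cdot>\<^bsub>S\<^esub> s) = low X t \<cdot> mid s"
  using assms mid_simps[OF assms(1)] mid_simps[OF assms(4)] by (simp add: low_def)

lemma lift_simps [simp]:
  assumes "w \<in> Arr C" "Cod C w = K" "x \<in> Arr C" "Dom C x = Dom C w" "Cod C x = X"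
  shows "lift X w x \<in> Arr S" "Dom S (lift X w x) = w" "Cod S (lift X w x) = st X"
      "low X (lift X w x) = x"
proof -
  have X: "X \<in> Obj C" using assms by auto
  have e: "bang C K \<cdot> w = bang C X \<cdot> x" by (rule bang_eq) (use assms X in simp_all)
  have "lift X w x \<in> Hom S w (st X)"
    unfolding lift_def by (rule slice_ArrI) (use assms X e in \<open>simp_all add: star_obj_def\<close>)
  then show "lift X w x \<in> Arr S" "Dom S (lift X w x) = w" "Cod S (lift X w x) = st X" by simp_all
  show "low X (lift X w x) = x" using assms X e by (simp add: low_def lift_def)
qed

lemma low_eqI:
  assumes "t \<in> Arr S" "t' \<in> Arr S" "Dom S t = Dom S t'" "Cod S t = st X" "Cod S t' = st X" "X \<in> Obj C"
      "low X t = low X t'"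
  shows "t = t'"
proof (rule slice_eqI[of C K])
  note m = mid_simps[OF assms(1)] mid_simps[OF assms(2)]
  have "st X \<cdot> mid t = st X \<cdot> mid t'"
    using m(8) m(16) assms(3-5) by metis
  then show "mid t = mid t'"
    by - (rule pb_eqI[of "bang C K" "bang C X"]; use assms m(1-7) m(9-15) in
        \<open>simp add: low_def star_obj_def\<close>)
qed (use assms in simp_all)

lemma star_arr_simps [simp]:
  assumes "f \<in> Arr C"
  shows "star_arr C K f \<in> Arr S" "Dom S (star_arr C K f) = st (Dom C f)"
      "Cod S (star_arr C K f) = st (Cod C f)"
proof -
  have e: "bang C K \<cdot> pb1 C (bang C K) (bang C (Dom C f)) =
      bang C (Cod C f) \<cdot> (f \<cdot> pb2 C (bang C K) (bang C (Dom C f)))"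
    by (rule bang_eq) (use assms in simp_all)
  have "star_arr C K f \<in> Hom S (st (Dom C f)) (st (Cod C f))"
    unfolding star_arr_def Let_def by (rule slice_ArrI) (use assms e in \<open>simp_all add: star_obj_def\<close>)
  then show "star_arr C K f \<in> Arr S" "Dom S (star_arr C K f) = st (Dom C f)"
      "Cod S (star_arr C K f) = st (Cod C f)" by simp_all
qed

lemma low_star_arr:
  assumes "f \<in> Arr C" "Cod C f = Y"
  shows "low Y (star_arr C K f) = f \<cdot> pb2 C (bang C K) (bang C (Dom C f))"
proof -
  have Y: "Y \<in> Obj C" using assms by auto
  have e: "bang C K \<cdot> pb1 C (bang C K) (bang C (Dom C f)) =
      bang C (Cod C f) \<cdot> (f \<cdot> pb2 C (bang C K) (bang C (Dom C f)))"
    by (rule bang_eq) (use assms Y in simp_all)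
  then show ?thesis using assms Y unfolding star_arr_def Let_def low_def by simp
qed

lemma low_star_arr_comp [simp]:
  assumes "f \<in> Arr C" "Cod C f = Y" "t \<in> Arr S" "Cod S t = st (Dom C f)"
  shows "low Y (star_arr C K f \<cdot>\<^bsub>S\<^esub> t) = f \<cdot> low (Dom C f) t"
proof -
  have Y: "Y \<in> Obj C" using assms by auto
  have "low Y (star_arr C K f \<cdot>\<^bsub>S\<^esub> t) = low Y (star_arr C K f) \<cdot> mid t"
    by (rule low_comp) (use assms Y in simp_all)
  also have "\<dots> = f \<cdot> low (Dom C f) t"
    unfolding low_star_arr[OF assms(1,2)] using assms mid_simps[OF assms(3)] by (simp add: low_def)
  finally show ?thesis .
qed

lemma star_arr_comp [simp]:
  assumes "f \<in> Arr C" "g \<in> Arr C" "Dom C g = Cod C f"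
  shows "star_arr C K g \<cdot>\<^bsub>S\<^esub> star_arr C K f = star_arr C K (g \<cdot> f)"
proof (rule low_eqI[of _ _ "Cod C g"])
  show "low (Cod C g) (star_arr C K g \<cdot>\<^bsub>S\<^esub> star_arr C K f) = low (Cod C g) (star_arr C K (g \<cdot> f))"
    using assms by (simp add: low_star_arr)
qed (use assms in simp_all)

lemma low_Idn: "X \<in> Obj C \<Longrightarrow> low X (Idn S (st X)) = pb2 C (bang C K) (bang C X)"
  by (simp add: low_def)

lemma star_arr_Idn: "X \<in> Obj C \<Longrightarrow> star_arr C K (Idn C X) = Idn S (st X)"
  by (rule low_eqI[of _ _ X]) (simp_all add: low_star_arr low_Idn)

lemma star_terminal: "is_terminal C T \<Longrightarrow> is_terminal S (st T)"
  unfolding is_terminal_def[of S]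
proof (intro conjI ballI)
  assume T: "is_terminal C T"
  have TO [simp]: "T \<in> Obj C" using T by (simp add: is_terminal_def)
  show "st T \<in> Obj S" by simp
  fix w assume "w \<in> Obj S"
  then have w: "w \<in> Arr C" "Cod C w = K" by simp_all
  note tt = to_terminal[OF T, of "Dom C w"]
  show "\<exists>!f. f \<in> Hom S w (st T)"
  proof (rule ex1I[of _ "lift T w (to_terminal T (Dom C w))"])
    show "lift T w (to_terminal T (Dom C w)) \<in> Hom S w (st T)" using w tt by simp
    fix f assume f: "f \<in> Hom S w (st T)"
    have "low T f = to_terminal T (Dom C w)" by (rule terminal_arrows_eq[OF T]) (use f w tt in simp_all)
    then show "f = lift T w (to_terminal T (Dom C w))" using f w tt
      by (intro low_eqI[of _ _ T]) simp_all
  qed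
qed

lemma star_product:
  assumes P: "is_product C X Y p q"
  shows "is_product S (st X) (st Y) (star_arr C K p) (star_arr C K q)"
proof (rule S.is_productI)
  note [simp] = is_productD[OF P]
  have [simp]: "X \<in> Obj C" "Y \<in> Obj C" using Cod_Obj[of p] Cod_Obj[of q] by simp_all
  show "star_arr C K p \<in> Arr S" "star_arr C K q \<in> Arr S"
      "Dom S (star_arr C K q) = Dom S (star_arr C K p)"
    "Cod S (star_arr C K p) = st X" "Cod S (star_arr C K q) = st Y" by simp_all
  fix w f g assume fg: "f \<in> Hom S w (st X)" "g \<in> Hom S w (st Y)"
  then have [simp]: "f \<in> Arr S" "Dom S f = w" "Cod S f = st X" "g \<in> Arr S" "Dom S g = w"
      "Cod S g = st Y" by simp_all
  have [simp]: "w \<in> Arr C" "Cod C w = K" using mid_simps(4,6)[of f C K] by simp_all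
  note [simp] = pair_product[OF P, of "low X f" "low Y g"]
  let ?u = "lift (Dom C p) w (pair_into C p q (low X f) (low Y g))"
  show "\<exists>u\<in>Hom S w (Dom S (star_arr C K p)). star_arr C K p \<cdot>\<^bsub>S\<^esub> u = f \<and> star_arr C K q \<cdot>\<^bsub>S\<^esub> u = g"
  proof (rule bexI[of _ ?u], intro conjI)
    show "star_arr C K p \<cdot>\<^bsub>S\<^esub> ?u = f" by (rule low_eqI[of _ _ X]) simp_all
    show "star_arr C K q \<cdot>\<^bsub>S\<^esub> ?u = g" by (rule low_eqI[of _ _ Y]) simp_all
  qed simp_all
next
  note [simp] = is_productD[OF P]
  have [simp]: "X \<in> Obj C" "Y \<in> Obj C" using Cod_Obj[of p] Cod_Obj[of q] by simp_all
  fix u v assume uv: "u \<in> Arr S" "v \<in> Arr S" "Dom S u = Dom S v" "Cod S u = Dom S (star_arr C K p)"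
      "Cod S v = Dom S (star_arr C K p)"
    "star_arr C K p \<cdot>\<^bsub>S\<^esub> u = star_arr C K p \<cdot>\<^bsub>S\<^esub> v" "star_arr C K q \<cdot>\<^bsub>S\<^esub> u = star_arr C K q \<cdot>\<^bsub>S\<^esub> v"
  have "p \<cdot> low (Dom C p) u = p \<cdot> low (Dom C p) v" "q \<cdot> low (Dom C p) u = q \<cdot> low (Dom C p) v"
    using arg_cong[OF uv(6), of "low X"] arg_cong[OF uv(7), of "low Y"] uv(1-5) by simp_all
  then have "low (Dom C p) u = low (Dom C p) v" by - (rule product_eqI[OF P]; use uv(1-5) in simp)
  then show "u = v" by - (rule low_eqI[of _ _ "Dom C p"]; use uv(1-5) in simp)
qed

subsection \<open>Base change of internal categories and functors\<close>

lemma star_icat_simps [simp]: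
  "Ob (star_icat C K A) = st (Ob A)" "Mor (star_icat C K A) = st (Mor A)"
      "Src (star_icat C K A) = star_arr C K (Src A)"
  "Tgt (star_icat C K A) = star_arr C K (Tgt A)" "Ids (star_icat C K A) = star_arr C K (Ids A)"
  by (simp_all add: star_icat_def Let_def)

lemma star_ifun_simps [simp]:
  "FDom (star_ifun C K F) = star_icat C K (FDom F)" "FCod (star_ifun C K F) = star_icat C K (FCod F)"
  "F0 (star_ifun C K F) = star_arr C K (F0 F)" "F1 (star_ifun C K F) = star_arr C K (F1 F)"
  by (simp_all add: star_ifun_def)

text \<open>Under the bijection \<open>low\<close>, composition in \<open>K\<^sup>*A\<close> is composition in \<open>A\<close>.\<close>

lemma star_Cmp:
  assumes [simp]: "internal_category C A"
  shows "Cmp (star_icat C K A) \<in> Hom S (pb_obj S (star_arr C K (Src A)) (star_arr C K (Tgt A)))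
      (st (Mor A))"
    "\<And>g f. g \<in> Arr S \<Longrightarrow> f \<in> Arr S \<Longrightarrow> Dom S g = Dom S f \<Longrightarrow> Cod S g = st (Mor A) \<Longrightarrow> Cod S f = st (Mor A) \<Longrightarrow>
      Src A \<cdot> low (Mor A) g = Tgt A \<cdot> low (Mor A) f \<Longrightarrow>
      icomp S (star_icat C K A) g f \<in> Hom S (Dom S f) (st (Mor A)) \<and>
      low (Mor A) (icomp S (star_icat C K A) g f) = icomp C A (low (Mor A) g) (low (Mor A) f)"
proof -
  let ?s = "star_arr C K (Src A)" and ?t = "star_arr C K (Tgt A)" and ?P = "pb_obj C (Src A) (Tgt A)"
  let ?p = "pb1 C (Src A) (Tgt A)" and ?q = "pb2 C (Src A) (Tgt A)"
  let ?p' = "pb1 S ?s ?t" and ?q' = "pb2 S ?s ?t" and ?P' = "pb_obj S ?s ?t"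
  let ?u = "pair_into S (star_arr C K ?p) (star_arr C K ?q) ?p' ?q'"
  have sq: "Src A \<cdot> low (Mor A) ?p' = Tgt A \<cdot> low (Mor A) ?q'"
    using arg_cong[OF S.pb_square[of ?s ?t], of "low (Ob A)"] by simp
  have P' [simp]: "?P' \<in> Arr C" "Cod C ?P' = K" using S.pb_simps(7)[of ?s ?t] by simp_all
  let ?w = "lift ?P ?P' (pbpair (Src A) (Tgt A) (low (Mor A) ?p') (low (Mor A) ?q'))"
  have w: "?w \<in> Hom S ?P' (st ?P)" using sq by simp
  have wp: "star_arr C K ?p \<cdot>\<^bsub>S\<^esub> ?w = ?p'" by (rule low_eqI[of _ _ "Mor A"]) (use sq in simp_all)
  have wq: "star_arr C K ?q \<cdot>\<^bsub>S\<^esub> ?w = ?q'" by (rule low_eqI[of _ _ "Mor A"]) (use sq in simp_all)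
  have "\<exists>!u. u \<in> Hom S (Dom S ?p') (Dom S (star_arr C K ?p)) \<and> star_arr C K ?p \<cdot>\<^bsub>S\<^esub> u = ?p' \<and>
      star_arr C K ?q \<cdot>\<^bsub>S\<^esub> u = ?q'"
  proof (rule ex1I[of _ ?w])
    show "?w \<in> Hom S (Dom S ?p') (Dom S (star_arr C K ?p)) \<and> star_arr C K ?p \<cdot>\<^bsub>S\<^esub> ?w = ?p' \<and>
        star_arr C K ?q \<cdot>\<^bsub>S\<^esub> ?w = ?q'"
      using w wp wq by simp
    fix v assume v: "v \<in> Hom S (Dom S ?p') (Dom S (star_arr C K ?p)) \<and> star_arr C K ?p \<cdot>\<^bsub>S\<^esub> v = ?p' \<and>
        star_arr C K ?q \<cdot>\<^bsub>S\<^esub> v = ?q'"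
    then have vp: "star_arr C K ?p \<cdot>\<^bsub>S\<^esub> v = ?p'" and vq: "star_arr C K ?q \<cdot>\<^bsub>S\<^esub> v = ?q'" by blast+
    have v' [simp]: "v \<in> Arr S" "Dom S v = ?P'" "Cod S v = st ?P" using v by simp_all
    have "?p \<cdot> low ?P v = low (Mor A) ?p'" "?q \<cdot> low ?P v = low (Mor A) ?q'"
      using arg_cong[OF vp, of "low (Mor A)"] arg_cong[OF vq, of "low (Mor A)"] by simp_all
    then have "low ?P v = low ?P ?w" using sq by - (rule pb_eqI[of "Src A" "Tgt A"]; simp)
    then show "v = ?w" using w by - (rule low_eqI[of _ _ ?P]; simp)
  qed
  from theI'[OF this] have u: "?u \<in> Hom S ?P' (st ?P)" "star_arr C K ?p \<cdot>\<^bsub>S\<^esub> ?u = ?p'"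
      "star_arr C K ?q \<cdot>\<^bsub>S\<^esub> ?u = ?q'"
    unfolding pair_into_def[symmetric] by simp_all
  have Cmp: "Cmp (star_icat C K A) = star_arr C K (Cmp A) \<cdot>\<^bsub>S\<^esub> ?u" by (simp add: star_icat_def Let_def)
  show "Cmp (star_icat C K A) \<in> Hom S ?P' (st (Mor A))" unfolding Cmp using u by simp
  fix g f assume gf [simp]: "g \<in> Arr S" "f \<in> Arr S" "Dom S g = Dom S f" "Cod S g = st (Mor A)"
      "Cod S f = st (Mor A)"
    "Src A \<cdot> low (Mor A) g = Tgt A \<cdot> low (Mor A) f"
  have c [simp]: "?s \<cdot>\<^bsub>S\<^esub> g = ?t \<cdot>\<^bsub>S\<^esub> f" by (rule low_eqI[of _ _ "Ob A"]) simp_all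
  let ?x = "S.pbpair ?s ?t g f"
  have ux: "?u \<cdot>\<^bsub>S\<^esub> ?x \<in> Arr S" "Dom S (?u \<cdot>\<^bsub>S\<^esub> ?x) = Dom S f" "Cod S (?u \<cdot>\<^bsub>S\<^esub> ?x) = st ?P" using u
    by simp_all
  have pqux: "star_arr C K ?p \<cdot>\<^bsub>S\<^esub> (?u \<cdot>\<^bsub>S\<^esub> ?x) = ?p' \<cdot>\<^bsub>S\<^esub> ?x"
      "star_arr C K ?q \<cdot>\<^bsub>S\<^esub> (?u \<cdot>\<^bsub>S\<^esub> ?x) = ?q' \<cdot>\<^bsub>S\<^esub> ?x"
    by (rule S.comp_eq_comp[OF u(2)]; use u(1) in simp)
      (rule S.comp_eq_comp[OF u(3)]; use u(1) in simp)
  have "?p \<cdot> low ?P (?u \<cdot>\<^bsub>S\<^esub> ?x) = low (Mor A) g" "?q \<cdot> low ?P (?u \<cdot>\<^bsub>S\<^esub> ?x) = low (Mor A) f"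
    using ux arg_cong[OF pqux(1), of "low (Mor A)"] arg_cong[OF pqux(2), of "low (Mor A)"] by simp_all
  then have l: "low ?P (?u \<cdot>\<^bsub>S\<^esub> ?x) = pbpair (Src A) (Tgt A) (low (Mor A) g) (low (Mor A) f)"
    using ux by - (rule pb_eqI[of "Src A" "Tgt A"]; simp)
  have i: "icomp S (star_icat C K A) g f = star_arr C K (Cmp A) \<cdot>\<^bsub>S\<^esub> (?u \<cdot>\<^bsub>S\<^esub> ?x)"
    using u by (simp add: icomp_def Cmp)
  show "icomp S (star_icat C K A) g f \<in> Hom S (Dom S f) (st (Mor A)) \<and>
      low (Mor A) (icomp S (star_icat C K A) g f) = icomp C A (low (Mor A) g) (low (Mor A) f)"
    unfolding i using ux l by (simp add: icomp_def)
qed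

lemma star_internal_category:
  assumes A [simp]: "internal_category C A"
  shows "internal_category S (star_icat C K A)"
proof (rule S.internal_categoryI)
  let ?A = "star_icat C K A"
  have c: "Src A \<cdot> low (Mor A) g = Tgt A \<cdot> low (Mor A) f"
    if "g \<in> Hom S w (Mor ?A)" "f \<in> Hom S w (Mor ?A)" "Src ?A \<cdot>\<^bsub>S\<^esub> g = Tgt ?A \<cdot>\<^bsub>S\<^esub> f" for g f w
    using arg_cong[OF that(3), of "low (Ob A)"] that(1,2) by simp
  note ic = star_Cmp(2)[OF A]
  {
    fix w g f assume gf: "g \<in> Hom S w (Mor ?A)" "f \<in> Hom S w (Mor ?A)" "Src ?A \<cdot>\<^bsub>S\<^esub> g = Tgt ?A \<cdot>\<^bsub>S\<^esub> f"
    show "Src ?A \<cdot>\<^bsub>S\<^esub> icomp S ?A g f = Src ?A \<cdot>\<^bsub>S\<^esub> f \<and> Tgt ?A \<cdot>\<^bsub>S\<^esub> icomp S ?A g f = Tgt ?A \<cdot>\<^bsub>S\<^esub> g"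
      by (rule conjI; rule low_eqI[of _ _ "Ob A"]; use ic[of g f] gf(1,2) c[OF gf] in simp)
  next
    fix w f assume f: "f \<in> Hom S w (Mor ?A)"
    show "icomp S ?A (Ids ?A \<cdot>\<^bsub>S\<^esub> (Tgt ?A \<cdot>\<^bsub>S\<^esub> f)) f = f"
      by (rule low_eqI[of _ _ "Mor A"]; use ic[of "Ids ?A \<cdot>\<^bsub>S\<^esub> (Tgt ?A \<cdot>\<^bsub>S\<^esub> f)" f] f in simp)
    show "icomp S ?A f (Ids ?A \<cdot>\<^bsub>S\<^esub> (Src ?A \<cdot>\<^bsub>S\<^esub> f)) = f"
      by (rule low_eqI[of _ _ "Mor A"]; use ic[of f "Ids ?A \<cdot>\<^bsub>S\<^esub> (Src ?A \<cdot>\<^bsub>S\<^esub> f)"] f in simp)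
  next
    fix w h g f assume hgf: "h \<in> Hom S w (Mor ?A)" "g \<in> Hom S w (Mor ?A)" "f \<in> Hom S w (Mor ?A)"
      "Src ?A \<cdot>\<^bsub>S\<^esub> h = Tgt ?A \<cdot>\<^bsub>S\<^esub> g" "Src ?A \<cdot>\<^bsub>S\<^esub> g = Tgt ?A \<cdot>\<^bsub>S\<^esub> f"
    note c1 = c[OF hgf(1,2,4)] and c2 = c[OF hgf(2,3,5)]
    show "icomp S ?A (icomp S ?A h g) f = icomp S ?A h (icomp S ?A g f)"
      by (rule low_eqI[of _ _ "Mor A"];
          use ic[of h g] ic[of g f] ic[of "icomp S ?A h g" f] ic[of h "icomp S ?A g f"] hgf(1-3) c1 c2
              in \<open>simp add: icomp_assoc\<close>)
  }
  show "Src ?A \<cdot>\<^bsub>S\<^esub> Ids ?A = Idn S (Ob ?A)" "Tgt ?A \<cdot>\<^bsub>S\<^esub> Ids ?A = Idn S (Ob ?A)"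
    by (simp_all add: star_arr_Idn)
  show "Cmp ?A \<in> Hom S (pb_obj S (Src ?A) (Tgt ?A)) (Mor ?A)" using star_Cmp(1)[OF A] by simp
qed simp_all

declare star_internal_category [simp]

lemma low_icomp:
  assumes "internal_category C A" "g \<in> Arr S" "f \<in> Arr S" "Cod S g = st (Mor A)" "Cod S f = st (Mor A)"
    "Src (star_icat C K A) \<cdot>\<^bsub>S\<^esub> g = Tgt (star_icat C K A) \<cdot>\<^bsub>S\<^esub> f"
  shows "low (Mor A) (icomp S (star_icat C K A) g f) = icomp C A (low (Mor A) g) (low (Mor A) f)"
proof -
  have "Dom S g = Dom S f" using S.composable_Dom[of "star_icat C K A" g f] assms by simp
  then show ?thesis using star_Cmp(2)[OF assms(1), of g f] arg_cong[OF assms(6), of "low (Ob A)"]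
      assms(1-5) by simp
qed

lemma star_composable:
  assumes "internal_category C A" "g \<in> Arr S" "f \<in> Arr S" "Dom S g = Dom S f" "Cod S g = st (Mor A)"
      "Cod S f = st (Mor A)"
    "Src A \<cdot> low (Mor A) g = Tgt A \<cdot> low (Mor A) f"
  shows "star_arr C K (Src A) \<cdot>\<^bsub>S\<^esub> g = star_arr C K (Tgt A) \<cdot>\<^bsub>S\<^esub> f"
  by (rule low_eqI[of _ _ "Ob A"]; use assms in simp)

lemma star_internal_functor [simp]:
  assumes F [simp]: "internal_functor C F"
  shows "internal_functor S (star_ifun C K F)"
proof (rule S.internal_functorI)
  let ?F = "star_ifun C K F"
  fix w f assume "f \<in> Hom S w (Mor (FDom ?F))"
  then show "Src (FCod ?F) \<cdot>\<^bsub>S\<^esub> (F1 ?F \<cdot>\<^bsub>S\<^esub> f) = F0 ?F \<cdot>\<^bsub>S\<^esub> (Src (FDom ?F) \<cdot>\<^bsub>S\<^esub> f) \<and>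
    Tgt (FCod ?F) \<cdot>\<^bsub>S\<^esub> (F1 ?F \<cdot>\<^bsub>S\<^esub> f) = F0 ?F \<cdot>\<^bsub>S\<^esub> (Tgt (FDom ?F) \<cdot>\<^bsub>S\<^esub> f)"
    by - (rule conjI; rule low_eqI[of _ _ "Ob (FCod F)"]; simp)
next
  let ?F = "star_ifun C K F"
  fix w x assume "x \<in> Hom S w (Ob (FDom ?F))"
  then show "F1 ?F \<cdot>\<^bsub>S\<^esub> (Ids (FDom ?F) \<cdot>\<^bsub>S\<^esub> x) = Ids (FCod ?F) \<cdot>\<^bsub>S\<^esub> (F0 ?F \<cdot>\<^bsub>S\<^esub> x)"
    by - (rule low_eqI[of _ _ "Mor (FCod F)"]; simp)
next
  let ?F = "star_ifun C K F" and ?A = "FDom F" and ?B = "FCod F"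
  fix w g f assume gf: "g \<in> Hom S w (Mor (FDom ?F))" "f \<in> Hom S w (Mor (FDom ?F))"
      "Src (FDom ?F) \<cdot>\<^bsub>S\<^esub> g = Tgt (FDom ?F) \<cdot>\<^bsub>S\<^esub> f"
  then have [simp]: "g \<in> Arr S" "Dom S g = w" "Cod S g = st (Mor ?A)" "f \<in> Arr S" "Dom S f = w"
      "Cod S f = st (Mor ?A)" by simp_all
  have c: "Src ?A \<cdot> low (Mor ?A) g = Tgt ?A \<cdot> low (Mor ?A) f" using arg_cong[OF gf(3), of "low (Ob ?A)"]
    by simp
  have ic: "icomp S (star_icat C K ?A) g f \<in> Hom S w (st (Mor ?A))" using gf by simp
  have c': "star_arr C K (Src ?B) \<cdot>\<^bsub>S\<^esub> (star_arr C K (F1 F) \<cdot>\<^bsub>S\<^esub> g) =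
      star_arr C K (Tgt ?B) \<cdot>\<^bsub>S\<^esub> (star_arr C K (F1 F) \<cdot>\<^bsub>S\<^esub> f)"
    by (rule star_composable) (simp_all add: c)
  have "star_arr C K (F1 F) \<cdot>\<^bsub>S\<^esub> icomp S (star_icat C K ?A) g f =
      icomp S (star_icat C K ?B) (star_arr C K (F1 F) \<cdot>\<^bsub>S\<^esub> g) (star_arr C K (F1 F) \<cdot>\<^bsub>S\<^esub> f)"
    by (rule low_eqI[of _ _ "Mor ?B"])
        (use ic gf(3) c c' in \<open>simp_all add: low_icomp del: star_arr_comp\<close>)
  then show "F1 ?F \<cdot>\<^bsub>S\<^esub> icomp S (FDom ?F) g f = icomp S (FCod ?F) (F1 ?F \<cdot>\<^bsub>S\<^esub> g) (F1 ?F \<cdot>\<^bsub>S\<^esub> f)" by simp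
qed simp_all

end

subsection \<open>Base change of cones\<close>

text \<open>Base change when both \<open>C\<close> and \<open>C/K\<close> are cartesian closed, so that both have functor categories.\<close>

locale base_change_cc = base_change C K + lexcc_cat C + S: lexcc_cat "slice C K"
  for C :: "('o, 'm) cat" (structure) and K :: 'o
begin

lemma star_terminal_iso:
  "star_terminal_iso C K \<in> Hom (CAT S) (terminal (CAT S)) (star_icat C K (terminal (CAT C)))"
proof -
  have "is_terminal (CAT S) (star_icat C K (terminal (CAT C)))"
    by (rule S.is_terminal_CATI) (simp_all add: star_terminal)
  then have "\<exists>!u. u \<in> Hom (CAT S) (terminal (CAT S)) (star_icat C K (terminal (CAT C)))"
    unfolding is_terminal_def by (metis CAT_simps(1) S.terminal_CAT_simps(1))
  then show ?thesis unfolding star_terminal_iso_def by (rule theI')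
qed

text \<open>The comparison \<open>K\<^sup>*[J, A] \<rightarrow> [K\<^sup>*J, K\<^sup>*A]\<close> is compatible with evaluation on generalized elements.\<close>

lemma star_expo_iso:
  assumes J [simp]: "internal_category C J" and A [simp]: "internal_category C A"
  defines "X \<equiv> expo (CAT C) J A"
  defines "G \<equiv> star_expo_iso C K J A"
  shows "internal_functor S G" "FDom G = star_icat C K X"
      "FCod G = expo (CAT S) (star_icat C K J) (star_icat C K A)"
    "w \<in> Arr S \<Longrightarrow> Cod S w = st (Mor X) \<Longrightarrow> d \<in> Arr S \<Longrightarrow> Dom S w = Dom S d \<Longrightarrow> Cod S d = st (Mor J) \<Longrightarrow>
      low (Mor A) (F1 (ev (CAT S) (star_icat C K J) (star_icat C K A)) \<cdot>\<^bsub>S\<^esub>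
        S.cp1 (expo (CAT S) (star_icat C K J) (star_icat C K A)) (star_icat C K J) (F1 G \<cdot>\<^bsub>S\<^esub> w) d) =
      F1 (ev (CAT C) J A) \<cdot> cp1 X J (low (Mor X) w) (low (Mor J) d)"
proof -
  let ?X = "star_icat C K X" and ?J = "star_icat C K J" and ?A = "star_icat C K A"
  let ?p = "proj1 (CAT C) X J" and ?q = "proj2 (CAT C) X J"
  let ?p' = "proj1 (CAT S) ?X ?J" and ?q' = "proj2 (CAT S) ?X ?J"
  have X [simp]: "internal_category C X" unfolding X_def by simp
  have P: "is_product (CAT S) ?X ?J (star_ifun C K ?p) (star_ifun C K ?q)"
    by (rule S.is_product_CATI[of _ "star_icat C K (prod_obj (CAT C) X J)"])
      (simp_all add: star_product CAT_proj_products)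
  let ?r = "pair_into (CAT S) (star_ifun C K ?p) (star_ifun C K ?q) ?p' ?q'"
  have r: "?r \<in> Arr (CAT S)" "Dom (CAT S) ?r = Dom (CAT S) ?q'"
      "Cod (CAT S) ?r = Dom (CAT S) (star_ifun C K ?p)"
    "star_ifun C K ?p \<cdot>\<^bsub>CAT S\<^esub> ?r = ?p'" "star_ifun C K ?q \<cdot>\<^bsub>CAT S\<^esub> ?r = ?q'"
    by (rule S.K.pair_product[OF P]; simp)+
  have r' [simp]: "internal_functor S ?r" "FDom ?r = prod_obj (CAT S) ?X ?J"
      "FCod ?r = star_icat C K (prod_obj (CAT C) X J)"
    using r(1-3) by simp_all
  let ?f = "star_ifun C K (ev (CAT C) J A) \<cdot>\<^bsub>CAT S\<^esub> ?r"
  have f: "?f \<in> Hom (CAT S) (prod_obj (CAT S) ?X ?J) ?A" by (simp add: X_def[symmetric])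
  have G: "G = transpose (CAT S) ?X ?J ?A ?f" unfolding G_def star_expo_iso_def Let_def X_def ..
  note t = S.transpose_elements[of ?X ?J ?A ?f, OF _ _ _ f, folded G]
  show "internal_functor S G" "FDom G = ?X" "FCod G = expo (CAT S) ?J ?A" using t(1-3) by simp_all
  assume w: "w \<in> Arr S" "Cod S w = st (Mor X)"
      and d: "d \<in> Arr S" "Dom S w = Dom S d" "Cod S d = st (Mor J)"
  let ?c = "S.cp1 ?X ?J w d"
  let ?m = "F1 ?r \<cdot>\<^bsub>S\<^esub> ?c"
  have c [simp]: "?c \<in> Arr S" "Dom S ?c = Dom S d" "Cod S ?c = Mor (prod_obj (CAT S) ?X ?J)" using w d
    by simp_all
  have pr: "F1 (star_ifun C K ?p) \<cdot>\<^bsub>S\<^esub> F1 ?r = F1 ?p'" "F1 (star_ifun C K ?q) \<cdot>\<^bsub>S\<^esub> F1 ?r = F1 ?q'"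
    using arg_cong[OF r(4), of F1] arg_cong[OF r(5), of F1] by (simp_all del: star_ifun_simps(4))
  have "F1 (star_ifun C K ?p) \<cdot>\<^bsub>S\<^esub> ?m = F1 ?p' \<cdot>\<^bsub>S\<^esub> ?c" by (rule S.comp_eq_comp[OF pr(1)]) simp_all
  then have mw: "star_arr C K (F1 ?p) \<cdot>\<^bsub>S\<^esub> ?m = w" using w d by simp
  have "F1 (star_ifun C K ?q) \<cdot>\<^bsub>S\<^esub> ?m = F1 ?q' \<cdot>\<^bsub>S\<^esub> ?c" by (rule S.comp_eq_comp[OF pr(2)]) simp_all
  then have md: "star_arr C K (F1 ?q) \<cdot>\<^bsub>S\<^esub> ?m = d" using w d by simp
  let ?M = "Mor (prod_obj (CAT C) X J)"
  have m: "?m \<in> Arr S" "Dom S ?m = Dom S d" "Cod S ?m = st ?M" by simp_all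
  have "F1 ?p \<cdot> low ?M ?m = low (Mor X) w" "F1 ?q \<cdot> low ?M ?m = low (Mor J) d"
    using arg_cong[OF mw, of "low (Mor X)"] arg_cong[OF md, of "low (Mor J)"] m by simp_all
  then have lm: "low ?M ?m = cp1 X J (low (Mor X) w) (low (Mor J) d)"
    by - (rule cp1_eqI; use m w d in simp)
  have "F1 (ev (CAT S) ?J ?A) \<cdot>\<^bsub>S\<^esub> S.cp1 (expo (CAT S) ?J ?A) ?J (F1 G \<cdot>\<^bsub>S\<^esub> w) d = F1 ?f \<cdot>\<^bsub>S\<^esub> ?c"
    by (rule t(5)) (use w d in simp_all)
  also have "\<dots> = star_arr C K (F1 (ev (CAT C) J A)) \<cdot>\<^bsub>S\<^esub> ?m" by (simp add: X_def[symmetric])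
  finally have "low (Mor A) (F1 (ev (CAT S) ?J ?A) \<cdot>\<^bsub>S\<^esub> S.cp1 (expo (CAT S) ?J ?A) ?J (F1 G \<cdot>\<^bsub>S\<^esub> w) d) =
      low (Mor A) (star_arr C K (F1 (ev (CAT C) J A)) \<cdot>\<^bsub>S\<^esub> ?m)" by simp
  also have "\<dots> = F1 (ev (CAT C) J A) \<cdot> low ?M ?m"
    using m by (simp add: X_def[symmetric])
  finally show "low (Mor A) (F1 (ev (CAT S) ?J ?A) \<cdot>\<^bsub>S\<^esub> S.cp1 (expo (CAT S) ?J ?A) ?J (F1 G \<cdot>\<^bsub>S\<^esub> w) d) =
      F1 (ev (CAT C) J A) \<cdot> cp1 X J (low (Mor X) w) (low (Mor J) d)" unfolding lm .
qed

text \<open>The components of \<open>K\<^sup>*(V, \<gamma>)\<close> are the images under \<open>K\<^sup>*\<close> of those of \<open>(V, \<gamma>)\<close>.\<close>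

lemma star_cone_components:
  assumes F: "internal_functor C F" "FDom F = J" "FCod F = A" and c: "(V, \<gamma>) \<in> Obj (cone_cat C F)"
  defines "V' \<equiv> fst (star_cone C K F (V, \<gamma>))" and "\<gamma>' \<equiv> snd (star_cone C K F (V, \<gamma>))"
  shows "internal_functor S V'" "F0 V' \<in> Hom S (Ob (terminal (CAT S))) (st (Ob A))"
    "low (Ob A) (F0 V') = F0 V \<cdot> tt (Dom C (Ob (terminal (CAT S))))"
    "d \<in> Arr S \<Longrightarrow> Cod S d = st (Ob J) \<Longrightarrow>
      low (Mor A) (S.component (star_icat C K J) (star_icat C K A) \<gamma>' d) = component J A \<gamma>
          (low (Ob J) d)"
proof -
  let ?u = "star_terminal_iso C K" and ?G = "star_expo_iso C K J A" and ?X = "expo (CAT C) J A"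
  let ?T = "terminal (CAT C)" and ?T' = "terminal (CAT S)"
  note [simp] = F cone_cat_ObjD[OF F c]
  have [simp]: "internal_category C J" "internal_category C A" using ifun_simps(1,2)[OF F(1)]
    by simp_all
  have u [simp]: "internal_functor S ?u" "FDom ?u = ?T'" "FCod ?u = star_icat C K ?T"
    using star_terminal_iso by simp_all
  note G [simp] = star_expo_iso(1-3)[of J A]
  have V': "V' = star_ifun C K V \<cdot>\<^bsub>CAT S\<^esub> ?u" and \<gamma>': "\<gamma>' = F1 ?G \<cdot>\<^bsub>S\<^esub> star_arr C K \<gamma> \<cdot>\<^bsub>S\<^esub> F0 ?u"
    unfolding V'_def \<gamma>'_def by (simp_all add: star_cone_def)
  show "internal_functor S V'" "F0 V' \<in> Hom S (Ob ?T') (st (Ob A))" unfolding V' by simp_all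
  have [simp]: "Ob ?T' \<in> Arr C" "Cod C (Ob ?T') = K"
    using S.terminal_CAT_simps(2) unfolding is_terminal_def by simp_all
  have lu: "low (Ob ?T) (F0 ?u \<cdot>\<^bsub>S\<^esub> t) = tt (Dom C (Dom S t))" if "t \<in> Arr S" "Cod S t = Ob ?T'" for t
    using that by (subst to_tt) simp_all
  show "low (Ob A) (F0 V') = F0 V \<cdot> tt (Dom C (Ob ?T'))"
    unfolding V' using lu[of "Idn S (Ob ?T')"] by simp
  assume d: "d \<in> Arr S" "Cod S d = st (Ob J)"
  let ?t = "S.tt (Dom S d)"
  have t: "?t \<in> Arr S" "Dom S ?t = Dom S d" "Cod S ?t = Ob ?T'" using d by simp_all
  have "low (Mor A) (S.component (star_icat C K J) (star_icat C K A) \<gamma>' d) =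
      F1 (ev (CAT C) J A) \<cdot> cp1 ?X J (low (Mor ?X) (star_arr C K \<gamma> \<cdot>\<^bsub>S\<^esub> (F0 ?u \<cdot>\<^bsub>S\<^esub> ?t)))
          (low (Mor J) (star_arr C K (Ids J) \<cdot>\<^bsub>S\<^esub> d))"
    unfolding S.component_def \<gamma>'
    using star_expo_iso(4)[of J A "star_arr C K \<gamma> \<cdot>\<^bsub>S\<^esub> (F0 ?u \<cdot>\<^bsub>S\<^esub> ?t)" "star_arr C K (Ids J) \<cdot>\<^bsub>S\<^esub> d"] d
        t
    by (simp del: low_star_arr_comp)
  also have "\<dots> = component J A \<gamma> (low (Ob J) d)"
    unfolding component_def using d t lu[OF t(1,3)] by simp
  finally show "low (Mor A) (S.component (star_icat C K J) (star_icat C K A) \<gamma>' d) =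
      component J A \<gamma> (low (Ob J) d)" .
qed

lemma star_elem_cone:
  assumes F [simp]: "internal_functor C F" "FDom F = J" "FCod F = A" and s0: "is_terminal S s0"
    and T: "is_terminal C (Dom C s0)" and c: "elem_cone F (Dom C s0) x \<delta>"
  shows "S.elem_cone (star_ifun C K F) s0 (lift (Ob A) s0 x) (star_arr C K \<delta>)"
proof -
  have [simp]: "internal_category C J" "internal_category C A" using ifun_simps(1,2)[OF F(1)]
    by simp_all
  have [simp]: "s0 \<in> Arr C" "Cod C s0 = K" using s0 by (simp_all add: is_terminal_def)
  have x [simp]: "x \<in> Arr C" "Dom C x = Dom C s0" "Cod C x = Ob A" "\<delta> \<in> Arr C" "Dom C \<delta> = Ob J"
      "Cod C \<delta> = Mor A"
    and \<delta>: "Src A \<cdot> \<delta> = x \<cdot> to_terminal (Dom C s0) (Ob J)" "Tgt A \<cdot> \<delta> = F0 F"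
      "\<And>V u. u \<in> Hom C V (Mor J) \<Longrightarrow> icomp C A (F1 F \<cdot> u) (\<delta> \<cdot> (Src J \<cdot> u)) = \<delta> \<cdot> (Tgt J \<cdot> u)"
    using c unfolding elem_cone_def by simp_all
  note [simp] = to_terminal[OF T] S.to_terminal[OF s0]
  have mt: "mid (S.to_terminal s0 w) = to_terminal (Dom C s0) (Dom C w)" if "w \<in> Arr C" "Cod C w = K"
      for w
    using that mid_simps[of "S.to_terminal s0 w" C K] by (intro terminal_arrows_eq[OF T]) simp_all
  show ?thesis
    unfolding S.elem_cone_def
  proof (intro conjI allI impI)
    show "lift (Ob A) s0 x \<in> Hom S s0 (Ob (FCod (star_ifun C K F)))"
      "star_arr C K \<delta> \<in> Hom S (Ob (FDom (star_ifun C K F))) (Mor (FCod (star_ifun C K F)))" by simp_all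
    have "star_arr C K (Src A \<cdot> \<delta>) = lift (Ob A) s0 x \<cdot>\<^bsub>S\<^esub> S.to_terminal s0 (st (Ob J))"
      by (rule low_eqI[of _ _ "Ob A"])
        (simp_all add: low_star_arr low_comp mt \<delta>(1) to_terminal_comp[OF T])
    then show "Src (FCod (star_ifun C K F)) \<cdot>\<^bsub>S\<^esub> star_arr C K \<delta> =
        lift (Ob A) s0 x \<cdot>\<^bsub>S\<^esub> S.to_terminal s0 (Ob (FDom (star_ifun C K F)))"
      by simp
    show "Tgt (FCod (star_ifun C K F)) \<cdot>\<^bsub>S\<^esub> star_arr C K \<delta> = F0 (star_ifun C K F)" by (simp add: \<delta>(2))
    fix w u assume u: "u \<in> Hom S w (Mor (FDom (star_ifun C K F)))"
    have st: "Src A \<cdot> (F1 F \<cdot> y) = Tgt A \<cdot> (\<delta> \<cdot> (Src J \<cdot> y))" if "y \<in> Arr C" "Cod C y = Mor J" for y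
      using that comp_eq_comp[OF \<delta>(2), of "Src J \<cdot> y"] by simp
    have cc: "star_arr C K (Src A) \<cdot>\<^bsub>S\<^esub> (star_arr C K (F1 F) \<cdot>\<^bsub>S\<^esub> u) =
        star_arr C K (Tgt A) \<cdot>\<^bsub>S\<^esub> (star_arr C K \<delta> \<cdot>\<^bsub>S\<^esub> (star_arr C K (Src J) \<cdot>\<^bsub>S\<^esub> u))"
      by (rule star_composable) (use u st in simp_all)
    have "icomp S (star_icat C K A) (star_arr C K (F1 F) \<cdot>\<^bsub>S\<^esub> u)
        (star_arr C K \<delta> \<cdot>\<^bsub>S\<^esub> (star_arr C K (Src J) \<cdot>\<^bsub>S\<^esub> u)) =
      star_arr C K \<delta> \<cdot>\<^bsub>S\<^esub> (star_arr C K (Tgt J) \<cdot>\<^bsub>S\<^esub> u)"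
    proof (rule low_eqI[of _ _ "Mor A"])
      show "low (Mor A) (icomp S (star_icat C K A) (star_arr C K (F1 F) \<cdot>\<^bsub>S\<^esub> u)
          (star_arr C K \<delta> \<cdot>\<^bsub>S\<^esub> (star_arr C K (Src J) \<cdot>\<^bsub>S\<^esub> u))) =
        low (Mor A) (star_arr C K \<delta> \<cdot>\<^bsub>S\<^esub> (star_arr C K (Tgt J) \<cdot>\<^bsub>S\<^esub> u))"
        using u cc \<delta>(3)[of "low (Mor J) u" "Dom C w"] by (subst low_icomp) simp_all
    qed (use u cc S.icomp_simps[of "star_icat C K A", OF _ _ _ _ _ cc[folded star_icat_simps]] in
        simp_all)
    then show "icomp S (FCod (star_ifun C K F)) (F1 (star_ifun C K F) \<cdot>\<^bsub>S\<^esub> u)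
        (star_arr C K \<delta> \<cdot>\<^bsub>S\<^esub> (Src (FDom (star_ifun C K F)) \<cdot>\<^bsub>S\<^esub> u)) =
       star_arr C K \<delta> \<cdot>\<^bsub>S\<^esub> (Tgt (FDom (star_ifun C K F)) \<cdot>\<^bsub>S\<^esub> u)" by simp
  qed
qed

text \<open>Base change along an isomorphism: if \<open>K\<close> is terminal, then the universal property of the image
  under \<open>K\<^sup>*\<close> of a cone implies that of the cone itself.\<close>

lemma star_terminal_cone:
  assumes F [simp]: "internal_functor C F" "FDom F = J" "FCod F = A"
      and cone: "(V, \<gamma>) \<in> Obj (cone_cat C F)"
    and t: "is_terminal (cone_cat S (star_ifun C K F)) (star_cone C K F (V, \<gamma>))"
        and KT: "is_terminal C K"
  shows "elem_universal F (Ob (terminal (CAT C))) (F0 V) (component J A \<gamma> (Idn C (Ob J)))"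
proof -
  have icat [simp]: "internal_category C J" "internal_category C A" using ifun_simps(1,2)[OF F(1)]
    by simp_all
  note [simp] = cone_cat_ObjD[OF F cone]
  define V' where "V' = fst (star_cone C K F (V, \<gamma>))"
  define \<gamma>' where "\<gamma>' = snd (star_cone C K F (V, \<gamma>))"
  let ?J = "star_icat C K J" and ?A = "star_icat C K A" and ?F = "star_ifun C K F"
  let ?s = "Ob (terminal (CAT S))" and ?T = "Ob (terminal (CAT C))"
  note sc = star_cone_components[OF F cone, folded V'_def \<gamma>'_def]
  have cone': "(V', \<gamma>') \<in> Obj (cone_cat S ?F)"
    using t unfolding is_terminal_def V'_def \<gamma>'_def by simp
  have s: "is_terminal S ?s" by simp
  then have s' [simp]: "?s \<in> Arr C" "Cod C ?s = K" by (simp_all add: is_terminal_def)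
  have T: "is_terminal C (Dom C ?s)"
    unfolding is_terminal_def
  proof (intro conjI ballI)
    show "Dom C ?s \<in> Obj C" by simp
    fix X assume X [simp]: "X \<in> Obj C"
    note [simp] = to_terminal[OF KT, of X]
    have w: "to_terminal K X \<in> Obj S" by simp
    note ts = S.to_terminal[OF s w]
    note m = mid_simps[OF ts(1), unfolded ts(2,3)]
    show "\<exists>!f. f \<in> Hom C X (Dom C ?s)"
    proof (rule ex1I[of _ "mid (S.to_terminal ?s (to_terminal K X))"])
      show "mid (S.to_terminal ?s (to_terminal K X)) \<in> Hom C X (Dom C ?s)" using m by simp
      fix f assume f: "f \<in> Hom C X (Dom C ?s)"
      have "?s \<cdot> f = to_terminal K X" by (rule terminal_arrows_eq[OF KT]) (use f in simp_all)
      then have "(to_terminal K X, f, ?s) \<in> Hom S (to_terminal K X) ?s"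
        by (intro slice_ArrI) (use f in simp_all)
      then have "(to_terminal K X, f, ?s) = S.to_terminal ?s (to_terminal K X)"
        using ts by (intro S.terminal_arrows_eq[OF s]) simp_all
      then show "f = mid (S.to_terminal ?s (to_terminal K X))" by (metis mid_triple)
    qed
  qed
  note [simp] = to_terminal[OF T] S.to_terminal[OF s]
  have mt: "mid (S.to_terminal ?s w) = to_terminal (Dom C ?s) (Dom C w)" if "w \<in> Arr C" "Cod C w = K"
      for w
    using that mid_simps[of "S.to_terminal ?s w" C K] by (intro terminal_arrows_eq[OF T]) simp_all
  let ?\<delta> = "component J A \<gamma> (Idn C (Ob J))" and ?\<delta>' = "S.component ?J ?A \<gamma>' (Idn S (st (Ob J)))"
  let ?v = "F0 V \<cdot> tt (Dom C ?s)"
  have v': "F0 V' \<in> Hom S ?s (st (Ob A))" "low (Ob A) (F0 V') = ?v" using sc(2,3) by simp_all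
  have F': "internal_functor S ?F" "FDom ?F = ?J" "FCod ?F = ?A" by simp_all
  have un': "S.elem_universal ?F ?s (F0 V') ?\<delta>'"
    using S.terminal_cone_elem_universal[OF F', of V' \<gamma>'] t unfolding V'_def \<gamma>'_def by simp
  note c' = S.cone_elem_cone[OF F' cone', simplified]
  have \<delta>' [simp]: "?\<delta>' \<in> Arr S" "Dom S ?\<delta>' = st (Ob J)" "Cod S ?\<delta>' = st (Mor A)"
    "star_arr C K (Src A) \<cdot>\<^bsub>S\<^esub> ?\<delta>' = F0 V' \<cdot>\<^bsub>S\<^esub> S.to_terminal ?s (st (Ob J))"
    using c' unfolding S.elem_cone_def by simp_all
  have low\<delta>: "low (Mor A) ?\<delta>' = ?\<delta> \<cdot> low (Ob J) (Idn S (st (Ob J)))"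
    using sc(4)[of "Idn S (st (Ob J))"]
        component_comp[of J A \<gamma> "Idn C (Ob J)" "low (Ob J) (Idn S (st (Ob J)))"] by simp
  have \<delta>c: "elem_cone F ?T (F0 V) ?\<delta>" by (rule cone_elem_cone[OF F cone])
  have "elem_cone F (Dom C ?s) ?v ?\<delta>"
    by (rule elem_cone_change_terminal[OF F(1) _ T \<delta>c]) simp
  then have Sv: "Src A \<cdot> ?\<delta> = ?v \<cdot> to_terminal (Dom C ?s) (Ob J)" unfolding elem_cone_def by simp
  \<comment> \<open>since \<open>K\<close> is terminal, the projection \<open>K\<^sup>*(Ob J) \<rightarrow> Ob J\<close> has a section\<close>
  let ?l = "low (Ob J) (Idn S (st (Ob J)))"
  let ?r = "mid (lift (Ob J) (to_terminal K (Ob J)) (Idn C (Ob J)))"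
  have l: "?l \<in> Hom C (Dom C (st (Ob J))) (Ob J)"
    using low_simps[of "Idn S (st (Ob J))" "Ob J"] S.Idn_arr[of "st (Ob J)"] by simp
  have L: "lift (Ob J) (to_terminal K (Ob J)) (Idn C (Ob J)) \<in> Hom S (to_terminal K (Ob J)) (st (Ob J))"
    using to_terminal[OF KT, of "Ob J"] by simp
  have r: "?r \<in> Hom C (Ob J) (Dom C (st (Ob J)))" "?l \<cdot> ?r = Idn C (Ob J)"
    using L mid_simps[of "lift (Ob J) (to_terminal K (Ob J)) (Idn C (Ob J))" C K]
        to_terminal[OF KT, of "Ob J"]
      low_comp[of "Idn S (st (Ob J))" "Ob J" "lift (Ob J) (to_terminal K (Ob J)) (Idn C (Ob J))"]
        by (auto simp del: st_simps(3))
  have cancel: "f = g" if "f \<cdot> ?l = g \<cdot> ?l" "f \<in> Hom C (Ob J) Y" "g \<in> Hom C (Ob J) Y" for f g Y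
  proof -
    have "f \<cdot> (?l \<cdot> ?r) = (g \<cdot> ?l) \<cdot> ?r" by (rule comp_eq_comp[OF that(1)]) (use that l r in simp_all)
    also have "\<dots> = g \<cdot> (?l \<cdot> ?r)" using that l r by (intro comp_assoc) simp_all
    finally show ?thesis using that unfolding r(2) by simp
  qed
  have "elem_universal F (Dom C ?s) ?v ?\<delta>"
    unfolding elem_universal_def
  proof (intro conjI allI impI)
    show "elem_cone F (Dom C ?s) ?v ?\<delta>" by fact
    fix x \<delta>x assume cx: "elem_cone F (Dom C ?s) x \<delta>x"
    have x [simp]: "x \<in> Arr C" "Dom C x = Dom C ?s" "Cod C x = Ob A" "\<delta>x \<in> Arr C" "Dom C \<delta>x = Ob J"
        "Cod C \<delta>x = Mor A"
      using cx unfolding elem_cone_def by simp_all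
    have ex1: "\<exists>!h. h \<in> Hom S ?s (st (Mor A)) \<and> star_arr C K (Src A) \<cdot>\<^bsub>S\<^esub> h = lift (Ob A) ?s x \<and>
      star_arr C K (Tgt A) \<cdot>\<^bsub>S\<^esub> h = F0 V' \<and> icomp S ?A ?\<delta>' (h \<cdot>\<^bsub>S\<^esub> S.to_terminal ?s (st (Ob J))) =
          star_arr C K \<delta>x"
      using un'[unfolded S.elem_universal_def, THEN conjunct2, rule_format, OF
          star_elem_cone[OF F s T cx]]
      unfolding F' star_icat_simps F .
    have iff: "(h \<in> Hom S ?s (st (Mor A)) \<and> star_arr C K (Src A) \<cdot>\<^bsub>S\<^esub> h = lift (Ob A) ?s x \<and>
        star_arr C K (Tgt A) \<cdot>\<^bsub>S\<^esub> h = F0 V' \<and> icomp S ?A ?\<delta>' (h \<cdot>\<^bsub>S\<^esub> S.to_terminal ?s (st (Ob J))) =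
            star_arr C K \<delta>x) \<longleftrightarrow>
      (Src A \<cdot> low (Mor A) h = x \<and> Tgt A \<cdot> low (Mor A) h = ?v \<and>
        icomp C A ?\<delta> (low (Mor A) h \<cdot> to_terminal (Dom C ?s) (Ob J)) = \<delta>x)" if h: "h \<in> Hom S ?s
            (st (Mor A))" for h
    proof -
      have h' [simp]: "h \<in> Arr S" "Dom S h = ?s" "Cod S h = st (Mor A)" using h by simp_all
      have 1: "star_arr C K (Src A) \<cdot>\<^bsub>S\<^esub> h = lift (Ob A) ?s x \<longleftrightarrow> Src A \<cdot> low (Mor A) h = x"
      proof
        assume "star_arr C K (Src A) \<cdot>\<^bsub>S\<^esub> h = lift (Ob A) ?s x"
        from arg_cong[OF this, of "low (Ob A)"] show "Src A \<cdot> low (Mor A) h = x" by simp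
      next
        assume e: "Src A \<cdot> low (Mor A) h = x"
        show "star_arr C K (Src A) \<cdot>\<^bsub>S\<^esub> h = lift (Ob A) ?s x"
          by (rule low_eqI[of _ _ "Ob A"]) (use e in simp_all)
      qed
      have 2: "star_arr C K (Tgt A) \<cdot>\<^bsub>S\<^esub> h = F0 V' \<longleftrightarrow> Tgt A \<cdot> low (Mor A) h = ?v"
      proof
        assume "star_arr C K (Tgt A) \<cdot>\<^bsub>S\<^esub> h = F0 V'"
        from arg_cong[OF this, of "low (Ob A)"] show "Tgt A \<cdot> low (Mor A) h = ?v" using v' by simp
      next
        assume e: "Tgt A \<cdot> low (Mor A) h = ?v"
        show "star_arr C K (Tgt A) \<cdot>\<^bsub>S\<^esub> h = F0 V'"
          by (rule low_eqI[of _ _ "Ob A"]) (use e v' in simp_all)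
      qed
      have 3: "icomp S ?A ?\<delta>' (h \<cdot>\<^bsub>S\<^esub> S.to_terminal ?s (st (Ob J))) = star_arr C K \<delta>x \<longleftrightarrow>
          icomp C A ?\<delta> (low (Mor A) h \<cdot> to_terminal (Dom C ?s) (Ob J)) = \<delta>x"
        if e: "star_arr C K (Tgt A) \<cdot>\<^bsub>S\<^esub> h = F0 V'" "Tgt A \<cdot> low (Mor A) h = ?v"
      proof -
        let ?h' = "h \<cdot>\<^bsub>S\<^esub> S.to_terminal ?s (st (Ob J))"
            and ?h = "low (Mor A) h \<cdot> to_terminal (Dom C ?s) (Ob J)"
        have cc': "Src ?A \<cdot>\<^bsub>S\<^esub> ?\<delta>' = Tgt ?A \<cdot>\<^bsub>S\<^esub> ?h'"
          using S.comp_eq_comp[OF e(1), of "S.to_terminal ?s (st (Ob J))"] by simp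
        have cc: "Src A \<cdot> ?\<delta> = Tgt A \<cdot> ?h"
          unfolding Sv by (rule comp_eq_comp[OF e(2), symmetric]) simp_all
        have i: "icomp S ?A ?\<delta>' ?h' \<in> Hom S (st (Ob J)) (st (Mor A))"
        proof -
          have m: "?h' \<in> Arr S" "Cod S ?h' = Mor ?A" "Dom S ?h' = st (Ob J)" "Cod S ?\<delta>' = Mor ?A"
            by simp_all
          show ?thesis
            using S.icomp_simps(1-3)[OF star_internal_category[OF icat(2)] \<delta>'(1) m(1) m(4) m(2) cc']
                m(3) by simp
        qed
        have lh: "low (Mor A) ?h' = ?h \<cdot> ?l"
          using l mid_simps[of "S.to_terminal ?s (st (Ob J))" C K]
          by (simp add: low_comp mt to_terminal_comp[OF T])
        have li: "low (Mor A) (icomp S ?A ?\<delta>' ?h') = icomp C A ?\<delta> ?h \<cdot> ?l"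
          using low_icomp[OF icat(2) _ _ _ _ cc'] cc l unfolding low\<delta> lh by (simp add: icomp_comp)
        have ls: "low (Mor A) (star_arr C K \<delta>x) = \<delta>x \<cdot> ?l" by (simp add: low_star_arr low_Idn)
        show ?thesis
        proof
          assume "icomp S ?A ?\<delta>' ?h' = star_arr C K \<delta>x"
          from arg_cong[OF this, of "low (Mor A)"] have "icomp C A ?\<delta> ?h \<cdot> ?l = \<delta>x \<cdot> ?l"
            unfolding li ls .
          then show "icomp C A ?\<delta> ?h = \<delta>x" by (rule cancel) (use cc in simp_all)
        next
          assume e: "icomp C A ?\<delta> ?h = \<delta>x"
          show "icomp S ?A ?\<delta>' ?h' = star_arr C K \<delta>x"
            by (rule low_eqI[of _ _ "Mor A"]) (use i in \<open>simp_all add: li ls e del: low_star_arr_comp\<close>)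
        qed
      qed
      show ?thesis using h 1 2 3 by blast
    qed
    obtain h where h: "h \<in> Hom S ?s (st (Mor A))" "Src A \<cdot> low (Mor A) h = x"
        "Tgt A \<cdot> low (Mor A) h = ?v"
      "icomp C A ?\<delta> (low (Mor A) h \<cdot> to_terminal (Dom C ?s) (Ob J)) = \<delta>x" using ex1 iff by blast
    show "\<exists>!h. h \<in> Hom C (Dom C ?s) (Mor (FCod F)) \<and> Src (FCod F) \<cdot> h = x \<and> Tgt (FCod F) \<cdot> h = ?v \<and>
        icomp C (FCod F) ?\<delta> (h \<cdot> to_terminal (Dom C ?s) (Ob (FDom F))) = \<delta>x"
      unfolding F
    proof (rule ex1I[of _ "low (Mor A) h"])
      show "low (Mor A) h \<in> Hom C (Dom C ?s) (Mor A) \<and> Src A \<cdot> low (Mor A) h = x \<and>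
          Tgt A \<cdot> low (Mor A) h = ?v \<and>
        icomp C A ?\<delta> (low (Mor A) h \<cdot> to_terminal (Dom C ?s) (Ob J)) =
            \<delta>x" using h(1) by (intro conjI h) simp
      fix k assume k: "k \<in> Hom C (Dom C ?s) (Mor A) \<and> Src A \<cdot> k = x \<and> Tgt A \<cdot> k = ?v \<and>
        icomp C A ?\<delta> (k \<cdot> to_terminal (Dom C ?s) (Ob J)) = \<delta>x"
      have L: "lift (Mor A) ?s k \<in> Hom S ?s (st (Mor A))" "low (Mor A) (lift (Mor A) ?s k) = k" using k
        by simp_all
      have "lift (Mor A) ?s k = h"
        using ex1 iff[OF L(1)] iff[OF h(1)] h k unfolding L(2) by blast
      then show "k = low (Mor A) h" using L(2) by simp
    qed
  qed
  from elem_universal_change_terminal[OF F(1) T _ this, of ?T]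
  have "elem_universal F ?T (?v \<cdot> to_terminal (Dom C ?s) ?T) ?\<delta>" by simp
  moreover have "?v \<cdot> to_terminal (Dom C ?s) ?T = F0 V"
  proof -
    have "tt ?T = Idn C ?T" using to_tt[of "Idn C ?T"] by simp
    then show ?thesis by simp
  qed
  ultimately show ?thesis by simp
qed

end

section \<open>Initial objects of comma categories as limits\<close>

context lex_cat
begin

text \<open>The comma category of a global object \<open>a\<close> of \<open>A\<close> and a functor \<open>R : B \<rightarrow> A\<close>, given by its projection
  \<open>P\<close> to \<open>B\<close> and the arrow \<open>q : Ob D \<rightarrow> Mor A\<close> of the structure arrows \<open>a \<rightarrow> R b\<close>. An arrow of \<open>D\<close> is
  determined by its source \<open>x\<close> and its image \<open>g\<close> in \<open>B\<close>.\<close>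

lemma ex_comma_category:
  assumes R [simp]: "internal_functor C R" "FDom R = B" "FCod R = A" and T: "is_terminal C T"
      and a: "a \<in> Hom C T (Ob A)"
  obtains D P q where "P \<in> Hom (CAT C) D B" "q \<in> Hom C (Ob D) (Mor A)"
    "Src A \<cdot> q = a \<cdot> to_terminal T (Ob D)" "Tgt A \<cdot> q = F0 R \<cdot> F0 P"
    "\<And>W u. u \<in> Hom C W (Mor D) \<Longrightarrow> icomp C A (F1 R \<cdot> (F1 P \<cdot> u)) (q \<cdot> (Src D \<cdot> u)) = q \<cdot> (Tgt D \<cdot> u)"
    "\<And>W f b. f \<in> Hom C W (Mor A) \<Longrightarrow> b \<in> Hom C W (Ob B) \<Longrightarrow> Src A \<cdot> f = a \<cdot> to_terminal T W \<Longrightarrow>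
       Tgt A \<cdot> f = F0 R \<cdot> b \<Longrightarrow> \<exists>x\<in>Hom C W (Ob D). q \<cdot> x = f \<and> F0 P \<cdot> x = b"
    "\<And>W x y. x \<in> Hom C W (Ob D) \<Longrightarrow> y \<in> Hom C W (Ob D) \<Longrightarrow> q \<cdot> x = q \<cdot> y \<Longrightarrow> F0 P \<cdot> x = F0 P \<cdot> y \<Longrightarrow> x = y"
    "\<And>W x g. x \<in> Hom C W (Ob D) \<Longrightarrow> g \<in> Hom C W (Mor B) \<Longrightarrow> Src B \<cdot> g = F0 P \<cdot> x \<Longrightarrow>
       \<exists>u\<in>Hom C W (Mor D). Src D \<cdot> u = x \<and> F1 P \<cdot> u = g"
proof -
  have [simp]: "internal_category C B" "internal_category C A" using ifun_simps(1,2)[OF R(1)]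
    by simp_all
  have a' [simp]: "a \<in> Arr C" "Dom C a = T" "Cod C a = Ob A" using a by simp_all
  have [simp]: "T \<in> Obj C" using T by (simp add: is_terminal_def)
  note [simp] = to_terminal[OF T] to_terminal_comp[OF T]
  let ?p = "pb1 C (Src A) a"
  let ?D = "pb_obj C (Tgt A \<cdot> ?p) (F0 R)"
  let ?q = "?p \<cdot> pb1 C (Tgt A \<cdot> ?p) (F0 R)" and ?c = "pb2 C (Tgt A \<cdot> ?p) (F0 R)"
  have q [simp]: "?q \<in> Arr C" "Dom C ?q = ?D" "Cod C ?q = Mor A"
      and c [simp]: "?c \<in> Arr C" "Dom C ?c = ?D" "Cod C ?c = Ob B"
    by simp_all
  have qt: "Tgt A \<cdot> ?q = F0 R \<cdot> ?c" using pb_square[of "Tgt A \<cdot> ?p" "F0 R"] by simp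
  have "Src A \<cdot> ?q = a \<cdot> (pb2 C (Src A) a \<cdot> pb1 C (Tgt A \<cdot> ?p) (F0 R))"
    by (rule pb_square_comp) simp_all
  also have "pb2 C (Src A) a \<cdot> pb1 C (Tgt A \<cdot> ?p) (F0 R) = to_terminal T ?D"
    by (rule terminal_arrows_eq[OF T]) simp_all
  finally have qs: "Src A \<cdot> ?q = a \<cdot> to_terminal T ?D" .
  have ex: "\<exists>x\<in>Hom C W ?D. ?q \<cdot> x = f \<and> ?c \<cdot> x = b"
    if f: "f \<in> Hom C W (Mor A)" "b \<in> Hom C W (Ob B)" "Src A \<cdot> f = a \<cdot> to_terminal T W"
        "Tgt A \<cdot> f = F0 R \<cdot> b" for W f b
  proof -
    have W [simp]: "W \<in> Obj C" using f(1) by auto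
    let ?y = "pbpair (Src A) a f (to_terminal T W)"
    show ?thesis
      using f by (intro bexI[of _ "pbpair (Tgt A \<cdot> ?p) (F0 R) ?y b"]) simp_all
  qed
  have eqI: "x = y" if xy: "x \<in> Arr C" "y \<in> Arr C" "Dom C x = Dom C y" "Cod C x = ?D" "Cod C y = ?D"
      "?q \<cdot> x = ?q \<cdot> y" "?c \<cdot> x = ?c \<cdot> y" for x y
  proof (rule pb_eqI[of "Tgt A \<cdot> ?p" "F0 R"])
    show "pb1 C (Tgt A \<cdot> ?p) (F0 R) \<cdot> x = pb1 C (Tgt A \<cdot> ?p) (F0 R) \<cdot> y"
    proof (rule pb_eqI[of "Src A" a])
      show "pb2 C (Src A) a \<cdot> (pb1 C (Tgt A \<cdot> ?p) (F0 R) \<cdot> x) =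
          pb2 C (Src A) a \<cdot> (pb1 C (Tgt A \<cdot> ?p) (F0 R) \<cdot> y)"
        by (rule terminal_arrows_eq[OF T]) (use xy in simp_all)
    qed (use xy in simp_all)
  qed (use xy in simp_all)
  define q where "q = ?q"
  define c where "c = ?c"
  define D0 where "D0 = ?D"
  note ex = ex[folded q_def c_def D0_def] and eqI = eqI[folded q_def c_def D0_def]
      and qs = qs[folded q_def D0_def]
    and qt = qt[folded q_def c_def]
  have [simp]: "q \<in> Arr C" "Dom C q = D0" "Cod C q = Mor A" "c \<in> Arr C" "Dom C c = D0" "Cod C c = Ob B"
      "D0 \<in> Obj C"
    using q c unfolding q_def c_def D0_def by simp_all
  have qs' [simp]: "Src A \<cdot> (q \<cdot> x) = a \<cdot> to_terminal T (Dom C x)"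
      and qt' [simp]: "Tgt A \<cdot> (q \<cdot> x) = F0 R \<cdot> (c \<cdot> x)"
    if "x \<in> Arr C" "Cod C x = D0" for x
    using comp_eq_comp[OF qs, of x] comp_eq_comp[OF qt, of x] that by simp_all
  let ?M = "pb_obj C c (Src B)" and ?x = "pb1 C c (Src B)" and ?g = "pb2 C c (Src B)"
  have xg [simp]: "Src B \<cdot> (?g \<cdot> u) = c \<cdot> (?x \<cdot> u)" if "u \<in> Arr C" "Cod C u = ?M" for u
    using pb_square_comp[of c "Src B" u] that by simp
  have xg1: "Src B \<cdot> ?g = c \<cdot> ?x" using pb_square[of c "Src B"] by simp
  have "\<exists>t\<in>Hom C ?M D0. q \<cdot> t = icomp C A (F1 R \<cdot> ?g) (q \<cdot> ?x) \<and> c \<cdot> t = Tgt B \<cdot> ?g"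
    by (rule ex) (simp_all add: xg1)
  then obtain t where t: "t \<in> Hom C ?M D0" "q \<cdot> t = icomp C A (F1 R \<cdot> ?g) (q \<cdot> ?x)" "c \<cdot> t = Tgt B \<cdot> ?g"
    by blast
  have [simp]: "t \<in> Arr C" "Dom C t = ?M" "Cod C t = D0" using t(1) by simp_all
  have qt1 [simp]: "q \<cdot> (t \<cdot> u) = icomp C A (F1 R \<cdot> (?g \<cdot> u)) (q \<cdot> (?x \<cdot> u))"
      and ct1 [simp]: "c \<cdot> (t \<cdot> u) = Tgt B \<cdot> (?g \<cdot> u)"
    if "u \<in> Arr C" "Cod C u = ?M" for u
    using comp_eq_comp[OF t(2), of u] comp_eq_comp[OF t(3), of u] that by (simp_all add: icomp_comp xg1)
  let ?i = "pbpair c (Src B) (Idn C D0) (Ids B \<cdot> c)"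
  let ?k = "\<lambda>v u. pbpair c (Src B) (?x \<cdot> u) (icomp C B (?g \<cdot> v) (?g \<cdot> u))"
  have cmp: "Src B \<cdot> (?g \<cdot> v) = Tgt B \<cdot> (?g \<cdot> u)" if "v \<in> Hom C W ?M" "u \<in> Hom C W ?M" "?x \<cdot> v = t \<cdot> u"
      for v u W
    using that by simp
  have k: "?k v u \<in> Arr C" "Dom C (?k v u) = Dom C u" "Cod C (?k v u) = ?M" "?x \<cdot> ?k v u = ?x \<cdot> u"
      "?g \<cdot> ?k v u = icomp C B (?g \<cdot> v) (?g \<cdot> u)" if "v \<in> Hom C W ?M" "u \<in> Hom C W ?M" "?x \<cdot> v = t \<cdot> u"
          for v u W
    using that(1,2) cmp[OF that] by simp_all
  have tk: "t \<cdot> ?k v u = t \<cdot> v" if vu: "v \<in> Hom C W ?M" "u \<in> Hom C W ?M" "?x \<cdot> v = t \<cdot> u" for v u W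
  proof (rule eqI)
    have "q \<cdot> (t \<cdot> ?k v u) = icomp C A (F1 R \<cdot> icomp C B (?g \<cdot> v) (?g \<cdot> u)) (q \<cdot> (?x \<cdot> u))"
      using k[OF vu] vu(1,2) by (simp del: pbpair_simps)
    also have "\<dots> = icomp C A (F1 R \<cdot> (?g \<cdot> v)) (icomp C A (F1 R \<cdot> (?g \<cdot> u)) (q \<cdot> (?x \<cdot> u)))"
      using vu(1,2) cmp[OF vu] by (simp add: icomp_assoc)
    also have "\<dots> = q \<cdot> (t \<cdot> v)" using vu by simp
    finally show "q \<cdot> (t \<cdot> ?k v u) = q \<cdot> (t \<cdot> v)" .
    show "c \<cdot> (t \<cdot> ?k v u) = c \<cdot> (t \<cdot> v)" using k[OF vu] vu(1,2) cmp[OF vu] by (simp del: pbpair_simps)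
  qed (use k[OF vu] vu(1,2) in \<open>simp_all del: pbpair_simps\<close>)
  obtain D where D: "internal_category C D" "Ob D = D0" "Mor D = ?M" "Src D = ?x" "Tgt D = t"
      "Ids D = ?i"
    "\<And>W v u. v \<in> Hom C W ?M \<Longrightarrow> u \<in> Hom C W ?M \<Longrightarrow> ?x \<cdot> v = t \<cdot> u \<Longrightarrow> icomp C D v u = ?k v u"
  proof (rule ex_internal_category[of D0 ?M ?x t ?i ?k])
    show "t \<cdot> ?i = Idn C D0" by (rule eqI) (simp_all add: qt)
    fix W v u assume vu: "v \<in> Hom C W ?M" "u \<in> Hom C W ?M" "?x \<cdot> v = t \<cdot> u"
    show "?k v u \<in> Hom C W ?M \<and> ?x \<cdot> ?k v u = ?x \<cdot> u \<and> t \<cdot> ?k v u = t \<cdot> v"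
      using k[OF vu] tk[OF vu] vu(2) by (simp del: pbpair_simps)
  next
    fix V W v u h assume vu: "v \<in> Hom C W ?M" "u \<in> Hom C W ?M" and h: "h \<in> Hom C V W"
        and e: "?x \<cdot> v = t \<cdot> u"
    have "?x \<cdot> (v \<cdot> h) = (t \<cdot> u) \<cdot> h" by (rule comp_eq_comp[OF e]) (use vu h in simp_all)
    then have e': "v \<cdot> h \<in> Hom C V ?M" "u \<cdot> h \<in> Hom C V ?M" "?x \<cdot> (v \<cdot> h) = t \<cdot> (u \<cdot> h)" using vu h
      by simp_all
    show "?k v u \<cdot> h = ?k (v \<cdot> h) (u \<cdot> h)"
      using vu h cmp[OF vu e] by (simp add: pbpair_comp icomp_comp)
  next
    fix W u assume u: "u \<in> Hom C W ?M"
    have 1: "?i \<cdot> (t \<cdot> u) \<in> Hom C W ?M" "?x \<cdot> (?i \<cdot> (t \<cdot> u)) = t \<cdot> u" using u by simp_all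
    show "?k (?i \<cdot> (t \<cdot> u)) u = u"
      by (rule pb_eqI[of c "Src B"]) (use k[OF 1(1) u 1(2)] u in simp_all)
    show "?k u (?i \<cdot> (?x \<cdot> u)) = u"
      by (rule pb_eqI[of c "Src B"]) (use u in simp_all)
  next
    fix W w v u assume w: "w \<in> Hom C W ?M" "v \<in> Hom C W ?M" "u \<in> Hom C W ?M"
        and e: "?x \<cdot> w = t \<cdot> v" "?x \<cdot> v = t \<cdot> u"
    note k1 = k[OF w(1,2) e(1)] and k2 = k[OF w(2,3) e(2)] and c1 = cmp[OF w(1,2) e(1)]
        and c2 = cmp[OF w(2,3) e(2)]
    show "?k (?k w v) u = ?k w (?k v u)"
      unfolding k1(5) k2(4,5) using w c1 c2 by (simp add: icomp_assoc)
  qed simp_all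
  let ?P = "\<lparr>FDom = D, FCod = B, F0 = c, F1 = ?g\<rparr>"
  have P: "internal_functor C ?P"
  proof (rule internal_functorI)
    fix W v u assume *: "v \<in> Hom C W (Mor (FDom ?P))" "u \<in> Hom C W (Mor (FDom ?P))"
        "Src (FDom ?P) \<cdot> v = Tgt (FDom ?P) \<cdot> u"
    then have vu: "v \<in> Hom C W ?M" "u \<in> Hom C W ?M" "?x \<cdot> v = t \<cdot> u" by (simp_all add: D(1-6))
    show "F1 ?P \<cdot> icomp C (FDom ?P) v u = icomp C (FCod ?P) (F1 ?P \<cdot> v) (F1 ?P \<cdot> u)"
      using D(7)[OF vu] k(5)[OF vu] by simp
  qed (simp_all add: D(1-6))
  show thesis
  proof (rule that[of ?P D q])
    show "?P \<in> Hom (CAT C) D B" using P by simp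
    show "Src A \<cdot> q = a \<cdot> to_terminal T (Ob D)" "Tgt A \<cdot> q = F0 R \<cdot> F0 ?P" using qs qt
      by (simp_all add: D)
    fix W f b assume "f \<in> Hom C W (Mor A)" "b \<in> Hom C W (Ob B)" "Src A \<cdot> f = a \<cdot> to_terminal T W"
        "Tgt A \<cdot> f = F0 R \<cdot> b"
    from ex[OF this] show "\<exists>x\<in>Hom C W (Ob D). q \<cdot> x = f \<and> F0 ?P \<cdot> x = b" by (simp add: D)
  next
    fix W x y assume "x \<in> Hom C W (Ob D)" "y \<in> Hom C W (Ob D)" "q \<cdot> x = q \<cdot> y" "F0 ?P \<cdot> x = F0 ?P \<cdot> y"
    then show "x = y" by - (rule eqI; simp add: D)
  next
    fix W x g assume "x \<in> Hom C W (Ob D)" "g \<in> Hom C W (Mor B)" "Src B \<cdot> g = F0 ?P \<cdot> x"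
    then show "\<exists>u\<in>Hom C W (Mor D). Src D \<cdot> u = x \<and> F1 ?P \<cdot> u = g"
      by (intro bexI[of _ "pbpair c (Src B) x g"]) (simp_all add: D)
  qed (simp_all add: D)
qed

text \<open>A universal arrow \<open>\<eta> : a \<rightarrow> R v\<close> from \<open>a : T \<rightarrow> Ob A\<close> to \<open>R\<close>, at all stages, where \<open>T\<close> is
  terminal.\<close>

definition universal_arrow :: "('o, 'm) ifun \<Rightarrow> 'o \<Rightarrow> 'm \<Rightarrow> 'm \<Rightarrow> 'm \<Rightarrow> bool" where
  "universal_arrow R T a v \<eta> \<longleftrightarrow>
     v \<in> Hom C T (Ob (FDom R)) \<and> \<eta> \<in> Hom C T (Mor (FCod R)) \<and> Src (FCod R) \<cdot> \<eta> = a \<and> Tgt (FCod R) \<cdot> \<eta> =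
         F0 R \<cdot> v \<and>
     (\<forall>W b f. b \<in> Hom C W (Ob (FDom R)) \<longrightarrow> f \<in> Hom C W (Mor (FCod R)) \<longrightarrow>
        Src (FCod R) \<cdot> f = a \<cdot> to_terminal T W \<longrightarrow> Tgt (FCod R) \<cdot> f = F0 R \<cdot> b \<longrightarrow>
        (\<exists>!g. g \<in> Hom C W (Mor (FDom R)) \<and> Src (FDom R) \<cdot> g = v \<cdot> to_terminal T W \<and> Tgt (FDom R) \<cdot> g = b
            \<and>
              icomp C (FCod R) (F1 R \<cdot> g) (\<eta> \<cdot> to_terminal T W) = f))"

text \<open>If all functors into \<open>B\<close> have limits and \<open>R\<close> preserves them, then the limit of the projection from
  the comma category is the vertex of a universal arrow from \<open>a\<close> to \<open>R\<close>, at all stages. Uniqueness at later stages needs no base change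
  of the limit: the component of the limit cone at the universal arrow is the identity, and naturality
  of the cone then determines all other arrows.\<close>

lemma universal_arrow_from_limits:
  assumes R [simp]: "internal_functor C R" "FDom R = B" "FCod R = A" and T: "is_terminal C T"
      and a: "a \<in> Hom C T (Ob A)"
    and lim: "\<And>D P. P \<in> Hom (CAT C) D B \<Longrightarrow> \<exists>v \<gamma>. elem_universal P T v \<gamma> \<and>
       elem_universal (R \<cdot>\<^bsub>CAT C\<^esub> P) T (F0 R \<cdot> v) (F1 R \<cdot> \<gamma>)"
  shows "\<exists>v \<eta>. universal_arrow R T a v \<eta>"
proof -
  have [simp]: "internal_category C B" "internal_category C A" using ifun_simps(1,2)[OF R(1)]
    by simp_all
  have a' [simp]: "a \<in> Arr C" "Dom C a = T" "Cod C a = Ob A" using a by simp_all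
  have [simp]: "T \<in> Obj C" using T by (simp add: is_terminal_def)
  note [simp] = to_terminal[OF T] to_terminal_comp[OF T]
  have TT: "to_terminal T T = Idn C T" by (rule terminal_arrows_eq[OF T]) simp_all
  obtain P D q where P: "P \<in> Hom (CAT C) D B" and q: "q \<in> Hom C (Ob D) (Mor A)"
    and qs: "Src A \<cdot> q = a \<cdot> to_terminal T (Ob D)" and qt: "Tgt A \<cdot> q = F0 R \<cdot> F0 P"
    and qn: "\<And>W u. u \<in> Hom C W (Mor D) \<Longrightarrow>
        icomp C A (F1 R \<cdot> (F1 P \<cdot> u)) (q \<cdot> (Src D \<cdot> u)) = q \<cdot> (Tgt D \<cdot> u)"
    and ex0: "\<And>W f b. f \<in> Hom C W (Mor A) \<Longrightarrow> b \<in> Hom C W (Ob B) \<Longrightarrow> Src A \<cdot> f = a \<cdot> to_terminal T W \<Longrightarrow>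
       Tgt A \<cdot> f = F0 R \<cdot> b \<Longrightarrow> \<exists>x\<in>Hom C W (Ob D). q \<cdot> x = f \<and> F0 P \<cdot> x = b"
    and un0: "\<And>W x y. x \<in> Hom C W (Ob D) \<Longrightarrow> y \<in> Hom C W (Ob D) \<Longrightarrow> q \<cdot> x = q \<cdot> y \<Longrightarrow> F0 P \<cdot> x = F0 P \<cdot> y \<Longrightarrow>
        x = y"
    and ex1: "\<And>W x g. x \<in> Hom C W (Ob D) \<Longrightarrow> g \<in> Hom C W (Mor B) \<Longrightarrow> Src B \<cdot> g = F0 P \<cdot> x \<Longrightarrow>
       \<exists>u\<in>Hom C W (Mor D). Src D \<cdot> u = x \<and> F1 P \<cdot> u = g"
    by (rule ex_comma_category[OF R T a]) (rule that; blast)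
  have [simp]: "internal_functor C P" "FDom P = D" "FCod P = B" using P by simp_all
  have [simp]: "internal_category C D" using ifun_simps(1)[of P] by simp
  have [simp]: "q \<in> Arr C" "Dom C q = Ob D" "Cod C q = Mor A" using q by simp_all
  obtain v \<gamma> where uP: "elem_universal P T v \<gamma>"
      and uRP: "elem_universal (R \<cdot>\<^bsub>CAT C\<^esub> P) T (F0 R \<cdot> v) (F1 R \<cdot> \<gamma>)"
    using lim[OF P] by blast
  have cP: "elem_cone P T v \<gamma>" using uP unfolding elem_universal_def by blast
  have v [simp]: "v \<in> Arr C" "Dom C v = T" "Cod C v = Ob B" "\<gamma> \<in> Arr C" "Dom C \<gamma> = Ob D"
      "Cod C \<gamma> = Mor B"
    and \<gamma>: "Src B \<cdot> \<gamma> = v \<cdot> to_terminal T (Ob D)" "Tgt B \<cdot> \<gamma> = F0 P"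
      "\<And>V u. u \<in> Hom C V (Mor D) \<Longrightarrow> icomp C B (F1 P \<cdot> u) (\<gamma> \<cdot> (Src D \<cdot> u)) = \<gamma> \<cdot> (Tgt D \<cdot> u)"
    using cP unfolding elem_cone_def by simp_all
  have \<gamma>' [simp]: "Src B \<cdot> (\<gamma> \<cdot> x) = v \<cdot> to_terminal T (Dom C x)" "Tgt B \<cdot> (\<gamma> \<cdot> x) = F0 P \<cdot> x"
    if "x \<in> Arr C" "Cod C x = Ob D" for x
    using comp_eq_comp[OF \<gamma>(1), of x] comp_eq_comp[OF \<gamma>(2), of x] that by simp_all
  have "elem_cone (R \<cdot>\<^bsub>CAT C\<^esub> P) T a q" unfolding elem_cone_def using qs qt qn by simp
  then have "\<exists>!h. h \<in> Hom C T (Mor A) \<and> Src A \<cdot> h = a \<and> Tgt A \<cdot> h = F0 R \<cdot> v \<and>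
      icomp C A (F1 R \<cdot> \<gamma>) (h \<cdot> to_terminal T (Ob D)) = q"
    using uRP unfolding elem_universal_def by simp
  then obtain \<eta> where \<eta>: "\<eta> \<in> Hom C T (Mor A)" "Src A \<cdot> \<eta> = a" "Tgt A \<cdot> \<eta> = F0 R \<cdot> v"
      "icomp C A (F1 R \<cdot> \<gamma>) (\<eta> \<cdot> to_terminal T (Ob D)) = q" by blast
  have [simp]: "\<eta> \<in> Arr C" "Dom C \<eta> = T" "Cod C \<eta> = Mor A" using \<eta>(1) by simp_all
  have \<eta>' [simp]: "Src A \<cdot> (\<eta> \<cdot> x) = a \<cdot> x" "Tgt A \<cdot> (\<eta> \<cdot> x) = F0 R \<cdot> (v \<cdot> x)"
      if "x \<in> Arr C" "Cod C x = T" for x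
    using comp_eq_comp[OF \<eta>(2), of x] comp_eq_comp[OF \<eta>(3), of x] that by simp_all
  have "\<exists>x\<in>Hom C T (Ob D). q \<cdot> x = \<eta> \<and> F0 P \<cdot> x = v" by (rule ex0) (simp_all add: TT \<eta>(2,3))
  then obtain x0 where x0: "x0 \<in> Hom C T (Ob D)" "q \<cdot> x0 = \<eta>" "F0 P \<cdot> x0 = v" by blast
  have [simp]: "x0 \<in> Arr C" "Dom C x0 = T" "Cod C x0 = Ob D" using x0(1) by simp_all
  have x0' [simp]: "q \<cdot> (x0 \<cdot> w) = \<eta> \<cdot> w" "F0 P \<cdot> (x0 \<cdot> w) = v \<cdot> w" if "w \<in> Arr C" "Cod C w = T" for w
    using comp_eq_comp[OF x0(2), of w] comp_eq_comp[OF x0(3), of w] that by simp_all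
  have factor: "icomp C B g (\<gamma> \<cdot> (x0 \<cdot> to_terminal T W)) = \<gamma> \<cdot> y"
    if g: "g \<in> Hom C W (Mor B)" "Src B \<cdot> g = v \<cdot> to_terminal T W"
        and y: "y \<in> Hom C W (Ob D)" "F0 P \<cdot> y = Tgt B \<cdot> g"
      "icomp C A (F1 R \<cdot> g) (\<eta> \<cdot> to_terminal T W) = q \<cdot> y" for W g y
  proof -
    have W [simp]: "W \<in> Obj C" using g(1) by auto
    have "\<exists>u\<in>Hom C W (Mor D). Src D \<cdot> u = x0 \<cdot> to_terminal T W \<and> F1 P \<cdot> u = g"
      by (rule ex1) (use g in simp_all)
    then obtain u where u: "u \<in> Hom C W (Mor D)" "Src D \<cdot> u = x0 \<cdot> to_terminal T W" "F1 P \<cdot> u = g"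
      by blast
    have "Tgt D \<cdot> u = y"
    proof (rule un0[of _ W])
      show "q \<cdot> (Tgt D \<cdot> u) = q \<cdot> y" using qn[OF u(1)] y(3) unfolding u(2,3) by simp
      show "F0 P \<cdot> (Tgt D \<cdot> u) = F0 P \<cdot> y" using ifun_app(2)[of P u B] u y(2) by simp
    qed (use u y in simp_all)
    then show ?thesis using \<gamma>(3)[OF u(1)] unfolding u(2,3) by simp
  qed
  have D0: "Ob D \<in> Obj C" by simp
  have id: "\<gamma> \<cdot> x0 = Ids B \<cdot> v"
  proof -
    have "\<exists>!h. h \<in> Hom C T (Mor B) \<and> Src B \<cdot> h = v \<and> Tgt B \<cdot> h = v \<and>
        icomp C B \<gamma> (h \<cdot> to_terminal T (Ob D)) = \<gamma>"
      using uP cP unfolding elem_universal_def by simp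
    moreover have "\<gamma> \<cdot> x0 \<in> Hom C T (Mor B) \<and> Src B \<cdot> (\<gamma> \<cdot> x0) = v \<and> Tgt B \<cdot> (\<gamma> \<cdot> x0) = v \<and>
        icomp C B \<gamma> ((\<gamma> \<cdot> x0) \<cdot> to_terminal T (Ob D)) = \<gamma>"
      using factor[of \<gamma> "Ob D" "Idn C (Ob D)"] \<gamma>(1,2) \<eta>(4) by (simp add: TT x0(3))
    moreover have "Ids B \<cdot> v \<in> Hom C T (Mor B) \<and> Src B \<cdot> (Ids B \<cdot> v) = v \<and> Tgt B \<cdot> (Ids B \<cdot> v) = v \<and>
        icomp C B \<gamma> ((Ids B \<cdot> v) \<cdot> to_terminal T (Ob D)) = \<gamma>"
      using \<gamma>(1) by simp
    ultimately show ?thesis by blast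
  qed
  have "universal_arrow R T a v \<eta>"
    unfolding universal_arrow_def R
  proof (intro conjI allI impI)
    fix W b f assume b: "b \<in> Hom C W (Ob B)"
        and f: "f \<in> Hom C W (Mor A)" "Src A \<cdot> f = a \<cdot> to_terminal T W" "Tgt A \<cdot> f = F0 R \<cdot> b"
    have W [simp]: "W \<in> Obj C" using b by auto
    obtain y where y: "y \<in> Hom C W (Ob D)" "q \<cdot> y = f" "F0 P \<cdot> y = b" using ex0[OF f(1) b f(2,3)]
      by blast
    have [simp]: "y \<in> Arr C" "Dom C y = W" "Cod C y = Ob D" using y(1) by simp_all
    show "\<exists>!g. g \<in> Hom C W (Mor B) \<and> Src B \<cdot> g = v \<cdot> to_terminal T W \<and> Tgt B \<cdot> g = b \<and>
           icomp C A (F1 R \<cdot> g) (\<eta> \<cdot> to_terminal T W) = f"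
    proof (rule ex1I[of _ "\<gamma> \<cdot> y"])
      have cc: "Src A \<cdot> (F1 R \<cdot> \<gamma>) = Tgt A \<cdot> (\<eta> \<cdot> to_terminal T (Ob D))" using \<gamma>(1) by simp
      have "icomp C A (F1 R \<cdot> \<gamma>) (\<eta> \<cdot> to_terminal T (Ob D)) \<cdot> y =
          icomp C A (F1 R \<cdot> (\<gamma> \<cdot> y)) (\<eta> \<cdot> to_terminal T W)"
        using icomp_comp[OF _ _ _ _ _ cc, of y] by simp
      then show "\<gamma> \<cdot> y \<in> Hom C W (Mor B) \<and> Src B \<cdot> (\<gamma> \<cdot> y) = v \<cdot> to_terminal T W \<and> Tgt B \<cdot> (\<gamma> \<cdot> y) = b \<and>
           icomp C A (F1 R \<cdot> (\<gamma> \<cdot> y)) (\<eta> \<cdot> to_terminal T W) = f"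
        unfolding \<eta>(4) y(2) by (simp add: y(3))
      fix g assume g: "g \<in> Hom C W (Mor B) \<and> Src B \<cdot> g = v \<cdot> to_terminal T W \<and> Tgt B \<cdot> g = b \<and>
           icomp C A (F1 R \<cdot> g) (\<eta> \<cdot> to_terminal T W) = f"
      then have "icomp C B g (\<gamma> \<cdot> (x0 \<cdot> to_terminal T W)) = \<gamma> \<cdot> y"
        by (intro factor) (simp_all add: y)
      moreover have "\<gamma> \<cdot> (x0 \<cdot> to_terminal T W) = (Ids B \<cdot> v) \<cdot> to_terminal T W"
        by (rule comp_eq_comp[OF id]) simp_all
      moreover have "icomp C B g (Ids B \<cdot> (v \<cdot> to_terminal T W)) = g" using g
        by (intro icomp_Ids_right) simp_all
      ultimately show "g = \<gamma> \<cdot> y" by simp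
    qed
  qed (use \<eta> in simp_all)
  then show ?thesis by blast
qed

section \<open>Adjunctions from universal arrows\<close>

text \<open>A functor \<open>R\<close> with universal arrows \<open>e\<close> from the generic object of \<open>A\<close> to \<open>R\<close> has a left adjoint.\<close>

lemma adjunction_from_universal_arrows:
  assumes R [simp]: "internal_functor C R" "FDom R = B" "FCod R = A"
    and l: "l \<in> Hom C (Ob A) (Ob B)"
        and e: "e \<in> Hom C (Ob A) (Mor A)" "Src A \<cdot> e = Idn C (Ob A)" "Tgt A \<cdot> e = F0 R \<cdot> l"
    and un: "\<And>W p b f. p \<in> Hom C W (Ob A) \<Longrightarrow> b \<in> Hom C W (Ob B) \<Longrightarrow> f \<in> Hom C W (Mor A) \<Longrightarrow> Src A \<cdot> f = p \<Longrightarrow>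
        Tgt A \<cdot> f = F0 R \<cdot> b \<Longrightarrow>
      \<exists>!g. g \<in> Hom C W (Mor B) \<and> Src B \<cdot> g = l \<cdot> p \<and> Tgt B \<cdot> g = b \<and> icomp C A (F1 R \<cdot> g) (e \<cdot> p) = f"
  shows "\<exists>L \<eta> \<epsilon>. L \<in> Hom (CAT C) A B \<and> adjunction C L R \<eta> \<epsilon>"
proof -
  have [simp]: "internal_category C B" "internal_category C A" using ifun_simps(1,2)[OF R(1)]
    by simp_all
  have [simp]: "l \<in> Arr C" "Dom C l = Ob A" "Cod C l = Ob B" "e \<in> Arr C" "Dom C e = Ob A"
      "Cod C e = Mor A" using l e(1) by simp_all
  have e' [simp]: "Src A \<cdot> (e \<cdot> p) = p" "Tgt A \<cdot> (e \<cdot> p) = F0 R \<cdot> (l \<cdot> p)"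
      if "p \<in> Arr C" "Cod C p = Ob A" for p
    using comp_eq_comp[OF e(2), of p] comp_eq_comp[OF e(3), of p] that by simp_all
  have eqI: "g = g'" if "p \<in> Arr C" "Cod C p = Ob A" "g \<in> Arr C" "g' \<in> Arr C" "Dom C g = Dom C p"
      "Dom C g' = Dom C p" "Cod C g = Mor B" "Cod C g' = Mor B"
    "Src B \<cdot> g = l \<cdot> p" "Src B \<cdot> g' = l \<cdot> p" "Tgt B \<cdot> g = Tgt B \<cdot> g'"
        "icomp C A (F1 R \<cdot> g) (e \<cdot> p) = icomp C A (F1 R \<cdot> g') (e \<cdot> p)" for p g g'
  proof -
    have "\<exists>!h. h \<in> Hom C (Dom C p) (Mor B) \<and> Src B \<cdot> h = l \<cdot> p \<and> Tgt B \<cdot> h = Tgt B \<cdot> g' \<and>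
        icomp C A (F1 R \<cdot> h) (e \<cdot> p) = icomp C A (F1 R \<cdot> g') (e \<cdot> p)"
      by (rule un) (use that in simp_all)
    moreover have "g \<in> Hom C (Dom C p) (Mor B) \<and> Src B \<cdot> g = l \<cdot> p \<and> Tgt B \<cdot> g = Tgt B \<cdot> g' \<and>
        icomp C A (F1 R \<cdot> g) (e \<cdot> p) = icomp C A (F1 R \<cdot> g') (e \<cdot> p)"
      using that by simp
    moreover have "g' \<in> Hom C (Dom C p) (Mor B) \<and> Src B \<cdot> g' = l \<cdot> p \<and> Tgt B \<cdot> g' = Tgt B \<cdot> g' \<and>
        icomp C A (F1 R \<cdot> g') (e \<cdot> p) = icomp C A (F1 R \<cdot> g') (e \<cdot> p)"
      using that by simp
    ultimately show ?thesis by blast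
  qed
  have "\<exists>!g. g \<in> Hom C (Mor A) (Mor B) \<and> Src B \<cdot> g = l \<cdot> Src A \<and> Tgt B \<cdot> g = l \<cdot> Tgt A \<and>
      icomp C A (F1 R \<cdot> g) (e \<cdot> Src A) = icomp C A (e \<cdot> Tgt A) (Idn C (Mor A))"
    by (rule un) simp_all
  then obtain m where m: "m \<in> Hom C (Mor A) (Mor B)" "Src B \<cdot> m = l \<cdot> Src A" "Tgt B \<cdot> m = l \<cdot> Tgt A"
    "icomp C A (F1 R \<cdot> m) (e \<cdot> Src A) = icomp C A (e \<cdot> Tgt A) (Idn C (Mor A))" by blast
  have [simp]: "m \<in> Arr C" "Dom C m = Mor A" "Cod C m = Mor B" using m(1) by simp_all
  have mst [simp]: "Src B \<cdot> (m \<cdot> h) = l \<cdot> (Src A \<cdot> h)" "Tgt B \<cdot> (m \<cdot> h) = l \<cdot> (Tgt A \<cdot> h)"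
      if "h \<in> Arr C" "Cod C h = Mor A" for h
    using comp_eq_comp[OF m(2), of h] comp_eq_comp[OF m(3), of h] that by simp_all
  have mn: "icomp C A (F1 R \<cdot> (m \<cdot> h)) (e \<cdot> (Src A \<cdot> h)) = icomp C A (e \<cdot> (Tgt A \<cdot> h)) h"
      if h: "h \<in> Arr C" "Cod C h = Mor A" for h
  proof -
    have cc: "Src A \<cdot> (F1 R \<cdot> m) = Tgt A \<cdot> (e \<cdot> Src A)" "Src A \<cdot> (e \<cdot> Tgt A) = Tgt A \<cdot> Idn C (Mor A)"
      using m(2) by simp_all
    show ?thesis using arg_cong[OF m(4), of "\<lambda>x. x \<cdot> h"] cc h by (simp add: icomp_comp)
  qed
  let ?L = "\<lparr>FDom = A, FCod = B, F0 = l, F1 = m\<rparr>"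
  have L [simp]: "internal_functor C ?L"
  proof (rule internal_functorI)
    fix W x assume x: "x \<in> Hom C W (Ob (FDom ?L))"
    have "m \<cdot> (Ids A \<cdot> x) = Ids B \<cdot> (l \<cdot> x)"
      by (rule eqI[of x]) (use x mn[of "Ids A \<cdot> x"] in simp_all)
    then show "F1 ?L \<cdot> (Ids (FDom ?L) \<cdot> x) = Ids (FCod ?L) \<cdot> (F0 ?L \<cdot> x)" by simp
  next
    fix W h k assume hk: "h \<in> Hom C W (Mor (FDom ?L))" "k \<in> Hom C W (Mor (FDom ?L))"
        and c: "Src (FDom ?L) \<cdot> h = Tgt (FDom ?L) \<cdot> k"
    have [simp]: "h \<in> Arr C" "Dom C h = W" "Cod C h = Mor A" "k \<in> Arr C" "Dom C k = W" "Cod C k = Mor A"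
        and c' [simp]: "Src A \<cdot> h = Tgt A \<cdot> k"
      using hk c by simp_all
    have "m \<cdot> icomp C A h k = icomp C B (m \<cdot> h) (m \<cdot> k)"
    proof (rule eqI[of "Src A \<cdot> k"])
      have "icomp C A (F1 R \<cdot> icomp C B (m \<cdot> h) (m \<cdot> k)) (e \<cdot> (Src A \<cdot> k)) =
         icomp C A (icomp C A (F1 R \<cdot> (m \<cdot> h)) (F1 R \<cdot> (m \<cdot> k))) (e \<cdot> (Src A \<cdot> k))" by simp
      also have "\<dots> = icomp C A (e \<cdot> (Tgt A \<cdot> h)) (icomp C A h k)"
        using mn[of h] mn[of k] by (intro icomp_paste[where b = "e \<cdot> (Tgt A \<cdot> k)"]) simp_all
      also have "\<dots> = icomp C A (F1 R \<cdot> (m \<cdot> icomp C A h k)) (e \<cdot> (Src A \<cdot> k))"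
        using mn[of "icomp C A h k"] by simp
      finally show "icomp C A (F1 R \<cdot> (m \<cdot> icomp C A h k)) (e \<cdot> (Src A \<cdot> k)) =
        icomp C A (F1 R \<cdot> icomp C B (m \<cdot> h) (m \<cdot> k)) (e \<cdot> (Src A \<cdot> k))" ..
    qed simp_all
    then show "F1 ?L \<cdot> icomp C (FDom ?L) h k = icomp C (FCod ?L) (F1 ?L \<cdot> h) (F1 ?L \<cdot> k)" by simp
  qed simp_all
  have "\<exists>!g. g \<in> Hom C (Ob B) (Mor B) \<and> Src B \<cdot> g = l \<cdot> F0 R \<and> Tgt B \<cdot> g = Idn C (Ob B) \<and>
      icomp C A (F1 R \<cdot> g) (e \<cdot> F0 R) = Ids A \<cdot> F0 R"
    by (rule un) simp_all
  then obtain \<epsilon> where \<epsilon>: "\<epsilon> \<in> Hom C (Ob B) (Mor B)" "Src B \<cdot> \<epsilon> = l \<cdot> F0 R" "Tgt B \<cdot> \<epsilon> = Idn C (Ob B)"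
    "icomp C A (F1 R \<cdot> \<epsilon>) (e \<cdot> F0 R) = Ids A \<cdot> F0 R" by blast
  have [simp]: "\<epsilon> \<in> Arr C" "Dom C \<epsilon> = Ob B" "Cod C \<epsilon> = Mor B" using \<epsilon>(1) by simp_all
  have \<epsilon>st [simp]: "Src B \<cdot> (\<epsilon> \<cdot> b) = l \<cdot> (F0 R \<cdot> b)" "Tgt B \<cdot> (\<epsilon> \<cdot> b) = b"
      if "b \<in> Arr C" "Cod C b = Ob B" for b
    using comp_eq_comp[OF \<epsilon>(2), of b] comp_eq_comp[OF \<epsilon>(3), of b] that by simp_all
  have \<epsilon>n: "icomp C A (F1 R \<cdot> (\<epsilon> \<cdot> b)) (e \<cdot> (F0 R \<cdot> b)) = Ids A \<cdot> (F0 R \<cdot> b)"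
      if b: "b \<in> Arr C" "Cod C b = Ob B" for b
  proof -
    have cc: "Src A \<cdot> (F1 R \<cdot> \<epsilon>) = Tgt A \<cdot> (e \<cdot> F0 R)" using \<epsilon>(2) by simp
    show ?thesis using arg_cong[OF \<epsilon>(4), of "\<lambda>x. x \<cdot> b"] cc b by (simp add: icomp_comp)
  qed
  have nat\<eta>: "nat_trans C (Idn (CAT C) A) (R \<cdot>\<^bsub>CAT C\<^esub> ?L) e"
    unfolding nat_trans_def Let_def using e mn[of "Idn C (Mor A)"] by simp
  have "icomp C B (\<epsilon> \<cdot> Tgt B) (m \<cdot> F1 R) = icomp C B (Idn C (Mor B)) (\<epsilon> \<cdot> Src B)"
  proof (rule eqI[of "F0 R \<cdot> Src B"])
    have [simp]: "Src A \<cdot> F1 R = F0 R \<cdot> Src B" "Tgt A \<cdot> F1 R = F0 R \<cdot> Tgt B"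
      using ifun_laws(1,2)[OF R(1)] by simp_all
    have "icomp C A (F1 R \<cdot> icomp C B (\<epsilon> \<cdot> Tgt B) (m \<cdot> F1 R)) (e \<cdot> (F0 R \<cdot> Src B)) =
      icomp C A (icomp C A (F1 R \<cdot> (\<epsilon> \<cdot> Tgt B)) (F1 R \<cdot> (m \<cdot> F1 R))) (e \<cdot> (F0 R \<cdot> Src B))" by simp
    also have "\<dots> = icomp C A (F1 R \<cdot> (\<epsilon> \<cdot> Tgt B)) (icomp C A (F1 R \<cdot> (m \<cdot> F1 R)) (e \<cdot> (F0 R \<cdot> Src B)))"
      by (rule icomp_assoc) simp_all
    also have "\<dots> = icomp C A (F1 R \<cdot> (\<epsilon> \<cdot> Tgt B)) (icomp C A (e \<cdot> (F0 R \<cdot> Tgt B)) (F1 R))"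
      using mn[of "F1 R"] by simp
    also have "\<dots> = icomp C A (icomp C A (F1 R \<cdot> (\<epsilon> \<cdot> Tgt B)) (e \<cdot> (F0 R \<cdot> Tgt B))) (F1 R)"
      by (rule icomp_assoc[symmetric]) simp_all
    also have "\<dots> = F1 R" using \<epsilon>n[of "Tgt B"] by simp
    also have "F1 R = icomp C A (F1 R) (icomp C A (F1 R \<cdot> (\<epsilon> \<cdot> Src B)) (e \<cdot> (F0 R \<cdot> Src B)))"
      using \<epsilon>n[of "Src B"] by simp
    also have "\<dots> = icomp C A (icomp C A (F1 R) (F1 R \<cdot> (\<epsilon> \<cdot> Src B))) (e \<cdot> (F0 R \<cdot> Src B))"
      by (rule icomp_assoc[symmetric]) simp_all
    also have "\<dots> = icomp C A (F1 R \<cdot> icomp C B (Idn C (Mor B)) (\<epsilon> \<cdot> Src B)) (e \<cdot> (F0 R \<cdot> Src B))"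
      by simp
    finally show "icomp C A (F1 R \<cdot> icomp C B (\<epsilon> \<cdot> Tgt B) (m \<cdot> F1 R)) (e \<cdot> (F0 R \<cdot> Src B)) =
      icomp C A (F1 R \<cdot> icomp C B (Idn C (Mor B)) (\<epsilon> \<cdot> Src B)) (e \<cdot> (F0 R \<cdot> Src B))" .
  qed (simp_all add: ifun_laws(1,2)[OF R(1), unfolded R])
  then have nat\<epsilon>: "nat_trans C (?L \<cdot>\<^bsub>CAT C\<^esub> R) (Idn (CAT C) B) \<epsilon>"
    unfolding nat_trans_def Let_def using \<epsilon>(2,3) by simp
  have "icomp C B (\<epsilon> \<cdot> l) (m \<cdot> e) = Ids B \<cdot> l"
  proof (rule eqI[of "Idn C (Ob A)"])
    have "icomp C A (F1 R \<cdot> icomp C B (\<epsilon> \<cdot> l) (m \<cdot> e)) e =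
        icomp C A (icomp C A (F1 R \<cdot> (\<epsilon> \<cdot> l)) (F1 R \<cdot> (m \<cdot> e))) e" using e(2,3) by simp
    also have "\<dots> = icomp C A (F1 R \<cdot> (\<epsilon> \<cdot> l)) (icomp C A (F1 R \<cdot> (m \<cdot> e)) e)"
      by (rule icomp_assoc) (use e(2,3) in simp_all)
    also have "\<dots> = icomp C A (F1 R \<cdot> (\<epsilon> \<cdot> l)) (icomp C A (e \<cdot> (F0 R \<cdot> l)) e)" using mn[of e] e(2,3)
      by simp
    also have "\<dots> = icomp C A (icomp C A (F1 R \<cdot> (\<epsilon> \<cdot> l)) (e \<cdot> (F0 R \<cdot> l))) e"
      by (rule icomp_assoc[symmetric]) (use e(2,3) in simp_all)
    also have "\<dots> = e" using \<epsilon>n[of l] e(3) by simp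
    finally show "icomp C A (F1 R \<cdot> icomp C B (\<epsilon> \<cdot> l) (m \<cdot> e)) (e \<cdot> Idn C (Ob A)) =
        icomp C A (F1 R \<cdot> (Ids B \<cdot> l)) (e \<cdot> Idn C (Ob A))"
      using e(3) by simp
  qed (use e(2,3) in simp_all)
  then have "adjunction C ?L R e \<epsilon>"
    unfolding adjunction_def Let_def using nat\<eta> nat\<epsilon> \<epsilon>(4) by simp
  moreover have "?L \<in> Hom (CAT C) A B" by simp
  ultimately show ?thesis by blast
qed

end

section \<open>Finite limits and exponentials in slices\<close>

lemma lex_from_finite_limits:
  fixes C :: "('o, 'm) cat" (structure)
  assumes "category C" and lim: "has_finite_limits C"
  shows "lex_cat C"
proof -
  interpret category C by fact
  show ?thesis
  proof
    let ?J = "\<lparr>Obj = {}, Arr = {}, Dom = \<lambda>_. 0, Cod = \<lambda>_. 0, Idn = \<lambda>_. 0, Comp = \<lambda>_ _. 0\<rparr> :: (nat, nat)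
        cat"
    have "category ?J" by unfold_locales simp_all
    then obtain X p where X: "is_limit_cone ?J C (\<lambda>_. undefined) (\<lambda>_. undefined) X p"
      using lim unfolding has_finite_limits_def by (fastforce simp: is_functor_def)
    have cone: "is_cone ?J C (\<lambda>_. undefined) (\<lambda>_. undefined) Y p \<longleftrightarrow> Y \<in> Obj C" for Y p
      by (simp add: is_cone_def)
    have "is_terminal C X"
      using X unfolding is_limit_cone_def is_terminal_def cone by simp
    then show "\<exists>T. is_terminal C T" ..
  next
    fix f g assume [simp]: "f \<in> Arr C" "g \<in> Arr C" and fg: "Cod C f = Cod C g"
    \<comment> \<open>the shape of cospans \<open>0 \<rightarrow> 2 \<leftarrow> 1\<close>; the arrows \<open>0\<close>, \<open>1\<close>, \<open>2\<close> are the identities\<close>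
    let ?J = "\<lparr>Obj = {0, 1, 2}, Arr = {0, 1, 2, 3, 4}, Dom = \<lambda>u. if u = 3 then 0 else if u =
        4 then 1 else u,
      Cod = \<lambda>u. if u = 3 \<or> u = 4 then 2 else u, Idn = \<lambda>j. j, Comp = \<lambda>v u.
          if u = 3 \<or> u = 4 then u else v\<rparr> :: (nat, nat) cat"
    let ?Fo = "\<lambda>j. if j = 0 then Dom C f else if j = 1 then Dom C g else Cod C f"
    let ?Fa = "\<lambda>u. if u = 3 then f else if u = 4 then g else Idn C (?Fo u)"
    have J: "category ?J" by unfold_locales (auto split: if_splits)
    have F: "is_functor ?J C ?Fo ?Fa"
      unfolding is_functor_def using fg by (auto split: if_splits)
    obtain X p where X: "is_limit_cone ?J C ?Fo ?Fa X p"
      using lim J F unfolding has_finite_limits_def by fastforce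
    have cone: "is_cone ?J C ?Fo ?Fa Y q \<longleftrightarrow> Y \<in> Obj C \<and> q 0 \<in> Hom C Y (Dom C f) \<and>
        q 1 \<in> Hom C Y (Dom C g) \<and>
        q 2 \<in> Hom C Y (Cod C f) \<and> f \<cdot> q 0 = q 2 \<and> g \<cdot> q 1 = q 2" for Y q
      unfolding is_cone_def using fg by auto
    have XO: "X \<in> Obj C"
        and p: "p 0 \<in> Hom C X (Dom C f)" "p 1 \<in> Hom C X (Dom C g)" "f \<cdot> p 0 = p 2" "g \<cdot> p 1 = p 2"
      using X unfolding is_limit_cone_def cone by blast+
    have "is_pullback C f g (p 0) (p 1)"
      unfolding is_pullback_def
    proof (rule bexI[OF _ XO], intro conjI allI impI)
      show "p 0 \<in> Hom C X (Dom C f)" "p 1 \<in> Hom C X (Dom C g)" "f \<cdot> p 0 = g \<cdot> p 1" using p by simp_all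
      fix W h k assume hk: "h \<in> Hom C W (Dom C f) \<and> k \<in> Hom C W (Dom C g) \<and> f \<cdot> h = g \<cdot> k"
      let ?q = "\<lambda>j :: nat. if j = 0 then h else if j = 1 then k else f \<cdot> h"
      have "is_cone ?J C ?Fo ?Fa W ?q" unfolding cone using hk fg by auto
      then have "\<exists>!u. u \<in> Hom C W X \<and> (\<forall>j\<in>Obj ?J. p j \<cdot> u = ?q j)"
        using X unfolding is_limit_cone_def by blast
      moreover have "(u \<in> Hom C W X \<and> (\<forall>j\<in>Obj ?J. p j \<cdot> u = ?q j)) \<longleftrightarrow>
          (u \<in> Hom C W X \<and> p 0 \<cdot> u = h \<and> p 1 \<cdot> u = k)" for u
      proof -
        have "p 2 \<cdot> u = f \<cdot> h" if u: "u \<in> Hom C W X" "p 0 \<cdot> u = h"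
        proof -
          have "f \<cdot> (p 0 \<cdot> u) = p 2 \<cdot> u" by (rule comp_eq_comp[OF p(3)]) (use p(1) u in simp_all)
          then show ?thesis unfolding u(2) by simp
        qed
        then show ?thesis by auto
      qed
      ultimately show "\<exists>!u. u \<in> Hom C W X \<and> p 0 \<cdot> u = h \<and> p 1 \<cdot> u = k" by simp
    qed
    then show "\<exists>p q. is_pullback C f g p q" by blast
  qed
qed

text \<open>The slice over a terminal object is isomorphic to the category itself, hence again cartesian closed.
  The exponentials are constructed directly, since the chosen products of the slice need not
  correspond to those of the category.\<close>

lemma (in lexcc_cat) slice_terminal_lexcc:
  assumes T: "is_terminal C K"
  shows "lexcc_cat (slice C K)"
proof -
  have K [simp]: "K \<in> Obj C" using T by (simp add: is_terminal_def)
  interpret S: lex_cat "slice C K" by (rule slice_lex[OF K])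
  let ?S = "slice C K"
  have up: "(w, h, z) \<in> Hom ?S w z" if "w \<in> Obj ?S" "z \<in> Obj ?S" "h \<in> Hom C (Dom C w) (Dom C z)"
      for w h z
    by (rule slice_ArrI; (rule terminal_arrows_eq[OF T])?) (use that in simp_all)
  have m [simp]: "mid t \<in> Arr C" "Dom C (mid t) = Dom C (Dom ?S t)" "Cod C (mid t) = Dom C (Cod ?S t)"
      if "t \<in> Arr ?S" for t
    using mid_simps[OF that] by simp_all
  have prod: "is_product C (Dom C x) (Dom C y) (mid (proj1 ?S x y)) (mid (proj2 ?S x y))"
    if x: "x \<in> Obj ?S" "y \<in> Obj ?S" for x y
  proof (rule is_productI)
    note pS = S.proj_simps[OF x]
    note [simp] = pS(1-6)
    have [simp]: "prod_obj ?S x y \<in> Arr C" "Cod C (prod_obj ?S x y) = K" using pS(7) by simp_all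
    show "mid (proj1 ?S x y) \<in> Arr C" "mid (proj2 ?S x y) \<in> Arr C"
        "Dom C (mid (proj2 ?S x y)) = Dom C (mid (proj1 ?S x y))"
      "Cod C (mid (proj1 ?S x y)) = Dom C x" "Cod C (mid (proj2 ?S x y)) = Dom C y" by simp_all
    fix W f g assume fg: "f \<in> Hom C W (Dom C x)" "g \<in> Hom C W (Dom C y)"
    have W: "W \<in> Obj C" using fg by auto
    note tW = to_terminal[OF T W]
    let ?f = "(to_terminal K W, f, x)" and ?g = "(to_terminal K W, g, y)"
    have F: "?f \<in> Hom ?S (to_terminal K W) x" and G: "?g \<in> Hom ?S (to_terminal K W) y"
      by (rule up; use fg tW x in simp)+
    have u: "S.pr x y ?f ?g \<in> Arr ?S" "Dom ?S (S.pr x y ?f ?g) = to_terminal K W"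
        "Cod ?S (S.pr x y ?f ?g) = prod_obj ?S x y"
      "proj1 ?S x y \<cdot>\<^bsub>?S\<^esub> S.pr x y ?f ?g = ?f" "proj2 ?S x y \<cdot>\<^bsub>?S\<^esub> S.pr x y ?f ?g = ?g"
      using S.pr_simps[OF x, of ?f ?g] F G by simp_all
    show "\<exists>u\<in>Hom C W (Dom C (mid (proj1 ?S x y))). mid (proj1 ?S x y) \<cdot> u = f \<and>
        mid (proj2 ?S x y) \<cdot> u = g"
      using arg_cong[OF u(4), of mid] arg_cong[OF u(5), of mid] u(1-3) tW
      by (intro bexI[of _ "mid (S.pr x y ?f ?g)"]) simp_all
  next
    note pS = S.proj_simps[OF x]
    note [simp] = pS(1-6)
    have [simp]: "prod_obj ?S x y \<in> Arr C" "Cod C (prod_obj ?S x y) = K" using pS(7) by simp_all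
    fix u v assume uv: "u \<in> Arr C" "v \<in> Arr C" "Dom C u = Dom C v"
        "Cod C u = Dom C (mid (proj1 ?S x y))" "Cod C v = Dom C (mid (proj1 ?S x y))"
      "mid (proj1 ?S x y) \<cdot> u = mid (proj1 ?S x y) \<cdot> v"
          "mid (proj2 ?S x y) \<cdot> u = mid (proj2 ?S x y) \<cdot> v"
    have W: "Dom C v \<in> Obj C" using uv by simp
    note tW = to_terminal[OF T W]
    let ?u = "(to_terminal K (Dom C v), u, prod_obj ?S x y)"
        and ?v = "(to_terminal K (Dom C v), v, prod_obj ?S x y)"
    have U: "?u \<in> Hom ?S (to_terminal K (Dom C v)) (prod_obj ?S x y)"
        and V: "?v \<in> Hom ?S (to_terminal K (Dom C v)) (prod_obj ?S x y)"
      by (rule up; use uv tW in simp)+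
    have "?u = ?v"
    proof (rule S.prod_eqI[of _ _ x y])
      show "proj1 ?S x y \<cdot>\<^bsub>?S\<^esub> ?u = proj1 ?S x y \<cdot>\<^bsub>?S\<^esub> ?v"
        by (rule slice_eqI[of C K]) (use U V uv in simp_all)
      show "proj2 ?S x y \<cdot>\<^bsub>?S\<^esub> ?u = proj2 ?S x y \<cdot>\<^bsub>?S\<^esub> ?v"
        by (rule slice_eqI[of C K]) (use U V uv in simp_all)
    qed (use U V x in simp_all)
    then show "u = v" by simp
  qed
  show ?thesis
  proof (intro lexcc_cat.intro ccc.intro ccc_axioms.intro)
    show "lex_cat ?S" "fprod_cat ?S" by unfold_locales
    fix x y assume xy: "x \<in> Obj ?S" "y \<in> Obj ?S"
    let ?X = "Dom C x" and ?Y = "Dom C y"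
    have [simp]: "x \<in> Arr C" "Cod C x = K" "y \<in> Arr C" "Cod C y = K" using xy by simp_all
    let ?Z = "expo C ?X ?Y"
    let ?z = "to_terminal K ?Z"
    note tZ [simp] = to_terminal[OF T, of ?Z]
    have z: "?z \<in> Obj ?S" by simp
    let ?m1 = "\<lambda>w. mid (proj1 ?S w x)" and ?m2 = "\<lambda>w. mid (proj2 ?S w x)"
    let ?e = "(prod_obj ?S ?z x, app ?X ?Y (?m1 ?z) (?m2 ?z), y)"
    have mm: "?m1 w \<in> Hom C (Dom C (prod_obj ?S w x)) (Dom C w)"
        "?m2 w \<in> Hom C (Dom C (prod_obj ?S w x)) ?X" if "w \<in> Obj ?S" for w
      using S.proj_simps[OF that xy(1)] by simp_all
    have e: "?e \<in> Hom ?S (prod_obj ?S ?z x) y"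
      by (rule up[OF S.proj_simps(7)[OF z xy(1)] xy(2)]) (use mm[OF z] in simp)
    have mt: "mid (?e \<cdot>\<^bsub>?S\<^esub> times_right ?S g x) = app ?X ?Y (mid g \<cdot> ?m1 w) (?m2 w)"
        if g: "g \<in> Hom ?S w ?z" for g w
    proof -
      have [simp]: "g \<in> Arr ?S" "Dom ?S g = w" "Cod ?S g = ?z" using g by simp_all
      have w: "w \<in> Obj ?S" using S.Dom_Obj[of g] by simp
      note t = S.times_right_simps[of g x, OF _ xy(1)]
      have t1: "proj1 ?S ?z x \<cdot>\<^bsub>?S\<^esub> times_right ?S g x = g \<cdot>\<^bsub>?S\<^esub> proj1 ?S w x"
        "proj2 ?S ?z x \<cdot>\<^bsub>?S\<^esub> times_right ?S g x = proj2 ?S w x"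
        using w xy z unfolding times_right_def by simp_all
      have "?m1 ?z \<cdot> mid (times_right ?S g x) = mid g \<cdot> ?m1 w"
          "?m2 ?z \<cdot> mid (times_right ?S g x) = ?m2 w"
        using arg_cong[OF t1(1), of mid] arg_cong[OF t1(2), of mid] by simp_all
      then show ?thesis using t mm[OF z] by (simp add: app_comp)
    qed
    have "is_exponential ?S x y ?z ?e"
      unfolding is_exponential_def
    proof (intro conjI ballI)
      show "?z \<in> Obj ?S" by (rule z)
      show "?e \<in> Hom ?S (prod_obj ?S ?z x) y" by (rule e)
      fix w f assume w: "w \<in> Obj ?S" and f: "f \<in> Hom ?S (prod_obj ?S w x) y"
      have [simp]: "w \<in> Arr C" "Cod C w = K" using w by simp_all
      note P = prod[OF w xy(1)]
      let ?W = "Dom C w"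
      have [simp]: "?m1 w \<in> Arr C" "Dom C (?m1 w) = Dom C (prod_obj ?S w x)" "Cod C (?m1 w) = ?W"
        "?m2 w \<in> Arr C" "Dom C (?m2 w) = Dom C (prod_obj ?S w x)" "Cod C (?m2 w) = ?X" using mm[OF w]
          by simp_all
      have [simp]: "mid f \<in> Arr C" "Dom C (mid f) = Dom C (prod_obj ?S w x)" "Cod C (mid f) = ?Y"
        using f by simp_all
      note pp = pair_product[OF P]
      let ?i = "pair_into C (?m1 w) (?m2 w) (proj1 C ?W ?X) (proj2 C ?W ?X)"
      have i [simp]: "?i \<in> Arr C" "Dom C ?i = prod_obj C ?W ?X" "Cod C ?i = Dom C (prod_obj ?S w x)"
        "?m1 w \<cdot> ?i = proj1 C ?W ?X" "?m2 w \<cdot> ?i = proj2 C ?W ?X"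
        using pp[of "proj1 C ?W ?X" "proj2 C ?W ?X"] by simp_all
      have ii: "?i \<cdot> pr ?W ?X (?m1 w) (?m2 w) = Idn C (Dom C (prod_obj ?S w x))"
        by (rule product_eqI[OF P])
            (simp_all add: comp_eq_comp[OF i(4)] comp_eq_comp[OF i(5)] Dom_Obj[of "?m1 w", simplified]
            flip: comp_assoc)
      let ?f = "mid f \<cdot> ?i"
      let ?t = "transpose C ?W ?X ?Y ?f"
      have t: "?t \<in> Arr C" "Dom C ?t = ?W" "Cod C ?t = ?Z" by (rule transpose_props; simp)+
      let ?g = "(w, ?t, ?z)"
      have g: "?g \<in> Hom ?S w ?z" by (rule up[OF w z]) (use t in simp)
      have "app ?X ?Y (?t \<cdot> ?m1 w) (?m2 w) = ?f \<cdot> pr ?W ?X (?m1 w) (?m2 w)"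
        by (rule app_transpose) simp_all
      also have "\<dots> = mid f \<cdot> (?i \<cdot> pr ?W ?X (?m1 w) (?m2 w))" by simp
      also have "\<dots> = mid f" unfolding ii by simp
      finally have tf: "app ?X ?Y (?t \<cdot> ?m1 w) (?m2 w) = mid f" .
      show "\<exists>!g. g \<in> Hom ?S w ?z \<and> ?e \<cdot>\<^bsub>?S\<^esub> times_right ?S g x = f"
      proof (rule ex1I[of _ ?g], intro conjI)
        show "?g \<in> Hom ?S w ?z" by (rule g)
        have gS: "?g \<in> Arr ?S" using g by simp
        show "?e \<cdot>\<^bsub>?S\<^esub> times_right ?S ?g x = f"
        proof (rule slice_eqI[of C K])
          show "mid (?e \<cdot>\<^bsub>?S\<^esub> times_right ?S ?g x) = mid f" unfolding mt[OF g] using tf by simp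
        qed (use e f S.times_right_simps[OF gS xy(1)] in simp_all)
        fix h assume h: "h \<in> Hom ?S w ?z \<and> ?e \<cdot>\<^bsub>?S\<^esub> times_right ?S h x = f"
        then have hh: "h \<in> Hom ?S w ?z" and he: "?e \<cdot>\<^bsub>?S\<^esub> times_right ?S h x = f" by blast+
        have [simp]: "mid h \<in> Arr C" "Dom C (mid h) = ?W" "Cod C (mid h) = ?Z" using hh by simp_all
        have hf: "app ?X ?Y (mid h \<cdot> ?m1 w) (?m2 w) = mid f" using mt[OF hh] he by simp
        have "mid h = ?t"
        proof (rule expo_eqI[of ?X ?Y])
          fix V a b assume "a \<in> Hom C V (Dom C (mid h))" "b \<in> Hom C V ?X"
          then have ab: "a \<in> Arr C" "Dom C a = V" "Cod C a = ?W" "b \<in> Arr C" "Dom C b = V"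
              "Cod C b = ?X" by simp_all
          let ?p = "pair_into C (?m1 w) (?m2 w) a b"
          have p: "?p \<in> Arr C" "Dom C ?p = V" "Cod C ?p = Dom C (prod_obj ?S w x)" "?m1 w \<cdot> ?p = a"
              "?m2 w \<cdot> ?p = b"
            using pp[of a b] ab by simp_all
          have "app ?X ?Y (mid h \<cdot> a) b = app ?X ?Y (mid h \<cdot> ?m1 w) (?m2 w) \<cdot> ?p" using p
            by (simp add: app_comp)
          also have "\<dots> = app ?X ?Y (?t \<cdot> ?m1 w) (?m2 w) \<cdot> ?p" unfolding hf tf ..
          also have "\<dots> = app ?X ?Y (?t \<cdot> a) b" using p t by (simp add: app_comp)
          finally show "app ?X ?Y (mid h \<cdot> a) b = app ?X ?Y (?t \<cdot> a) b" .
        qed (use t in simp_all)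
        then show "h = ?g" by (intro slice_eqI[of C K]) (use hh in simp_all)
      qed
    qed
    then show "\<exists>Z e. is_exponential ?S x y Z e" by blast
  qed
qed

section \<open>The adjoint functor theorem\<close>

context lexcc_cat
begin

lemma universal_cone_elem_universal:
  assumes F: "internal_functor C F" "FDom F = J" "FCod F = A" and u: "universal_cone C F (V, \<gamma>)"
  shows "elem_universal F (Ob (terminal (CAT C))) (F0 V) (component J A \<gamma> (Idn C (Ob J)))"
proof -
  interpret B: base_change_cc C "terminal C"
    by (intro base_change_cc.intro base_change.intro base_change_axioms.intro slice_terminal_lexcc)
      (simp_all add: terminal lex_cat_axioms lexcc_cat_axioms)
  have c: "(V, \<gamma>) \<in> Obj (cone_cat C F)" using u unfolding universal_cone_def by blast
  have "is_terminal (cone_cat (slice C (terminal C)) (star_ifun C (terminal C) F))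
      (star_cone C (terminal C) F (V, \<gamma>))"
    using u terminal_Obj unfolding universal_cone_def by blast
  then show ?thesis by (rule B.star_terminal_cone[OF F c _ terminal])
qed

lemma component_postcomp:
  assumes R: "internal_functor C R" "FDom R = B" "FCod R = A" and J: "internal_category C J"
    and g: "\<gamma> \<in> Hom C (Ob (terminal (CAT C))) (Mor (expo (CAT C) J B))"
        and d: "d \<in> Arr C" "Cod C d = Ob J"
  shows "component J A (F1 (postcomp C J R) \<cdot> \<gamma>) d = F1 R \<cdot> component J B \<gamma> d"
proof -
  note [simp] = R J d
  have [simp]: "internal_category C B" "internal_category C A" using ifun_simps(1,2)[OF R(1)]
    by simp_all
  have [simp]: "\<gamma> \<in> Arr C" "Dom C \<gamma> = Ob (terminal (CAT C))" "Cod C \<gamma> = Mor (expo (CAT C) J B)" using g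
    by simp_all
  have "R \<cdot>\<^bsub>CAT C\<^esub> ev (CAT C) J B \<in> Hom (CAT C) (prod_obj (CAT C) (expo (CAT C) J B) J) A" by simp
  note t = transpose_elements[OF _ _ _ this]
  have P: "postcomp C J R = transpose (CAT C) (expo (CAT C) J B) J A (R \<cdot>\<^bsub>CAT C\<^esub> ev (CAT C) J B)"
    by (simp add: postcomp_def)
  have [simp]: "internal_functor C (postcomp C J R)" "FDom (postcomp C J R) = expo (CAT C) J B"
      "FCod (postcomp C J R) = expo (CAT C) J A"
    unfolding P using t(1-3) by simp_all
  show ?thesis
    unfolding component_def using t(5)[of "\<gamma> \<cdot> tt (Dom C d)" "Ids J \<cdot> d", folded P] by simp
qed

end

theorem theorem2p20:
  fixes E :: "('o, 'm) cat"
    and A B :: "('o, 'm) icat"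
    and R :: "('o, 'm) ifun"
  assumes "category E" and "has_finite_limits E" and "locally_cartesian_closed E"
    and "internal_category E A" and "internal_category E B"
    and "internally_complete E B"
    and "R \<in> Hom (CAT E) B A" and "internally_continuous E R"
  shows "\<exists>L \<eta> \<epsilon>. L \<in> Hom (CAT E) A B \<and> adjunction E L R \<eta> \<epsilon>"
proof -
  interpret lex_cat E by (rule lex_from_finite_limits) fact+
  note [simp] = assms(4,5)
  have R [simp]: "internal_functor E R" "FDom R = B" "FCod R = A" using assms(7) by simp_all
  \<comment> \<open>over the object of objects of \<open>A\<close>, there is a generic object \<open>a\<close> of \<open>A\<close>\<close>
  let ?I = "Ob A"
  let ?S = "slice E ?I"
  interpret base_change E ?I by unfold_locales simp
  have "ccc ?S" using assms(3) unfolding ccc_iff locally_cartesian_closed_def by simp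
  then interpret S: lexcc_cat ?S by (rule lexcc_cat.intro[OF S.lex_cat_axioms])
  let ?A = "star_icat E ?I A" and ?B = "star_icat E ?I B" and ?R = "star_ifun E ?I R"
  let ?T = "Idn E ?I" and ?U = "Ob (terminal (CAT ?S))"
  have T: "is_terminal ?S ?T" by (rule slice_terminal) simp
  have tT: "S.to_terminal ?T p = (p, p, ?T)" if p: "p \<in> Arr E" "Cod E p = ?I" for p
  proof (rule S.terminal_arrows_eq[OF T])
    have "(p, p, ?T) \<in> Hom ?S p ?T" by (rule slice_ArrI) (use p in simp_all)
    then show "(p, p, ?T) \<in> Arr ?S" "Dom ?S (S.to_terminal ?T p) = Dom ?S (p, p, ?T)"
        "Cod ?S (p, p, ?T) = ?T"
      using S.to_terminal[OF T, of p] p by simp_all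
  qed (use S.to_terminal[OF T, of p] p in simp_all)
  \<comment> \<open>the diagonal of \<open>Ob A\<close>, seen as a global element of the base change of \<open>Ob A\<close>\<close>
  let ?a = "lift ?I ?T ?T"
  have a: "?a \<in> Hom ?S ?T (Ob ?A)" by simp
  have R': "internal_functor ?S ?R" "FDom ?R = ?B" "FCod ?R = ?A" by simp_all
  have lim: "\<exists>v \<gamma>. S.elem_universal P ?T v \<gamma> \<and>
      S.elem_universal (?R \<cdot>\<^bsub>CAT ?S\<^esub> P) ?T (F0 ?R \<cdot>\<^bsub>?S\<^esub> v) (F1 ?R \<cdot>\<^bsub>?S\<^esub> \<gamma>)"
    if P: "P \<in> Hom (CAT ?S) D ?B" for D P
  proof -
    have P': "internal_functor ?S P" "FDom P = D" "FCod P = ?B" using P by simp_all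
    note [simp] = P'
    have D [simp]: "internal_category ?S D" using S.ifun_simps(1)[OF P'(1)] by simp
    obtain V \<pi> where V: "universal_cone ?S P (V, \<pi>)"
      using assms(6) P' unfolding internally_complete_def by fastforce
    have RV: "universal_cone ?S (?R \<cdot>\<^bsub>CAT ?S\<^esub> P) (?R \<cdot>\<^bsub>CAT ?S\<^esub> V, F1 (postcomp ?S D ?R) \<cdot>\<^bsub>?S\<^esub> \<pi>)"
      using assms(8)[unfolded internally_continuous_def, rule_format, of ?I P V \<pi>] V by simp
    have "(V, \<pi>) \<in> Obj (cone_cat ?S P)" using V unfolding universal_cone_def by blast
    note c [simp] = S.cone_cat_ObjD[OF P' this]
    let ?\<gamma> = "S.component D ?B \<pi> (Idn ?S (Ob D))" and ?v = "F0 V \<cdot>\<^bsub>?S\<^esub> S.to_terminal ?U ?T"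
    have RP: "internal_functor ?S (?R \<cdot>\<^bsub>CAT ?S\<^esub> P)" "FDom (?R \<cdot>\<^bsub>CAT ?S\<^esub> P) = D"
        "FCod (?R \<cdot>\<^bsub>CAT ?S\<^esub> P) = ?A" by simp_all
    have T0: "is_terminal ?S ?U" by (rule S.terminal_CAT_simps)
    have "S.elem_universal P ?T ?v ?\<gamma>"
      by (rule S.elem_universal_change_terminal[OF P'(1) T0 T S.universal_cone_elem_universal[OF P' V]])
    moreover have "S.component D ?A (F1 (postcomp ?S D ?R) \<cdot>\<^bsub>?S\<^esub> \<pi>) (Idn ?S (Ob D)) = F1 ?R \<cdot>\<^bsub>?S\<^esub> ?\<gamma>"
      by (rule S.component_postcomp[OF R']) (use S.icat_simps(1)[OF D] in simp_all)
    moreover have "F0 (?R \<cdot>\<^bsub>CAT ?S\<^esub> V) \<cdot>\<^bsub>?S\<^esub> S.to_terminal ?U ?T = F0 ?R \<cdot>\<^bsub>?S\<^esub> ?v"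
      using S.to_terminal[OF T0, of ?T] by simp
    ultimately show ?thesis
      using S.elem_universal_change_terminal[OF RP(1) T0 T S.universal_cone_elem_universal[OF RP RV]]
        by metis
  qed
  have "\<exists>v \<eta>. S.universal_arrow ?R ?T ?a v \<eta>"
    by (rule S.universal_arrow_from_limits[OF R' T a]) (rule lim)
  then obtain v \<eta> where u: "S.universal_arrow ?R ?T ?a v \<eta>" by blast
  then have v: "v \<in> Hom ?S ?T (Ob ?B)"
      and \<eta>: "\<eta> \<in> Hom ?S ?T (Mor ?A)" "Src ?A \<cdot>\<^bsub>?S\<^esub> \<eta> = ?a" "Tgt ?A \<cdot>\<^bsub>?S\<^esub> \<eta> = F0 ?R \<cdot>\<^bsub>?S\<^esub> v"
    unfolding S.universal_arrow_def R' by blast+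
  note un = u[unfolded S.universal_arrow_def R', THEN conjunct2, THEN conjunct2, THEN conjunct2, THEN
      conjunct2, rule_format]
  have v' [simp]: "v \<in> Arr ?S" "Dom ?S v = ?T" "Cod ?S v = st (Ob B)" using v by simp_all
  have \<eta>' [simp]: "\<eta> \<in> Arr ?S" "Dom ?S \<eta> = ?T" "Cod ?S \<eta> = st (Mor A)" using \<eta>(1) by simp_all
  let ?l = "low (Ob B) v" and ?e = "low (Mor A) \<eta>"
  have e: "Src A \<cdot>\<^bsub>E\<^esub> ?e = Idn E (Ob A)" "Tgt A \<cdot>\<^bsub>E\<^esub> ?e = F0 R \<cdot>\<^bsub>E\<^esub> ?l"
    using arg_cong[OF \<eta>(2), of "low (Ob A)"] arg_cong[OF \<eta>(3), of "low (Ob A)"] by simp_all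
  show ?thesis
  proof (rule adjunction_from_universal_arrows[OF R _ _ e])
    show "?l \<in> Hom E (Ob A) (Ob B)" "?e \<in> Hom E (Ob A) (Mor A)" by simp_all
    fix W p b f assume p: "p \<in> Hom E W (Ob A)" and b: "b \<in> Hom E W (Ob B)" and f: "f \<in> Hom E W (Mor A)"
      and fp: "Src A \<cdot>\<^bsub>E\<^esub> f = p" and fb: "Tgt A \<cdot>\<^bsub>E\<^esub> f = F0 R \<cdot>\<^bsub>E\<^esub> b"
    have [simp]: "p \<in> Arr E" "Dom E p = W" "Cod E p = Ob A" "b \<in> Arr E" "Dom E b = W" "Cod E b = Ob B"
      "f \<in> Arr E" "Dom E f = W" "Cod E f = Mor A" using p b f by simp_all
    have tp: "(p, p, ?T) \<in> Arr ?S" using slice_ArrI[of p E ?I ?T p] by simp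
    let ?b = "lift (Ob B) p b" and ?f = "lift (Mor A) p f"
    have "Src ?A \<cdot>\<^bsub>?S\<^esub> ?f = ?a \<cdot>\<^bsub>?S\<^esub> S.to_terminal ?T p"
      by (rule low_eqI[of _ _ "Ob A"]) (simp_all add: tT tp low_comp[of ?a] fp)
    moreover have "Tgt ?A \<cdot>\<^bsub>?S\<^esub> ?f = F0 ?R \<cdot>\<^bsub>?S\<^esub> ?b"
      by (rule low_eqI[of _ _ "Ob A"]) (simp_all add: fb)
    ultimately have ex1: "\<exists>!g. g \<in> Hom ?S p (Mor ?B) \<and> Src ?B \<cdot>\<^bsub>?S\<^esub> g = v \<cdot>\<^bsub>?S\<^esub> (p, p, ?T) \<and>
        Tgt ?B \<cdot>\<^bsub>?S\<^esub> g = ?b \<and>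
           icomp ?S ?A (F1 ?R \<cdot>\<^bsub>?S\<^esub> g) (\<eta> \<cdot>\<^bsub>?S\<^esub> (p, p, ?T)) = ?f"
      using un[of ?b p ?f] unfolding tT[OF \<open>p \<in> Arr E\<close> \<open>Cod E p = Ob A\<close>] by simp
    have iff: "(g \<in> Hom ?S p (Mor ?B) \<and> Src ?B \<cdot>\<^bsub>?S\<^esub> g = v \<cdot>\<^bsub>?S\<^esub> (p, p, ?T) \<and> Tgt ?B \<cdot>\<^bsub>?S\<^esub> g = ?b \<and>
           icomp ?S ?A (F1 ?R \<cdot>\<^bsub>?S\<^esub> g) (\<eta> \<cdot>\<^bsub>?S\<^esub> (p, p, ?T)) = ?f) \<longleftrightarrow>
        (Src B \<cdot>\<^bsub>E\<^esub> low (Mor B) g = ?l \<cdot>\<^bsub>E\<^esub> p \<and> Tgt B \<cdot>\<^bsub>E\<^esub> low (Mor B) g = b \<and>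
           icomp E A (F1 R \<cdot>\<^bsub>E\<^esub> low (Mor B) g) (?e \<cdot>\<^bsub>E\<^esub> p) = f)" if g: "g \<in> Hom ?S p (st (Mor B))" for g
    proof -
      have [simp]: "g \<in> Arr ?S" "Dom ?S g = p" "Cod ?S g = st (Mor B)" using g by simp_all
      have inj: "s = t \<longleftrightarrow> low X s = low X t" if "s \<in> Hom ?S p (st X)" "t \<in> Hom ?S p (st X)" "X \<in> Obj E"
          for s t X
        using that low_eqI[of s t X] by auto
      have 1: "Src ?B \<cdot>\<^bsub>?S\<^esub> g = v \<cdot>\<^bsub>?S\<^esub> (p, p, ?T) \<longleftrightarrow> Src B \<cdot>\<^bsub>E\<^esub> low (Mor B) g = ?l \<cdot>\<^bsub>E\<^esub> p"
        by (subst inj[of _ "Ob B"]) (simp_all add: tp low_comp[of v])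
      have 2: "Tgt ?B \<cdot>\<^bsub>?S\<^esub> g = ?b \<longleftrightarrow> Tgt B \<cdot>\<^bsub>E\<^esub> low (Mor B) g = b"
        by (subst inj[of _ "Ob B"]) simp_all
      have 3: "icomp ?S ?A (F1 ?R \<cdot>\<^bsub>?S\<^esub> g) (\<eta> \<cdot>\<^bsub>?S\<^esub> (p, p, ?T)) = ?f \<longleftrightarrow>
          icomp E A (F1 R \<cdot>\<^bsub>E\<^esub> low (Mor B) g) (?e \<cdot>\<^bsub>E\<^esub> p) = f"
        if s: "Src B \<cdot>\<^bsub>E\<^esub> low (Mor B) g = ?l \<cdot>\<^bsub>E\<^esub> p"
      proof -
        let ?h = "\<eta> \<cdot>\<^bsub>?S\<^esub> (p, p, ?T)" and ?k = "star_arr E ?I (F1 R) \<cdot>\<^bsub>?S\<^esub> g"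
        have hk: "?k \<in> Arr ?S" "?h \<in> Arr ?S" "Dom ?S ?k = Dom ?S ?h" "Cod ?S ?k = st (Mor A)"
            "Cod ?S ?h = st (Mor A)" "Dom ?S ?h = p"
          using tp by simp_all
        have l: "low (Mor A) ?k = F1 R \<cdot>\<^bsub>E\<^esub> low (Mor B) g" "low (Mor A) ?h = ?e \<cdot>\<^bsub>E\<^esub> p" using tp
          by (simp_all add: low_comp[of \<eta>])
        have "Src A \<cdot>\<^bsub>E\<^esub> (F1 R \<cdot>\<^bsub>E\<^esub> low (Mor B) g) = Tgt A \<cdot>\<^bsub>E\<^esub> (?e \<cdot>\<^bsub>E\<^esub> p)"
          using s comp_eq_comp[OF e(2), of p] by simp
        then have i: "icomp ?S ?A ?k ?h \<in> Hom ?S p (st (Mor A)) \<and>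
            low (Mor A) (icomp ?S ?A ?k ?h) = icomp E A (F1 R \<cdot>\<^bsub>E\<^esub> low (Mor B) g) (?e \<cdot>\<^bsub>E\<^esub> p)"
          using star_Cmp(2)[OF assms(4) hk(1-5)] unfolding l hk(6) by blast
        then have "icomp ?S ?A ?k ?h = ?f \<longleftrightarrow> icomp E A (F1 R \<cdot>\<^bsub>E\<^esub> low (Mor B) g) (?e \<cdot>\<^bsub>E\<^esub> p) = f"
          by (subst inj[of _ "Mor A"]) simp_all
        then show ?thesis by simp
      qed
      show ?thesis using 1 2 3 g by auto
    qed
    obtain g where g: "g \<in> Hom ?S p (st (Mor B))" "Src B \<cdot>\<^bsub>E\<^esub> low (Mor B) g = ?l \<cdot>\<^bsub>E\<^esub> p"
        "Tgt B \<cdot>\<^bsub>E\<^esub> low (Mor B) g = b"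
      "icomp E A (F1 R \<cdot>\<^bsub>E\<^esub> low (Mor B) g) (?e \<cdot>\<^bsub>E\<^esub> p) = f" using ex1 iff unfolding star_icat_simps
        by blast
    show "\<exists>!g. g \<in> Hom E W (Mor B) \<and> Src B \<cdot>\<^bsub>E\<^esub> g = ?l \<cdot>\<^bsub>E\<^esub> p \<and> Tgt B \<cdot>\<^bsub>E\<^esub> g = b \<and>
        icomp E A (F1 R \<cdot>\<^bsub>E\<^esub> g) (?e \<cdot>\<^bsub>E\<^esub> p) = f"
    proof (rule ex1I[of _ "low (Mor B) g"])
      show "low (Mor B) g \<in> Hom E W (Mor B) \<and> Src B \<cdot>\<^bsub>E\<^esub> low (Mor B) g = ?l \<cdot>\<^bsub>E\<^esub> p \<and>
          Tgt B \<cdot>\<^bsub>E\<^esub> low (Mor B) g = b \<and>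
        icomp E A (F1 R \<cdot>\<^bsub>E\<^esub> low (Mor B) g) (?e \<cdot>\<^bsub>E\<^esub> p) = f" using g(1) by (intro conjI g) simp
      fix k assume k: "k \<in> Hom E W (Mor B) \<and> Src B \<cdot>\<^bsub>E\<^esub> k = ?l \<cdot>\<^bsub>E\<^esub> p \<and> Tgt B \<cdot>\<^bsub>E\<^esub> k = b \<and>
          icomp E A (F1 R \<cdot>\<^bsub>E\<^esub> k) (?e \<cdot>\<^bsub>E\<^esub> p) = f"
      have L: "lift (Mor B) p k \<in> Hom ?S p (st (Mor B))" "low (Mor B) (lift (Mor B) p k) = k" using k
        by simp_all
      have "lift (Mor B) p k = g"
        using ex1 iff[OF L(1)] iff[OF g(1)] g k unfolding L(2) by blast
      then show "k = low (Mor B) g" using L(2) by simp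
    qed
  qed
qed

end
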